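(* Let $n\ge 1$, $-\infty\le a<b\le+\infty$, and let $B_0,B_1\in L^1_{\mathrm{loc}}((a,b),\mathbb{C}^{2n\times 2n})$ with $B_0(x),B_1(x)$ self-adjoint for a.e. $x\in(a,b)$. Assume that for every $\lambda\in\mathbb{C}$ and every non-trivial solution $y\in \mathrm{AC}_{\mathrm{loc}}((a,b),\mathbb{C}^{2n})$ of $Jy'=(B_0(x)+\lambda B_1(x))y$ one has $\int_c^d (B_1(x)y(x),y(x))\,dx>0$ for all $[c,d]\subset(a,b)$, $c<d$. Assume also that $m_a(\lambda)$ and $m_b(\lambda)$ are each constant for $\lambda\in\mathbb{C}\setminus\mathbb{R}$. Fix $\lambda_0\in\mathbb{C}\setminus\mathbb{R}$. (i) There exist solutions $\{u_j^a(x;\lambda_0)\}_{j=1}^n$ of $Jy'=(B_0+\lambda_0B_1)y$ that lie left in $(a,b)$ and solutions $\{u_j^b(x;\lambda_0)\}_{j=1}^n$ of the same equation that lie right in $(a,b)$ such that, with $U^a(x;\lambda_0)$ and $U^b(x;\lambda_0)$ the $2n\times n$ matrices having these solutions as columns, the restriction of $\mathcal{L}_M$ to the domain $$\mathcal{D}=\{y\in\mathcal{D}_M:\ \lim_{x\to a^+}U^a(x;\lambda_0)^*Jy(x)=0,\ \lim_{x\to b^-}U^b(x;\lambda_0)^*Jy(x)=0\}$$ is a self-adjoint operator. (ii) Suppose in addition that $a$ is finite and that $B_0,B_1\in L^1((a,c),\mathbb{C}^{2n\times 2n})$ for every $c\in(a,b)$. Let $\alpha\in\mathbb{C}^{n\times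 2n}$ be any fixed matrix with $\operatorname{rank}\alpha=n$ and $\alpha J\alpha^*=0$. Then there exist solutions $\{u_j^b(x;\lambda_0)\}_{j=1}^n$ of $Jy'=(B_0+\lambda_0B_1)y$ that lie right in $(a,b)$ such that, with $U^b(x;\lambda_0)$ the matrix having these as columns, the restriction of $\mathcal{L}_M$ to the domain $$\mathcal{D}^{\alpha}=\{y\in\mathcal{D}_M:\ \alpha y(a)=0,\ \lim_{x\to b^-}U^b(x;\lambda_0)^*Jy(x)=0\}$$ is a self-adjoint operator.
   Context: $J=\begin{pmatrix}0_n&-I_n\\ I_n&0_n\end{pmatrix}$; $(\cdot,\cdot)$ is the usual inner product on $\mathbb{C}^{2n}$; $\mathrm{AC}_{\mathrm{loc}}$ denotes local absolute continuity; solutions of the ODE are $\mathrm{AC}_{\mathrm{loc}}((a,b),\mathbb{C}^{2n})$ functions satisfying it a.e. For an interval $I\subset(a,b)$, $L^2_{B_1}(I,\mathbb{C}^{2n})$ is the Hilbert space of (classes of) measurable $f:I\to\mathbb{C}^{2n}$ with $\|f\|_{B_1}^2=\int_I(B_1f,f)\,dx<\infty$, modulo functions with $\|f\|_{B_1}=0$, with inner product $\langle f,g\rangle_{B_1}=\int_I(B_1f,g)\,dx$. ($B_1(x)$ need not be invertible.) A solution $y$ of $Jy'=(B_0+\lambda B_1)y$ lies left in $(a,b)$ if for any $c\in(a,b)$ its restriction to $(a,c)$ is in $L^2_{B_1}((a,c),\mathbb{C}^{2n})$; it lies right in $(a,b)$ if for any $c\in(a,b)$ its restriction to $(c,b)$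 is in $L^2_{B_1}((c,b),\mathbb{C}^{2n})$. $m_a(\lambda)$ (resp. $m_b(\lambda)$) is the dimension of the space of solutions that lie left (resp. right) in $(a,b)$. Maximal operator: $\mathcal{D}_M$ is the set of $y\in\mathrm{AC}_{\mathrm{loc}}((a,b),\mathbb{C}^{2n})\cap L^2_{B_1}((a,b),\mathbb{C}^{2n})$ for which there exists $f\in L^2_{B_1}((a,b),\mathbb{C}^{2n})$ with $Jy'-B_0y=B_1f$ a.e. in $(a,b)$; such $f$ is unique in $L^2_{B_1}$, and $\mathcal{L}_My:=f$. Self-adjointness is in the Hilbert space $L^2_{B_1}((a,b),\mathbb{C}^{2n})$.
   Formalization: For singular B_1 the value L_M y need not depend only on the class of y, and then "self-adjoint operator" can fail. Proved: the graph of the restriction always equals its adjoint (as a linear relation); it is a densely defined self-adjoint operator whenever L_M is well defined on classes. *)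

theory Defs
  imports "HOL-Analysis.Analysis" "HOL-Library.Function_Algebras"
begin

subsection \<open>Linear algebra over the complex numbers\<close>

text \<open>Vectors in the complex space of dimension \<open>2n\<close> are indexed by \<open>'n + 'n\<close>: the summand
  \<open>Inl\<close> is the first block of \<open>n\<close> coordinates and \<open>Inr\<close> the second one. The inner product of the
  library is the real one, so the complex inner product (linear in the first argument) and the
  conjugate transpose are introduced here.\<close>

definition cinner :: "complex ^ 'm::finite \<Rightarrow> complex ^ 'm \<Rightarrow> complex" where
  "cinner u v = (\<Sum>i\<in>UNIV. u $ i * cnj (v $ i))"

definition madj :: "complex ^ 'k::finite ^ 'm::finite \<Rightarrow> complex ^ 'm ^ 'k" where
  "madj A = (\<chi> i j. cnj (A $ j $ i))"

definition Jmat :: "complex ^ ('n::finite + 'n) ^ ('n + 'n)" where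
  "Jmat = (\<chi> i j. case (i, j) of
      (Inl p, Inr q) \<Rightarrow> (if p = q then - 1 else 0)
    | (Inr p, Inl q) \<Rightarrow> (if p = q then 1 else 0)
    | _ \<Rightarrow> 0)"

subsection \<open>Absolute continuity and local integrability on an interval \<open>(a,b)\<close>\<close>

text \<open>A division is a finite set of non-degenerate or degenerate compact intervals with pairwise
  disjoint interiors; its union \<open>T\<close> need not be all of \<open>{c..d}\<close>.\<close>

definition abs_cont_on :: "real \<Rightarrow> real \<Rightarrow> (real \<Rightarrow> 'v::real_normed_vector) \<Rightarrow> bool" where
  "abs_cont_on c d f \<longleftrightarrow>
     (\<forall>\<epsilon>>0. \<exists>\<delta>>0. \<forall>\<D> T. \<D> division_of T \<and> T \<subseteq> {c..d} \<and> (\<Sum>K\<in>\<D>. Sup K - Inf K) < \<delta>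
        \<longrightarrow> (\<Sum>K\<in>\<D>. norm (f (Sup K) - f (Inf K))) < \<epsilon>)"

definition AC_loc :: "ereal \<Rightarrow> ereal \<Rightarrow> (real \<Rightarrow> 'v::real_normed_vector) set" where
  "AC_loc a b = {f. \<forall>c d. c < d \<and> {c..d} \<subseteq> einterval a b \<longrightarrow> abs_cont_on c d f}"

definition L1_loc :: "ereal \<Rightarrow> ereal \<Rightarrow> (real \<Rightarrow> 'v::euclidean_space) set" where
  "L1_loc a b = {f. \<forall>c d. {c..d} \<subseteq> einterval a b \<longrightarrow> f absolutely_integrable_on {c..d}}"

subsection \<open>The Hilbert space of square integrable functions with weight \<open>B\<close>\<close>

text \<open>Functions live on all of \<open>real\<close>, but only their values on \<open>I\<close> are used. The weight occurring
  below is positive semidefinite almost everywhere (a consequence of the definiteness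
  hypothesis), so integrability of the complex-valued integrand \<open>(Bf,f)\<close> is finiteness
  of its integral.\<close>

definition L2_fun :: "real set \<Rightarrow> (real \<Rightarrow> complex ^ 'm::finite ^ 'm) \<Rightarrow> (real \<Rightarrow> complex ^ 'm) set" where
  "L2_fun I B = {f. f \<in> borel_measurable (lebesgue_on I) \<and>
                    set_integrable lebesgue I (\<lambda>x. cinner (B x *v f x) (f x))}"

definition L2_inner ::
  "real set \<Rightarrow> (real \<Rightarrow> complex ^ 'm::finite ^ 'm) \<Rightarrow> (real \<Rightarrow> complex ^ 'm) \<Rightarrow> (real \<Rightarrow> complex ^ 'm) \<Rightarrow> complex" where
  "L2_inner I B f g = (LINT x:I|lebesgue. cinner (B x *v f x) (g x))"

definition L2_rel ::
  "real set \<Rightarrow> (real \<Rightarrow> complex ^ 'm::finite ^ 'm) \<Rightarrow> ((real \<Rightarrow> complex ^ 'm) \<times> (real \<Rightarrow> complex ^ 'm)) set" where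
  "L2_rel I B = {(f, g). f \<in> L2_fun I B \<and> g \<in> L2_fun I B \<and>
                         L2_inner I B (\<lambda>x. f x - g x) (\<lambda>x. f x - g x) = 0}"

definition L2_space ::
  "real set \<Rightarrow> (real \<Rightarrow> complex ^ 'm::finite ^ 'm) \<Rightarrow> (real \<Rightarrow> complex ^ 'm) set set" where
  "L2_space I B = L2_fun I B // L2_rel I B"

definition L2_class ::
  "real set \<Rightarrow> (real \<Rightarrow> complex ^ 'm::finite ^ 'm) \<Rightarrow> (real \<Rightarrow> complex ^ 'm) \<Rightarrow> (real \<Rightarrow> complex ^ 'm) set" where
  "L2_class I B f = L2_rel I B `` {f}"

text \<open>Inner product and distance of classes, computed on representatives.\<close>

definition class_inner ::
  "real set \<Rightarrow> (real \<Rightarrow> complex ^ 'm::finite ^ 'm) \<Rightarrow> (real \<Rightarrow> complex ^ 'm) set \<Rightarrow> (real \<Rightarrow> complex ^ 'm) set \<Rightarrow> complex" where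
  "class_inner I B F G = L2_inner I B (SOME f. f \<in> F) (SOME g. g \<in> G)"

definition class_dist ::
  "real set \<Rightarrow> (real \<Rightarrow> complex ^ 'm::finite ^ 'm) \<Rightarrow> (real \<Rightarrow> complex ^ 'm) set \<Rightarrow> (real \<Rightarrow> complex ^ 'm) set \<Rightarrow> real" where
  "class_dist I B F G =
     (let h = (\<lambda>x. (SOME f. f \<in> F) x - (SOME g. g \<in> G) x) in sqrt (Re (L2_inner I B h h)))"

subsection \<open>Adjoints and self-adjointness in the Hilbert space\<close>

text \<open>Operators are given by their graphs, which are sets of pairs (argument, value) of classes.\<close>

definition adjoint_graph ::
  "real set \<Rightarrow> (real \<Rightarrow> complex ^ 'm::finite ^ 'm) \<Rightarrow>
   ((real \<Rightarrow> complex ^ 'm) set \<times> (real \<Rightarrow> complex ^ 'm) set) set \<Rightarrow>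
   ((real \<Rightarrow> complex ^ 'm) set \<times> (real \<Rightarrow> complex ^ 'm) set) set" where
  "adjoint_graph I B G =
     {(V, W). V \<in> L2_space I B \<and> W \<in> L2_space I B \<and>
              (\<forall>(F, TF)\<in>G. class_inner I B TF V = class_inner I B F W)}"

definition selfadjoint_graph ::
  "real set \<Rightarrow> (real \<Rightarrow> complex ^ 'm::finite ^ 'm) \<Rightarrow>
   ((real \<Rightarrow> complex ^ 'm) set \<times> (real \<Rightarrow> complex ^ 'm) set) set \<Rightarrow> bool" where
  "selfadjoint_graph I B G \<longleftrightarrow> adjoint_graph I B G = G"

definition L2_dense ::
  "real set \<Rightarrow> (real \<Rightarrow> complex ^ 'm::finite ^ 'm) \<Rightarrow> (real \<Rightarrow> complex ^ 'm) set set \<Rightarrow> bool" where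
  "L2_dense I B S \<longleftrightarrow> S \<subseteq> L2_space I B \<and>
     (\<forall>F\<in>L2_space I B. \<forall>\<epsilon>>0. \<exists>G\<in>S. class_dist I B F G < \<epsilon>)"

definition selfadjoint_operator ::
  "real set \<Rightarrow> (real \<Rightarrow> complex ^ 'm::finite ^ 'm) \<Rightarrow>
   ((real \<Rightarrow> complex ^ 'm) set \<times> (real \<Rightarrow> complex ^ 'm) set) set \<Rightarrow> bool" where
  "selfadjoint_operator I B G \<longleftrightarrow>
     single_valued G \<and> L2_dense I B (Domain G) \<and> adjoint_graph I B G = G"

subsection \<open>The Hamiltonian system\<close>

definition is_solution ::
  "ereal \<Rightarrow> ereal \<Rightarrow> (real \<Rightarrow> complex ^ ('n::finite + 'n) ^ ('n + 'n)) \<Rightarrow> (real \<Rightarrow> complex ^ ('n + 'n) ^ ('n + 'n)) \<Rightarrow>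
   complex \<Rightarrow> (real \<Rightarrow> complex ^ ('n + 'n)) \<Rightarrow> bool" where
  "is_solution a b B0 B1 \<zeta> y \<longleftrightarrow> y \<in> AC_loc a b \<and>
     (AE x in lebesgue. x \<in> einterval a b \<longrightarrow>
        (\<exists>y'. (y has_vector_derivative y') (at x) \<and>
              Jmat *v y' = B0 x *v y x + \<zeta> *s (B1 x *v y x)))"

definition lies_left ::
  "ereal \<Rightarrow> ereal \<Rightarrow> (real \<Rightarrow> complex ^ 'm::finite ^ 'm) \<Rightarrow> (real \<Rightarrow> complex ^ 'm) \<Rightarrow> bool" where
  "lies_left a b B1 y \<longleftrightarrow> (\<forall>c\<in>einterval a b. y \<in> L2_fun (einterval a (ereal c)) B1)"

definition lies_right ::
  "ereal \<Rightarrow> ereal \<Rightarrow> (real \<Rightarrow> complex ^ 'm::finite ^ 'm) \<Rightarrow> (real \<Rightarrow> complex ^ 'm) \<Rightarrow> bool" where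
  "lies_right a b B1 y \<longleftrightarrow> (\<forall>c\<in>einterval a b. y \<in> L2_fun (einterval (ereal c) b) B1)"

text \<open>Complex vector space structure on vector-valued functions, used for the dimension of
  solution spaces. A function on \<open>(a,b)\<close> is represented by its extension by zero.\<close>

definition fscale :: "complex \<Rightarrow> (real \<Rightarrow> complex ^ 'm) \<Rightarrow> (real \<Rightarrow> complex ^ 'm)" where
  "fscale c f = (\<lambda>x. c *s f x)"

global_interpretation cfun: vector_space "fscale :: complex \<Rightarrow> (real \<Rightarrow> complex ^ 'm::finite) \<Rightarrow> _"
  by unfold_locales
    (simp_all add: fscale_def fun_eq_iff vector_add_ldistrib vector_sadd_rdistrib vector_smult_assoc)

definition m_left ::
  "ereal \<Rightarrow> ereal \<Rightarrow> (real \<Rightarrow> complex ^ ('n::finite + 'n) ^ ('n + 'n)) \<Rightarrow> (real \<Rightarrow> complex ^ ('n + 'n) ^ ('n + 'n)) \<Rightarrow>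
   complex \<Rightarrow> nat" where
  "m_left a b B0 B1 \<zeta> = cfun.dim {y. is_solution a b B0 B1 \<zeta> y \<and> lies_left a b B1 y \<and>
                                      (\<forall>x. x \<notin> einterval a b \<longrightarrow> y x = 0)}"

definition m_right ::
  "ereal \<Rightarrow> ereal \<Rightarrow> (real \<Rightarrow> complex ^ ('n::finite + 'n) ^ ('n + 'n)) \<Rightarrow> (real \<Rightarrow> complex ^ ('n + 'n) ^ ('n + 'n)) \<Rightarrow>
   complex \<Rightarrow> nat" where
  "m_right a b B0 B1 \<zeta> = cfun.dim {y. is_solution a b B0 B1 \<zeta> y \<and> lies_right a b B1 y \<and>
                                       (\<forall>x. x \<notin> einterval a b \<longrightarrow> y x = 0)}"

subsection \<open>The maximal operator\<close>

definition max_rel ::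
  "ereal \<Rightarrow> ereal \<Rightarrow> (real \<Rightarrow> complex ^ ('n::finite + 'n) ^ ('n + 'n)) \<Rightarrow> (real \<Rightarrow> complex ^ ('n + 'n) ^ ('n + 'n)) \<Rightarrow>
   (real \<Rightarrow> complex ^ ('n + 'n)) \<Rightarrow> (real \<Rightarrow> complex ^ ('n + 'n)) \<Rightarrow> bool" where
  "max_rel a b B0 B1 y f \<longleftrightarrow> f \<in> L2_fun (einterval a b) B1 \<and>
     (AE x in lebesgue. x \<in> einterval a b \<longrightarrow>
        (\<exists>y'. (y has_vector_derivative y') (at x) \<and>
              Jmat *v y' - B0 x *v y x = B1 x *v f x))"

definition max_dom ::
  "ereal \<Rightarrow> ereal \<Rightarrow> (real \<Rightarrow> complex ^ ('n::finite + 'n) ^ ('n + 'n)) \<Rightarrow> (real \<Rightarrow> complex ^ ('n + 'n) ^ ('n + 'n)) \<Rightarrow>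
   (real \<Rightarrow> complex ^ ('n + 'n)) set" where
  "max_dom a b B0 B1 = {y \<in> AC_loc a b \<inter> L2_fun (einterval a b) B1. \<exists>f. max_rel a b B0 B1 y f}"

definition max_op ::
  "ereal \<Rightarrow> ereal \<Rightarrow> (real \<Rightarrow> complex ^ ('n::finite + 'n) ^ ('n + 'n)) \<Rightarrow> (real \<Rightarrow> complex ^ ('n + 'n) ^ ('n + 'n)) \<Rightarrow>
   (real \<Rightarrow> complex ^ ('n + 'n)) \<Rightarrow> (real \<Rightarrow> complex ^ ('n + 'n)) set" where
  "max_op a b B0 B1 y = L2_class (einterval a b) B1 (SOME f. max_rel a b B0 B1 y f)"

text \<open>The value of the maximal operator is determined by the function \<open>y\<close>, but not always by the
  class of \<open>y\<close>: where \<open>B1\<close> is not invertible there may be a \<open>y\<close> in the maximal domain whose class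
  is zero while its image is not. The graph below, formed in the Hilbert space, is then
  a linear relation which is not single-valued.\<close>

definition restr_graph ::
  "ereal \<Rightarrow> ereal \<Rightarrow> (real \<Rightarrow> complex ^ ('n::finite + 'n) ^ ('n + 'n)) \<Rightarrow> (real \<Rightarrow> complex ^ ('n + 'n) ^ ('n + 'n)) \<Rightarrow>
   (real \<Rightarrow> complex ^ ('n + 'n)) set \<Rightarrow>
   ((real \<Rightarrow> complex ^ ('n + 'n)) set \<times> (real \<Rightarrow> complex ^ ('n + 'n)) set) set" where
  "restr_graph a b B0 B1 D = (\<lambda>y. (L2_class (einterval a b) B1 y, max_op a b B0 B1 y)) ` D"

text \<open>\<open>selfadjoint_restr a b B0 B1 D\<close>: the restriction of the maximal operator to \<open>D\<close> coincides with
  its adjoint; and, whenever the maximal operator is well defined on classes, it is a densely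
  defined self-adjoint operator in the usual sense.\<close>

definition selfadjoint_restr ::
  "ereal \<Rightarrow> ereal \<Rightarrow> (real \<Rightarrow> complex ^ ('n::finite + 'n) ^ ('n + 'n)) \<Rightarrow> (real \<Rightarrow> complex ^ ('n + 'n) ^ ('n + 'n)) \<Rightarrow>
   (real \<Rightarrow> complex ^ ('n + 'n)) set \<Rightarrow> bool" where
  "selfadjoint_restr a b B0 B1 D \<longleftrightarrow>
     selfadjoint_graph (einterval a b) B1 (restr_graph a b B0 B1 D) \<and>
     (single_valued (restr_graph a b B0 B1 (max_dom a b B0 B1)) \<longrightarrow>
        selfadjoint_operator (einterval a b) B1 (restr_graph a b B0 B1 D))"

subsection \<open>Boundary conditions\<close>

text \<open>One-sided limits at the end points, which may be infinite, are taken along the extended reals.\<close>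

definition bc_left ::
  "ereal \<Rightarrow> (real \<Rightarrow> complex ^ 'n::finite ^ ('n + 'n)) \<Rightarrow> (real \<Rightarrow> complex ^ ('n + 'n)) \<Rightarrow> bool" where
  "bc_left a U y \<longleftrightarrow>
     (((\<lambda>x. madj (U x) *v (Jmat *v y x)) \<circ> real_of_ereal) \<longlongrightarrow> 0) (at_right a)"

definition bc_right ::
  "ereal \<Rightarrow> (real \<Rightarrow> complex ^ 'n::finite ^ ('n + 'n)) \<Rightarrow> (real \<Rightarrow> complex ^ ('n + 'n)) \<Rightarrow> bool" where
  "bc_right b U y \<longleftrightarrow>
     (((\<lambda>x. madj (U x) *v (Jmat *v y x)) \<circ> real_of_ereal) \<longlongrightarrow> 0) (at_left b)"

text \<open>\<open>\<alpha> y(a) = 0\<close>, where \<open>y(a)\<close> denotes the continuous extension of \<open>y\<close> to the end point \<open>a\<close>.\<close>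

definition bc_regular ::
  "ereal \<Rightarrow> complex ^ ('n::finite + 'n) ^ 'n \<Rightarrow> (real \<Rightarrow> complex ^ ('n + 'n)) \<Rightarrow> bool" where
  "bc_regular a \<alpha> y \<longleftrightarrow>
     (\<exists>ya. ((y \<circ> real_of_ereal) \<longlongrightarrow> ya) (at_right a) \<and> \<alpha> *v ya = 0)"

end

theory Submission
  imports Defs
begin

text \<open>Let \<open>T y = f\<close> stand for \<open>J y' - B\<^sub>0 y = B\<^sub>1 f\<close>, let \<open>N(\<zeta>)\<close> be the space of solutions of
  \<open>T y = \<zeta> y\<close> that are square integrable near a given end point, and let \<open>E(y, z)\<close> be the limit of
  \<open>(J y, z)\<close> at this end point. Approximating the right hand side by compactly supported ones yields
  sufficiently many functions in the radical of \<open>E\<close>, so that for each non-real \<open>\<zeta>\<close> the form \<open>E\<close> is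
  determined by its values on \<open>N(\<zeta>)\<close>. At an interior point \<open>J\<close> has signature \<open>(n, n)\<close>, and it
  differs from \<open>E\<close> by a multiple of the norm whose sign is that of the imaginary part of \<open>\<zeta>\<close>; since
  \<open>N(\<zeta>)\<close> and \<open>N(cnj \<zeta>)\<close> have the same dimension, a maximal isotropic subspace of \<open>N(\<zeta>)\<close> has
  dimension \<open>n\<close>. The conditions \<open>E(y, u) = 0\<close> for \<open>u\<close> in such a subspace, at both end points, make \<open>T\<close>
  symmetric. For \<open>\<mu> = \<zeta>\<close> and \<open>\<mu> = cnj \<zeta>\<close> the solutions of \<open>T y = \<mu> y\<close> satisfying the condition at
  one end point form an \<open>n\<close>-dimensional space, and those for the two end points meet only in \<open>0\<close>.
  Hence solutions of \<open>T y = \<mu> y + f\<close> constructed near the two end points can be glued, \<open>T - \<mu>\<close> is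
  onto, and \<open>T\<close> is self-adjoint. At a regular end point the isotropic subspace consists of
  the solutions with boundary values in the range of \<open>J \<alpha>\<^sup>*\<close>.\<close>

subsection \<open>Absolutely continuous functions of a real variable\<close>

text \<open>Solutions are identified with their values at an interior point \<open>c\<close>, so
  that all subspaces live in the complex 2n-space. The pairing of N(\<zeta>) with N(cnj \<zeta>)
  then is \<open>J\<close> itself, because the two integrals in Green's formula cancel; hence the
  radical of E on N(\<zeta>) is the \<open>J\<close>-annihilator of N(cnj \<zeta>), and equality of
  the dimensions gives dim L + dim L' = 2n for an isotropic L containing the radical and its
  orthogonal space L'. For L maximal E is semidefinite on L', but its sign is not known. One sign
  bounds dim L' by n; with the other one the same bound applies to the \<open>J\<close>-annihilator
  of L, a subspace of N(cnj \<zeta>), where the imaginary part has the opposite sign. The second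
  difficulty is that \<open>B1\<close> may be singular. Functions are then determined only modulo a
  seminorm, limits in the weighted space have to be selected measurably, and T may be a linear
  relation on classes. Therefore self-adjointness is proved for graphs, from symmetry and
  surjectivity at two conjugate parameters, and density is deduced afterwards from the equality with
  the adjoint.\<close>

lemma lebesgue_differentiation_real:
  fixes f :: "real \<Rightarrow> 'a::euclidean_space"
  assumes f: "f integrable_on {c..d}"
  shows "\<exists>N. negligible N \<and>
    (\<forall>x\<in>{c<..<d} - N. ((\<lambda>x. integral {c..x} f) has_vector_derivative f x) (at x))"
proof -
  define F where "F x = integral {c..x} f" for x
  \<comment> \<open>At such a point arbitrarily short intervals ending in \<open>x\<close> have a
    Riemann term and an integral that differ by more than \<open>e\<close> times the length.
    Vitali's lemma selects disjoint ones, and Henstock's lemma makes their total length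
    small.\<close>
  define E where "E e = {x\<in>{c<..<d}. \<forall>\<delta>>0. \<exists>h. h \<noteq> 0 \<and> \<bar>h\<bar> < \<delta> \<and>
      norm (F (x + h) - F x - h *\<^sub>R f x) > e * \<bar>h\<bar>}" for e
  have negE: "negligible (E e)" if "e > 0" for e
  proof (subst negligible_outer_le, intro allI impI)
    fix \<eta> :: real assume "\<eta> > 0"
    \<comment> \<open>The 5 compensates for the fivefold enlargement of the balls in Vitali's lemma:
      disjoint intervals of total length at most \<eta>/5 become a cover of measure at most
      \<eta>.\<close>
    define \<epsilon> where "\<epsilon> = e * \<eta> / 5"
    have "\<epsilon> > 0" using \<open>e > 0\<close> \<open>\<eta> > 0\<close> by (simp add: \<epsilon>_def)
    obtain \<gamma> where "gauge \<gamma>" and \<gamma>: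
      "\<And>p. \<lbrakk>p tagged_partial_division_of (cbox c d); \<gamma> fine p\<rbrakk> \<Longrightarrow>
             sum (\<lambda>(x,k). norm(measure lborel k *\<^sub>R f x - integral k f)) p < \<epsilon>"
      using Henstock_lemma[of f c d \<epsilon>] f \<open>\<epsilon> > 0\<close> by auto
    have "\<exists>h. h \<noteq> 0 \<and> \<bar>h\<bar> < 1 \<and> cball (x + h/2) (\<bar>h\<bar>/2) \<subseteq> \<gamma> x \<inter> {c..d} \<and>
       norm (F (x + h) - F x - h *\<^sub>R f x) > e * \<bar>h\<bar>" if "x \<in> E e" for x
    proof -
      have "open (\<gamma> x \<inter> {c<..<d})" "x \<in> \<gamma> x \<inter> {c<..<d}"
        using \<open>gauge \<gamma>\<close> that by (auto simp: gauge_def E_def)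
      then obtain \<delta> where \<delta>: "\<delta> > 0" "ball x \<delta> \<subseteq> \<gamma> x \<inter> {c<..<d}"
        using open_contains_ball by metis
      have "min \<delta> 1 > 0" using \<delta> by auto
      then obtain h where h: "h \<noteq> 0" "\<bar>h\<bar> < min \<delta> 1" "norm (F (x + h) - F x - h *\<^sub>R f x) > e * \<bar>h\<bar>"
        using \<open>x \<in> E e\<close> unfolding E_def by blast
      have "cball (x + h/2) (\<bar>h\<bar>/2) \<subseteq> ball x \<delta>"
      proof
        fix y assume "y \<in> cball (x + h/2) (\<bar>h\<bar>/2)"
        then have "\<bar>x + h/2 - y\<bar> \<le> \<bar>h\<bar>/2" by (simp add: dist_real_def)
        then have "\<bar>x - y\<bar> \<le> \<bar>h\<bar>" by (simp add: abs_if split: if_splits)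
        then show "y \<in> ball x \<delta>" using h by (simp add: dist_real_def)
      qed
      then show ?thesis using h \<delta> by (intro exI[of _ h]) force
    qed
    then obtain h where h: "\<And>x. x \<in> E e \<Longrightarrow> h x \<noteq> 0 \<and> \<bar>h x\<bar> < 1 \<and>
       cball (x + h x/2) (\<bar>h x\<bar>/2) \<subseteq> \<gamma> x \<inter> {c..d} \<and>
       norm (F (x + h x) - F x - h x *\<^sub>R f x) > e * \<bar>h x\<bar>"
      by metis
    \<comment> \<open>The interval between \<open>x\<close> and \<open>x + h x\<close>, where
      \<open>h x\<close> may have either sign, is written as a closed ball; its end point
      \<open>x\<close> serves as the tag.\<close>
    define a where "a x = x + h x/2" for x
    define r where "r x = \<bar>h x\<bar>/2" for x
    have mem: "x \<in> cball (a x) (r x)" for x by (simp add: a_def r_def dist_real_def)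
    have "E e \<subseteq> (\<Union>x\<in>E e. cball (a x) (r x))" using mem by blast
    moreover have "\<And>x. x \<in> E e \<Longrightarrow> 0 < r x \<and> r x \<le> 1" using h by (force simp: r_def)
    ultimately obtain C where C: "countable C" "C \<subseteq> E e"
      "pairwise (\<lambda>i j. disjnt (cball (a i) (r i)) (cball (a j) (r j))) C"
      "E e \<subseteq> (\<Union>i\<in>C. cball (a i) (5 * r i))"
      by (rule Vitali_covering_lemma_cballs)
    have cb: "cball (a x) (r x) = {a x - r x..a x + r x}" for x by (rule cball_eq_atLeastAtMost)
    have bound: "(\<Sum>x\<in>C'. 2 * r x) \<le> \<eta> / 5" if C': "C' \<subseteq> C" "finite C'" for C'
    proof -
      define p where "p = (\<lambda>x. (x, cball (a x) (r x))) ` C'"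
      have "p tagged_partial_division_of (cbox c d)"
        unfolding tagged_partial_division_of_def
      proof (intro conjI allI impI)
        show "finite p" using C' by (simp add: p_def)
        fix x K assume "(x, K) \<in> p"
        then have K: "x \<in> C'" "K = cball (a x) (r x)" by (auto simp: p_def)
        show "x \<in> K" using K mem by simp
        have "x \<in> E e" using K C C' by auto
        then show "K \<subseteq> cbox c d" using h[of x] K by (auto simp: a_def r_def)
        show "\<exists>a b. K = cbox a b" using K cb by auto
      next
        fix x1 K1 x2 K2
        assume A: "(x1, K1) \<in> p \<and> (x2, K2) \<in> p \<and> (x1, K1) \<noteq> (x2, K2)"
        then have "x1 \<in> C'" "x2 \<in> C'" "x1 \<noteq> x2" "K1 = cball (a x1) (r x1)" "K2 = cball (a x2) (r x2)"
          by (auto simp: p_def)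
        then have "disjnt K1 K2" using C(3) C' by (auto simp: pairwise_def)
        then show "interior K1 \<inter> interior K2 = {}"
          using interior_subset by (fastforce simp: disjnt_def)
      qed
      moreover have "\<gamma> fine p"
        unfolding fine_def p_def using h C(2) C' by (force simp: a_def r_def)
      ultimately have "sum (\<lambda>(x,k). norm(measure lborel k *\<^sub>R f x - integral k f)) p < \<epsilon>" by (rule \<gamma>)
      also have "sum (\<lambda>(x,k). norm(measure lborel k *\<^sub>R f x - integral k f)) p =
        (\<Sum>x\<in>C'. norm (measure lborel (cball (a x) (r x)) *\<^sub>R f x - integral (cball (a x) (r x)) f))"
        unfolding p_def by (subst sum.reindex) (auto simp: inj_on_def)
      finally have *: "\<dots> < \<epsilon>" .
      have "e * (2 * r x) \<le> norm (measure lborel (cball (a x) (r x)) *\<^sub>R f x - integral (cball (a x) (r x)) f)"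
        if "x \<in> C'" for x
      proof -
        have xE: "x \<in> E e" using that C C' by auto
        note hx = h[OF xE]
        have sub: "cball (a x) (r x) \<subseteq> {c..d}" using hx by (auto simp: a_def r_def)
        have con: "measure lborel (cball (a x) (r x)) = \<bar>h x\<bar>" unfolding cb by (simp add: r_def)
        have ints: "f integrable_on {c..t}" if "t \<in> {c..d}" for t
          using f that by (auto intro: integrable_subinterval_real)
        have xcd: "x \<in> {c..d}" using xE by (auto simp: E_def)
        show ?thesis
        proof (cases "h x > 0")
          case True
          then have e1: "cball (a x) (r x) = {x..x + h x}" unfolding cb by (auto simp: a_def r_def)
          have "x + h x \<in> {c..d}" using sub e1 True by auto
          then have "integral {c..x} f + integral {x..x + h x} f = integral {c..x + h x} f"
            by (intro Henstock_Kurzweil_Integration.integral_combine ints) (use xcd True in auto)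
          then have "integral (cball (a x) (r x)) f = F (x + h x) - F x"
            unfolding e1 F_def by (simp add: algebra_simps)
          then show ?thesis using hx True con by (simp add: r_def norm_minus_commute)
        next
          case False
          then have hn: "h x < 0" using hx by auto
          then have e1: "cball (a x) (r x) = {x + h x..x}" unfolding cb by (auto simp: a_def r_def)
          have "x + h x \<in> {c..d}" using sub e1 hn by auto
          then have "integral {c..x + h x} f + integral {x + h x..x} f = integral {c..x} f"
            by (intro Henstock_Kurzweil_Integration.integral_combine ints) (use xcd hn in auto)
          then have "integral (cball (a x) (r x)) f = F x - F (x + h x)"
            unfolding e1 F_def by (simp add: algebra_simps)
          then have "measure lborel (cball (a x) (r x)) *\<^sub>R f x - integral (cball (a x) (r x)) f =
             F (x + h x) - F x - h x *\<^sub>R f x" unfolding con using hn by simp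
          then show ?thesis using hx hn by (simp add: r_def)
        qed
      qed
      then have "(\<Sum>x\<in>C'. e * (2 * r x)) \<le>
         (\<Sum>x\<in>C'. norm (measure lborel (cball (a x) (r x)) *\<^sub>R f x - integral (cball (a x) (r x)) f))"
        by (rule sum_mono)
      with * have "e * (\<Sum>x\<in>C'. 2 * r x) < \<epsilon>" by (simp add: sum_distrib_left)
      then show ?thesis using \<open>e > 0\<close> by (simp add: \<epsilon>_def field_simps)
    qed
    define T where "T = (\<Union>i\<in>C. cball (a i) (5 * r i))"
    have lm: "cball (a i) (5 * r i) \<in> lmeasurable" for i by simp
    have b2: "measure lebesgue (\<Union>i\<in>C'. cball (a i) (5 * r i)) \<le> \<eta>" if C': "C' \<subseteq> C" "finite C'" for C'
    proof -
      have "measure lebesgue (\<Union>i\<in>C'. cball (a i) (5 * r i)) \<le>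
         (\<Sum>i\<in>C'. measure lebesgue (cball (a i) (5 * r i)))"
        using that by (intro measure_UNION_le) auto
      also have "\<dots> = (\<Sum>i\<in>C'. 5 * (2 * r i))"
        by (intro sum.cong refl) (simp add: cball_eq_atLeastAtMost r_def)
      also have "\<dots> = 5 * (\<Sum>i\<in>C'. 2 * r i)" by (simp add: sum_distrib_left)
      also have "\<dots> \<le> \<eta>" using bound[OF C'] by simp
      finally show ?thesis .
    qed
    have "T \<in> lmeasurable" "measure lebesgue T \<le> \<eta>"
      unfolding T_def using fmeasurable_UN_bound[OF \<open>countable C\<close> lm b2]
        measure_UN_bound[OF \<open>countable C\<close> lm b2] by auto
    then show "\<exists>T. E e \<subseteq> T \<and> T \<in> lmeasurable \<and> measure lebesgue T \<le> \<eta>"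
      using C(4) T_def by blast
  qed
  define N where "N = (\<Union>n. E (1 / (Suc n)))"
  have "negligible N" unfolding N_def by (intro negligible_Union_nat negE) simp
  moreover have "(F has_vector_derivative f x) (at x)" if "x \<in> {c<..<d} - N" for x
    unfolding has_vector_derivative_def has_derivative_at_alt
  proof (intro conjI allI impI)
    show "bounded_linear (\<lambda>h. h *\<^sub>R f x)" by (rule bounded_linear_scaleR_left)
    fix e :: real assume "e > 0"
    then obtain n where n: "1 / (Suc n) < e" using nat_approx_posE by blast
    have xE: "x \<notin> E (1 / (Suc n))" "x \<in> {c<..<d}" using that by (auto simp: N_def)
    obtain \<delta> where \<delta>: "\<delta> > 0"
      "\<And>h. h \<noteq> 0 \<Longrightarrow> \<bar>h\<bar> < \<delta> \<Longrightarrow> norm (F (x + h) - F x - h *\<^sub>R f x) \<le> 1 / (Suc n) * \<bar>h\<bar>"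
    proof -
      have "\<not> (\<forall>\<delta>>0. \<exists>h. h \<noteq> 0 \<and> \<bar>h\<bar> < \<delta> \<and>
          norm (F (x + h) - F x - h *\<^sub>R f x) > 1 / (Suc n) * \<bar>h\<bar>)"
        using xE unfolding E_def by blast
      then show ?thesis using that by (metis not_le)
    qed
    show "\<exists>d>0. \<forall>y. norm (y - x) < d \<longrightarrow> norm (F y - F x - (y - x) *\<^sub>R f x) \<le> e * norm (y - x)"
    proof (intro exI conjI allI impI, rule \<open>\<delta> > 0\<close>)
      fix y assume y: "norm (y - x) < \<delta>"
      show "norm (F y - F x - (y - x) *\<^sub>R f x) \<le> e * norm (y - x)"
      proof (cases "y = x")
        case False
        have "norm (F y - F x - (y - x) *\<^sub>R f x) \<le> 1 / (Suc n) * norm (y - x)"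
          using \<delta>(2)[of "y - x"] False y by simp
        also have "\<dots> \<le> e * norm (y - x)" using n by (intro mult_right_mono) auto
        finally show ?thesis .
      qed simp
    qed
  qed
  ultimately show ?thesis unfolding F_def by blast
qed

lemma division_real_intervals:
  fixes T :: "real set"
  assumes "\<D> division_of T" "K \<in> \<D>"
  shows "K = {Inf K..Sup K}" "Inf K \<le> Sup K" "{Inf K..Sup K} \<subseteq> T" "Inf K \<in> T" "Sup K \<in> T"
proof -
  obtain u v where "K = cbox u v" "K \<noteq> {}"
    using division_ofD(3,4)[OF assms] by blast
  then have "K = {u..v}" "u \<le> v" by auto
  then show *: "K = {Inf K..Sup K}" "Inf K \<le> Sup K" by auto
  show "{Inf K..Sup K} \<subseteq> T" using division_ofD(2)[OF assms] * by simp
  then show "Inf K \<in> T" "Sup K \<in> T" using *(2) by auto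
qed

text \<open>The norm of \<open>f\<close> is truncated at a height \<open>k\<close> so large that the
  part above it has integral below \<epsilon>/2 over the whole interval; the part below contributes
  at most \<open>k\<close> times the total length.\<close>

lemma abs_cont_on_indefinite_integral:
  fixes f :: "real \<Rightarrow> 'a::euclidean_space"
  assumes f: "f absolutely_integrable_on {c..d}"
  shows "abs_cont_on c d (\<lambda>x. integral {c..x} f)"
  unfolding abs_cont_on_def
proof (intro allI impI)
  fix \<epsilon> :: real assume "\<epsilon> > 0"
  define g where "g x = norm (f x)" for x
  define gk where "gk k x = min (g x) (real k)" for k x
  have g: "g absolutely_integrable_on {c..d}" unfolding g_def by (rule set_integrable_norm[OF f])
  have gki: "gk k absolutely_integrable_on {c..d}" for k
    unfolding gk_def by (rule absolutely_integrable_min_1[OF g]) auto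
  have "(\<lambda>k. integral {c..d} (gk k)) \<longlonglongrightarrow> integral {c..d} g"
  proof (rule dominated_convergence(2))
    show "gk k integrable_on {c..d}" for k using gki by (rule absolutely_integrable_on_def[THEN iffD1, THEN conjunct1])
    show "g integrable_on {c..d}" using g by (rule absolutely_integrable_on_def[THEN iffD1, THEN conjunct1])
    show "norm (gk k x) \<le> g x" for k x by (auto simp: gk_def g_def)
    show "(\<lambda>k. gk k x) \<longlonglongrightarrow> g x" for x
    proof (rule tendsto_eventually)
      obtain K :: nat where "g x \<le> K" using real_arch_simple by blast
      then show "\<forall>\<^sub>F k in sequentially. gk k x = g x"
        unfolding eventually_sequentially gk_def by (intro exI[of _ K]) (auto simp: min_def)
    qed
  qed
  then have "\<forall>\<^sub>F k in sequentially. dist (integral {c..d} (gk k)) (integral {c..d} g) < \<epsilon>/2"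
    using \<open>\<epsilon> > 0\<close> by (intro tendstoD) auto
  then have "\<exists>k. dist (integral {c..d} (gk k)) (integral {c..d} g) < \<epsilon>/2"
    unfolding eventually_sequentially by blast
  then obtain k where k: "integral {c..d} g - integral {c..d} (gk k) < \<epsilon>/2"
    unfolding dist_real_def by (metis abs_diff_less_iff abs_minus_commute abs_less_iff)
  have gi: "g integrable_on {c..d}" "gk k integrable_on {c..d}"
    using g gki by (auto simp: absolutely_integrable_on_def)
  have gkle: "gk k x \<le> real k" and gkleg: "gk k x \<le> g x" for x by (simp_all add: gk_def)
  show "\<exists>\<delta>>0. \<forall>\<D> T. \<D> division_of T \<and> T \<subseteq> {c..d} \<and> (\<Sum>K\<in>\<D>. Sup K - Inf K) < \<delta>
        \<longrightarrow> (\<Sum>K\<in>\<D>. norm (integral {c..Sup K} f - integral {c..Inf K} f)) < \<epsilon>"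
  proof (intro exI conjI allI impI)
    show "\<epsilon> / (2 * (real k + 1)) > 0" using \<open>\<epsilon> > 0\<close> by simp
    fix \<D> T
    assume *: "\<D> division_of T \<and> T \<subseteq> {c..d} \<and> (\<Sum>K\<in>\<D>. Sup K - Inf K) < \<epsilon> / (2 * (real k + 1))"
    then have div: "\<D> division_of T" and T: "T \<subseteq> {c..d}" by auto
    have "norm (integral {c..Sup K} f - integral {c..Inf K} f) \<le>
        integral K (\<lambda>x. g x - gk k x) + real k * (Sup K - Inf K)" if "K \<in> \<D>" for K
    proof -
      note I = division_real_intervals[OF div that]
      have sub: "{Inf K..Sup K} \<subseteq> {c..d}" using I T by auto
      then have cd: "c \<le> Inf K" "Sup K \<le> d" using I(2) by auto
      have "integral {c..Inf K} f + integral {Inf K..Sup K} f = integral {c..Sup K} f"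
        using f cd I by (intro Henstock_Kurzweil_Integration.integral_combine)
          (auto simp: absolutely_integrable_on_def intro: integrable_subinterval_real)
      then have "integral {c..Sup K} f - integral {c..Inf K} f = integral {Inf K..Sup K} f"
        by (simp add: algebra_simps)
      also have "norm \<dots> \<le> integral {Inf K..Sup K} g" unfolding g_def
        using absolutely_integrable_on_subinterval[OF f sub] 
        by (intro integral_norm_bound_integral) (auto simp: absolutely_integrable_on_def)
      also have "\<dots> \<le> integral {Inf K..Sup K} (\<lambda>x. (g x - gk k x) + k)"
        using integrable_subinterval_real[OF gi(1) sub] integrable_subinterval_real[OF gi(2) sub]
        by (intro integral_le integrable_add integrable_diff) (simp_all add: gkle integrable_const_ivl)
      also have "\<dots> = integral {Inf K..Sup K} (\<lambda>x. g x - gk k x) + real k * (Sup K - Inf K)"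
        using integrable_subinterval_real[OF gi(1) sub] integrable_subinterval_real[OF gi(2) sub] I(2)
        by (subst Henstock_Kurzweil_Integration.integral_add) (auto intro: integrable_diff)
      finally show ?thesis using I(1) by simp
    qed
    then have "(\<Sum>K\<in>\<D>. norm (integral {c..Sup K} f - integral {c..Inf K} f)) \<le>
        (\<Sum>K\<in>\<D>. integral K (\<lambda>x. g x - gk k x)) + real k * (\<Sum>K\<in>\<D>. Sup K - Inf K)"
      by (simp add: sum_distrib_left sum.distrib[symmetric] sum_mono)
    also have "(\<Sum>K\<in>\<D>. integral K (\<lambda>x. g x - gk k x)) = integral T (\<lambda>x. g x - gk k x)"
      by (rule integral_combine_division_topdown[symmetric, OF integrable_on_subdivision[OF div _ T] div])
        (use gi in \<open>auto intro: integrable_diff\<close>)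
    also have "\<dots> \<le> integral {c..d} (\<lambda>x. g x - gk k x)"
      by (rule integral_subset_le[OF T integrable_on_subdivision[OF div _ T]])
        (use gi gkleg in \<open>auto intro: integrable_diff\<close>)
    also have "\<dots> = integral {c..d} g - integral {c..d} (gk k)"
      using gi by (rule Henstock_Kurzweil_Integration.integral_diff)
    also have "\<dots> < \<epsilon>/2" by (rule k)
    also have "real k * (\<Sum>K\<in>\<D>. Sup K - Inf K) \<le> real k * (\<epsilon> / (2 * (real k + 1)))"
      using * by (intro mult_left_mono) auto
    also have "\<dots> \<le> \<epsilon>/2" using \<open>\<epsilon> > 0\<close> by (simp add: field_simps)
    finally show "(\<Sum>K\<in>\<D>. norm (integral {c..Sup K} f - integral {c..Inf K} f)) < \<epsilon>" by simp
  qed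
qed

lemma abs_cont_on_cong:
  assumes "\<And>x. x \<in> {c..d} \<Longrightarrow> f x = g x"
  shows "abs_cont_on c d f \<longleftrightarrow> abs_cont_on c d g"
proof -
  have "(\<Sum>K\<in>\<D>. norm (f (Sup K) - f (Inf K))) = (\<Sum>K\<in>\<D>. norm (g (Sup K) - g (Inf K)))"
    if "\<D> division_of T" "T \<subseteq> {c..d}" for \<D> T
  proof (intro sum.cong refl)
    fix K assume "K \<in> \<D>"
    note I = division_real_intervals[OF that(1) this]
    have "Inf K \<in> {c..d}" "Sup K \<in> {c..d}" using I(4,5) that(2) by blast+
    then show "norm (f (Sup K) - f (Inf K)) = norm (g (Sup K) - g (Inf K))" by (simp add: assms)
  qed
  then show ?thesis unfolding abs_cont_on_def by (metis (no_types, lifting))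
qed

lemma abs_cont_on_single:
  assumes "abs_cont_on c d f" "\<epsilon> > 0"
  obtains \<delta> where "\<delta> > 0"
    "\<And>u v. c \<le> u \<Longrightarrow> u \<le> v \<Longrightarrow> v \<le> d \<Longrightarrow> v - u < \<delta> \<Longrightarrow> norm (f v - f u) < \<epsilon>"
proof -
  obtain \<delta> where \<delta>: "\<delta> > 0" "\<And>\<D> T. \<D> division_of T \<and> T \<subseteq> {c..d} \<and> (\<Sum>K\<in>\<D>. Sup K - Inf K) < \<delta>
        \<Longrightarrow> (\<Sum>K\<in>\<D>. norm (f (Sup K) - f (Inf K))) < \<epsilon>"
    using assms unfolding abs_cont_on_def by metis
  show ?thesis
  proof (rule that[OF \<delta>(1)])
    fix u v assume "c \<le> u" "u \<le> v" "v \<le> d" "v - u < \<delta>"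
    moreover have "{{u..v}} division_of {u..v}" using \<open>u \<le> v\<close> by (auto simp: division_of_def)
    ultimately show "norm (f v - f u) < \<epsilon>" using \<delta>(2)[of "{{u..v}}" "{u..v}"] by auto
  qed
qed

lemma abs_cont_on_imp_continuous_on:
  assumes "abs_cont_on c d f"
  shows "continuous_on {c..d} f"
  unfolding continuous_on_iff
proof (intro ballI allI impI)
  fix x e assume x: "x \<in> {c..d}" and e: "(0::real) < e"
  obtain \<delta> where \<delta>: "\<delta> > 0"
    "\<And>u v. c \<le> u \<Longrightarrow> u \<le> v \<Longrightarrow> v \<le> d \<Longrightarrow> v - u < \<delta> \<Longrightarrow> norm (f v - f u) < e"
    using abs_cont_on_single[OF assms e] by metis
  have "dist (f y) (f x) < e" if "y \<in> {c..d}" "dist y x < \<delta>" for y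
  proof (cases "x \<le> y")
    case True then show ?thesis using \<delta>(2)[of x y] that x by (auto simp: dist_norm)
  next
    case False then show ?thesis using \<delta>(2)[of y x] that x by (auto simp: dist_norm norm_minus_commute)
  qed
  then show "\<exists>d'>0. \<forall>x'\<in>{c..d}. dist x' x < d' \<longrightarrow> dist (f x') (f x) < e" using \<delta>(1) by blast
qed

text \<open>The increment of the product splits into two increments with one factor each; both
  factors are bounded, being continuous on a compact interval.\<close>

lemma abs_cont_on_bilinear:
  fixes prod :: "'a::real_normed_vector \<Rightarrow> 'b::real_normed_vector \<Rightarrow> 'c::real_normed_vector"
  assumes "bounded_bilinear prod" and f: "abs_cont_on c d f" and g: "abs_cont_on c d g"
  shows "abs_cont_on c d (\<lambda>x. prod (f x) (g x))"
proof -
  interpret bounded_bilinear prod by fact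
  obtain K where K: "K > 0" "\<And>a b. norm (prod a b) \<le> norm a * norm b * K" using pos_bounded by blast
  have "bounded (f ` {c..d})" "bounded (g ` {c..d})"
    using f g by (auto intro!: compact_imp_bounded compact_continuous_image abs_cont_on_imp_continuous_on)
  then obtain F G where F: "\<And>x. x \<in> {c..d} \<Longrightarrow> norm (f x) \<le> F" "F > 0"
    and G: "\<And>x. x \<in> {c..d} \<Longrightarrow> norm (g x) \<le> G" "G > 0"
    unfolding bounded_pos by (metis image_eqI)
  show ?thesis unfolding abs_cont_on_def
  proof (intro allI impI)
    fix \<epsilon> :: real assume "\<epsilon> > 0"
    then have "\<epsilon> / (2 * G * K) > 0" "\<epsilon> / (2 * F * K) > 0" using F G K by auto
    note pos = this
    obtain \<delta>1 where \<delta>1: "\<delta>1 > 0"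
      "\<And>\<D> T. \<D> division_of T \<and> T \<subseteq> {c..d} \<and> (\<Sum>K\<in>\<D>. Sup K - Inf K) < \<delta>1
        \<Longrightarrow> (\<Sum>K\<in>\<D>. norm (f (Sup K) - f (Inf K))) < \<epsilon> / (2 * G * K)"
      using f[unfolded abs_cont_on_def, rule_format, OF pos(1)] by blast
    obtain \<delta>2 where \<delta>2: "\<delta>2 > 0"
      "\<And>\<D> T. \<D> division_of T \<and> T \<subseteq> {c..d} \<and> (\<Sum>K\<in>\<D>. Sup K - Inf K) < \<delta>2
        \<Longrightarrow> (\<Sum>K\<in>\<D>. norm (g (Sup K) - g (Inf K))) < \<epsilon> / (2 * F * K)"
      using g[unfolded abs_cont_on_def, rule_format, OF pos(2)] by blast
    note \<delta> = \<delta>1 \<delta>2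
    show "\<exists>\<delta>>0. \<forall>\<D> T. \<D> division_of T \<and> T \<subseteq> {c..d} \<and> (\<Sum>K\<in>\<D>. Sup K - Inf K) < \<delta> \<longrightarrow>
      (\<Sum>K\<in>\<D>. norm (prod (f (Sup K)) (g (Sup K)) - prod (f (Inf K)) (g (Inf K)))) < \<epsilon>"
    proof (intro exI conjI allI impI)
      show "min \<delta>1 \<delta>2 > 0" using \<delta> by auto
      fix \<D> T assume *: "\<D> division_of T \<and> T \<subseteq> {c..d} \<and> (\<Sum>K\<in>\<D>. Sup K - Inf K) < min \<delta>1 \<delta>2"
      have "norm (prod (f (Sup J)) (g (Sup J)) - prod (f (Inf J)) (g (Inf J))) \<le>
         (G * K) * norm (f (Sup J) - f (Inf J)) + (F * K) * norm (g (Sup J) - g (Inf J))" if "J \<in> \<D>" for J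
      proof -
        note I = division_real_intervals[OF conjunct1[OF *] that]
        have J: "Inf J \<in> {c..d}" "Sup J \<in> {c..d}" using I(4,5) * by blast+
        have "prod (f (Sup J)) (g (Sup J)) - prod (f (Inf J)) (g (Inf J)) =
          prod (f (Sup J) - f (Inf J)) (g (Sup J)) + prod (f (Inf J)) (g (Sup J) - g (Inf J))"
          by (simp add: diff_left diff_right)
        also have "norm \<dots> \<le> norm (f (Sup J) - f (Inf J)) * norm (g (Sup J)) * K +
            norm (f (Inf J)) * norm (g (Sup J) - g (Inf J)) * K"
          by (rule norm_triangle_le, rule add_mono[OF K(2) K(2)])
        also have "\<dots> \<le> norm (f (Sup J) - f (Inf J)) * G * K + F * norm (g (Sup J) - g (Inf J)) * K"
          using J F G K(1) by (intro add_mono mult_right_mono mult_left_mono) auto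
        finally show ?thesis by (simp add: mult_ac)
      qed
      then have "(\<Sum>K\<in>\<D>. norm (prod (f (Sup K)) (g (Sup K)) - prod (f (Inf K)) (g (Inf K)))) \<le>
         (\<Sum>J\<in>\<D>. (G * K) * norm (f (Sup J) - f (Inf J)) + (F * K) * norm (g (Sup J) - g (Inf J)))"
        by (rule sum_mono)
      also have "\<dots> = (G * K) * (\<Sum>J\<in>\<D>. norm (f (Sup J) - f (Inf J))) +
          (F * K) * (\<Sum>J\<in>\<D>. norm (g (Sup J) - g (Inf J)))"
        by (simp add: sum.distrib sum_distrib_left)
      also have "\<dots> < (G * K) * (\<epsilon> / (2 * G * K)) + (F * K) * (\<epsilon> / (2 * F * K))"
        using * F G K by (intro add_strict_mono mult_strict_left_mono \<delta>) auto
      also have "\<dots> = \<epsilon>" using F G K by simp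
      finally show "(\<Sum>K\<in>\<D>. norm (prod (f (Sup K)) (g (Sup K)) - prod (f (Inf K)) (g (Inf K)))) < \<epsilon>" .
    qed
  qed
qed

lemma abs_cont_on_add_const:
  assumes "abs_cont_on c d f"
  shows "abs_cont_on c d (\<lambda>x. k + f x)"
  using assms unfolding abs_cont_on_def by simp

text \<open>Fundamental theorem of calculus for absolutely continuous functions, proved with gauges:
  intervals tagged in \<open>N\<close> lie in an open set of small measure, where absolute
  continuity controls the increments, and the other tags satisfy the usual straddle estimate.
  Integrability of \<open>g\<close> is part of the conclusion.\<close>

lemma has_integral_abs_cont_on:
  fixes f :: "real \<Rightarrow> 'a::banach"
  assumes ac: "abs_cont_on c d f" and "c \<le> d" and N: "negligible N"
    and der: "\<And>x. x \<in> {c..d} - N \<Longrightarrow> (f has_vector_derivative g x) (at x)"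
  shows "(g has_integral (f d - f c)) {c..d}"
proof -
  \<comment> \<open>With the value 0 on \<open>N\<close>, a tag in \<open>N\<close> contributes only
    the increment of \<open>f\<close>.\<close>
  define g0 where "g0 x = (if x \<in> N then 0 else g x)" for x
  have "(g0 has_integral (f d - f c)) {c..d}"
    unfolding has_integral_real
  proof (intro allI impI)
    fix e :: real assume "e > 0"
    then obtain \<delta> where \<delta>: "\<delta> > 0" "\<And>\<D> T. \<D> division_of T \<and> T \<subseteq> {c..d} \<and> (\<Sum>K\<in>\<D>. Sup K - Inf K) < \<delta>
        \<Longrightarrow> (\<Sum>K\<in>\<D>. norm (f (Sup K) - f (Inf K))) < e/2"
      using ac unfolding abs_cont_on_def by (metis half_gt_zero)
    obtain U where U: "open U" "N \<subseteq> U" "U \<in> lmeasurable" "measure lebesgue U < \<delta>"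
    proof -
      obtain U where U: "open U" "N \<subseteq> U" "U - N \<in> lmeasurable" "emeasure lebesgue (U - N) < ennreal \<delta>"
        using sets_lebesgue_outer_open[OF negligible_imp_sets[OF N] \<delta>(1)] by metis
      have neg: "negligible ((U - N) - U \<union> (U - (U - N)))"
        by (rule negligible_subset[OF N]) auto
      have "U \<in> lmeasurable"
        by (rule lmeasurable_negligible_symdiff[OF U(3) neg])
      moreover have "measure lebesgue (U - N) < \<delta>"
        using U(4) \<delta>(1) emeasure_eq_measure2[OF U(3)] by (simp add: ennreal_less_iff)
      ultimately show ?thesis
        using that U(1,2) measure_negligible_symdiff[OF U(3) neg] by simp
    qed
    define e' where "e' = e / (2 * (d - c + 1))"
    have "e' > 0" using \<open>e > 0\<close> \<open>c \<le> d\<close> by (simp add: e'_def)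
    have "\<exists>r>0. \<forall>y. norm (y - x) < r \<longrightarrow> norm (f y - f x - (y - x) *\<^sub>R g x) \<le> e' * norm (y - x)"
      if "x \<in> {c..d} - N" for x
      using der[OF that] \<open>e' > 0\<close> unfolding has_vector_derivative_def has_derivative_at_alt by blast
    then obtain r where r: "\<And>x. x \<in> {c..d} - N \<Longrightarrow> r x > 0"
      "\<And>x y. x \<in> {c..d} - N \<Longrightarrow> norm (y - x) < r x \<Longrightarrow> norm (f y - f x - (y - x) *\<^sub>R g x) \<le> e' * norm (y - x)"
      by metis
    define \<gamma> where "\<gamma> x = (if x \<in> N then U else if x \<in> {c..d} then ball x (r x) else ball x 1)" for x
    have gau: "gauge \<gamma>" unfolding gauge_def \<gamma>_def using U r by auto
    show "\<exists>\<gamma>. gauge \<gamma> \<and> (\<forall>\<D>. \<D> tagged_division_of {c..d} \<and> \<gamma> fine \<D> \<longrightarrow>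
        norm ((\<Sum>(x, k)\<in>\<D>. measure lborel k *\<^sub>R g0 x) - (f d - f c)) < e)"
    proof (intro exI conjI allI impI, rule gau)
      fix p assume p: "p tagged_division_of {c..d} \<and> \<gamma> fine p"
      then have ptag: "p tagged_division_of {c..d}" and fine: "\<gamma> fine p" by auto
      have fin: "finite p" using ptag by auto
      define L where "L K = f (Sup K) - f (Inf K)" for K
      define p1 where "p1 = {(x,K)\<in>p. x \<in> N}"
      define p2 where "p2 = {(x,K)\<in>p. x \<notin> N}"
      have p12: "p = p1 \<union> p2" "p1 \<inter> p2 = {}" "finite p1" "finite p2"
        using fin by (auto simp: p1_def p2_def intro: finite_subset[OF _ fin])
      have K: "K = {Inf K..Sup K}" "Inf K \<le> Sup K" "x \<in> K" "K \<subseteq> {c..d}" "K \<subseteq> \<gamma> x"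
        "measure lborel K = Sup K - Inf K" if xK: "(x,K) \<in> p" for x K
      proof -
        obtain u v where "K = cbox u v" "x \<in> K" "K \<subseteq> {c..d}" using ptag xK by blast
        then have *: "K = {u..v}" "u \<le> v" by auto
        then show "K = {Inf K..Sup K}" "Inf K \<le> Sup K" "measure lborel K = Sup K - Inf K" by auto
        show "x \<in> K" "K \<subseteq> {c..d}" by fact+
        show "K \<subseteq> \<gamma> x" using fine xK by auto
      qed
      have fdc: "f d - f c = (\<Sum>(x,K)\<in>p. L K)"
        unfolding L_def using additive_tagged_division_1[OF \<open>c \<le> d\<close> ptag, of f] by simp
      have "(\<Sum>(x, k)\<in>p. measure lborel k *\<^sub>R g0 x) - (f d - f c) = (\<Sum>(x,K)\<in>p. measure lborel K *\<^sub>R g0 x - L K)"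
        unfolding fdc by (simp add: sum_subtractf split_def)
      also have "\<dots> = (\<Sum>(x,K)\<in>p1. measure lborel K *\<^sub>R g0 x - L K) + (\<Sum>(x,K)\<in>p2. measure lborel K *\<^sub>R g0 x - L K)"
        using p12 by (simp add: sum.union_disjoint)
      also have "norm \<dots> \<le> norm (\<Sum>(x,K)\<in>p1. measure lborel K *\<^sub>R g0 x - L K) + norm (\<Sum>(x,K)\<in>p2. measure lborel K *\<^sub>R g0 x - L K)"
        by (rule norm_triangle_ineq)
      also have "norm (\<Sum>(x,K)\<in>p1. measure lborel K *\<^sub>R g0 x - L K) < e/2"
      proof -
        have p1: "p1 tagged_partial_division_of {c..d}"
          using ptag p12(1) by (meson Un_upper1 tagged_division_of_def tagged_partial_division_subset)
        define T where "T = \<Union>(snd ` p1)"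
        have tT: "p1 tagged_division_of T" unfolding T_def by (rule tagged_partial_division_of_Union_self[OF p1])
        have dT: "snd ` p1 division_of T" by (rule division_of_tagged_division[OF tT])
        have "K \<subseteq> {c..d} \<and> K \<subseteq> U" if K1: "K \<in> snd ` p1" for K
        proof -
          obtain x where "(x,K) \<in> p" "x \<in> N" using K1 by (auto simp: p1_def)
          then show ?thesis using K(4,5)[of x K] by (simp add: \<gamma>_def)
        qed
        then have T: "T \<subseteq> {c..d}" "T \<subseteq> U" unfolding T_def by blast+
        have "(\<Sum>K\<in>snd ` p1. Sup K - Inf K) = (\<Sum>K\<in>snd ` p1. measure lebesgue K)"
        proof (intro sum.cong refl)
          fix J assume "J \<in> snd ` p1"
          then obtain q where "q \<in> p1" "J = snd q" by blast
          then have "(fst q, J) \<in> p" using p12(1) by simp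
          then have J: "J = {Inf J..Sup J}" "Inf J \<le> Sup J" using K(1,2) by blast+
          have "measure lebesgue {u..v} = v - u" if "u \<le> v" for u v :: real using that by simp
          from this[OF J(2)] show "Sup J - Inf J = measure lebesgue J" using J(1) by metis
        qed
        also have "\<dots> = measure lebesgue T"
          using content_division[OF dT] by simp
        also have "\<dots> \<le> measure lebesgue U"
        proof (rule measure_mono_fmeasurable[OF T(2) _ U(3)])
          have "snd ` p1 \<subseteq> sets lebesgue"
          proof
            fix K assume "K \<in> snd ` p1"
            then obtain u v where "K = cbox u v" using division_ofD(4)[OF dT] by blast
            then show "K \<in> sets lebesgue" by simp
          qed
          then show "T \<in> sets lebesgue" unfolding T_def
            using p12(3) by (intro sets.finite_Union) auto
        qed
        finally have "(\<Sum>K\<in>snd ` p1. Sup K - Inf K) < \<delta>" using U(4) by simp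
        then have "(\<Sum>K\<in>snd ` p1. norm (L K)) < e/2" unfolding L_def using \<delta>(2)[of "snd ` p1" T] dT T by auto
        moreover have "(\<Sum>(x,K)\<in>p1. norm (L K)) = (\<Sum>K\<in>snd ` p1. norm (L K))"
        proof -
          \<comment> \<open>An interval carrying several tags is degenerate and has increment 0, so
            the sum over pairs equals the sum over intervals. The empty set is treated separately
            because its \<open>Sup\<close> and \<open>Inf\<close> are unspecified.\<close>
          define D where "D K = (if K = {} then 0 else norm (L K))" for K
          have ne: "K \<noteq> {}" if "(x,K) \<in> p1" for x K using that K(3) p12(1) by blast
          have "(\<Sum>(x,K)\<in>p1. norm (L K)) = (\<Sum>(x,K)\<in>p1. D K)"
            using ne by (intro sum.cong refl) (auto simp: D_def)
          also have "\<dots> = sum D (snd ` p1)"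
          proof (rule sum.over_tagged_division_lemma[OF tT])
            fix u v :: real assume "box u v = {}"
            then have "cbox u v = {} \<or> u = v" by (auto simp: box_eq_empty)
            then show "D (cbox u v) = 0" by (auto simp: D_def L_def)
          qed
          also have "\<dots> = (\<Sum>K\<in>snd ` p1. norm (L K))"
            using ne by (intro sum.cong refl) (auto simp: D_def)
          finally show ?thesis .
        qed
        moreover have "norm (\<Sum>(x,K)\<in>p1. measure lborel K *\<^sub>R g0 x - L K) \<le> (\<Sum>(x,K)\<in>p1. norm (L K))"
          by (rule order_trans[OF norm_sum]) (auto simp: p1_def g0_def intro!: sum_mono)
        ultimately show ?thesis by linarith
      qed
      also have "norm (\<Sum>(x,K)\<in>p2. measure lborel K *\<^sub>R g0 x - L K) \<le> (\<Sum>(x,K)\<in>p2. e' * measure lborel K)"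
      proof (rule sum_norm_le, clarify)
        fix x K assume xK2: "(x,K) \<in> p2"
        then have xK: "(x,K) \<in> p" "x \<notin> N" by (auto simp: p2_def)
        note KK = K[OF xK(1)]
        have xin: "x \<in> {c..d} - N" using KK xK by auto
        have sub: "K \<subseteq> ball x (r x)" using KK(5) xin by (auto simp: \<gamma>_def)
        have m: "Inf K \<in> K" "Sup K \<in> K" "Inf K \<le> x" "x \<le> Sup K" using KK(1,2,3) by (metis atLeastAtMost_iff order_refl)+
        have u: "norm (f (Inf K) - f x - (Inf K - x) *\<^sub>R g x) \<le> e' * (x - Inf K)"
          using r(2)[OF xin, of "Inf K"] sub m by (force simp: dist_real_def)
        have v: "norm (f (Sup K) - f x - (Sup K - x) *\<^sub>R g x) \<le> e' * (Sup K - x)"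
          using r(2)[OF xin, of "Sup K"] sub m by (force simp: dist_real_def)
        have "measure lborel K *\<^sub>R g0 x - L K = (f (Inf K) - f x - (Inf K - x) *\<^sub>R g x) - (f (Sup K) - f x - (Sup K - x) *\<^sub>R g x)"
          unfolding KK(6) using xK(2) by (simp add: g0_def L_def algebra_simps)
        also have "norm \<dots> \<le> e' * (x - Inf K) + e' * (Sup K - x)"
          using u v by (meson add_mono norm_triangle_ineq4 order_trans)
        finally have "norm (measure lborel K *\<^sub>R g0 x - L K) \<le> e' * (x - Inf K) + e' * (Sup K - x)" .
        then show "norm (measure lborel K *\<^sub>R g0 x - L K) \<le> e' * measure lborel K"
          unfolding KK(6) by (simp add: algebra_simps)
      qed
      also have "\<dots> \<le> (\<Sum>(x,K)\<in>p. e' * measure lborel K)"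
        using p12 \<open>e' > 0\<close> fin by (intro sum_mono2) auto
      also have "\<dots> = e' * (d - c)"
        using additive_content_tagged_division[of p c d] ptag \<open>c \<le> d\<close>
        by (simp add: sum_distrib_left[symmetric] split_def)
      also have "\<dots> \<le> e/2" using \<open>e > 0\<close> \<open>c \<le> d\<close> by (simp add: e'_def field_simps)
      finally show "norm ((\<Sum>(x, k)\<in>p. measure lborel k *\<^sub>R g0 x) - (f d - f c)) < e" by simp
    qed
  qed
  then show ?thesis
    by (rule has_integral_spike[OF N, rotated]) (auto simp: g0_def)
qed


subsection \<open>Primitives of locally integrable functions\<close>

text \<open>The equation y' = g in integrated form: it mentions no exceptional null set and passes
  easily to subintervals, linear combinations and glued functions.\<close>

definition primitive_on :: "real set \<Rightarrow> (real \<Rightarrow> 'a::banach) \<Rightarrow> (real \<Rightarrow> 'a) \<Rightarrow> bool" where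
  "primitive_on S g y \<longleftrightarrow> (\<forall>s t. s \<le> t \<and> {s..t} \<subseteq> S \<longrightarrow> (g has_integral (y t - y s)) {s..t})"

lemma primitive_onD:
  "primitive_on S g y \<Longrightarrow> s \<le> t \<Longrightarrow> {s..t} \<subseteq> S \<Longrightarrow> (g has_integral (y t - y s)) {s..t}"
  unfolding primitive_on_def by blast

lemma primitive_on_subset: "primitive_on S g y \<Longrightarrow> T \<subseteq> S \<Longrightarrow> primitive_on T g y"
  unfolding primitive_on_def by blast

text \<open>The interiors of the compact intervals already cover, so that statements about interior
  differentiability on each of them reach every point.\<close>

lemma einterval_cover:
  assumes "a < b"
  obtains l u :: "nat \<Rightarrow> real" where "\<And>i. l i < u i" "\<And>i. {l i..u i} \<subseteq> einterval a b"
    "einterval a b = (\<Union>i. {l i<..<u i})" "\<And>i. {l i..u i} \<subseteq> {l (Suc i)..u (Suc i)}"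
proof -
  obtain l u :: "nat \<Rightarrow> real" where
    X: "einterval a b = (\<Union>i. {l i .. u i})"
      "incseq u" "decseq l" "\<And>i. l i < u i" "\<And>i. a < l i" "\<And>i. u i < b"
      "l \<longlonglongrightarrow> a" "u \<longlonglongrightarrow> b"
    using that by (rule einterval_Icc_approximation[OF assms])
  have sub: "{l i..u i} \<subseteq> einterval a b" for i
    unfolding X(1) by (rule UN_upper) simp
  have "\<exists>i. x \<in> {l i<..<u i}" if "x \<in> einterval a b" for x
  proof -
    have "a < ereal x" "ereal x < b" using that by (auto simp: einterval_iff)
    then have "\<forall>\<^sub>F i in sequentially. ereal (l i) < ereal x" "\<forall>\<^sub>F i in sequentially. ereal x < ereal (u i)"
      using X(7,8) by (auto dest: order_tendstoD)
    then have "\<forall>\<^sub>F i in sequentially. x \<in> {l i<..<u i}" by eventually_elim auto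
    then show ?thesis by (auto simp: eventually_sequentially)
  qed
  moreover have "{l i<..<u i} \<subseteq> einterval a b" for i
    by (rule order_trans[OF _ sub[of i]]) auto
  ultimately have "einterval a b = (\<Union>i. {l i<..<u i})" by blast
  moreover have "{l i..u i} \<subseteq> {l (Suc i)..u (Suc i)}" for i
    using incseq_SucD[OF X(2), of i] decseq_SucD[OF X(3), of i] by auto
  ultimately show ?thesis by (rule that[OF X(4) sub])
qed

lemma einterval_Icc: "x \<in> einterval a b \<Longrightarrow> y \<in> einterval a b \<Longrightarrow> {x..y} \<subseteq> einterval a b"
proof
  fix z assume "x \<in> einterval a b" "y \<in> einterval a b" "z \<in> {x..y}"
  then have "a < ereal x" "ereal x \<le> ereal z" "ereal z \<le> ereal y" "ereal y < b"
    by (auto simp: einterval_iff)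
  then show "z \<in> einterval a b" unfolding einterval_iff by (meson less_le_trans le_less_trans)
qed

text \<open>From left to right this is the fundamental theorem for absolutely continuous functions;
  from right to left it is absolute continuity of the integral together with Lebesgue
  differentiation on countably many compact intervals.\<close>

lemma AC_loc_iff_primitive:
  fixes y g :: "real \<Rightarrow> 'a::euclidean_space"
  assumes ab: "a < b" and g: "g \<in> L1_loc a b"
  shows "(y \<in> AC_loc a b \<and> (AE x in lebesgue. x \<in> einterval a b \<longrightarrow> (y has_vector_derivative g x) (at x)))
     \<longleftrightarrow> primitive_on (einterval a b) g y" (is "?L \<longleftrightarrow> ?R")
proof
  assume ?L
  then have ac: "\<And>c d. c < d \<Longrightarrow> {c..d} \<subseteq> einterval a b \<Longrightarrow> abs_cont_on c d y"
    and "AE x in lebesgue. x \<in> einterval a b \<longrightarrow> (y has_vector_derivative g x) (at x)"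
    by (auto simp: AC_loc_def)
  then obtain N where "negligible N" "{x. \<not> (x \<in> einterval a b \<longrightarrow> (y has_vector_derivative g x) (at x))} \<subseteq> N"
    unfolding eventually_ae_filter_negligible by blast
  then have N: "negligible N" "\<And>x. x \<in> einterval a b - N \<Longrightarrow> (y has_vector_derivative g x) (at x)"
    by auto
  show ?R unfolding primitive_on_def
  proof (intro allI impI, elim conjE)
    fix s t :: real assume st: "s \<le> t" "{s..t} \<subseteq> einterval a b"
    show "(g has_integral y t - y s) {s..t}"
    proof (cases "s = t")
      case True then show ?thesis using has_integral_refl(2)[of g s] by simp
    next
      case False
      then show ?thesis using st N by (intro has_integral_abs_cont_on[where N=N] ac) auto
    qed
  qed
next
  assume R: ?R
  have y: "y x = y c + integral {c..x} g" if "x \<in> {c..d}" "{c..d} \<subseteq> einterval a b" for c d x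
  proof -
    have "(g has_integral y x - y c) {c..x}" using that by (intro primitive_onD[OF R]) auto
    then have "integral {c..x} g = y x - y c" by (rule integral_unique)
    then show ?thesis by simp
  qed
  have "abs_cont_on c d y" if "c < d" "{c..d} \<subseteq> einterval a b" for c d
  proof -
    have "abs_cont_on c d (\<lambda>x. y c + integral {c..x} g)"
      using g that by (intro abs_cont_on_add_const abs_cont_on_indefinite_integral) (auto simp: L1_loc_def)
    then show ?thesis using abs_cont_on_cong[of c d y "\<lambda>x. y c + integral {c..x} g"] y that by metis
  qed
  then have "y \<in> AC_loc a b" by (auto simp: AC_loc_def)
  moreover have "AE x in lebesgue. x \<in> einterval a b \<longrightarrow> (y has_vector_derivative g x) (at x)"
  proof -
    obtain l u :: "nat \<Rightarrow> real" where lu: "\<And>i. l i < u i" "\<And>i. {l i..u i} \<subseteq> einterval a b"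
      "einterval a b = (\<Union>i. {l i<..<u i})" using einterval_cover[OF ab] by metis
    have "\<exists>N. negligible N \<and> (\<forall>x\<in>{l i<..<u i} - N. ((\<lambda>x. integral {l i..x} g) has_vector_derivative g x) (at x))" for i
      by (rule lebesgue_differentiation_real)
        (use g lu(2) in \<open>auto simp: L1_loc_def absolutely_integrable_on_def\<close>)
    then obtain N where N: "\<And>i. negligible (N i)"
      "\<And>i x. x \<in> {l i<..<u i} - N i \<Longrightarrow> ((\<lambda>x. integral {l i..x} g) has_vector_derivative g x) (at x)"
      by metis
    have "negligible (\<Union>i. N i)" by (intro negligible_Union_nat N)
    then have "AE x in lebesgue. x \<notin> (\<Union>i. N i)"
      by (intro AE_not_in) (simp add: negligible_iff_null_sets)
    moreover have "(y has_vector_derivative g x) (at x)" if x: "x \<in> einterval a b" "x \<notin> (\<Union>i. N i)" for x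
    proof -
      obtain i where i: "x \<in> {l i<..<u i}" using x lu(3) by blast
      have "((\<lambda>x. y (l i) + integral {l i..x} g) has_vector_derivative 0 + g x) (at x)"
        by (intro has_vector_derivative_add has_vector_derivative_const N(2)) (use i x in auto)
      then have "((\<lambda>x. y (l i) + integral {l i..x} g) has_vector_derivative g x) (at x)" by simp
      then show ?thesis
        by (rule has_vector_derivative_transform_within_open[where S="{l i<..<u i}"])
          (use i in \<open>auto intro!: y[OF _ lu(2), symmetric]\<close>)
    qed
    ultimately show ?thesis by auto
  qed
  ultimately show ?L by blast
qed

lemma primitive_on_continuous:
  fixes y :: "real \<Rightarrow> 'a::euclidean_space"
  assumes "primitive_on S g y" "{c..d} \<subseteq> S"
  shows "continuous_on {c..d} y"
proof (cases "c \<le> d")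
  case True
  have "g integrable_on {c..d}" using primitive_onD[OF assms(1) True assms(2)] by blast
  then have "continuous_on {c..d} (\<lambda>x. y c + integral {c..x} g)"
    by (intro continuous_intros indefinite_integral_continuous_1)
  moreover have "y x = y c + integral {c..x} g" if "x \<in> {c..d}" for x
    using integral_unique[OF primitive_onD[OF assms(1), of c x]] that assms(2) by force
  ultimately show ?thesis by (metis (no_types, lifting) continuous_on_cong)
qed simp

text \<open>Integration by parts by way of absolute continuity: the product rule holds almost
  everywhere, and \<open>has_integral_abs_cont_on\<close> integrates it, supplying the integrability
  of the derivative as well.\<close>

lemma primitive_on_bilinear:
  fixes prod :: "'a::euclidean_space \<Rightarrow> 'b::euclidean_space \<Rightarrow> 'c::euclidean_space"
  assumes bl: "bounded_bilinear prod" and ab: "a < b"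
    and f: "f' \<in> L1_loc a b" "primitive_on (einterval a b) f' f"
    and g: "g' \<in> L1_loc a b" "primitive_on (einterval a b) g' g"
  shows "primitive_on (einterval a b) (\<lambda>x. prod (f x) (g' x) + prod (f' x) (g x)) (\<lambda>x. prod (f x) (g x))"
  unfolding primitive_on_def
proof (intro allI impI, elim conjE)
  fix s t :: real assume st: "s \<le> t" "{s..t} \<subseteq> einterval a b"
  let ?h = "\<lambda>x. prod (f x) (g' x) + prod (f' x) (g x)"
  show "(?h has_integral prod (f t) (g t) - prod (f s) (g s)) {s..t}"
  proof (cases "s = t")
    case True then show ?thesis using has_integral_refl(2)[of ?h s] by simp
  next
    case False
    have F: "f \<in> AC_loc a b" "AE x in lebesgue. x \<in> einterval a b \<longrightarrow> (f has_vector_derivative f' x) (at x)"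
      using AC_loc_iff_primitive[OF ab f(1), of f] f(2) by auto
    have G: "g \<in> AC_loc a b" "AE x in lebesgue. x \<in> einterval a b \<longrightarrow> (g has_vector_derivative g' x) (at x)"
      using AC_loc_iff_primitive[OF ab g(1), of g] g(2) by auto
    have "AE x in lebesgue. x \<in> einterval a b \<longrightarrow> ((\<lambda>x. prod (f x) (g x)) has_vector_derivative ?h x) (at x)"
      using F(2) G(2) by eventually_elim (auto intro: bounded_bilinear.has_vector_derivative[OF bl])
    then obtain N where "negligible N" "{x. \<not> (x \<in> einterval a b \<longrightarrow> ((\<lambda>x. prod (f x) (g x)) has_vector_derivative ?h x) (at x))} \<subseteq> N"
      unfolding eventually_ae_filter_negligible by blast
    then have N: "negligible N" "\<And>x. x \<in> {s..t} - N \<Longrightarrow> ((\<lambda>x. prod (f x) (g x)) has_vector_derivative ?h x) (at x)"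
      using st by auto
    have "abs_cont_on s t f" "abs_cont_on s t g"
      using F G st False by (auto simp: AC_loc_def)
    then have "abs_cont_on s t (\<lambda>x. prod (f x) (g x))" by (rule abs_cont_on_bilinear[OF bl])
    then show ?thesis using st N by (intro has_integral_abs_cont_on[where N=N]) auto
  qed
qed

subsection \<open>Linear differential equations with integrable coefficients\<close>

lemma bounded_bilinear_matrix_vector_mult:
  "bounded_bilinear (\<lambda>(A::complex^'m::finite^'k::finite) v. A *v v)"
proof -
  have "bilinear (\<lambda>(A::complex^'m^'k) v. A *v v)"
    unfolding bilinear_def
    by (auto intro!: linearI simp: matrix_vector_mult_def vec_eq_iff sum.distrib algebra_simps
        scaleR_sum_right)
  then show ?thesis by (simp add: bilinear_conv_bounded_bilinear)
qed

lemma absolutely_integrable_matrix_vector_mult: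
  fixes A :: "real \<Rightarrow> complex^'m::finite^'k::finite"
  assumes A: "A absolutely_integrable_on {s..t}" and y: "continuous_on {s..t} y"
  shows "(\<lambda>x. A x *v y x) absolutely_integrable_on {s..t}"
proof (rule absolutely_integrable_bounded_measurable_product[where h="\<lambda>v A. A *v v" and f=y and g=A])
  have "bounded_bilinear (\<lambda>v (A::complex^'m^'k). A *v v)"
    using bounded_bilinear.flip[OF bounded_bilinear_matrix_vector_mult] .
  then show "bilinear (\<lambda>v (A::complex^'m^'k). A *v v)" by (simp add: bilinear_conv_bounded_bilinear)
  show "y \<in> borel_measurable (lebesgue_on {s..t})"
    by (rule continuous_imp_measurable_on_sets_lebesgue[OF y]) simp
  show "bounded (y ` {s..t})" using y by (intro compact_imp_bounded compact_continuous_image) auto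
qed (use A in auto)

lemma norm_integral_diff_le:
  fixes h :: "real \<Rightarrow> 'a::euclidean_space"
  assumes h: "h absolutely_integrable_on {u..v}" and x: "x \<in> {u..v}" and t: "t \<in> {u..v}"
  shows "norm (integral {u..x} h - integral {u..t} h) \<le> integral {u..v} (\<lambda>x. norm (h x))"
proof -
  have hi: "h integrable_on {s..r}" "(\<lambda>x. norm (h x)) integrable_on {s..r}" if "{s..r} \<subseteq> {u..v}" for s r
    using absolutely_integrable_on_subinterval[OF h that] by (auto simp: absolutely_integrable_on_def)
  have *: "norm (integral {u..x} h - integral {u..t} h) \<le> integral {u..v} (\<lambda>x. norm (h x))"
    if "t \<le> x" "x \<in> {u..v}" "t \<in> {u..v}" for x t
  proof -
    have "integral {u..t} h + integral {t..x} h = integral {u..x} h"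
      using that by (intro Henstock_Kurzweil_Integration.integral_combine hi) auto
    then have "integral {u..x} h - integral {u..t} h = integral {t..x} h" by (simp add: algebra_simps)
    also have "norm \<dots> \<le> integral {t..x} (\<lambda>x. norm (h x))"
      using that by (intro integral_norm_bound_integral hi) auto
    also have "\<dots> \<le> integral {u..v} (\<lambda>x. norm (h x))"
      using that by (intro integral_subset_le hi) auto
    finally show ?thesis .
  qed
  show ?thesis
    using *[of t x] *[of x t] x t by (cases "t \<le> x") (auto simp: norm_minus_commute)
qed

lemma primitive_on_Icc_integral:
  fixes g :: "real \<Rightarrow> 'a::euclidean_space"
  assumes "g integrable_on {u..v}"
  shows "primitive_on {u..v} g (\<lambda>x. k + integral {u..x} g)"
  unfolding primitive_on_def
proof (intro allI impI, elim conjE)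
  fix s t assume st: "s \<le> t" "{s..t} \<subseteq> {u..v}"
  then have "integral {u..s} g + integral {s..t} g = integral {u..t} g"
    using assms by (intro Henstock_Kurzweil_Integration.integral_combine)
      (auto intro: integrable_subinterval_real)
  moreover have "g integrable_on {s..t}" using st assms by (auto intro: integrable_subinterval_real)
  ultimately show "(g has_integral k + integral {u..t} g - (k + integral {u..s} g)) {s..t}"
    by (metis add_diff_cancel_left add_diff_cancel_left' has_integral_integral)
qed

lemma primitive_on_glue:
  fixes y1 y2 :: "real \<Rightarrow> 'a::euclidean_space"
  assumes 1: "primitive_on {u..m} g1 y1" and 2: "primitive_on {m..v} g2 y2" and m: "y1 m = y2 m"
  shows "primitive_on {u..v} (\<lambda>x. if x \<le> m then g1 x else g2 x) (\<lambda>x. if x \<le> m then y1 x else y2 x)"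
  unfolding primitive_on_def
proof (intro allI impI, elim conjE)
  fix s t assume st: "s \<le> t" "{s..t} \<subseteq> {u..v}"
  let ?g = "\<lambda>x. if x \<le> m then g1 x else g2 x" and ?y = "\<lambda>x. if x \<le> m then y1 x else y2 x"
  have A: "(?g has_integral y1 t - y1 s) {s..t}" if "s \<le> t" "{s..t} \<subseteq> {u..m}" for s t
    using primitive_onD[OF 1 that] by (rule has_integral_spike[of "{}", rotated 2]) (use that in auto)
  have B: "(?g has_integral y2 t - y2 s) {s..t}" if "s \<le> t" "{s..t} \<subseteq> {m..v}" for s t
    using primitive_onD[OF 2 that] by (rule has_integral_spike[of "{m}", rotated 2]) (use that in auto)
  consider "t \<le> m" | "m < s" | "s \<le> m" "m < t" using st by linarith
  then show "(?g has_integral ?y t - ?y s) {s..t}"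
  proof cases
    case 1 then show ?thesis using A[of s t] st by auto
  next
    case 2 then show ?thesis using B[of s t] st by auto
  next
    case 3
    then have "(?g has_integral (y1 m - y1 s) + (y2 t - y2 m)) {s..t}"
      using st by (intro has_integral_combine[of s m t] A B) auto
    then show ?thesis using 3 m by simp
  qed
qed

lemma primitive_on_cong:
  assumes "primitive_on S g y" "\<And>x. x \<in> S \<Longrightarrow> g x = g' x" "\<And>x. x \<in> S \<Longrightarrow> y x = y' x"
  shows "primitive_on S g' y'"
  unfolding primitive_on_def
proof (intro allI impI, elim conjE)
  fix s t :: real assume st: "s \<le> t" "{s..t} \<subseteq> S"
  then have "s \<in> S" "t \<in> S" by auto
  then have "(g has_integral y' t - y' s) {s..t}"
    using primitive_onD[OF assms(1) st] by (simp add: assms(3))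
  then show "(g' has_integral y' t - y' s) {s..t}"
    by (rule has_integral_spike[of "{}", rotated 2]) (use st assms(2) in auto)
qed

lemma primitive_on_diff:
  assumes "primitive_on S g y" "primitive_on S g' y'"
  shows "primitive_on S (\<lambda>x. g x - g' x) (\<lambda>x. y x - y' x)"
  unfolding primitive_on_def
proof (intro allI impI, elim conjE)
  fix s t :: real assume st: "s \<le> t" "{s..t} \<subseteq> S"
  from has_integral_diff[OF primitive_onD[OF assms(1) st] primitive_onD[OF assms(2) st]]
  show "((\<lambda>x. g x - g' x) has_integral y t - y' t - (y s - y' s)) {s..t}"
    by (simp add: algebra_simps)
qed

locale linear_ode =
  fixes a b :: ereal and A :: "real \<Rightarrow> complex^'m::finite^'m" and r :: "real \<Rightarrow> complex^'m"
  assumes ab: "a < b" and A: "A \<in> L1_loc a b" and r: "r \<in> L1_loc a b"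
begin

definition sol_on :: "real set \<Rightarrow> (real \<Rightarrow> complex^'m) \<Rightarrow> bool" where
  "sol_on S y \<longleftrightarrow> primitive_on S (\<lambda>x. A x *v y x + r x) y"

definition hsol_on :: "real set \<Rightarrow> (real \<Rightarrow> complex^'m) \<Rightarrow> bool" where
  "hsol_on S y \<longleftrightarrow> primitive_on S (\<lambda>x. A x *v y x) y"

lemma sol_on_diff: "sol_on S y \<Longrightarrow> sol_on S z \<Longrightarrow> hsol_on S (\<lambda>x. y x - z x)"
  unfolding sol_on_def hsol_on_def
  by (drule (1) primitive_on_diff) (simp add: matrix_vector_mult_diff_distrib)

lemma Ai: "{s..t} \<subseteq> einterval a b \<Longrightarrow> A absolutely_integrable_on {s..t}"
  and ri: "{s..t} \<subseteq> einterval a b \<Longrightarrow> r absolutely_integrable_on {s..t}"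
  using A r by (auto simp: L1_loc_def)

text \<open>The base point \<open>t\<close> is arbitrary, and intervals not contained in (a,b)
  satisfy the property vacuously. In this form it is inherited when adjacent intervals are joined,
  which permits a proof by bisection with \<open>Bolzano\<close>.\<close>

definition "well_posed u v \<longleftrightarrow> ({u..v} \<subseteq> einterval a b \<longrightarrow>
   (\<forall>t\<in>{u..v}. (\<forall>w. \<exists>y. sol_on {u..v} y \<and> y t = w) \<and>
      (\<forall>y. hsol_on {u..v} y \<and> y t = 0 \<longrightarrow> (\<forall>x\<in>{u..v}. y x = 0))))"

text \<open>The solution is taken on the part containing \<open>t\<close> and continued to the other
  part through its value at \<open>m\<close>.\<close>

lemma well_posed_trans:
  assumes "well_posed u m" "well_posed m v" "u \<le> m" "m \<le> v"
  shows "well_posed u v"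
  unfolding well_posed_def
proof (intro impI ballI conjI allI, goal_cases)
  case (1 t w)
  then have sub: "{u..m} \<subseteq> einterval a b" "{m..v} \<subseteq> einterval a b" using assms by auto
  have "\<exists>y1 y2. sol_on {u..m} y1 \<and> sol_on {m..v} y2 \<and> y1 m = y2 m \<and> (if t \<le> m then y1 t = w else y2 t = w)"
  proof (cases "t \<le> m")
    case True
    then have "t \<in> {u..m}" using 1 by auto
    then obtain y1 where "sol_on {u..m} y1" "y1 t = w" using assms(1) sub unfolding well_posed_def by blast
    moreover have "m \<in> {m..v}" using assms by auto
    then obtain y2 where "sol_on {m..v} y2" "y2 m = y1 m" using assms(2) sub unfolding well_posed_def by blast
    ultimately show ?thesis using True by metis
  next
    case False
    then have "t \<in> {m..v}" using 1 by auto
    then obtain y1 where "sol_on {m..v} y1" "y1 t = w" using assms(2) sub unfolding well_posed_def by blast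
    moreover have "m \<in> {u..m}" using assms by auto
    then obtain y2 where "sol_on {u..m} y2" "y2 m = y1 m" using assms(1) sub unfolding well_posed_def by blast
    ultimately show ?thesis using False by metis
  qed
  then obtain y1 y2 where y: "sol_on {u..m} y1" "sol_on {m..v} y2" "y1 m = y2 m"
      "if t \<le> m then y1 t = w else y2 t = w" by blast
  let ?y = "\<lambda>x. if x \<le> m then y1 x else y2 x"
  have "sol_on {u..v} ?y" unfolding sol_on_def
    by (rule primitive_on_cong[OF primitive_on_glue[OF y(1)[unfolded sol_on_def] y(2)[unfolded sol_on_def] y(3)]]) auto
  then show ?case using y(4) by (intro exI[of _ ?y]) auto
next
  case (2 t y x)
  then have sub: "{u..m} \<subseteq> einterval a b" "{m..v} \<subseteq> einterval a b" using assms by auto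
  have P: "hsol_on {u..v} y" "y t = 0" using 2 by auto
  have h: "hsol_on {u..m} y" "hsol_on {m..v} y"
    using P(1) unfolding hsol_on_def by (rule primitive_on_subset; use assms in force)+
  have m: "m \<in> {u..m}" "m \<in> {m..v}" using assms by auto
  have "y m = 0"
  proof (cases "t \<le> m")
    case True
    then have "t \<in> {u..m}" using 2 by auto
    then show ?thesis using P(2) h sub m assms(1) unfolding well_posed_def by blast
  next
    case False
    then have "t \<in> {m..v}" using 2 by auto
    then show ?thesis using P(2) h sub m assms(2) unfolding well_posed_def by blast
  qed
  moreover have "m \<in> {u..m}" "m \<in> {m..v}" using assms by auto
  ultimately have "\<forall>x\<in>{u..m}. y x = 0" "\<forall>x\<in>{m..v}. y x = 0"
    using assms(1,2) h sub unfolding well_posed_def by blast+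
  then show ?case using 2 by (cases "x \<le> m") auto
qed

text \<open>Picard iteration: smallness of the integral of the norm of \<open>A\<close> makes the
  integral operator a contraction with constant 1/2 in the supremum norm. The same estimate, at a
  point where the norm is maximal, forces a homogeneous solution with a zero to vanish.\<close>

lemma well_posed_local:
  assumes K: "\<And>(M::complex^'m^'m) v. norm (M *v v) \<le> norm M * norm v * K"
    and uv: "{u..v} \<subseteq> einterval a b" and small: "integral {u..v} (\<lambda>x. norm (A x)) * K \<le> 1/2" and "K > 0"
  shows "well_posed u v"
  unfolding well_posed_def
proof (intro impI ballI conjI allI, goal_cases)
  case (1 t w)
  have "u \<le> v" using 1 by auto
  \<comment> \<open>The type of bounded continuous functions has the whole line as domain;
    composition with the projection onto \<open>{u..v}\<close> turns functions on the interval into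
    elements of it.\<close>
  define c where "c x = max u (min v x)" for x
  have c: "c x \<in> {u..v}" "x \<in> {u..v} \<Longrightarrow> c x = x" for x using \<open>u \<le> v\<close> by (auto simp: c_def)
  have cc: "continuous_on UNIV c" unfolding c_def by (intro continuous_intros)
  define h where "h f x = A x *v apply_bcontfun f x + r x" for f x
  have Af: "(\<lambda>x. A x *v apply_bcontfun f x) absolutely_integrable_on {u..v}" for f :: "real \<Rightarrow>\<^sub>C (complex^'m)"
    by (intro absolutely_integrable_matrix_vector_mult Ai uv continuous_on_apply_bcontfun) 
  have hf: "h f absolutely_integrable_on {u..v}" for f
    unfolding h_def by (intro set_integral_add Af ri uv)
  then have hfi: "h f integrable_on {u..v}" for f by (simp add: absolutely_integrable_on_def)
  define T0 where "T0 f x = w + (integral {u..c x} (h f) - integral {u..t} (h f))" for f x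
  have T0: "T0 f \<in> bcontfun" for f
  proof -
    have co: "continuous_on {u..v} (\<lambda>x. w + (integral {u..x} (h f) - integral {u..t} (h f)))"
      by (intro continuous_intros indefinite_integral_continuous_1 hfi)
    have "continuous_on UNIV (T0 f)" unfolding T0_def
      by (rule continuous_on_compose2[OF co cc]) (use c in auto)
    moreover have "bounded (range (T0 f))"
    proof (rule bounded_subset)
      show "bounded ((\<lambda>x. w + (integral {u..x} (h f) - integral {u..t} (h f))) ` {u..v})"
        by (intro compact_imp_bounded compact_continuous_image co) auto
      show "range (T0 f) \<subseteq> (\<lambda>x. w + (integral {u..x} (h f) - integral {u..t} (h f))) ` {u..v}"
        using c by (auto simp: T0_def)
    qed
    ultimately show ?thesis by (simp add: bcontfun_def)
  qed
  define T where "T f = Bcontfun (T0 f)" for f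
  have T: "apply_bcontfun (T f) x = T0 f x" for f x by (simp add: T_def Bcontfun_inverse T0)
  have "\<exists>!f\<in>UNIV. T f = f"
  proof (rule Banach_fix)
    show "complete (UNIV :: (real \<Rightarrow>\<^sub>C (complex^'m)) set)" by (rule complete_UNIV)
    show "dist (T f) (T g) \<le> (1/2) * dist f g" for f g
    proof (rule dist_bound)
      fix x
      have d: "h f x - h g x = A x *v (apply_bcontfun f x - apply_bcontfun g x)" for x
        by (simp add: h_def matrix_vector_mult_diff_distrib)
      have di: "(\<lambda>x. h f x - h g x) absolutely_integrable_on {u..v}" by (intro set_integral_diff hf)
      have si: "h f integrable_on {u..x}" if "x \<in> {u..v}" for f x
        by (rule integrable_subinterval_real[OF hfi]) (use that in auto)
      have "dist (apply_bcontfun (T f) x) (apply_bcontfun (T g) x) =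
        norm (integral {u..c x} (\<lambda>x. h f x - h g x) - integral {u..t} (\<lambda>x. h f x - h g x))"
        using c(1)[of x] 1 unfolding T T0_def
        by (simp add: Henstock_Kurzweil_Integration.integral_diff si dist_norm algebra_simps)
      also have "\<dots> \<le> integral {u..v} (\<lambda>x. norm (h f x - h g x))"
        using norm_integral_diff_le[OF di c(1)] 1 by blast
      also have "\<dots> \<le> integral {u..v} (\<lambda>x. (K * dist f g) * norm (A x))"
      proof (rule integral_le)
        show "(\<lambda>x. norm (h f x - h g x)) integrable_on {u..v}" using di by (simp add: absolutely_integrable_on_def)
        show "(\<lambda>x. (K * dist f g) * norm (A x)) integrable_on {u..v}"
          using Ai[OF uv] by (intro integrable_on_mult_right) (simp add: absolutely_integrable_on_def)
        fix x
        have "norm (h f x - h g x) \<le> norm (A x) * norm (apply_bcontfun f x - apply_bcontfun g x) * K"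
          unfolding d by (rule K)
        also have "\<dots> \<le> norm (A x) * dist f g * K"
          using \<open>K > 0\<close> dist_bounded[of f x g] by (intro mult_right_mono mult_left_mono) (auto simp: dist_norm)
        finally show "norm (h f x - h g x) \<le> (K * dist f g) * norm (A x)" by (simp add: mult_ac)
      qed
      also have "\<dots> = (integral {u..v} (\<lambda>x. norm (A x)) * K) * dist f g" by simp
      also have "\<dots> \<le> (1/2) * dist f g" using small by (intro mult_right_mono) auto
      finally show "dist (apply_bcontfun (T f) x) (apply_bcontfun (T g) x) \<le> (1/2) * dist f g" .
    qed
  qed auto
  then obtain f where f: "T f = f" by blast
  let ?y = "apply_bcontfun f"
  have y: "?y x = w - integral {u..t} (h f) + integral {u..x} (h f)" if "x \<in> {u..v}" for x
    using T[of f x] c(2)[OF that] by (simp add: f T0_def)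
  have "primitive_on {u..v} (h f) ?y"
    by (rule primitive_on_cong[OF primitive_on_Icc_integral[OF hfi]]) (use y in auto)
  then have "sol_on {u..v} ?y" unfolding sol_on_def h_def .
  moreover have "?y t = w" using y[OF 1(2)] by simp
  ultimately show ?case by blast
next
  case (2 t y x)
  have yt: "y t = 0" and P: "primitive_on {u..v} (\<lambda>x. A x *v y x) y" using 2 by (auto simp: hsol_on_def)
  have cont: "continuous_on {u..v} y" by (rule primitive_on_continuous[OF P order_refl])
  have Ay: "(\<lambda>x. A x *v y x) absolutely_integrable_on {u..v}"
    by (intro absolutely_integrable_matrix_vector_mult Ai uv cont)
  have "continuous_on {u..v} (\<lambda>x. norm (y x))" using cont by (intro continuous_intros)
  moreover have "{u..v} \<noteq> {}" using 2 by auto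
  ultimately obtain x0 where x0: "x0 \<in> {u..v}" "\<And>x. x \<in> {u..v} \<Longrightarrow> norm (y x) \<le> norm (y x0)"
    using continuous_attains_sup[of "{u..v}" "\<lambda>x. norm (y x)"] by auto
  have yx: "integral {u..x} (\<lambda>x. A x *v y x) = y x - y u" if "x \<in> {u..v}" for x
    using that by (intro integral_unique primitive_onD[OF P]) auto
  have "norm (y x0) = norm (integral {u..x0} (\<lambda>x. A x *v y x) - integral {u..t} (\<lambda>x. A x *v y x))"
    using yx[OF x0(1)] yx[OF 2(2)] yt by simp
  also have "\<dots> \<le> integral {u..v} (\<lambda>x. norm (A x *v y x))"
    by (rule norm_integral_diff_le[OF Ay x0(1) 2(2)])
  also have "\<dots> \<le> integral {u..v} (\<lambda>x. (K * norm (y x0)) * norm (A x))"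
  proof (rule integral_le)
    show "(\<lambda>x. norm (A x *v y x)) integrable_on {u..v}" using Ay by (simp add: absolutely_integrable_on_def)
    show "(\<lambda>x. (K * norm (y x0)) * norm (A x)) integrable_on {u..v}"
      using Ai[OF uv] by (intro integrable_on_mult_right) (simp add: absolutely_integrable_on_def)
    fix x assume "x \<in> {u..v}"
    have "norm (A x *v y x) \<le> norm (A x) * norm (y x) * K" by (rule K)
    also have "\<dots> \<le> norm (A x) * norm (y x0) * K"
      using \<open>K > 0\<close> x0(2)[OF \<open>x \<in> {u..v}\<close>] by (intro mult_right_mono mult_left_mono) auto
    finally show "norm (A x *v y x) \<le> (K * norm (y x0)) * norm (A x)" by (simp add: mult_ac)
  qed
  also have "\<dots> = (integral {u..v} (\<lambda>x. norm (A x)) * K) * norm (y x0)" by simp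
  also have "\<dots> \<le> (1/2) * norm (y x0)" using small by (intro mult_right_mono) auto
  finally have "norm (y x0) = 0" by simp
  then show ?case using x0(2)[of x] 2 by auto
qed

lemma well_posed_all:
  assumes "u \<le> v" shows "well_posed u v"
proof (cases "{u..v} \<subseteq> einterval a b")
  case False then show ?thesis by (simp add: well_posed_def)
next
  case uv: True
  obtain K where K: "K > 0" "\<And>(M::complex^'m^'m) v. norm (M *v v) \<le> norm M * norm v * K"
    using bounded_bilinear.pos_bounded[OF bounded_bilinear_matrix_vector_mult] by blast
  show ?thesis using assms
  proof (induction u v rule: Bolzano)
    case (trans p q s)
    then show ?case using well_posed_trans by blast
  next
    case (local x)
    then have xin: "x \<in> einterval a b" using uv by auto
    obtain p q where pq: "p < x" "x < q" "{p..q} \<subseteq> einterval a b"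
    proof -
      obtain e where "e > 0" "ball x e \<subseteq> einterval a b"
        using xin open_einterval open_contains_ball by blast
      then show ?thesis using that[of "x - e/2" "x + e/2"] by (auto simp: ball_def dist_real_def subset_iff abs_less_iff)
    qed
    let ?n = "\<lambda>x. norm (A x)"
    have ni: "?n integrable_on {p..q}" using Ai[OF pq(3)] by (simp add: absolutely_integrable_on_def)
    have "continuous_on {p..q} (\<lambda>x. integral {p..x} ?n)" by (rule indefinite_integral_continuous_1[OF ni])
    \<comment> \<open>The primitive at both ends of a short interval around \<open>x\<close>
      deviates by less than 1/(4K), so the integral over the interval stays below the bound 1/(2K)
      required by \<open>well_posed_local\<close>.\<close>
    moreover have "x \<in> {p..q}" "1/(4*K) > 0" using pq K by auto
    ultimately obtain d where d: "d > 0" "\<And>z. z \<in> {p..q} \<Longrightarrow> dist z x < d \<Longrightarrow> dist (integral {p..z} ?n) (integral {p..x} ?n) < 1/(4*K)"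
      unfolding continuous_on_iff by meson
    show ?case
    proof (intro exI conjI allI impI)
      show "min d (min (x - p) (q - x)) > 0" using d pq by auto
      fix s t assume st: "s \<le> x \<and> x \<le> t \<and> t - s < min d (min (x - p) (q - x))"
      then have in_pq: "s \<in> {p..q}" "t \<in> {p..q}" "s \<le> t" "dist s x < d" "dist t x < d" by (auto simp: dist_real_def)
      have "integral {p..s} ?n + integral {s..t} ?n = integral {p..t} ?n"
        using in_pq ni by (intro Henstock_Kurzweil_Integration.integral_combine) (auto intro: integrable_subinterval_real)
      moreover have "dist (integral {p..s} ?n) (integral {p..x} ?n) < 1/(4*K)" "dist (integral {p..t} ?n) (integral {p..x} ?n) < 1/(4*K)"
        using d(2) in_pq by blast+
      ultimately have "integral {s..t} ?n < 1/(4*K) + 1/(4*K)" unfolding dist_real_def by linarith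
      then have "integral {s..t} ?n * K \<le> 1/2" using K(1) by (simp add: field_simps)
      moreover have "{s..t} \<subseteq> einterval a b" using in_pq pq(3) by auto
      ultimately show "well_posed s t" using well_posed_local[OF K(2) _ _ K(1)] by blast
    qed
  qed
qed

lemma hsol_zero:
  assumes "hsol_on (einterval a b) y" "t \<in> einterval a b" "y t = 0" "x \<in> einterval a b"
  shows "y x = 0"
proof -
  let ?u = "min x t" and ?v = "max x t"
  have sub: "{?u..?v} \<subseteq> einterval a b" using assms(2,4) by (intro einterval_Icc) (auto simp: min_def max_def)
  have "well_posed ?u ?v" by (rule well_posed_all) auto
  moreover have "hsol_on {?u..?v} y" using assms(1) sub unfolding hsol_on_def by (rule primitive_on_subset)
  moreover have "t \<in> {?u..?v}" "x \<in> {?u..?v}" by auto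
  ultimately show ?thesis using sub assms(3) unfolding well_posed_def by blast
qed

text \<open>Solutions on compact intervals containing \<open>c\<close> agree by uniqueness, so the
  global solution can be defined at each \<open>x\<close> from the interval between \<open>x\<close>
  and \<open>c\<close> alone.\<close>

lemma sol_exists:
  assumes c: "c \<in> einterval a b"
  shows "\<exists>y. sol_on (einterval a b) y \<and> y c = w"
proof -
  define y where "y x = (SOME f. sol_on {min x c..max x c} f \<and> f c = w) x" for x
  have yZ: "y x = Z x" if Z: "sol_on {u..v} Z" "Z c = w" and uv: "{u..v} \<subseteq> einterval a b" "c \<in> {u..v}" "x \<in> {u..v}" for x u v Z
  proof -
    let ?I = "{min x c..max x c}"
    let ?f = "SOME f. sol_on ?I f \<and> f c = w"
    have sub: "?I \<subseteq> {u..v}" using uv by auto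
    then have Z': "sol_on ?I Z" using Z(1) unfolding sol_on_def by (rule primitive_on_subset[rotated])
    then have "sol_on ?I ?f \<and> ?f c = w" using Z(2) someI[of "\<lambda>f. sol_on ?I f \<and> f c = w" Z] by blast
    then have "hsol_on ?I (\<lambda>x. ?f x - Z x)" "?f c - Z c = 0" using sol_on_diff Z' Z(2) by auto
    moreover have "well_posed (min x c) (max x c)" by (rule well_posed_all) auto
    moreover have "c \<in> ?I" "x \<in> ?I" by auto
    moreover have "?I \<subseteq> einterval a b" using sub uv(1) by (rule order_trans)
    ultimately have "?f x - Z x = 0" unfolding well_posed_def by blast
    then show ?thesis by (simp add: y_def)
  qed
  have ex: "\<exists>Z. sol_on {u..v} Z \<and> Z c = w" if "{u..v} \<subseteq> einterval a b" "c \<in> {u..v}" for u v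
    using well_posed_all[of u v] that unfolding well_posed_def by auto
  have "sol_on (einterval a b) y" unfolding sol_on_def primitive_on_def
  proof (intro allI impI, elim conjE)
    fix s t :: real assume st: "s \<le> t" "{s..t} \<subseteq> einterval a b"
    have "min s c \<in> einterval a b" "max t c \<in> einterval a b" using st c by (auto simp: min_def max_def)
    then have sub: "{min s c..max t c} \<subseteq> einterval a b" by (rule einterval_Icc)
    then obtain Z where Z: "sol_on {min s c..max t c} Z" "Z c = w" using ex by fastforce
    have yZ': "y x = Z x" if x: "x \<in> {s..t}" for x
    proof (rule yZ[OF Z sub])
      show "x \<in> {min s c..max t c}" using x by (simp add: min.coboundedI1 max.coboundedI1)
    qed simp
    have "primitive_on {s..t} (\<lambda>x. A x *v Z x + r x) Z"
      by (rule primitive_on_subset[OF Z(1)[unfolded sol_on_def]]) auto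
    then have "primitive_on {s..t} (\<lambda>x. A x *v y x + r x) y"
      by (rule primitive_on_cong) (use yZ' in auto)
    then show "((\<lambda>x. A x *v y x + r x) has_integral y t - y s) {s..t}" by (rule primitive_onD[OF _ st(1) order_refl])
  qed
  moreover have "y c = w"
  proof -
    obtain Z where "sol_on {c..c} Z" "Z c = w" using ex[of c c] c by auto
    then show ?thesis using yZ[of c c Z c] c by auto
  qed
  ultimately show ?thesis by blast
qed

end

subsection \<open>The complex inner product\<close>

lemma cinner_add_left: "cinner (u + v) w = cinner u w + cinner v w"
  and cinner_add_right: "cinner u (v + w) = cinner u v + cinner u w"
  and cinner_diff_left: "cinner (u - v) w = cinner u w - cinner v w"
  and cinner_diff_right: "cinner u (v - w) = cinner u v - cinner u w"
  and cinner_minus_left: "cinner (- u) v = - cinner u v"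
  and cinner_minus_right: "cinner u (- v) = - cinner u v"
  and cinner_scale_left: "cinner (k *s u) v = k * cinner u v"
  and cinner_scale_right: "cinner u (k *s v) = cnj k * cinner u v"
  and cinner_scaleR_left: "cinner (r *\<^sub>R u) v = r *\<^sub>R cinner u v"
  and cinner_scaleR_right: "cinner u (r *\<^sub>R v) = r *\<^sub>R cinner u v"
  and cinner_zero_left [simp]: "cinner 0 v = 0"
  and cinner_zero_right [simp]: "cinner u 0 = 0"
  by (simp_all add: cinner_def algebra_simps sum.distrib sum_subtractf sum_negf sum_distrib_left
      scaleR_sum_right)

lemma cinner_commute: "cinner v u = cnj (cinner u v)"
  by (simp add: cinner_def mult.commute)

lemma Re_cinner: "Re (cinner u v) = inner u v"
  by (simp add: cinner_def inner_vec_def inner_complex_def)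

lemma cinner_self: "cinner u u = of_real ((norm u)\<^sup>2)"
proof -
  have "cinner u u = of_real (\<Sum>i\<in>UNIV. (cmod (u $ i))\<^sup>2)"
    by (simp add: cinner_def complex_norm_square del: of_real_power)
  also have "(\<Sum>i\<in>UNIV. (cmod (u $ i))\<^sup>2) = (norm u)\<^sup>2"
    by (simp add: norm_vec_def L2_set_def sum_nonneg)
  finally show ?thesis .
qed

lemma cinner_madj: "cinner (A *v u) v = cinner u (madj A *v v)"
proof -
  have "cinner (A *v u) v = (\<Sum>i\<in>UNIV. \<Sum>j\<in>UNIV. A $ i $ j * u $ j * cnj (v $ i))"
    by (simp add: cinner_def matrix_vector_mult_def sum_distrib_right)
  also have "\<dots> = (\<Sum>j\<in>UNIV. \<Sum>i\<in>UNIV. A $ i $ j * u $ j * cnj (v $ i))" by (rule sum.swap)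
  also have "\<dots> = cinner u (madj A *v v)"
    by (simp add: cinner_def matrix_vector_mult_def madj_def sum_distrib_left mult_ac)
  finally show ?thesis .
qed

lemma bounded_bilinear_cinner: "bounded_bilinear cinner"
proof -
  have "bilinear (cinner :: complex^'m \<Rightarrow> complex^'m \<Rightarrow> complex)"
    unfolding bilinear_def
    by (auto intro!: linearI simp: cinner_add_left cinner_add_right cinner_scaleR_left cinner_scaleR_right)
  then show ?thesis by (simp add: bilinear_conv_bounded_bilinear)
qed

lemma cinner_eq_zero_imp: "(\<And>v. cinner u v = 0) \<Longrightarrow> u = 0"
  using cinner_self[of u] by simp

lemma cinner_axis: "cinner u (axis i 1) = u $ i"
  by (simp add: cinner_def axis_def if_distrib[of cnj] if_distrib[of "\<lambda>z. _ * z"] cong: if_cong)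

section \<open>Positive semidefinite matrices\<close>

definition psd :: "complex^'m^'m \<Rightarrow> bool" where
  "psd B \<longleftrightarrow> madj B = B \<and> (\<forall>v. 0 \<le> Re (cinner (B *v v) v))"

lemma psd_commute: "psd B \<Longrightarrow> cinner (B *v u) v = cnj (cinner (B *v v) u)"
  by (metis cinner_commute cinner_madj psd_def)

lemma psd_self: assumes "psd B" shows "cinner (B *v v) v = of_real (Re (cinner (B *v v) v))"
proof -
  have "Im (cinner (B *v v) v) = - Im (cinner (B *v v) v)"
    by (subst psd_commute[OF assms]) simp
  then show ?thesis by (simp add: complex_eq_iff)
qed

lemma quadratic_nonneg_imp_cmod_le:
  fixes s :: complex and \<alpha> \<beta> :: real
  assumes q: "\<And>t. 0 \<le> \<alpha> + 2 * Re (cnj t * s) + (cmod t)\<^sup>2 * \<beta>" and \<beta>: "\<beta> \<ge> 0"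
  shows "(cmod s)\<^sup>2 \<le> \<alpha> * \<beta>"
proof -
  have q': "0 \<le> \<alpha> - 2 * k * (cmod s)\<^sup>2 + k\<^sup>2 * (cmod s)\<^sup>2 * \<beta>" for k :: real
  proof -
    have "Re (cnj (- of_real k * s) * s) = - k * (cmod s)\<^sup>2"
      by (simp add: cmod_def power2_eq_square algebra_simps)
    moreover have "(cmod (- of_real k * s))\<^sup>2 = k\<^sup>2 * (cmod s)\<^sup>2"
      by (simp add: norm_mult power_mult_distrib)
    ultimately show ?thesis using q[of "- of_real k * s"] by simp
  qed
  show ?thesis
  proof (cases "\<beta> = 0")
    case True
    have "cmod s = 0"
    proof (rule ccontr)
      assume "cmod s \<noteq> 0"
      then have p: "(cmod s)\<^sup>2 > 0" by simp
      \<comment> \<open>This choice of the real parameter turns the right-hand side into \<alpha> -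
        2(|\<alpha>| + 1), which is negative.\<close>
      have "0 \<le> \<alpha> - 2 * ((\<bar>\<alpha>\<bar> + 1) / (cmod s)\<^sup>2) * (cmod s)\<^sup>2" using q'[of "(\<bar>\<alpha>\<bar> + 1) / (cmod s)\<^sup>2"] True by simp
      then show False using p by simp
    qed
    then show ?thesis using True by simp
  next
    case False
    then have "\<beta> > 0" using \<beta> by simp
    then show ?thesis using q'[of "1 / \<beta>"] by (simp add: field_simps power2_eq_square)
  qed
qed

lemma psd_quadratic:
  assumes "psd B"
  shows "Re (cinner (B *v (u + t *s v)) (u + t *s v)) =
     Re (cinner (B *v u) u) + 2 * Re (cnj t * cinner (B *v u) v) + (cmod t)\<^sup>2 * Re (cinner (B *v v) v)"
proof -
  have "cinner (B *v (u + t *s v)) (u + t *s v) = cinner (B *v u) u + cnj t * cinner (B *v u) v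
     + t * cinner (B *v v) u + t * cnj t * cinner (B *v v) v"
    by (simp add: matrix_vector_right_distrib matrix_vector_mult_scaleR vector_scalar_commute
        cinner_add_left cinner_add_right cinner_scale_left cinner_scale_right algebra_simps)
  moreover have "t * cinner (B *v v) u = cnj (cnj t * cinner (B *v u) v)"
    using psd_commute[OF assms, of v u] by simp
  moreover have "Re (t * cnj t * cinner (B *v v) v) = (cmod t)\<^sup>2 * Re (cinner (B *v v) v)"
    by (simp add: complex_norm_square[symmetric] del: of_real_power)
  ultimately show ?thesis by simp
qed

lemma psd_Cauchy_Schwarz:
  assumes "psd B"
  shows "(cmod (cinner (B *v u) v))\<^sup>2 \<le> Re (cinner (B *v u) u) * Re (cinner (B *v v) v)"
proof (rule quadratic_nonneg_imp_cmod_le)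
  show "0 \<le> Re (cinner (B *v u) u) + 2 * Re (cnj t * cinner (B *v u) v) + (cmod t)\<^sup>2 * Re (cinner (B *v v) v)" for t
    unfolding psd_quadratic[OF assms, symmetric] using assms by (simp add: psd_def)
  show "0 \<le> Re (cinner (B *v v) v)" using assms by (simp add: psd_def)
qed

text \<open>Cauchy-Schwarz for the form of \<open>B\<close> with \<open>B v\<close> as the second
  vector. It turns smallness of the seminorm into smallness of the vector \<open>B v\<close>
  itself.\<close>

lemma psd_norm_le:
  assumes B: "psd B" and K: "\<And>v. norm (B *v v) \<le> K * norm v"
  shows "(norm (B *v v))\<^sup>2 \<le> K * Re (cinner (B *v v) v)"
proof -
  let ?w = "B *v v"
  have nn: "0 \<le> Re (cinner (B *v v) v)" using B by (simp add: psd_def)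
  have "((norm ?w)\<^sup>2)\<^sup>2 = (cmod (cinner (B *v v) ?w))\<^sup>2"
    unfolding cinner_self norm_of_real by simp
  also have "\<dots> \<le> Re (cinner (B *v v) v) * Re (cinner (B *v ?w) ?w)" by (rule psd_Cauchy_Schwarz[OF B])
  also have "\<dots> \<le> Re (cinner (B *v v) v) * ((K * norm ?w) * norm ?w)"
  proof (rule mult_left_mono[OF _ nn])
    have "Re (cinner (B *v ?w) ?w) \<le> norm (B *v ?w) * norm ?w"
      unfolding Re_cinner by (rule norm_cauchy_schwarz)
    also have "\<dots> \<le> (K * norm ?w) * norm ?w" by (intro mult_right_mono K) auto
    finally show "Re (cinner (B *v ?w) ?w) \<le> (K * norm ?w) * norm ?w" .
  qed
  finally have *: "(norm ?w)\<^sup>2 * (norm ?w)\<^sup>2 \<le> (norm ?w)\<^sup>2 * (K * Re (cinner (B *v v) v))"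
    by (simp add: power2_eq_square mult_ac)
  show ?thesis
  proof (cases "?w = 0")
    case False
    then have "0 < (norm ?w)\<^sup>2" by simp
    then show ?thesis by (rule mult_left_le_imp_le[OF *])
  next
    case True
    then have "Re (cinner (B *v v) v) = 0" by simp
    then show ?thesis using True by simp
  qed
qed

subsection \<open>Square integrable functions with respect to a matrix weight\<close>

definition sq :: "'a measure \<Rightarrow> ('a \<Rightarrow> complex^'m^'m) \<Rightarrow> ('a \<Rightarrow> complex^'m) \<Rightarrow> bool" where
  "sq M B f \<longleftrightarrow> f \<in> borel_measurable M \<and> integrable M (\<lambda>x. cinner (B x *v f x) (f x))"

definition ip :: "'a measure \<Rightarrow> ('a \<Rightarrow> complex^'m^'m) \<Rightarrow> ('a \<Rightarrow> complex^'m) \<Rightarrow> ('a \<Rightarrow> complex^'m) \<Rightarrow> complex" where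
  "ip M B f g = (\<integral>x. cinner (B x *v f x) (g x) \<partial>M)"

text \<open>Squared seminorm, so that quadratic expansions contain no roots; \<open>sqrt\<close> is
  applied where the triangle inequality is used.\<close>

definition nr :: "'a measure \<Rightarrow> ('a \<Rightarrow> complex^'m^'m) \<Rightarrow> ('a \<Rightarrow> complex^'m) \<Rightarrow> real" where
  "nr M B f = Re (ip M B f f)"

lemma borel_measurable_vec:
  fixes f :: "'a \<Rightarrow> complex^'m::finite"
  assumes "\<And>k. (\<lambda>x. f x $ k) \<in> borel_measurable M"
  shows "f \<in> borel_measurable M"
proof (subst borel_measurable_euclidean_space, intro ballI)
  fix i :: "complex^'m" assume "i \<in> Basis"
  then obtain k b where "i = axis k b" by (auto simp: Basis_vec_def)
  then have "(\<lambda>x. inner (f x) i) = (\<lambda>x. inner (f x $ k) b)" by (simp add: inner_axis)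
  moreover have "(\<lambda>x. inner (f x $ k) b) \<in> borel_measurable M" using assms[of k] by measurable
  ultimately show "(\<lambda>x. inner (f x) i) \<in> borel_measurable M" by simp
qed

lemma borel_measurable_bounded_bilinear:
  fixes prod :: "'b::euclidean_space \<Rightarrow> 'c::euclidean_space \<Rightarrow> 'd::euclidean_space"
  assumes "bounded_bilinear prod" "f \<in> borel_measurable M" "g \<in> borel_measurable M"
  shows "(\<lambda>x. prod (f x) (g x)) \<in> borel_measurable M"
  by (rule borel_measurable_continuous_Pair[OF assms(2,3)])
    (intro bounded_bilinear.continuous_on[OF assms(1)] continuous_intros)

lemmas borel_measurable_mv = borel_measurable_bounded_bilinear[OF bounded_bilinear_matrix_vector_mult]
lemmas borel_measurable_cinner = borel_measurable_bounded_bilinear[OF bounded_bilinear_cinner]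

locale weight =
  fixes M :: "'a measure" and B :: "'a \<Rightarrow> complex^'m::finite^'m"
  assumes B_meas: "B \<in> borel_measurable M" and B_psd: "AE x in M. psd (B x)"
begin

abbreviation "q f x \<equiv> Re (cinner (B x *v f x) (f x))"

lemma meas_q:
  assumes "f \<in> borel_measurable M" "g \<in> borel_measurable M"
  shows "(\<lambda>x. cinner (B x *v f x) (g x)) \<in> borel_measurable M"
  by (intro borel_measurable_cinner borel_measurable_mv B_meas assms)

lemma sq_meas: "sq M B f \<Longrightarrow> f \<in> borel_measurable M" by (simp add: sq_def)

lemma sq_q: "sq M B f \<Longrightarrow> integrable M (q f)" by (simp add: sq_def integrable_Re)

lemma sqI: assumes f: "f \<in> borel_measurable M" and q: "integrable M (q f)" shows "sq M B f"
proof -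
  have "integrable M (\<lambda>x. cinner (B x *v f x) (f x))"
  proof (rule Bochner_Integration.integrable_bound[OF q meas_q[OF f f]])
    show "AE x in M. norm (cinner (B x *v f x) (f x)) \<le> norm (q f x)"
      using B_psd by eventually_elim (metis norm_of_real order_refl psd_self real_norm_def)
  qed
  then show ?thesis using f by (simp add: sq_def)
qed

lemma integrable_ip:
  assumes f: "sq M B f" and g: "sq M B g"
  shows "integrable M (\<lambda>x. cinner (B x *v f x) (g x))"
proof (rule Bochner_Integration.integrable_bound)
  show "integrable M (\<lambda>x. q f x + q g x)" using sq_q[OF f] sq_q[OF g] by (rule Bochner_Integration.integrable_add)
  show "(\<lambda>x. cinner (B x *v f x) (g x)) \<in> borel_measurable M" using f g by (intro meas_q sq_meas)
  show "AE x in M. norm (cinner (B x *v f x) (g x)) \<le> norm (q f x + q g x)"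
    using B_psd
  proof eventually_elim
    case (elim x)
    then have nn: "q f x \<ge> 0" "q g x \<ge> 0" by (auto simp: psd_def)
    have "(cmod (cinner (B x *v f x) (g x)))\<^sup>2 \<le> q f x * q g x" by (rule psd_Cauchy_Schwarz[OF elim])
    also have "\<dots> \<le> (q f x + q g x)\<^sup>2"
      using mult_nonneg_nonneg[OF nn] zero_le_power2[of "q f x"] zero_le_power2[of "q g x"]
      unfolding power2_sum by linarith
    finally have "cmod (cinner (B x *v f x) (g x)) \<le> q f x + q g x"
      by (rule power2_le_imp_le) (use nn in simp)
    then show ?case using nn by simp
  qed
qed

lemma sq_add: assumes f: "sq M B f" and g: "sq M B g" shows "sq M B (\<lambda>x. f x + g x)"
  unfolding sq_def
proof
  show "(\<lambda>x. f x + g x) \<in> borel_measurable M" using f g by (intro borel_measurable_add sq_meas)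
  have "(\<lambda>x. cinner (B x *v (f x + g x)) (f x + g x)) =
    (\<lambda>x. (cinner (B x *v f x) (f x) + cinner (B x *v f x) (g x)) + (cinner (B x *v g x) (f x) + cinner (B x *v g x) (g x)))"
    by (simp add: fun_eq_iff matrix_vector_right_distrib cinner_add_left cinner_add_right algebra_simps)
  then show "integrable M (\<lambda>x. cinner (B x *v (f x + g x)) (f x + g x))"
    using f g by (simp add: integrable_ip)
qed

lemma sq_scale: assumes f: "sq M B f" shows "sq M B (\<lambda>x. k *s f x)"
  unfolding sq_def
proof
  show "(\<lambda>x. k *s f x) \<in> borel_measurable M"
  proof (rule borel_measurable_vec)
    fix i
    have "(\<lambda>x. cinner (f x) (axis i 1)) \<in> borel_measurable M"
      by (intro borel_measurable_cinner sq_meas[OF f] borel_measurable_const)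
    then show "(\<lambda>x. (k *s f x) $ i) \<in> borel_measurable M" by (simp add: cinner_axis)
  qed
  have "(\<lambda>x. cinner (B x *v (k *s f x)) (k *s f x)) = (\<lambda>x. (k * cnj k) * cinner (B x *v f x) (f x))"
    by (simp add: fun_eq_iff vector_scalar_commute cinner_scale_left cinner_scale_right)
  then show "integrable M (\<lambda>x. cinner (B x *v (k *s f x)) (k *s f x))"
    using integrable_ip[OF f f] by simp
qed

lemma sq_zero: "sq M B (\<lambda>x. 0)" by (simp add: sq_def)

lemma sq_diff: assumes "sq M B f" "sq M B g" shows "sq M B (\<lambda>x. f x - g x)"
  using sq_add[OF assms(1) sq_scale[OF assms(2), of "-1"]] by (simp add: vector_smult_lneg)

lemma ip_add_left: "sq M B f \<Longrightarrow> sq M B g \<Longrightarrow> sq M B h \<Longrightarrow> ip M B (\<lambda>x. f x + g x) h = ip M B f h + ip M B g h"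
  and ip_add_right: "sq M B f \<Longrightarrow> sq M B g \<Longrightarrow> sq M B h \<Longrightarrow> ip M B h (\<lambda>x. f x + g x) = ip M B h f + ip M B h g"
  and ip_diff_left: "sq M B f \<Longrightarrow> sq M B g \<Longrightarrow> sq M B h \<Longrightarrow> ip M B (\<lambda>x. f x - g x) h = ip M B f h - ip M B g h"
  and ip_diff_right: "sq M B f \<Longrightarrow> sq M B g \<Longrightarrow> sq M B h \<Longrightarrow> ip M B h (\<lambda>x. f x - g x) = ip M B h f - ip M B h g"
  by (simp_all add: ip_def matrix_vector_right_distrib matrix_vector_mult_diff_distrib
      cinner_add_left cinner_add_right cinner_diff_left cinner_diff_right integrable_ip)

lemma ip_scale_left: "ip M B (\<lambda>x. k *s f x) g = k * ip M B f g"
  and ip_scale_right: "ip M B f (\<lambda>x. k *s g x) = cnj k * ip M B f g"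
  by (simp_all add: ip_def vector_scalar_commute cinner_scale_left cinner_scale_right)

lemma ip_commute: "ip M B g f = cnj (ip M B f g)" if "f \<in> borel_measurable M" "g \<in> borel_measurable M"
proof -
  have "ip M B g f = (\<integral>x. cnj (cinner (B x *v f x) (g x)) \<partial>M)"
    unfolding ip_def
  proof (rule integral_cong_AE)
    show "AE x in M. cinner (B x *v g x) (f x) = cnj (cinner (B x *v f x) (g x))"
      using B_psd by eventually_elim (rule psd_commute)
    show "(\<lambda>x. cnj (cinner (B x *v f x) (g x))) \<in> borel_measurable M"
      using meas_q[OF that] by (rule borel_measurable_continuous_on[OF continuous_on_cnj[OF continuous_on_id]])
  qed (use meas_q that in auto)
  then show ?thesis by (simp add: ip_def)
qed

lemma nr_nonneg: "nr M B f \<ge> 0"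
proof (cases "integrable M (\<lambda>x. cinner (B x *v f x) (f x))")
  case True
  then have "nr M B f = (\<integral>x. q f x \<partial>M)" by (simp add: nr_def ip_def)
  also have "\<dots> \<ge> 0" using B_psd by (intro integral_nonneg_AE) (auto simp: psd_def)
  finally show ?thesis .
qed (simp add: nr_def ip_def not_integrable_integral_eq)

lemma nr_eq_integral: "sq M B f \<Longrightarrow> nr M B f = (\<integral>x. q f x \<partial>M)"
  by (simp add: nr_def ip_def sq_def)

lemma ip_self: "sq M B f \<Longrightarrow> ip M B f f = of_real (nr M B f)"
  using ip_commute[OF sq_meas sq_meas, of f f]
  by (simp add: nr_def complex_eq_iff)

lemma nr_quadratic:
  assumes f: "sq M B f" and g: "sq M B g"
  shows "nr M B (\<lambda>x. f x + t *s g x) = nr M B f + 2 * Re (cnj t * ip M B f g) + (cmod t)\<^sup>2 * nr M B g"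
proof -
  have tg: "sq M B (\<lambda>x. t *s g x)" by (rule sq_scale[OF g])
  have "ip M B (\<lambda>x. f x + t *s g x) (\<lambda>x. f x + t *s g x) = ip M B f f + cnj t * ip M B f g + t * ip M B g f + t * cnj t * ip M B g g"
    by (simp add: ip_add_left ip_add_right f g tg sq_add ip_scale_left ip_scale_right algebra_simps)
  moreover have "t * ip M B g f = cnj (cnj t * ip M B f g)"
    using ip_commute[OF sq_meas[OF f] sq_meas[OF g]] by simp
  moreover have "Re (t * cnj t * ip M B g g) = (cmod t)\<^sup>2 * nr M B g"
    by (simp add: complex_norm_square[symmetric] nr_def del: of_real_power)
  ultimately show ?thesis by (simp add: nr_def)
qed

lemma ip_Cauchy_Schwarz:
  assumes "sq M B f" "sq M B g"
  shows "(cmod (ip M B f g))\<^sup>2 \<le> nr M B f * nr M B g"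
proof (rule quadratic_nonneg_imp_cmod_le)
  show "0 \<le> nr M B f + 2 * Re (cnj t * ip M B f g) + (cmod t)\<^sup>2 * nr M B g" for t
    unfolding nr_quadratic[OF assms, symmetric] by (rule nr_nonneg)
qed (rule nr_nonneg)

lemma ip_le: "sq M B f \<Longrightarrow> sq M B g \<Longrightarrow> cmod (ip M B f g) \<le> sqrt (nr M B f) * sqrt (nr M B g)"
  using ip_Cauchy_Schwarz[of f g] by (metis real_sqrt_mult real_le_rsqrt)

lemma nr_scale: "nr M B (\<lambda>x. t *s g x) = (cmod t)\<^sup>2 * nr M B g"
proof -
  have "ip M B (\<lambda>x. t *s g x) (\<lambda>x. t *s g x) = (t * cnj t) * ip M B g g"
    by (simp add: ip_scale_left ip_scale_right)
  then show ?thesis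
    by (simp add: complex_norm_square[symmetric] nr_def del: of_real_power)
qed

lemma nr_triangle:
  assumes f: "sq M B f" and g: "sq M B g"
  shows "sqrt (nr M B (\<lambda>x. f x + g x)) \<le> sqrt (nr M B f) + sqrt (nr M B g)"
proof (rule real_le_lsqrt)
  have "nr M B (\<lambda>x. f x + g x) = nr M B f + 2 * Re (ip M B f g) + nr M B g"
    using nr_quadratic[OF f g, of 1] by simp
  also have "\<dots> \<le> nr M B f + 2 * (sqrt (nr M B f) * sqrt (nr M B g)) + nr M B g"
    using ip_le[OF f g] complex_Re_le_cmod[of "ip M B f g"] by linarith
  also have "\<dots> = (sqrt (nr M B f) + sqrt (nr M B g))\<^sup>2"
    by (simp add: power2_sum nr_nonneg)
  finally show "nr M B (\<lambda>x. f x + g x) \<le> (sqrt (nr M B f) + sqrt (nr M B g))\<^sup>2" .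
qed (simp_all add: nr_nonneg)

lemma nr_minus_commute: "nr M B (\<lambda>x. f x - g x) = nr M B (\<lambda>x. g x - f x)"
proof -
  have "(\<lambda>x. f x - g x) = (\<lambda>x. (-1) *s (g x - f x))" by (simp add: fun_eq_iff vector_smult_lneg)
  then show ?thesis using nr_scale[of "-1" "\<lambda>x. g x - f x"] by simp
qed

lemma nr_triangle_diff:
  assumes "sq M B f" "sq M B g" "sq M B h"
  shows "sqrt (nr M B (\<lambda>x. f x - h x)) \<le> sqrt (nr M B (\<lambda>x. f x - g x)) + sqrt (nr M B (\<lambda>x. g x - h x))"
  using nr_triangle[OF sq_diff[OF assms(1,2)] sq_diff[OF assms(2,3)]] by simp

text \<open>Only the images \<open>B f\<^sub>k\<close> have to converge: the seminorm of \<open>B\<close> is lower semicontinuous with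
  respect to them.\<close>

lemma nr_Fatou:
  assumes fk: "\<And>k. sq M B (fk k)" and f: "f \<in> borel_measurable M"
    and lim: "AE x in M. (\<lambda>k. B x *v fk k x) \<longlonglongrightarrow> B x *v f x"
    and C: "\<And>k. nr M B (fk k) \<le> C"
  shows "sq M B f" "nr M B f \<le> C"
proof -
  have C0: "C \<ge> 0" using C[of 0] nr_nonneg[of "fk 0"] by linarith
  have qm: "q g \<in> borel_measurable M" if "g \<in> borel_measurable M" for g
    using meas_q[OF that that] by measurable
  have lsc: "AE x in M. ennreal (q f x) \<le> liminf (\<lambda>k. ennreal (q (fk k) x))"
    using lim B_psd
  proof eventually_elim
    case (elim x)
    have nn: "q g x \<ge> 0" for g using elim by (auto simp: psd_def)
    show ?case
    proof (cases "q f x = 0")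
      case False
      then have pos: "q f x > 0" using nn[of f] by simp
      \<comment> \<open>By Cauchy-Schwarz this bounds \<open>q (fk k) x\<close> from below, and it
        depends on \<open>fk k\<close> only through \<open>B x *v fk k x\<close>, so that it
        converges.\<close>
      define r where "r k = (cmod (cinner (B x *v fk k x) (f x)))\<^sup>2 / q f x" for k
      have le: "r k \<le> q (fk k) x" for k
        using psd_Cauchy_Schwarz[OF elim(2), of "fk k x" "f x"] pos
        by (simp add: r_def pos_divide_le_eq)
      have "(\<lambda>k. cinner (B x *v fk k x) (f x)) \<longlonglongrightarrow> cinner (B x *v f x) (f x)"
        by (intro bounded_bilinear.tendsto[OF bounded_bilinear_cinner] elim tendsto_const)
      then have "r \<longlonglongrightarrow> (cmod (cinner (B x *v f x) (f x)))\<^sup>2 / q f x"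
        unfolding r_def by (intro tendsto_intros) (use pos in auto)
      also have "cmod (cinner (B x *v f x) (f x)) = q f x"
        using psd_self[OF elim(2), of "f x"] nn[of f] by (metis abs_of_nonneg norm_of_real)
      also have "(q f x)\<^sup>2 / q f x = q f x" using pos by (simp add: power2_eq_square)
      finally have "(\<lambda>k. ennreal (r k)) \<longlonglongrightarrow> ennreal (q f x)" by (intro tendsto_intros)
      then have "ennreal (q f x) = liminf (\<lambda>k. ennreal (r k))" by (simp add: lim_imp_Liminf)
      also have "\<dots> \<le> liminf (\<lambda>k. ennreal (q (fk k) x))"
        using le by (intro Liminf_mono always_eventually) (auto intro: ennreal_leI)
      finally show ?thesis .
    qed simp
  qed
  have nn: "AE x in M. 0 \<le> q g x" for g using B_psd by (auto simp: psd_def)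
  have nk: "(\<integral>\<^sup>+x. ennreal (q (fk k) x) \<partial>M) \<le> ennreal C" for k
    using nn_integral_eq_integral[OF sq_q[OF fk] nn] C[of k] nr_eq_integral[OF fk]
    by (simp add: ennreal_leI)
  have "(\<integral>\<^sup>+x. ennreal (q f x) \<partial>M) \<le> (\<integral>\<^sup>+x. liminf (\<lambda>k. ennreal (q (fk k) x)) \<partial>M)"
    by (rule nn_integral_mono_AE[OF lsc])
  also have "\<dots> \<le> liminf (\<lambda>k. \<integral>\<^sup>+x. ennreal (q (fk k) x) \<partial>M)"
    using qm[OF sq_meas[OF fk]] by (intro nn_integral_liminf) auto
  also have "\<dots> \<le> liminf (\<lambda>k::nat. ennreal C)" by (intro Liminf_mono always_eventually allI nk)
  also have "\<dots> = ennreal C" by (simp add: Liminf_const)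
  finally have fin: "(\<integral>\<^sup>+x. ennreal (q f x) \<partial>M) \<le> ennreal C" .
  then have "integrable M (q f)"
    by (intro integrableI_nonneg qm f nn) (simp add: le_less_trans[OF _ ennreal_less_top])
  then show s: "sq M B f" by (rule sqI[OF f])
  show "nr M B f \<le> C"
    using fin nn_integral_eq_integral[OF sq_q[OF s] nn] C0 by (simp add: nr_eq_integral[OF s])
qed

end

subsection \<open>Completeness\<close>

text \<open>A self-adjoint matrix is injective on its range and thus maps it onto itself. So the
  equation B w = B u has a solution w in the range of \<open>B\<close>; this is the one that
  regularization selects.\<close>

lemma psd_range_square:
  assumes B: "psd B"
  shows "\<exists>v. B *v (B *v v) = B *v u"
proof -
  let ?f = "\<lambda>v. B *v v"
  have lin: "linear ?f"
    by (rule bounded_linear.linear[OF bounded_bilinear.bounded_linear_right[OF bounded_bilinear_matrix_vector_mult]])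
  have sub: "subspace (range ?f)" by (rule linear_subspace_image[OF lin subspace_UNIV])
  have "inj_on ?f (range ?f)"
  proof (rule inj_onI)
    fix x y assume "x \<in> range ?f" "y \<in> range ?f" and e: "B *v x = B *v y"
    then have "x - y \<in> range ?f" using sub by (simp add: subspace_diff)
    then obtain z where z: "x - y = B *v z" by blast
    have "B *v (B *v z) = 0" using e unfolding z[symmetric] by (simp add: matrix_vector_mult_diff_distrib)
    then have "cinner (B *v z) (B *v z) = 0" using cinner_madj[of B z "B *v z"] B by (simp add: psd_def)
    then show "x = y" using z by (simp add: cinner_self)
  qed
  then have "dim (?f ` range ?f) = dim (range ?f)"
    using sub by (intro dim_image_eq[OF lin]) (simp add: span_eq_iff[THEN iffD2])
  moreover have "?f ` range ?f \<subseteq> range ?f" by blast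
  ultimately have "?f ` range ?f = range ?f"
    using sub by (intro subspace_dim_equal linear_subspace_image[OF lin]) auto
  then show ?thesis by (metis (no_types, lifting) image_iff rangeI)
qed

definition shifted :: "real \<Rightarrow> complex^'m^'m \<Rightarrow> complex^'m^'m" where
  "shifted \<epsilon> B = B + \<epsilon> *\<^sub>R mat 1"

text \<open>Tikhonov regularization: a measurable way of choosing a solution \<open>v\<close> of \<open>B v = Q\<close>.\<close>

definition tikhonov :: "real \<Rightarrow> complex^'m^'m \<Rightarrow> complex^'m \<Rightarrow> complex^'m" where
  "tikhonov \<epsilon> B Q = (\<chi> k. det (\<chi> i j. if j = k then Q $ i else shifted \<epsilon> B $ i $ j) / det (shifted \<epsilon> B))"

lemma shifted_mv: "shifted \<epsilon> B *v v = B *v v + \<epsilon> *\<^sub>R v"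
  using bounded_bilinear.scaleR_left[OF bounded_bilinear_matrix_vector_mult, of \<epsilon> "mat 1" v]
  by (simp add: shifted_def matrix_vector_mult_add_rdistrib)

lemma shifted_tikhonov:
  assumes B: "psd B" and "\<epsilon> > 0"
  shows "shifted \<epsilon> B *v tikhonov \<epsilon> B Q = Q"
proof -
  have "v = 0" if "shifted \<epsilon> B *v v = 0" for v
  proof -
    have "cinner (B *v v) v + \<epsilon> *\<^sub>R cinner v v = 0"
      using that unfolding shifted_mv by (metis cinner_add_left cinner_scaleR_left cinner_zero_left)
    then have "Re (cinner (B *v v) v) + \<epsilon> * (norm v)\<^sup>2 = 0"
      by (metis Re_complex_of_real cinner_self complex_scaleR plus_complex.sel(1) scaleR_complex.sel(1) zero_complex.sel(1))
    moreover have "Re (cinner (B *v v) v) \<ge> 0" using B by (simp add: psd_def)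
    ultimately have "\<epsilon> * (norm v)\<^sup>2 \<le> 0" by linarith
    then show ?thesis using \<open>\<epsilon> > 0\<close> by (simp add: mult_le_0_iff)
  qed
  then have "invertible (shifted \<epsilon> B)"
    unfolding invertible_left_inverse matrix_left_invertible_ker by blast
  then have "det (shifted \<epsilon> B) \<noteq> 0" by (simp add: invertible_det_nz)
  from cramer[OF this] show ?thesis unfolding tikhonov_def by blast
qed

text \<open>Let w = B v satisfy B w = B u, and let r be the regularized solution. The scaled error e
  = (w - r)/\<epsilon> satisfies B (e - v) = -\<epsilon> e; semidefiniteness gives |e| <= |v|, so r
  differs from w by at most \<epsilon> |v|.\<close>

lemma tikhonov_tendsto:
  assumes B: "psd B"
  shows "\<exists>w. (\<lambda>m. tikhonov (1 / Suc m) B (B *v u)) \<longlonglongrightarrow> w \<and> B *v w = B *v u"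
proof -
  obtain v where v: "B *v (B *v v) = B *v u" using psd_range_square[OF B] by blast
  let ?w = "B *v v"
  have "norm (tikhonov (1 / Suc m) B (B *v u) - ?w) \<le> (1 / Suc m) * norm v" for m
  proof -
    define \<epsilon> where "\<epsilon> = 1 / real (Suc m)"
    have \<epsilon>: "\<epsilon> > 0" by (simp add: \<epsilon>_def)
    let ?r = "tikhonov \<epsilon> B (B *v u)"
    have r: "B *v ?r + \<epsilon> *\<^sub>R ?r = B *v ?w" using shifted_tikhonov[OF B \<epsilon>, of "B *v u"] v by (simp add: shifted_mv)
    define e where "e = (1/\<epsilon>) *\<^sub>R (?w - ?r)"
    have re: "?w - ?r = \<epsilon> *\<^sub>R e" using \<epsilon> by (simp add: e_def)
    have "\<epsilon> *\<^sub>R (B *v e) = B *v (?w - ?r)"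
      unfolding re using bounded_bilinear.scaleR_right[OF bounded_bilinear_matrix_vector_mult, of B \<epsilon> e] by simp
    also have "\<dots> = \<epsilon> *\<^sub>R ?r" using r by (simp add: matrix_vector_mult_diff_distrib algebra_simps)
    finally have "B *v e = ?r" using \<epsilon> by simp
    also have "?r = B *v v - \<epsilon> *\<^sub>R e" using re by (simp add: algebra_simps)
    finally have Be: "B *v (e - v) = - (\<epsilon> *\<^sub>R e)" by (simp add: matrix_vector_mult_diff_distrib)
    have "0 \<le> Re (cinner (B *v (e - v)) (e - v))" using B by (simp add: psd_def)
    also have "\<dots> = - \<epsilon> * (inner e e - inner e v)"
      unfolding Be Re_cinner by (simp add: inner_diff_right algebra_simps)
    finally have "inner e e \<le> inner e v" using \<epsilon> by (simp add: mult_le_0_iff)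
    also have "\<dots> \<le> norm e * norm v" by (rule norm_cauchy_schwarz)
    finally have "norm e * norm e \<le> norm e * norm v" by (simp add: dot_square_norm power2_eq_square)
    then have "norm e \<le> norm v" by (cases "norm e = 0") (auto simp: mult_le_cancel_left)
    then have "norm (?w - ?r) \<le> \<epsilon> * norm v" unfolding re using \<epsilon> by simp
    then show ?thesis unfolding \<epsilon>_def by (simp add: norm_minus_commute)
  qed
  moreover have "(\<lambda>m. (1 / real (Suc m)) * norm v) \<longlonglongrightarrow> 0 * norm v"
    by (intro tendsto_mult_right LIMSEQ_Suc lim_1_over_n)
  then have "(\<lambda>m. (1 / real (Suc m)) * norm v) \<longlonglongrightarrow> 0" by simp
  ultimately have "(\<lambda>m. tikhonov (1 / Suc m) B (B *v u) - ?w) \<longlonglongrightarrow> 0"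
    by (rule Lim_null_comparison[OF always_eventually[OF allI]])
  then have "(\<lambda>m. tikhonov (1 / Suc m) B (B *v u)) \<longlonglongrightarrow> ?w" by (simp add: Lim_null[of _ ?w])
  then show ?thesis using v by blast
qed

context weight
begin

text \<open>Cramer's formula expresses the components by determinants in the entries of
  \<open>B x\<close> and \<open>Q x\<close>; the explicit definition of \<open>tikhonov\<close> aims
  at this.\<close>

lemma borel_measurable_tikhonov:
  assumes Q: "Q \<in> borel_measurable M"
  shows "(\<lambda>x. tikhonov \<epsilon> (B x) (Q x)) \<in> borel_measurable M"
proof (rule borel_measurable_vec)
  fix k
  have Bij: "(\<lambda>x. shifted \<epsilon> (B x) $ i $ j) \<in> borel_measurable M" for i j
    unfolding shifted_def by (rule borel_measurable_continuous_on[OF _ B_meas]) (intro continuous_intros)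
  have Qi: "(\<lambda>x. Q x $ i) \<in> borel_measurable M" for i
    by (rule borel_measurable_continuous_on[OF _ Q]) (intro continuous_intros)
  have ent: "(\<lambda>x. if p i = k then Q x $ i else shifted \<epsilon> (B x) $ i $ p i) \<in> borel_measurable M" for p i
    by (cases "p i = k") (auto intro: Bij Qi)
  show "(\<lambda>x. tikhonov \<epsilon> (B x) (Q x) $ k) \<in> borel_measurable M"
    unfolding tikhonov_def det_def
    by (simp, intro borel_measurable_divide borel_measurable_sum borel_measurable_times
        borel_measurable_prod borel_measurable_const ent Bij)
qed

text \<open>Riesz-Fischer for a possibly singular weight. A fast subsequence has images under
  \<open>B\<close> that converge almost everywhere; the range of a matrix is closed, so the limit
  again has the form \<open>B f\<close>, and \<open>tikhonov\<close> selects \<open>f\<close>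
  measurably. Lower semicontinuity of the seminorm gives convergence of the whole sequence.\<close>

theorem sq_complete:
  assumes fk: "\<And>k::nat. sq M B (fk k)"
    and cauchy: "\<And>e. e > 0 \<Longrightarrow> \<exists>N. \<forall>m\<ge>N. \<forall>n\<ge>N. nr M B (\<lambda>x. fk m x - fk n x) < e"
  shows "\<exists>f. sq M B f \<and> (\<lambda>k. nr M B (\<lambda>x. fk k x - f x)) \<longlonglongrightarrow> 0"
proof -
  \<comment> \<open>The rate 8^-k leaves 4^-k after multiplication by the weights 2^k used below;
    the weighted sum is then finite almost everywhere, which makes the images of the differences
    decay geometrically at almost every point.\<close>
  have "\<exists>N. \<forall>m\<ge>N. \<forall>n\<ge>N. nr M B (\<lambda>x. fk m x - fk n x) < (1/8)^k" for k by (rule cauchy) simp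
  then obtain N where N: "\<And>k m n. m \<ge> N k \<Longrightarrow> n \<ge> N k \<Longrightarrow> nr M B (\<lambda>x. fk m x - fk n x) < (1/8)^k" by metis
  \<comment> \<open>Summation makes the indices monotone, and the summand \<open>k\<close> makes
    them tend to infinity.\<close>
  define \<phi> where "\<phi> k = (\<Sum>i\<le>k. N i) + k" for k
  have \<phi>N: "\<phi> k \<ge> N k" for k unfolding \<phi>_def by (rule trans_le_add1) (rule member_le_sum, auto)
  have \<phi>k: "\<phi> k \<ge> k" "\<phi> (Suc k) \<ge> \<phi> k" for k by (auto simp: \<phi>_def)
  define g where "g k = fk (\<phi> k)" for k
  define d where "d k x = g (Suc k) x - g k x" for k x
  have g: "sq M B (g k)" and d: "sq M B (d k)" for k
    unfolding d_def g_def by (intro sq_diff fk)+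
  have nd: "nr M B (d k) \<le> (1/8)^k" for k
    unfolding d_def g_def using N[of k "\<phi> (Suc k)" "\<phi> k"] \<phi>N[of k] \<phi>k[of k] by simp
  have nnq: "AE x in M. 0 \<le> q h x" for h using B_psd by (auto simp: psd_def)
  have qm: "q h \<in> borel_measurable M" if "h \<in> borel_measurable M" for h
    using meas_q[OF that that] by measurable
  have "(\<integral>\<^sup>+x. (\<Sum>k. ennreal (2^k * q (d k) x)) \<partial>M) = (\<Sum>k. \<integral>\<^sup>+x. ennreal (2^k * q (d k) x) \<partial>M)"
    using qm[OF sq_meas[OF d]] by (intro nn_integral_suminf) auto
  also have "\<dots> = (\<Sum>k. ennreal (2^k * nr M B (d k)))"
  proof (rule suminf_cong)
    fix k
    have "(\<integral>\<^sup>+x. ennreal (2^k * q (d k) x) \<partial>M) = ennreal (\<integral>x. 2^k * q (d k) x \<partial>M)"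
      using nnq[of "d k"] sq_q[OF d, of k] by (intro nn_integral_eq_integral) auto
    then show "(\<integral>\<^sup>+x. ennreal (2^k * q (d k) x) \<partial>M) = ennreal (2^k * nr M B (d k))"
      by (simp add: nr_eq_integral[OF d])
  qed
  also have "\<dots> \<le> (\<Sum>k. ennreal ((1/4)^k))"
  proof (intro suminf_le allI ennreal_leI)
    fix k :: nat
    have "2^k * nr M B (d k) \<le> 2^k * (1/8)^k" by (intro mult_left_mono nd) auto
    also have "\<dots> = (1/4::real)^k" by (simp add: power_mult_distrib[symmetric])
    finally show "2^k * nr M B (d k) \<le> (1/4)^k" .
  qed auto
  also have "\<dots> = ennreal (\<Sum>k. (1/4)^k)" by (intro suminf_ennreal2 summable_geometric) auto
  also have "\<dots> < \<infinity>" by simp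
  finally have fin: "(\<integral>\<^sup>+x. (\<Sum>k. ennreal (2^k * q (d k) x)) \<partial>M) \<noteq> \<infinity>" by simp
  have "AE x in M. (\<Sum>k. ennreal (2^k * q (d k) x)) \<noteq> \<infinity>"
    using qm[OF sq_meas[OF d]] by (intro nn_integral_noteq_infinite[OF _ fin]) auto
  then have conv: "AE x in M. \<exists>u. (\<lambda>n. B x *v g n x) \<longlonglongrightarrow> B x *v u"
    using B_psd
  proof eventually_elim
    case (elim x)
    have nn: "0 \<le> q h x" for h using elim(2) by (auto simp: psd_def)
    have sm: "summable (\<lambda>k. 2^k * q (d k) x)"
      using elim(1) nn by (intro summable_suminf_not_top) auto
    define S where "S = (\<Sum>k. 2^k * q (d k) x)"
    have S: "2^k * q (d k) x \<le> S" for k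
      unfolding S_def using sum_le_suminf[OF sm, of "{k}"] nn by simp
    have "bounded_linear (\<lambda>v. B x *v v)"
      by (rule bounded_bilinear.bounded_linear_right[OF bounded_bilinear_matrix_vector_mult])
    then obtain K where K: "K > 0" "\<And>v. norm (B x *v v) \<le> K * norm v"
      using bounded_linear.pos_bounded[of "\<lambda>v. B x *v v"] by (auto simp: mult.commute)
    have "norm (B x *v d k x) \<le> sqrt (K * S) * (sqrt (1/2))^k" for k
    proof -
      have "(norm (B x *v d k x))\<^sup>2 \<le> K * q (d k) x" by (rule psd_norm_le[OF elim(2) K(2)])
      also have "\<dots> \<le> K * (S * (1/2)^k)"
        using S[of k] K(1) by (intro mult_left_mono) (auto simp: field_simps)
      finally have "norm (B x *v d k x) \<le> sqrt (K * (S * (1/2)^k))" by (rule real_le_rsqrt)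
      then show ?thesis by (simp add: real_sqrt_mult real_sqrt_power mult_ac)
    qed
    moreover have "summable (\<lambda>k. sqrt (K * S) * (sqrt (1/2))^k)"
      by (intro summable_mult summable_geometric) (simp add: real_sqrt_less_iff[of "1/2" 1, simplified])
    ultimately have "summable (\<lambda>k. B x *v d k x)" by (rule summable_comparison_test'[rotated])
    then have "(\<lambda>n. \<Sum>k<n. B x *v d k x) \<longlonglongrightarrow> (\<Sum>k. B x *v d k x)" by (rule summable_LIMSEQ)
    moreover have "(\<Sum>k<n. B x *v d k x) = B x *v g n x - B x *v g 0 x" for n
      using sum_lessThan_telescope[of "\<lambda>k. B x *v g k x" n]
      by (simp add: d_def matrix_vector_mult_diff_distrib)
    ultimately have "(\<lambda>n. (B x *v g n x - B x *v g 0 x) + B x *v g 0 x) \<longlonglongrightarrow> (\<Sum>k. B x *v d k x) + B x *v g 0 x"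
      by (intro tendsto_add tendsto_const) simp
    then have l: "(\<lambda>n. B x *v g n x) \<longlonglongrightarrow> (\<Sum>k. B x *v d k x) + B x *v g 0 x" by simp
    have "closed (range (\<lambda>v. B x *v v))"
      by (intro closed_subspace linear_subspace_image subspace_UNIV bounded_linear.linear) fact
    then have "(\<Sum>k. B x *v d k x) + B x *v g 0 x \<in> range (\<lambda>v. B x *v v)"
      by (rule closed_sequentially[OF _ _ l]) auto
    then show ?case using l by auto
  qed
  define Q where "Q x = lim (\<lambda>n. B x *v g n x)" for x
  define f where "f x = lim (\<lambda>m. tikhonov (1 / Suc m) (B x) (Q x))" for x
  have Qm: "Q \<in> borel_measurable M"
    unfolding Q_def by (intro borel_measurable_lim_metric borel_measurable_mv B_meas sq_meas[OF g])
  have fm: "f \<in> borel_measurable M"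
    unfolding f_def by (intro borel_measurable_lim_metric borel_measurable_tikhonov Qm)
  have lim: "AE x in M. (\<lambda>n. B x *v g n x) \<longlonglongrightarrow> B x *v f x"
    using conv B_psd
  proof eventually_elim
    case (elim x)
    then obtain u where u: "(\<lambda>n. B x *v g n x) \<longlonglongrightarrow> B x *v u" by blast
    then have Qx: "Q x = B x *v u" unfolding Q_def by (rule limI)
    obtain w where w: "(\<lambda>m. tikhonov (1 / Suc m) (B x) (B x *v u)) \<longlonglongrightarrow> w" "B x *v w = B x *v u"
      using tikhonov_tendsto[OF elim(2)] by blast
    have "f x = w" unfolding f_def Qx using w(1) by (rule limI)
    then show ?case using u w(2) by simp
  qed
  have est: "sq M B (\<lambda>x. fk n x - f x) \<and> nr M B (\<lambda>x. fk n x - f x) \<le> e"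
    if e: "\<And>m. m \<ge> N' \<Longrightarrow> nr M B (\<lambda>x. fk n x - fk m x) \<le> e" for n N' e
  proof -
    let ?h = "\<lambda>k x. fk n x - g (k + N') x"
    have 1: "sq M B (?h k)" for k by (intro sq_diff fk g)
    have 2: "(\<lambda>x. fk n x - f x) \<in> borel_measurable M" by (intro borel_measurable_diff fm sq_meas[OF fk])
    have 3: "AE x in M. (\<lambda>k. B x *v ?h k x) \<longlonglongrightarrow> B x *v (fk n x - f x)"
      using lim
    proof eventually_elim
      case (elim x)
      have "(\<lambda>k. B x *v g (k + N') x) \<longlonglongrightarrow> B x *v f x" using elim by (rule LIMSEQ_ignore_initial_segment)
      then show ?case unfolding matrix_vector_mult_diff_distrib by (intro tendsto_intros)
    qed
    have 4: "nr M B (?h k) \<le> e" for k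
      unfolding g_def by (rule e) (metis \<phi>k(1) le_add2 order_trans)
    show ?thesis using nr_Fatou[OF 1 2 3 4] by blast
  qed
  obtain N0 where "\<forall>m\<ge>N0. \<forall>n\<ge>N0. nr M B (\<lambda>x. fk m x - fk n x) < 1" using cauchy[of 1] by auto
  then have "sq M B (\<lambda>x. fk N0 x - f x)" using est[of N0 N0 1] by (meson less_imp_le order_refl)
  from sq_diff[OF fk[of N0] this] have sf: "sq M B f" by simp
  moreover have "(\<lambda>k. nr M B (\<lambda>x. fk k x - f x)) \<longlonglongrightarrow> 0"
  proof (rule LIMSEQ_I)
    fix r :: real assume "r > 0"
    then obtain N1 where N1: "\<forall>m\<ge>N1. \<forall>n\<ge>N1. nr M B (\<lambda>x. fk m x - fk n x) < r/2" using cauchy[of "r/2"] by auto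
    have "nr M B (\<lambda>x. fk k x - f x) \<le> r/2" if "k \<ge> N1" for k
      using est[of N1 k "r/2"] N1 that by (meson less_imp_le)
    then show "\<exists>no. \<forall>n\<ge>no. norm (nr M B (\<lambda>x. fk n x - f x) - 0) < r"
      using \<open>r > 0\<close> nr_nonneg by (intro exI[of _ N1]) (force simp: abs_of_nonneg)
  qed
  ultimately show ?thesis by blast
qed

text \<open>Projection argument without a closed subspace: a minimizing sequence in \<open>S\<close>
  is Cauchy by the parallelogram identity, and its limit, which may lie outside \<open>S\<close>,
  leaves a remainder that is orthogonal to \<open>S\<close> and realizes the distance.\<close>

theorem sq_dense_if_orthogonal_trivial:
  assumes S: "\<And>s. s \<in> S \<Longrightarrow> sq M B s" and "s0 \<in> S"
    and add: "\<And>s t k. s \<in> S \<Longrightarrow> t \<in> S \<Longrightarrow> (\<lambda>x. s x + k *s t x) \<in> S"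
    and orth: "\<And>r. sq M B r \<Longrightarrow> (\<And>s. s \<in> S \<Longrightarrow> ip M B s r = 0) \<Longrightarrow> nr M B r = 0"
    and f: "sq M B f" and e: "e > 0"
  shows "\<exists>s\<in>S. nr M B (\<lambda>x. f x - s x) < e"
proof (rule ccontr)
  assume neg: "\<not> ?thesis"
  define D where "D = (\<lambda>s. nr M B (\<lambda>x. f x - s x)) ` S"
  have Dne: "D \<noteq> {}" "bdd_below D" using \<open>s0 \<in> S\<close> nr_nonneg by (auto simp: D_def intro: bdd_belowI2[of S 0])
  define \<delta> where "\<delta> = Inf D"
  have "\<delta> \<ge> e" unfolding \<delta>_def using neg by (intro cInf_greatest Dne) (auto simp: D_def not_less)
  have low: "\<delta> \<le> nr M B (\<lambda>x. f x - s x)" if "s \<in> S" for s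
    unfolding \<delta>_def using that by (intro cInf_lower Dne) (auto simp: D_def)
  have "\<exists>s\<in>S. nr M B (\<lambda>x. f x - s x) < \<delta> + 1 / Suc k" for k :: nat
    using cInf_lessD[OF Dne(1), of "\<delta> + 1 / Suc k"] by (auto simp: \<delta>_def D_def)
  then obtain s where s: "\<And>k. s k \<in> S" "\<And>k. nr M B (\<lambda>x. f x - s k x) < \<delta> + 1 / Suc k" by metis
  have par: "nr M B (\<lambda>x. s k x - s l x) \<le> 2 / Suc k + 2 / Suc l" for k l
  proof -
    let ?u = "\<lambda>x. f x - s k x" and ?v = "\<lambda>x. f x - s l x"
    have uv: "sq M B ?u" "sq M B ?v" using f S s by (auto intro: sq_diff)
    \<comment> \<open>The midpoint of \<open>s k\<close> and \<open>s l\<close>, written in the form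
      that the closure property \<open>add\<close> provides.\<close>
    have m: "(\<lambda>x. s k x + (1/2) *s ((-1) *s s k x + s l x)) \<in> S"
    proof -
      have "(\<lambda>x. s l x + (-1) *s s k x) \<in> S" by (intro add s)
      from add[OF s(1)[of k] this, of "1/2"] show ?thesis by (simp add: add.commute)
    qed
    have "(\<lambda>x. f x - (s k x + (1/2) *s ((-1) *s s k x + s l x))) = (\<lambda>x. (1/2) *s (?u x + 1 *s ?v x))"
      by (simp add: fun_eq_iff vec_eq_iff field_simps)
    then have "\<delta> \<le> nr M B (\<lambda>x. (1/2) *s (?u x + 1 *s ?v x))" using low[OF m] by simp
    then have 1: "4 * \<delta> \<le> nr M B (\<lambda>x. ?u x + 1 *s ?v x)" unfolding nr_scale by (simp add: power2_eq_square)
    have "(\<lambda>x. s k x - s l x) = (\<lambda>x. ?v x + (-1) *s ?u x)" by (simp add: fun_eq_iff vec_eq_iff)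
    then have "nr M B (\<lambda>x. s k x - s l x) = nr M B ?v - 2 * Re (ip M B ?v ?u) + nr M B ?u"
      using nr_quadratic[OF uv(2,1), of "-1"] by simp
    moreover have "nr M B (\<lambda>x. ?u x + 1 *s ?v x) = nr M B ?u + 2 * Re (ip M B ?u ?v) + nr M B ?v"
      using nr_quadratic[OF uv, of 1] by simp
    moreover have "Re (ip M B ?v ?u) = Re (ip M B ?u ?v)"
      using ip_commute[OF sq_meas[OF uv(1)] sq_meas[OF uv(2)]] by simp
    ultimately show ?thesis using 1 s(2)[of k] s(2)[of l] by simp
  qed
  have ca: "\<exists>N. \<forall>m\<ge>N. \<forall>n\<ge>N. nr M B (\<lambda>x. s m x - s n x) < r" if "r > 0" for r
  proof -
    obtain N :: nat where N: "1 / Suc N < r / 4" using \<open>r > 0\<close> nat_approx_posE[of "r/4"] by auto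
    have "nr M B (\<lambda>x. s m x - s n x) < r" if "m \<ge> N" "n \<ge> N" for m n
    proof -
      have "1 / Suc m \<le> 1 / Suc N" "1 / Suc n \<le> 1 / Suc N" using that by (auto intro!: divide_left_mono)
      then show ?thesis using par[of m n] N by simp
    qed
    then show ?thesis by blast
  qed
  obtain h where h: "sq M B h" "(\<lambda>k. nr M B (\<lambda>x. s k x - h x)) \<longlonglongrightarrow> 0"
    using sq_complete[of s, OF S[OF s(1)] ca] by blast
  define r where "r x = f x - h x" for x
  have r: "sq M B r" unfolding r_def using f h(1) by (rule sq_diff)
  have sqh: "(\<lambda>k. sqrt (nr M B (\<lambda>x. s k x - h x))) \<longlonglongrightarrow> 0" using tendsto_real_sqrt[OF h(2)] by simp
  have near: "\<delta> \<le> nr M B (\<lambda>x. r x + k *s t x)" if t: "t \<in> S" for t k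
  proof -
    let ?g = "\<lambda>x. r x + k *s t x"
    have g: "sq M B ?g" by (intro sq_add r sq_scale S t)
    have "sqrt \<delta> - sqrt (nr M B (\<lambda>x. s n x - h x)) \<le> sqrt (nr M B ?g)" for n
    proof -
      have "(\<lambda>x. s n x + (-k) *s t x) \<in> S" by (intro add s t)
      from low[OF this] have "sqrt \<delta> \<le> sqrt (nr M B (\<lambda>x. ?g x + (h x - s n x)))"
        by (simp add: r_def vector_smult_lneg algebra_simps)
      also have "\<dots> \<le> sqrt (nr M B ?g) + sqrt (nr M B (\<lambda>x. h x - s n x))"
        by (rule nr_triangle[OF g sq_diff[OF h(1) S[OF s(1)]]])
      finally show ?thesis by (simp add: nr_minus_commute[of h])
    qed
    moreover have "(\<lambda>n. sqrt \<delta> - sqrt (nr M B (\<lambda>x. s n x - h x))) \<longlonglongrightarrow> sqrt \<delta> - 0"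
      by (intro tendsto_intros sqh)
    ultimately have "sqrt \<delta> \<le> sqrt (nr M B ?g)" by (intro LIMSEQ_le_const2[of _ "sqrt \<delta>"]) auto
    then show ?thesis by simp
  qed
  have nr_r: "nr M B r \<le> \<delta>"
  proof -
    have "sqrt (nr M B r) \<le> sqrt (\<delta> + 1 / Suc n) + sqrt (nr M B (\<lambda>x. s n x - h x))" for n
    proof -
      have "sqrt (nr M B r) \<le> sqrt (nr M B (\<lambda>x. f x - s n x)) + sqrt (nr M B (\<lambda>x. s n x - h x))"
        unfolding r_def by (rule nr_triangle_diff[OF f S[OF s(1)] h(1)])
      also have "sqrt (nr M B (\<lambda>x. f x - s n x)) \<le> sqrt (\<delta> + 1 / Suc n)" using s(2)[of n] by simp
      finally show ?thesis by simp
    qed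
    moreover have "(\<lambda>n. sqrt (\<delta> + 1 / Suc n) + sqrt (nr M B (\<lambda>x. s n x - h x))) \<longlonglongrightarrow> sqrt (\<delta> + 0) + 0"
      by (intro tendsto_intros sqh LIMSEQ_Suc lim_1_over_n)
    ultimately have "sqrt (nr M B r) \<le> sqrt \<delta>" by (intro LIMSEQ_le_const[of _ "sqrt \<delta>"]) auto
    then show ?thesis by simp
  qed
  have "ip M B t r = 0" if t: "t \<in> S" for t
  proof -
    have "(cmod (ip M B r t))\<^sup>2 \<le> 0 * nr M B t"
    proof (rule quadratic_nonneg_imp_cmod_le)
      fix k
      show "0 \<le> 0 + 2 * Re (cnj k * ip M B r t) + (cmod k)\<^sup>2 * nr M B t"
        using near[OF t, of k] nr_quadratic[OF r S[OF t], of k] nr_r by simp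
    qed (rule nr_nonneg)
    then show ?thesis using ip_commute[OF sq_meas[OF r] sq_meas[OF S[OF t]]] by simp
  qed
  then have "nr M B r = 0" by (rule orth[OF r])
  then have "\<delta> \<le> 0" using near[OF \<open>s0 \<in> S\<close>, of 0] by simp
  then show False using \<open>\<delta> \<ge> e\<close> e by simp
qed

end

subsection \<open>Restriction to subsets of the line\<close>

lemma L2_fun_iff_sq:
  assumes "S \<in> sets lebesgue"
  shows "f \<in> L2_fun S B \<longleftrightarrow> sq (lebesgue_on S) B f"
  using assms by (simp add: L2_fun_def sq_def set_integrable_def integrable_restrict_space)

lemma L2_inner_eq_ip:
  assumes "S \<in> sets lebesgue"
  shows "L2_inner S B f g = ip (lebesgue_on S) B f g"
  using assms by (simp add: L2_inner_def ip_def set_lebesgue_integral_def integral_restrict_space)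

definition cut :: "real set \<Rightarrow> (real \<Rightarrow> 'a::zero) \<Rightarrow> real \<Rightarrow> 'a" where
  "cut T f x = (if x \<in> T then f x else 0)"

lemma weight_subset:
  assumes w: "weight (lebesgue_on S) B" and T: "T \<subseteq> S" "S \<in> sets lebesgue" "T \<in> sets lebesgue"
  shows "weight (lebesgue_on T) B"
proof
  interpret weight "lebesgue_on S" B by fact
  show "B \<in> borel_measurable (lebesgue_on T)" by (rule measurable_restrict_mono[OF B_meas T(1)])
  have "AE x in lebesgue. x \<in> S \<longrightarrow> psd (B x)"
    using B_psd T(2) by (simp add: AE_restrict_space_iff)
  then have "AE x in lebesgue. x \<in> T \<longrightarrow> psd (B x)" by eventually_elim (use T in blast)
  then show "AE x in lebesgue_on T. psd (B x)" using T(3) by (simp add: AE_restrict_space_iff)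
qed

lemma integrable_lebesgue_on_subset:
  fixes h :: "real \<Rightarrow> 'b::{banach, second_countable_topology}"
  assumes "integrable (lebesgue_on S) h" "T \<subseteq> S" "S \<in> sets lebesgue" "T \<in> sets lebesgue"
  shows "integrable (lebesgue_on T) h"
proof -
  have "set_integrable lebesgue S h" using assms by (simp add: set_integrable_def integrable_restrict_space)
  then have "set_integrable lebesgue T h" using assms by (rule_tac set_integrable_subset)
  then show ?thesis using assms by (simp add: set_integrable_def integrable_restrict_space)
qed

lemma sq_subset:
  fixes S T :: "real set"
  assumes "sq (lebesgue_on S) B f" "T \<subseteq> S" "S \<in> sets lebesgue" "T \<in> sets lebesgue"
  shows "sq (lebesgue_on T) B f"
  unfolding sq_def
  using measurable_restrict_mono[OF _ assms(2)] integrable_lebesgue_on_subset[where T=T] assms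
  unfolding sq_def by blast

lemma sq_lebesgue_on_cong:
  assumes "\<And>x. x \<in> S \<Longrightarrow> f x = g x" "sq (lebesgue_on S) B f"
  shows "sq (lebesgue_on S) B g"
proof -
  have sp: "space (lebesgue_on S) = S" by (simp add: space_restrict_space)
  have "g \<in> borel_measurable (lebesgue_on S)"
    using assms measurable_cong[of "lebesgue_on S" f g borel] unfolding sq_def sp by blast
  moreover have "integrable (lebesgue_on S) (\<lambda>x. cinner (B x *v g x) (g x))"
    using assms Bochner_Integration.integrable_cong[of "lebesgue_on S" "lebesgue_on S" "\<lambda>x. cinner (B x *v f x) (f x)" "\<lambda>x. cinner (B x *v g x) (g x)"]
    unfolding sq_def sp by simp
  ultimately show ?thesis by (simp add: sq_def)
qed

lemma integral_lebesgue_on_cut: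
  fixes h :: "real \<Rightarrow> 'b::{banach, second_countable_topology}"
  assumes "T \<subseteq> S" "S \<in> sets lebesgue" "T \<in> sets lebesgue"
  shows "integral\<^sup>L (lebesgue_on S) (cut T h) = integral\<^sup>L (lebesgue_on T) h"
    and "integrable (lebesgue_on S) (cut T h) \<longleftrightarrow> integrable (lebesgue_on T) h"
proof -
  have "(\<lambda>x. indicator S x *\<^sub>R cut T h x) = (\<lambda>x. indicator T x *\<^sub>R h x)"
    using assms(1) by (auto simp: cut_def indicator_def fun_eq_iff)
  then show "integral\<^sup>L (lebesgue_on S) (cut T h) = integral\<^sup>L (lebesgue_on T) h"
    and "integrable (lebesgue_on S) (cut T h) \<longleftrightarrow> integrable (lebesgue_on T) h"
    using assms by (simp_all add: integral_restrict_space integrable_restrict_space)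
qed

lemma measurable_cut:
  fixes f :: "real \<Rightarrow> 'b::euclidean_space"
  assumes "f \<in> borel_measurable (lebesgue_on T)" "T \<in> sets lebesgue"
  shows "cut T f \<in> borel_measurable (lebesgue_on S)"
proof -
  have "(\<lambda>x. if x \<in> T then f x else 0) \<in> borel_measurable lebesgue"
    using assms by (simp add: borel_measurable_if)
  then have "cut T f \<in> borel_measurable lebesgue" by (simp add: cut_def[abs_def])
  then show ?thesis by (rule measurable_restrict_space1)
qed

lemma ip_cut_left:
  assumes "T \<subseteq> S" "S \<in> sets lebesgue" "T \<in> sets lebesgue"
  shows "ip (lebesgue_on S) B (cut T f) g = ip (lebesgue_on T) B f g"
proof -
  have "(\<lambda>x. cinner (B x *v cut T f x) (g x)) = cut T (\<lambda>x. cinner (B x *v f x) (g x))"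
    by (auto simp: cut_def fun_eq_iff)
  then show ?thesis unfolding ip_def by (simp add: integral_lebesgue_on_cut(1)[OF assms])
qed

lemma sq_cut:
  assumes "sq (lebesgue_on T) B f" "T \<subseteq> S" "S \<in> sets lebesgue" "T \<in> sets lebesgue"
  shows "sq (lebesgue_on S) B (cut T f)"
proof -
  have "(\<lambda>x. cinner (B x *v cut T f x) (cut T f x)) = cut T (\<lambda>x. cinner (B x *v f x) (f x))"
    by (auto simp: cut_def fun_eq_iff)
  then show ?thesis
    using assms by (simp add: sq_def measurable_cut integral_lebesgue_on_cut(2))
qed

lemma nr_cut:
  fixes S T :: "real set"
  assumes "T \<subseteq> S" "S \<in> sets lebesgue" "T \<in> sets lebesgue"
  shows "nr (lebesgue_on S) B (cut T f) = nr (lebesgue_on T) B f"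
proof -
  have "(\<lambda>x. cinner (B x *v cut T f x) (cut T f x)) = cut T (\<lambda>x. cinner (B x *v f x) (f x))"
    by (auto simp: cut_def fun_eq_iff)
  then show ?thesis by (simp add: nr_def ip_def integral_lebesgue_on_cut(1)[OF assms])
qed

lemma nr_subset_le:
  fixes S T :: "real set"
  assumes w: "weight (lebesgue_on S) B" and f: "sq (lebesgue_on S) B f"
    and T: "T \<subseteq> S" "S \<in> sets lebesgue" "T \<in> sets lebesgue"
  shows "nr (lebesgue_on T) B f \<le> nr (lebesgue_on S) B f"
proof -
  interpret weight "lebesgue_on S" B by fact
  have c: "sq (lebesgue_on S) B (cut T f)" by (rule sq_cut[OF sq_subset[OF f T] T])
  have "nr (lebesgue_on S) B (cut T f) \<le> nr (lebesgue_on S) B f"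
    unfolding nr_eq_integral[OF f] nr_eq_integral[OF c]
  proof (rule integral_mono_AE[OF sq_q[OF c] sq_q[OF f]])
    show "AE x in lebesgue_on S. q (cut T f) x \<le> q f x"
      using B_psd by eventually_elim (auto simp: cut_def psd_def)
  qed
  then show ?thesis by (simp add: nr_cut[OF T])
qed

lemma nr_diff_cut_tendsto:
  assumes w: "weight (lebesgue_on S) B" and f: "sq (lebesgue_on S) B f"
    and T: "\<And>k. T k \<subseteq> S" "S \<in> sets lebesgue" "\<And>k. T k \<in> sets lebesgue"
    and ev: "\<And>x. x \<in> S \<Longrightarrow> eventually (\<lambda>k. x \<in> T k) sequentially"
  shows "(\<lambda>k. nr (lebesgue_on S) B (\<lambda>x. f x - cut (T k) f x)) \<longlonglongrightarrow> 0"
proof -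
  interpret weight "lebesgue_on S" B by fact
  have c: "sq (lebesgue_on S) B (\<lambda>x. f x - cut (T k) f x)" for k
    by (intro sq_diff f sq_cut sq_subset[OF f] T)
  have "(\<lambda>k. \<integral>x. q (\<lambda>x. f x - cut (T k) f x) x \<partial>lebesgue_on S) \<longlonglongrightarrow> (\<integral>x. 0 \<partial>lebesgue_on S)"
  proof (rule integral_dominated_convergence[OF _ _ sq_q[OF f]])
    show "(\<lambda>x. q (\<lambda>x. f x - cut (T k) f x) x) \<in> borel_measurable (lebesgue_on S)" for k
      using sq_q[OF c, of k] by (rule borel_measurable_integrable)
    show "AE x in lebesgue_on S. (\<lambda>k. q (\<lambda>x. f x - cut (T k) f x) x) \<longlonglongrightarrow> 0"
    proof (rule AE_I2)
      fix x assume "x \<in> space (lebesgue_on S)"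
      then have "x \<in> S" by (simp add: space_restrict_space)
      from ev[OF this] have "\<forall>\<^sub>F k in sequentially. q (\<lambda>x. f x - cut (T k) f x) x = 0"
        by eventually_elim (simp add: cut_def)
      then show "(\<lambda>k. q (\<lambda>x. f x - cut (T k) f x) x) \<longlonglongrightarrow> 0" by (rule tendsto_eventually)
    qed
    show "AE x in lebesgue_on S. norm (q (\<lambda>x. f x - cut (T k) f x) x) \<le> q f x" for k
      using B_psd by eventually_elim (auto simp: cut_def psd_def)
  qed simp
  then show ?thesis by (simp add: nr_eq_integral[OF c])
qed

subsection \<open>Dimensions of annihilators and the signature of \<open>J\<close>\<close>

lemma sum_sum_UNIV: "(\<Sum>j\<in>UNIV. h j) = (\<Sum>j\<in>UNIV. h (Inl j)) + (\<Sum>j\<in>UNIV. h (Inr j))"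
  for h :: "'n::finite + 'n \<Rightarrow> 'b::comm_monoid_add"
proof -
  have U: "(UNIV :: ('n + 'n) set) = range Inl \<union> range Inr" by (auto intro: sum.exhaust_sel)
  show ?thesis unfolding U by (subst sum.union_disjoint) (auto simp: sum.reindex)
qed

lemma Jmat_Inl: "(Jmat *v u) $ Inl i = - (u $ Inr i)"
  and Jmat_Inr: "(Jmat *v u) $ Inr i = u $ Inl i"
  for u :: "complex ^ ('n::finite + 'n)"
proof -
  show "(Jmat *v u) $ Inl i = - (u $ Inr i)" "(Jmat *v u) $ Inr i = u $ Inl i"
    by (simp_all add: matrix_vector_mult_def Jmat_def sum_sum_UNIV if_distrib[of "\<lambda>z. z * _"] cong: if_cong)
qed

lemma Jmat_Jmat: "Jmat *v (Jmat *v u) = - u"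
proof (rule vec_eq_iff[THEN iffD2], rule allI)
  fix i show "(Jmat *v (Jmat *v u)) $ i = (- u) $ i" by (cases i) (simp_all add: Jmat_Inl Jmat_Inr)
qed

lemma cinner_Jmat: "cinner (Jmat *v u) v = - cinner u (Jmat *v v)"
  by (simp add: cinner_def sum_sum_UNIV Jmat_Inl Jmat_Inr sum_negf)

lemma cinner_Jmat_Jmat: "cinner (Jmat *v u) (Jmat *v v) = cinner u v"
  by (simp add: cinner_Jmat Jmat_Jmat cinner_minus_right)

lemma cinner_Jmat_commute: "cinner (Jmat *v v) u = - cnj (cinner (Jmat *v u) v)"
  by (metis cinner_Jmat cinner_commute complex_cnj_minus)

lemma dim_singleton_zero: "vec.dim {0 :: complex^'m::finite} = 0"
  using vec.dim_insert[of 0 "{}"] by (simp add: vec.dim_empty)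

lemma dim_subset_zero: "(V :: (complex^'m::finite) set) \<subseteq> {0} \<Longrightarrow> vec.dim V = 0"
  using vec.dim_subset[of V "{0}"] dim_singleton_zero by simp

lemma subspace_zero_set:
  assumes V: "vec.subspace V"
    and s: "\<And>u v k. u \<in> V \<Longrightarrow> v \<in> V \<Longrightarrow> s (u + k *s v) = s u + k * (s v :: complex)"
  shows "vec.subspace {p\<in>V. s p = 0}"
proof -
  have "s 0 = 0" using s[of 0 0 1] vec.subspace_0[OF V] by simp
  have add: "s (u + v) = s u + s v" if "u \<in> V" "v \<in> V" for u v using s[OF that, of 1] by simp
  have sc: "s (k *s v) = k * s v" if "v \<in> V" for k v
    using s[of 0 v k] \<open>s 0 = 0\<close> vec.subspace_0[OF V] that by simp
  show ?thesis using V \<open>s 0 = 0\<close>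
    by (intro vec.subspaceI) (auto simp: add sc vec.subspace_0 vec.subspace_add vec.subspace_scale)
qed

lemma dim_hyperplane:
  fixes V :: "(complex^'m::finite) set"
  assumes V: "vec.subspace V"
    and s: "\<And>u v k. u \<in> V \<Longrightarrow> v \<in> V \<Longrightarrow> s (u + k *s v) = s u + k * (s v :: complex)"
  shows "vec.dim V \<le> 1 + vec.dim {p\<in>V. s p = 0}"
proof (cases "\<forall>p\<in>V. s p = 0")
  case True
  then have "{p\<in>V. s p = 0} = V" by auto
  then show ?thesis by simp
next
  case False
  then obtain v0 where v0: "v0 \<in> V" "s v0 \<noteq> 0" by auto
  let ?K = "{p\<in>V. s p = 0}"
  have "V \<subseteq> vec.span (insert v0 ?K)"
  proof
    fix v assume v: "v \<in> V"
    let ?w = "v + (- (s v / s v0)) *s v0"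
    have "s ?w = 0" using s[OF v v0(1), of "- (s v / s v0)"] v0 by simp
    moreover have "?w \<in> V" using V v v0 by (intro vec.subspace_add vec.subspace_scale)
    ultimately have "?w \<in> ?K" by simp
    then have "?w + (s v / s v0) *s v0 \<in> vec.span (insert v0 ?K)"
      by (intro vec.span_add vec.span_scale vec.span_base) auto
    then show "v \<in> vec.span (insert v0 ?K)" by (simp add: vector_smult_lneg)
  qed
  then have "vec.dim V \<le> vec.dim (insert v0 ?K)" by (metis vec.dim_span vec.dim_subset)
  also have "\<dots> \<le> 1 + vec.dim ?K" by (simp add: vec.dim_insert)
  finally show ?thesis .
qed

lemma dim_zero_set:
  fixes V :: "(complex^'m::finite) set"
  assumes V: "vec.subspace V" and D: "finite D"
    and s: "\<And>u v k d. d \<in> D \<Longrightarrow> u \<in> V \<Longrightarrow> v \<in> V \<Longrightarrow> s (u + k *s v) d = s u d + k * (s v d :: complex)"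
  shows "vec.dim V \<le> card D + vec.dim {p\<in>V. \<forall>d\<in>D. s p d = 0}" "vec.subspace {p\<in>V. \<forall>d\<in>D. s p d = 0}"
proof -
  have "vec.dim V \<le> card D + vec.dim {p\<in>V. \<forall>d\<in>D. s p d = 0} \<and> vec.subspace {p\<in>V. \<forall>d\<in>D. s p d = 0}"
    using D s
  proof (induction D rule: finite_induct)
    case (insert x F)
    let ?K = "{p\<in>V. \<forall>d\<in>F. s p d = 0}"
    have IH: "vec.dim V \<le> card F + vec.dim ?K" "vec.subspace ?K" using insert by auto
    have eq: "{p\<in>V. \<forall>d\<in>insert x F. s p d = 0} = {p\<in>?K. s p x = 0}" by auto
    have lin: "s (u + k *s v) x = s u x + k * s v x" if "u \<in> ?K" "v \<in> ?K" for u v k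
      using insert.prems that by auto
    have "vec.dim ?K \<le> 1 + vec.dim {p\<in>?K. s p x = 0}" by (rule dim_hyperplane[OF IH(2) lin])
    moreover have "vec.subspace {p\<in>?K. s p x = 0}" by (rule subspace_zero_set[OF IH(2) lin])
    ultimately show ?case using IH insert.hyps unfolding eq by simp
  qed (use V in auto)
  then show "vec.dim V \<le> card D + vec.dim {p\<in>V. \<forall>d\<in>D. s p d = 0}" "vec.subspace {p\<in>V. \<forall>d\<in>D. s p d = 0}" by auto
qed

text \<open>Row rank equals column rank for a sesquilinear pairing of two subspaces.\<close>

lemma dim_pairing_le:
  fixes V :: "(complex^'m::finite) set" and L :: "(complex^'k::finite) set"
  assumes V: "vec.subspace V" and L: "vec.subspace L"
    and s1: "\<And>u v k q. u \<in> V \<Longrightarrow> v \<in> V \<Longrightarrow> q \<in> L \<Longrightarrow> s (u + k *s v) q = s u q + k * (s v q :: complex)"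
    and s2: "\<And>u v k p. u \<in> L \<Longrightarrow> v \<in> L \<Longrightarrow> p \<in> V \<Longrightarrow> s p (u + k *s v) = s p u + cnj k * s p v"
  shows "vec.dim V + vec.dim {q\<in>L. \<forall>p\<in>V. s p q = 0} \<le> vec.dim L + vec.dim {p\<in>V. \<forall>q\<in>L. s p q = 0}"
proof -
  let ?R = "{q\<in>L. \<forall>p\<in>V. s p q = 0}"
  obtain C0 where C0: "C0 \<subseteq> ?R" "vec.independent C0" "?R \<subseteq> vec.span C0" "card C0 = vec.dim ?R"
    using vec.basis_exists[of ?R] by blast
  \<comment> \<open>Basis vectors in the right kernel impose no condition on the left argument; the
    remaining ones, \<open>C - C0\<close>, cut out the left kernel and bound its
    codimension.\<close>
  obtain C where C: "C0 \<subseteq> C" "C \<subseteq> L" "vec.independent C" "L \<subseteq> vec.span C"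
    using vec.maximal_independent_subset_extend[of C0 L] C0 by blast
  have fin: "finite C" using C(3) by (rule vec.finiteI_independent)
  have "card C = vec.dim L" using vec.basis_card_eq_dim[OF C(2,4,3)] .
  then have card: "card (C - C0) + vec.dim ?R = vec.dim L"
    using C0(4) C(1) fin card_Diff_subset[of C0 C] card_mono[of C C0] finite_subset[of C0 C] by simp
  have "{p\<in>V. \<forall>d\<in>C - C0. s p d = 0} \<subseteq> {p\<in>V. \<forall>q\<in>L. s p q = 0}"
  proof safe
    fix p q assume p: "p \<in> V" and z: "\<forall>d\<in>C - C0. s p d = 0" and q: "q \<in> L"
    have s0: "s p 0 = 0" using s2[of 0 0 p 1] p vec.subspace_0[OF L] by simp
    have "vec.subspace {q\<in>L. s p q = 0}"
    proof (rule vec.subspaceI)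
      show "0 \<in> {q\<in>L. s p q = 0}" using s0 vec.subspace_0[OF L] by simp
      show "x + y \<in> {q\<in>L. s p q = 0}" if "x \<in> {q\<in>L. s p q = 0}" "y \<in> {q\<in>L. s p q = 0}" for x y
        using that s2[of x y p 1] p vec.subspace_add[OF L] by simp
      show "c *s x \<in> {q\<in>L. s p q = 0}" if "x \<in> {q\<in>L. s p q = 0}" for c x
        using that s2[of 0 x p c] p s0 vec.subspace_scale[OF L] vec.subspace_0[OF L] by simp
    qed
    moreover have "C \<subseteq> {q\<in>L. s p q = 0}" using z C C0 p by blast
    ultimately have "vec.span C \<subseteq> {q\<in>L. s p q = 0}" by (rule vec.span_minimal[rotated])
    then show "s p q = 0" using C(4) q by blast
  qed
  then have "vec.dim {p\<in>V. \<forall>d\<in>C - C0. s p d = 0} \<le> vec.dim {p\<in>V. \<forall>q\<in>L. s p q = 0}"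
    by (rule vec.dim_subset)
  moreover have "vec.dim V \<le> card (C - C0) + vec.dim {p\<in>V. \<forall>d\<in>C - C0. s p d = 0}"
    using fin C(2) s1 by (intro dim_zero_set[OF V]) auto
  ultimately show ?thesis using card by linarith
qed

text \<open>The reverse inequality is the same one for the conjugated pairing with exchanged
  arguments.\<close>

lemma dim_pairing:
  fixes V :: "(complex^'m::finite) set" and L :: "(complex^'k::finite) set"
  assumes V: "vec.subspace V" and L: "vec.subspace L"
    and s1: "\<And>u v k q. u \<in> V \<Longrightarrow> v \<in> V \<Longrightarrow> q \<in> L \<Longrightarrow> s (u + k *s v) q = s u q + k * (s v q :: complex)"
    and s2: "\<And>u v k p. u \<in> L \<Longrightarrow> v \<in> L \<Longrightarrow> p \<in> V \<Longrightarrow> s p (u + k *s v) = s p u + cnj k * s p v"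
  shows "vec.dim V + vec.dim {q\<in>L. \<forall>p\<in>V. s p q = 0} = vec.dim L + vec.dim {p\<in>V. \<forall>q\<in>L. s p q = 0}"
proof (rule antisym)
  show "vec.dim V + vec.dim {q\<in>L. \<forall>p\<in>V. s p q = 0} \<le> vec.dim L + vec.dim {p\<in>V. \<forall>q\<in>L. s p q = 0}"
    by (rule dim_pairing_le[OF V L s1 s2])
  have "vec.dim L + vec.dim {p\<in>V. \<forall>q\<in>L. cnj (s p q) = 0} \<le> vec.dim V + vec.dim {q\<in>L. \<forall>p\<in>V. cnj (s p q) = 0}"
    by (rule dim_pairing_le[OF L V]) (simp_all add: s1 s2)
  then show "vec.dim L + vec.dim {p\<in>V. \<forall>q\<in>L. s p q = 0} \<le> vec.dim V + vec.dim {q\<in>L. \<forall>p\<in>V. s p q = 0}" by simp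
qed

lemma subspace_annihilator:
  fixes V :: "(complex^'m::finite) set"
  assumes V: "vec.subspace V"
    and s1: "\<And>u v k q. u \<in> V \<Longrightarrow> v \<in> V \<Longrightarrow> q \<in> L \<Longrightarrow> s (u + k *s v) q = s u q + k * (s v q :: complex)"
  shows "vec.subspace {p\<in>V. \<forall>q\<in>L. s p q = 0}"
proof (cases "L = {}")
  case False
  have "vec.subspace {p\<in>V. s p q = 0}" if "q \<in> L" for q
    by (rule subspace_zero_set[OF V]) (rule s1[OF _ _ that])
  then have "vec.subspace (\<Inter>q\<in>L. {p\<in>V. s p q = 0})"
    by (intro vec.subspace_Inter) blast
  moreover have "(\<Inter>q\<in>L. {p\<in>V. s p q = 0}) = {p\<in>V. \<forall>q\<in>L. s p q = 0}" using False by auto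
  ultimately show ?thesis by simp
qed (use V in simp)

text \<open>The annihilator for the skew-Hermitian form (J u, v); by \<open>Jperp_sym\<close> it
  does not matter in which argument \<open>V\<close> is placed.\<close>

definition Jperp :: "(complex^('n::finite + 'n)) set \<Rightarrow> (complex^('n + 'n)) set" where
  "Jperp V = {z. \<forall>u\<in>V. cinner (Jmat *v z) u = 0}"

lemma subspace_Jperp: "vec.subspace (Jperp V)"
  using subspace_annihilator[OF vec.subspace_UNIV, of V "\<lambda>z u. cinner (Jmat *v z) u"]
  by (simp add: Jperp_def matrix_vector_right_distrib vector_scalar_commute cinner_add_left cinner_scale_left)

lemma dim_Jperp:
  fixes V :: "(complex^('n::finite + 'n)) set"
  assumes "vec.subspace V"
  shows "vec.dim V + vec.dim (Jperp V) = 2 * CARD('n)"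
proof -
  have "vec.dim (UNIV :: (complex^('n+'n)) set) + vec.dim {q\<in>V. \<forall>p\<in>UNIV. cinner (Jmat *v p) q = 0} =
     vec.dim V + vec.dim {p\<in>UNIV. \<forall>q\<in>V. cinner (Jmat *v p) q = 0}"
    by (rule dim_pairing[OF vec.subspace_UNIV assms])
      (simp_all add: matrix_vector_right_distrib vector_scalar_commute cinner_add_left cinner_scale_left
         cinner_add_right cinner_scale_right)
  moreover have "{q\<in>V. \<forall>p\<in>UNIV. cinner (Jmat *v p) q = 0} \<subseteq> {0}"
  proof clarify
    fix q assume "\<forall>p\<in>UNIV. cinner (Jmat *v p) q = 0"
    then have "cinner (Jmat *v (Jmat *v q)) q = 0" by blast
    then show "q = 0" by (simp add: Jmat_Jmat cinner_minus_left cinner_self)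
  qed
  then have "vec.dim {q\<in>V. \<forall>p\<in>UNIV. cinner (Jmat *v p) q = 0} = 0"
    by (rule dim_subset_zero)
  moreover have "vec.dim (UNIV :: (complex^('n+'n)) set) = 2 * CARD('n)" by (simp add: card_cart_basis)
  moreover have "{p\<in>UNIV. \<forall>q\<in>V. cinner (Jmat *v p) q = 0} = Jperp V" by (simp add: Jperp_def)
  ultimately show ?thesis by (metis (no_types, lifting) add.right_neutral)
qed

lemma Jperp_sym: "z \<in> Jperp V \<longleftrightarrow> (\<forall>u\<in>V. cinner (Jmat *v u) z = 0)"
  by (auto simp: Jperp_def cinner_Jmat_commute[of z])

lemma Jperp_antimono: "V \<subseteq> W \<Longrightarrow> Jperp W \<subseteq> Jperp V"
  by (auto simp: Jperp_def)

lemma Jperp_Jperp: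
  assumes "vec.subspace V"
  shows "Jperp (Jperp V) = V"
proof -
  have "V \<subseteq> Jperp (Jperp V)" unfolding Jperp_sym[abs_def] subset_iff by (auto simp: Jperp_sym Jperp_def)
  moreover have "vec.dim (Jperp (Jperp V)) = vec.dim V"
    using dim_Jperp[OF assms] dim_Jperp[OF subspace_Jperp, of V] by linarith
  ultimately show ?thesis using assms subspace_Jperp by (metis order_refl vec.subspace_dim_equal)
qed

text \<open>\<open>J\<close> has signature (n, n): there is a subspace of codimension n on which the
  form is nonpositive, and \<open>P\<close> meets it only in 0.\<close>

lemma dim_definite_le:
  fixes P :: "(complex^('n::finite + 'n)) set"
  assumes P: "vec.subspace P"
    and pos: "\<And>p. p \<in> P \<Longrightarrow> p \<noteq> 0 \<Longrightarrow> 0 < \<sigma> * Im (cinner (Jmat *v p) p)"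
  shows "vec.dim P \<le> CARD('n)"
proof -
  \<comment> \<open>On vectors with blocks k v and v the form equals (k - cnj k) |v|^2; with this
    \<open>k\<close>, \<sigma> times its imaginary part is -2 |\<sigma>| |v|^2.\<close>
  define k where "k = - of_real (sgn \<sigma>) * \<i>"
  let ?K = "{p\<in>P. \<forall>i\<in>UNIV. p $ Inl i - k * p $ Inr i = 0}"
  have "p = 0" if p: "p \<in> ?K" for p
  proof (rule ccontr)
    assume "p \<noteq> 0"
    then have pos': "0 < \<sigma> * Im (cinner (Jmat *v p) p)" using pos p by auto
    have pk: "p $ Inl i = k * p $ Inr i" for i using p by simp
    have "cinner (Jmat *v p) p = (\<Sum>i\<in>UNIV. (k - cnj k) * of_real ((cmod (p $ Inr i))\<^sup>2))"
      by (simp add: cinner_def sum_sum_UNIV Jmat_Inl Jmat_Inr pk complex_norm_square sum_negf[symmetric]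
          sum.distrib[symmetric] algebra_simps del: of_real_power)
    also have "\<dots> = of_real (- 2 * sgn \<sigma> * (\<Sum>i\<in>UNIV. (cmod (p $ Inr i))\<^sup>2)) * \<i>"
      by (simp add: k_def sum_distrib_left sum_distrib_right mult_ac)
    finally have "Im (cinner (Jmat *v p) p) = - 2 * sgn \<sigma> * (\<Sum>i\<in>UNIV. (cmod (p $ Inr i))\<^sup>2)" by simp
    then have "\<sigma> * Im (cinner (Jmat *v p) p) = - 2 * \<bar>\<sigma>\<bar> * (\<Sum>i\<in>UNIV. (cmod (p $ Inr i))\<^sup>2)"
      by (simp add: abs_sgn)
    moreover have "\<bar>\<sigma>\<bar> * (\<Sum>i\<in>UNIV. (cmod (p $ Inr i))\<^sup>2) \<ge> 0" by (simp add: sum_nonneg)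
    ultimately show False using pos' by simp
  qed
  then have "?K \<subseteq> {0}" by blast
  then have "vec.dim ?K = 0" by (rule dim_subset_zero)
  moreover have "vec.dim P \<le> CARD('n) + vec.dim ?K"
    by (rule dim_zero_set(1)[OF P]) (auto simp: algebra_simps)
  ultimately show ?thesis by linarith
qed

subsection \<open>Hamiltonian systems\<close>

lemma mat_mv: "mat k *v v = k *s (v :: complex^'m::finite)"
  by (simp add: vec_eq_iff matrix_vector_mult_def mat_def if_distrib[of "\<lambda>z. z * _"] cong: if_cong)

lemma bounded_linear_matrix_mult_left: "bounded_linear (\<lambda>B :: complex^'m::finite^'m. C ** B)"
proof -
  have "linear (\<lambda>B :: complex^'m^'m. C ** B)"
    by (rule linearI) (simp_all add: matrix_matrix_mult_def vec_eq_iff sum.distrib algebra_simps scaleR_sum_right)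
  then show ?thesis by (simp add: linear_conv_bounded_linear)
qed

lemma bounded_linear_mv: "bounded_linear (\<lambda>v :: complex^'m::finite. (C :: complex^'m^'k::finite) *v v)"
  by (rule bounded_bilinear.bounded_linear_right[OF bounded_bilinear_matrix_vector_mult])

lemma mv_minus: "C *v (- v) = - (C *v v)" for C :: "complex^'m::finite^'k::finite"
  by (rule linear_neg[OF bounded_linear.linear[OF bounded_linear_mv]])

lemma bounded_linear_cscale: "bounded_linear (\<lambda>v :: complex^'m::finite. k *s v)"
  using bounded_linear_mv[of "mat k"] by (simp add: mat_mv)

lemma L1_loc_linear: "f \<in> L1_loc a b \<Longrightarrow> bounded_linear h \<Longrightarrow> (\<lambda>x. h (f x)) \<in> L1_loc a b"
  unfolding L1_loc_def using absolutely_integrable_linear[where f=f and h=h] by (auto simp: o_def)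

lemma L1_loc_add: "f \<in> L1_loc a b \<Longrightarrow> g \<in> L1_loc a b \<Longrightarrow> (\<lambda>x. f x + g x) \<in> L1_loc a b"
  unfolding L1_loc_def by (auto intro: set_integral_add)

lemma primitive_on_linear:
  assumes "primitive_on S g y" "bounded_linear h"
  shows "primitive_on S (\<lambda>x. h (g x)) (\<lambda>x. h (y x))"
  unfolding primitive_on_def
proof (intro allI impI, elim conjE)
  fix s t :: real assume "s \<le> t" "{s..t} \<subseteq> S"
  from has_integral_linear[OF primitive_onD[OF assms(1) this] assms(2)]
  show "((\<lambda>x. h (g x)) has_integral h (y t) - h (y s)) {s..t}"
    by (simp add: o_def linear_diff[OF bounded_linear.linear[OF assms(2)]])
qed

lemma primitive_on_add:
  assumes "primitive_on S g y" "primitive_on S g' y'"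
  shows "primitive_on S (\<lambda>x. g x + g' x) (\<lambda>x. y x + y' x)"
  unfolding primitive_on_def
proof (intro allI impI, elim conjE)
  fix s t :: real assume st: "s \<le> t" "{s..t} \<subseteq> S"
  from has_integral_add[OF primitive_onD[OF assms(1) st] primitive_onD[OF assms(2) st]]
  show "((\<lambda>x. g x + g' x) has_integral y t + y' t - (y s + y' s)) {s..t}"
    by (simp add: algebra_simps)
qed

lemma absolutely_integrable_cinner:
  fixes f z :: "real \<Rightarrow> complex^'m::finite"
  assumes f: "f absolutely_integrable_on {s..t}" and z: "continuous_on {s..t} z"
  shows "(\<lambda>x. cinner (f x) (z x)) absolutely_integrable_on {s..t}"
proof (rule absolutely_integrable_bounded_measurable_product[where h="\<lambda>v u. cinner u v" and f=z])
  show "bilinear (\<lambda>v (u :: complex^'m). cinner u v)"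
    using bounded_bilinear.flip[OF bounded_bilinear_cinner] by (simp add: bilinear_conv_bounded_bilinear)
  show "z \<in> borel_measurable (lebesgue_on {s..t})"
    using z by (rule continuous_imp_measurable_on_sets_lebesgue) simp
  show "bounded (z ` {s..t})" using z by (intro compact_imp_bounded compact_continuous_image) auto
qed (use f in simp_all)

lemma absolutely_integrable_if_components:
  fixes f :: "real \<Rightarrow> complex^'m::finite"
  assumes "\<And>k. (\<lambda>x. cinner (f x) (axis k 1)) absolutely_integrable_on S"
  shows "f absolutely_integrable_on (S :: real set)"
proof (rule absolutely_integrable_componentwise)
  fix i :: "complex^'m" assume "i \<in> Basis"
  then obtain k b where "i = axis k b" by (auto simp: Basis_vec_def)
  then have "(\<lambda>x. inner (f x) i) = (\<lambda>y. inner y b) \<circ> (\<lambda>x. cinner (f x) (axis k 1))"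
    by (simp add: inner_axis cinner_axis o_def)
  then show "(\<lambda>x. inner (f x) i) absolutely_integrable_on S"
    using absolutely_integrable_linear[OF assms[of k] bounded_linear_inner_left[of b]] by simp
qed

locale ham =
  fixes a b :: ereal
    and B0 B1 :: "real \<Rightarrow> complex ^ ('n::finite + 'n) ^ ('n + 'n)"
  assumes ab: "a < b" and B0: "B0 \<in> L1_loc a b" and B1: "B1 \<in> L1_loc a b"
    and herm: "AE x in lebesgue. x \<in> einterval a b \<longrightarrow> madj (B0 x) = B0 x \<and> madj (B1 x) = B1 x"
    and definite: "\<And>\<zeta> y c d. \<lbrakk> is_solution a b B0 B1 \<zeta> y; \<exists>x\<in>einterval a b. y x \<noteq> 0;
                   c < d; {c..d} \<subseteq> einterval a b \<rbrakk>
         \<Longrightarrow> 0 < Re (LINT x:{c..d}|lebesgue. cinner (B1 x *v y x) (y x))"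
begin

abbreviation "X \<equiv> einterval a b"

text \<open>The inverse of \<open>J\<close> is -J, so this is the equation solved for y'.\<close>

definition rhs :: "(real \<Rightarrow> complex^('n+'n)) \<Rightarrow> (real \<Rightarrow> complex^('n+'n)) \<Rightarrow> real \<Rightarrow> complex^('n+'n)" where
  "rhs y F x = - (Jmat *v (B0 x *v y x + B1 x *v F x))"

text \<open>\<open>mrel y F\<close> is the equation \<open>J y' - B\<^sub>0 y = B\<^sub>1 F\<close> in integrated form.\<close>

definition mrel :: "(real \<Rightarrow> complex^('n+'n)) \<Rightarrow> (real \<Rightarrow> complex^('n+'n)) \<Rightarrow> bool" where
  "mrel y F \<longleftrightarrow> primitive_on X (rhs y F) y"

definition contX :: "(real \<Rightarrow> complex^('n+'n)) \<Rightarrow> bool" where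
  "contX y \<longleftrightarrow> (\<forall>s t. {s..t} \<subseteq> X \<longrightarrow> continuous_on {s..t} y)"

lemma mrel_contX: "mrel y F \<Longrightarrow> contX y"
  unfolding mrel_def contX_def by (blast intro: primitive_on_continuous)

lemma AC_loc_contX: "y \<in> AC_loc a b \<Longrightarrow> contX y"
  unfolding contX_def
proof (intro allI impI)
  fix s t assume y: "y \<in> AC_loc a b" and st: "{s..t} \<subseteq> X"
  show "continuous_on {s..t} y"
  proof (cases "s < t")
    case True
    then show ?thesis using y st by (intro abs_cont_on_imp_continuous_on) (auto simp: AC_loc_def)
  next
    case False
    then have "{s..t} = {} \<or> {s..t} = {s}" by auto
    then show ?thesis by auto
  qed
qed

lemma contX_measurable: assumes "contX z" shows "z \<in> borel_measurable (lebesgue_on X)"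
proof -
  have "continuous_on X z"
  proof (rule continuous_at_imp_continuous_on, rule ballI)
    fix x assume "x \<in> X"
    then obtain d where "d > 0" "ball x d \<subseteq> X" using open_einterval open_contains_ball by blast
    moreover have "{x - d/2..x + d/2} \<subseteq> ball x d" using \<open>d > 0\<close> by (auto simp: dist_real_def)
    ultimately have "continuous_on {x - d/2..x + d/2} z" using assms unfolding contX_def by blast
    then show "isCont z x" using \<open>d > 0\<close> by (intro continuous_on_interior) (auto simp: interior_atLeastAtMost_real)
  qed
  then show ?thesis by (rule continuous_imp_measurable_on_sets_lebesgue) simp
qed

lemma L1_mv: "A \<in> L1_loc a b \<Longrightarrow> contX y \<Longrightarrow> (\<lambda>x. A x *v y x) \<in> L1_loc a b"
  unfolding contX_def L1_loc_def by (auto intro: absolutely_integrable_matrix_vector_mult)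

lemma rhs_L1: "contX y \<Longrightarrow> (\<lambda>x. B1 x *v F x) \<in> L1_loc a b \<Longrightarrow> rhs y F \<in> L1_loc a b"
  unfolding rhs_def[abs_def]
  by (rule L1_loc_linear[OF L1_loc_add, OF L1_mv[OF B0] _ bounded_linear_minus[OF bounded_linear_mv]])

lemma Jmat_inverse: "Jmat *v u = v \<longleftrightarrow> u = - (Jmat *v v)"
  by (metis Jmat_Jmat add.inverse_inverse mv_minus)

text \<open>Continuity of \<open>y\<close>, available on either side, makes \<open>rhs\<close>
  locally integrable, as the equivalence of the pointwise and the integrated equation
  requires.\<close>

lemma mrel_iff:
  assumes F: "(\<lambda>x. B1 x *v F x) \<in> L1_loc a b"
  shows "mrel y F \<longleftrightarrow> y \<in> AC_loc a b \<and> (AE x in lebesgue. x \<in> X \<longrightarrow>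
        (\<exists>y'. (y has_vector_derivative y') (at x) \<and> Jmat *v y' = B0 x *v y x + B1 x *v F x))"
proof -
  have eq: "(\<exists>y'. (y has_vector_derivative y') (at x) \<and> Jmat *v y' = B0 x *v y x + B1 x *v F x)
      \<longleftrightarrow> (y has_vector_derivative rhs y F x) (at x)" for x
    unfolding Jmat_inverse rhs_def by auto
  show ?thesis unfolding eq mrel_def
    using AC_loc_iff_primitive[OF ab rhs_L1[OF _ F], of y y] AC_loc_contX[of y] mrel_contX[unfolded mrel_def, of y F]
    by blast
qed

lemma is_solution_iff: "is_solution a b B0 B1 \<zeta> y \<longleftrightarrow> mrel y (\<lambda>x. \<zeta> *s y x)"
proof (cases "contX y")
  case True
  have "(\<lambda>x. B1 x *v (\<zeta> *s y x)) \<in> L1_loc a b"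
  proof (rule L1_mv[OF B1])
    show "contX (\<lambda>x. \<zeta> *s y x)" using True unfolding contX_def
      by (auto intro: bounded_linear.continuous_on[OF bounded_linear_cscale])
  qed
  from mrel_iff[OF this] show ?thesis by (simp add: is_solution_def vector_scalar_commute)
next
  case False
  then show ?thesis using AC_loc_contX mrel_contX by (auto simp: is_solution_def)
qed

lemma mrel_lincomb: "mrel y F \<Longrightarrow> mrel z G \<Longrightarrow> mrel (\<lambda>x. y x + k *s z x) (\<lambda>x. F x + k *s G x)"
proof -
  assume "mrel y F" "mrel z G"
  then have "primitive_on X (\<lambda>x. rhs y F x + k *s rhs z G x) (\<lambda>x. y x + k *s z x)"
    unfolding mrel_def by (intro primitive_on_add primitive_on_linear[OF _ bounded_linear_cscale])
  moreover have "rhs y F x + k *s rhs z G x = rhs (\<lambda>x. y x + k *s z x) (\<lambda>x. F x + k *s G x) x" for x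
    by (simp add: rhs_def matrix_vector_right_distrib vector_scalar_commute vector_add_ldistrib algebra_simps)
  ultimately show "mrel (\<lambda>x. y x + k *s z x) (\<lambda>x. F x + k *s G x)" unfolding mrel_def by simp
qed

lemma mrel_cong:
  assumes "mrel y F" "\<And>x. x \<in> X \<Longrightarrow> y x = z x" "\<And>x. x \<in> X \<Longrightarrow> F x = G x"
  shows "mrel z G"
  using assms(1) unfolding mrel_def
  by (rule primitive_on_cong) (simp_all add: rhs_def assms(2,3))

text \<open>Products with constant matrices exhibit the coefficient as a continuous linear image of
  \<open>B0\<close> and \<open>B1\<close>, from which its local integrability is immediate.\<close>

definition ode_coeff :: "complex \<Rightarrow> real \<Rightarrow> complex ^ ('n + 'n) ^ ('n + 'n)" where
  "ode_coeff \<zeta> x = (mat (-1) ** Jmat) ** (B0 x + mat \<zeta> ** B1 x)"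

definition ode_term :: "(real \<Rightarrow> complex ^ ('n + 'n)) \<Rightarrow> real \<Rightarrow> complex ^ ('n + 'n)" where
  "ode_term F x = - (Jmat *v (B1 x *v F x))"

lemma ode_coeff_mv: "ode_coeff \<zeta> x *v v = - (Jmat *v (B0 x *v v + B1 x *v (\<zeta> *s v)))"
  unfolding ode_coeff_def
  by (simp add: matrix_vector_mul_assoc[symmetric] matrix_vector_mult_add_rdistrib mat_mv
      vector_scalar_commute vector_smult_lneg)

lemma rhs_ode: "rhs y (\<lambda>x. \<zeta> *s y x + F x) = (\<lambda>x. ode_coeff \<zeta> x *v y x + ode_term F x)"
  by (simp add: fun_eq_iff rhs_def ode_coeff_mv ode_term_def matrix_vector_right_distrib)

lemma mrel_ode:
  assumes F: "(\<lambda>x. B1 x *v F x) \<in> L1_loc a b" and t: "t \<in> X"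
  shows "\<exists>y. mrel y (\<lambda>x. \<zeta> *s y x + F x) \<and> y t = w"
    and "mrel y (\<lambda>x. \<zeta> *s y x) \<Longrightarrow> y t = 0 \<Longrightarrow> x \<in> X \<Longrightarrow> y x = 0"
proof -
  have A: "ode_coeff \<zeta> \<in> L1_loc a b" unfolding ode_coeff_def[abs_def]
    by (rule L1_loc_linear[OF L1_loc_add[OF B0 L1_loc_linear[OF B1 bounded_linear_matrix_mult_left]]
          bounded_linear_matrix_mult_left])
  have r: "ode_term F \<in> L1_loc a b" unfolding ode_term_def[abs_def]
    by (rule L1_loc_linear[OF F bounded_linear_minus[OF bounded_linear_mv]])
  interpret linear_ode a b "ode_coeff \<zeta>" "ode_term F" by unfold_locales (rule ab A r)+
  have 1: "sol_on X y \<longleftrightarrow> mrel y (\<lambda>x. \<zeta> *s y x + F x)" for y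
    unfolding sol_on_def mrel_def rhs_ode ..
  have "(\<lambda>x. ode_coeff \<zeta> x *v y x) = rhs y (\<lambda>x. \<zeta> *s y x)" for y
    by (simp add: fun_eq_iff rhs_def ode_coeff_mv)
  then have 2: "hsol_on X y \<longleftrightarrow> mrel y (\<lambda>x. \<zeta> *s y x)" for y
    unfolding hsol_on_def mrel_def by simp
  show "\<exists>y. mrel y (\<lambda>x. \<zeta> *s y x + F x) \<and> y t = w" using sol_exists[OF t, of w] unfolding 1 .
  show "mrel y (\<lambda>x. \<zeta> *s y x) \<Longrightarrow> y t = 0 \<Longrightarrow> x \<in> X \<Longrightarrow> y x = 0"
    using hsol_zero[of y t x] t unfolding 2 by blast
qed

lemma L1_zero: "(\<lambda>x. B1 x *v 0) \<in> L1_loc a b"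
  by (simp add: L1_loc_def)

lemma mrel_unique:
  assumes y: "mrel y (\<lambda>x. \<zeta> *s y x + F x)" and z: "mrel z (\<lambda>x. \<zeta> *s z x + F x)"
    and t: "t \<in> X" "y t = z t" and x: "x \<in> X"
  shows "y x = z x"
proof -
  have "mrel (\<lambda>x. y x + (-1) *s z x) (\<lambda>x. \<zeta> *s (y x + (-1) *s z x))"
    by (rule mrel_cong[OF mrel_lincomb[OF y z, of "-1"]])
      (simp_all add: vec_eq_iff algebra_simps)
  from mrel_ode(2)[OF L1_zero t(1) this _ x] t(2) show ?thesis by (simp add: vector_smult_lneg)
qed

lemma X_sets: "X \<in> sets lebesgue" by simp

lemma B1_meas: "B1 \<in> borel_measurable (lebesgue_on X)"
proof -
  obtain l u :: "nat \<Rightarrow> real" where lu: "\<And>i. l i < u i" "\<And>i. {l i..u i} \<subseteq> X"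
    "X = (\<Union>i. {l i<..<u i})" "\<And>i. {l i..u i} \<subseteq> {l (Suc i)..u (Suc i)}"
    using that by (rule einterval_cover[OF ab])
  have "cut {l i..u i} B1 \<in> borel_measurable (lebesgue_on X)" for i
  proof (rule measurable_cut)
    show "B1 \<in> borel_measurable (lebesgue_on {l i..u i})"
    proof (rule borel_measurable_integrable)
      show "integrable (lebesgue_on {l i..u i}) B1"
        using B1 lu(2)[of i] by (simp add: L1_loc_def set_integrable_def integrable_restrict_space)
    qed
  qed simp
  then show ?thesis
  proof (rule borel_measurable_LIMSEQ_metric)
    fix x assume "x \<in> space (lebesgue_on X)"
    then have "x \<in> X" by (simp add: space_restrict_space)
    then obtain i where i: "x \<in> {l i<..<u i}" using lu(3) by blast
    have "x \<in> {l j..u j}" if "j \<ge> i" for j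
      using that
    proof (induction j rule: dec_induct)
      case base show ?case using i by auto
    next
      case (step n) then show ?case using lu(4)[of n] by blast
    qed
    then have "\<forall>\<^sub>F j in sequentially. cut {l j..u j} B1 x = B1 x"
      unfolding eventually_sequentially cut_def by (intro exI[of _ i]) auto
    then show "(\<lambda>j. cut {l j..u j} B1 x) \<longlonglongrightarrow> B1 x" by (rule tendsto_eventually)
  qed
qed

text \<open>The indefinite integral is nondecreasing and has derivative \<open>g\<close> almost
  everywhere.\<close>

lemma AE_ge_zero_of_interval_integrals:
  fixes g :: "real \<Rightarrow> real"
  assumes g: "g \<in> L1_loc a b" and pos: "\<And>s t. s < t \<Longrightarrow> {s..t} \<subseteq> X \<Longrightarrow> 0 \<le> integral {s..t} g"
  shows "AE x in lebesgue. x \<in> X \<longrightarrow> 0 \<le> g x"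
proof -
  obtain l u :: "nat \<Rightarrow> real" where lu: "\<And>i. l i < u i" "\<And>i. {l i..u i} \<subseteq> X"
    "X = (\<Union>i. {l i<..<u i})"
    using einterval_cover[OF ab] by metis
  have gi: "g integrable_on {s..t}" if "{s..t} \<subseteq> X" for s t
    using g that by (auto simp: L1_loc_def absolutely_integrable_on_def)
  have "\<exists>N. negligible N \<and> (\<forall>x\<in>{l i<..<u i} - N. ((\<lambda>x. integral {l i..x} g) has_vector_derivative g x) (at x))" for i
    by (rule lebesgue_differentiation_real[OF gi[OF lu(2)]])
  then obtain N where N: "\<And>i. negligible (N i)"
    "\<And>i x. x \<in> {l i<..<u i} - N i \<Longrightarrow> ((\<lambda>x. integral {l i..x} g) has_vector_derivative g x) (at x)"
    by metis
  have "negligible (\<Union>i. N i)" by (intro negligible_Union_nat N)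
  then have "AE x in lebesgue. x \<notin> (\<Union>i. N i)"
    by (intro AE_not_in) (simp add: negligible_iff_null_sets)
  moreover have "0 \<le> g x" if x: "x \<in> X" "x \<notin> (\<Union>i. N i)" for x
  proof -
    obtain i where i: "x \<in> {l i<..<u i}" using x lu(3) by blast
    show ?thesis
    proof (rule mono_on_imp_deriv_nonneg)
      show "mono_on {l i..u i} (\<lambda>x. integral {l i..x} g)"
      proof (rule mono_onI)
        fix r s assume rs: "r \<in> {l i..u i}" "s \<in> {l i..u i}" "r \<le> s"
        have sub: "{p..q'} \<subseteq> X" if "l i \<le> p" "q' \<le> u i" for p q'
          using that lu(2)[of i] by (meson atLeastatMost_subset_iff order_trans)
        have "integral {l i..r} g + integral {r..s} g = integral {l i..s} g"
          using rs by (intro Henstock_Kurzweil_Integration.integral_combine gi sub) auto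
        moreover have "0 \<le> integral {r..s} g"
          using pos[of r s] sub[of r s] rs by (cases "r = s") auto
        ultimately show "integral {l i..r} g \<le> integral {l i..s} g" by linarith
      qed
      show "((\<lambda>x. integral {l i..x} g) has_real_derivative g x) (at x)"
        using N(2)[of x i] i x by (simp add: has_real_derivative_iff_has_vector_derivative)
      show "x \<in> interior {l i..u i}" using i by (simp add: interior_atLeastAtMost_real)
    qed
  qed
  ultimately show ?thesis by auto
qed

lemma q_L1:
  assumes y: "contX y" and z: "contX z"
  shows "(\<lambda>x. cinner (B1 x *v y x) (z x)) \<in> L1_loc a b"
  unfolding L1_loc_def
proof (clarify, rule absolutely_integrable_cinner)
  fix s t assume st: "{s..t} \<subseteq> X"
  show "continuous_on {s..t} z" using z st by (auto simp: contX_def)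
  show "(\<lambda>x. B1 x *v y x) absolutely_integrable_on {s..t}"
    using L1_mv[OF B1 y] st by (auto simp: L1_loc_def)
qed

text \<open>The definiteness hypothesis speaks about solutions only. Those for the spectral
  parameter 0 depend linearly on their value at \<open>c\<close> and attain every vector at every
  \<open>x\<close>; for each of them positivity over all intervals gives it almost everywhere. A
  countable dense set of initial values keeps the exceptional set null, and continuity covers the
  others.\<close>

lemma B1_psd: "AE x in lebesgue. x \<in> X \<longrightarrow> psd (B1 x)"
proof -
  obtain c where c: "c \<in> X"
    using einterval_nonempty[OF ab] by blast
  have "\<exists>y. mrel y (\<lambda>x. 0 *s y x + 0) \<and> y c = w" for w by (rule mrel_ode(1)[OF L1_zero c])
  then obtain Y where Y: "\<And>w. mrel (Y w) (\<lambda>x. 0 *s Y w x)" "\<And>w. Y w c = w" by (simp, metis)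
  have YY: "mrel (Y w) (\<lambda>x. 0 *s Y w x + 0)" for w using Y(1)[of w] by simp
  obtain D :: "(complex^('n+'n)) set" where D: "countable D" "\<And>S. open S \<Longrightarrow> S \<noteq> {} \<Longrightarrow> \<exists>d\<in>D. d \<in> S"
    using countable_dense_exists by metis
  have "AE x in lebesgue. x \<in> X \<longrightarrow> 0 \<le> Re (cinner (B1 x *v Y w x) (Y w x))" for w
  proof (cases "w = 0")
    case True
    have "Y w x = 0" if "x \<in> X" for x using mrel_ode(2)[OF L1_zero c Y(1)[of w] _ that] Y(2) True by simp
    then show ?thesis by auto
  next
    case False
    have L: "(\<lambda>x. cinner (B1 x *v Y w x) (Y w x)) \<in> L1_loc a b"
      by (rule q_L1) (rule mrel_contX[OF Y(1)])+
    show ?thesis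
    proof (rule AE_ge_zero_of_interval_integrals[OF L1_loc_linear[OF L bounded_linear_Re]])
      fix s t :: real assume st: "s < t" "{s..t} \<subseteq> X"
      have ai: "(\<lambda>x. cinner (B1 x *v Y w x) (Y w x)) absolutely_integrable_on {s..t}"
        using L st by (auto simp: L1_loc_def)
      have "0 < Re (LINT x:{s..t}|lebesgue. cinner (B1 x *v Y w x) (Y w x))"
        using Y(1,2)[of w] False c st by (intro definite[of 0]) (auto simp: is_solution_iff intro!: bexI[of _ c])
      also have "(LINT x:{s..t}|lebesgue. cinner (B1 x *v Y w x) (Y w x)) = integral {s..t} (\<lambda>x. cinner (B1 x *v Y w x) (Y w x))"
        by (rule set_lebesgue_integral_eq_integral(2)[OF ai])
      also have "Re \<dots> = integral {s..t} (\<lambda>x. Re (cinner (B1 x *v Y w x) (Y w x)))"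
        using integral_linear[OF _ bounded_linear_Re, of "\<lambda>x. cinner (B1 x *v Y w x) (Y w x)" "{s..t}"] ai
        by (simp add: o_def absolutely_integrable_on_def)
      finally show "0 \<le> integral {s..t} (\<lambda>x. Re (cinner (B1 x *v Y w x) (Y w x)))" by simp
    qed
  qed
  then have "AE x in lebesgue. \<forall>w\<in>D. x \<in> X \<longrightarrow> 0 \<le> Re (cinner (B1 x *v Y w x) (Y w x))"
    by (subst AE_ball_countable[OF D(1)]) blast
  with herm show ?thesis
  proof eventually_elim
    case (elim x)
    show ?case
    proof
      assume x: "x \<in> X"
      have lin: "Y (u + k *s v) x = Y u x + k *s Y v x" for u v k
      proof (rule mrel_unique[OF YY _ c _ x])
        show "mrel (\<lambda>x. Y u x + k *s Y v x) (\<lambda>x. 0 *s (Y u x + k *s Y v x) + 0)"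
          by (rule mrel_cong[OF mrel_lincomb[OF YY[of u] YY[of v], of k]]) simp_all
      qed (simp add: Y)
      have Y0: "Y 0 x = 0" using mrel_ode(2)[OF L1_zero c Y(1)[of 0] _ x] Y(2) by simp
      have "linear (\<lambda>w. Y w x)"
      proof (rule linearI)
        show "Y (u + v) x = Y u x + Y v x" for u v using lin[of u 1 v] by simp
        show "Y (r *\<^sub>R v) x = r *\<^sub>R Y v x" for r v
          using lin[of 0 "of_real r" v] Y0
          by (simp add: vector_scalar_mult_def scaleR_vec_def scaleR_conv_of_real)
      qed
      then have bl: "bounded_linear (\<lambda>w. Y w x)" by (simp add: linear_conv_bounded_linear)
      define Q where "Q w = Re (cinner (B1 x *v Y w x) (Y w x))" for w
      have cQ: "continuous_on UNIV Q" unfolding Q_def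
        by (intro continuous_intros bounded_bilinear.continuous_on[OF bounded_bilinear_cinner]
            bounded_linear.continuous_on[OF bounded_linear_mv] bounded_linear.continuous_on[OF bl])
      have "Q w \<ge> 0" for w
      proof (rule ccontr)
        assume "\<not> Q w \<ge> 0"
        then have "w \<in> Q -` {..<0}" by simp
        moreover have "open (Q -` {..<0})" using cQ by (intro open_vimage) auto
        ultimately obtain d where "d \<in> D" "Q d < 0" using D(2)[of "Q -` {..<0}"] by auto
        then show False using elim(2) x unfolding Q_def by force
      qed
      moreover have "\<exists>w. Y w x = v" for v
      proof -
        obtain y where y: "mrel y (\<lambda>x. 0 *s y x + 0)" "y x = v" using mrel_ode(1)[OF L1_zero x] by blast
        have "Y (y c) x = y x" by (rule mrel_unique[OF YY y(1) c _ x]) (simp add: Y)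
        then show ?thesis using y(2) by blast
      qed
      ultimately have "0 \<le> Re (cinner (B1 x *v v) v)" for v unfolding Q_def by metis
      then show "psd (B1 x)" using elim(1) x by (simp add: psd_def)
    qed
  qed
qed

lemma weight_X: "weight (lebesgue_on X) B1"
  by unfold_locales (use B1_meas B1_psd in \<open>auto simp: AE_restrict_space_iff\<close>)

lemma weight_sub: "S \<subseteq> X \<Longrightarrow> S \<in> sets lebesgue \<Longrightarrow> weight (lebesgue_on S) B1"
  by (rule weight_subset[OF weight_X _ X_sets])

definition L2l :: "(real \<Rightarrow> complex^('n+'n)) \<Rightarrow> bool" where
  "L2l F \<longleftrightarrow> (\<forall>s t. {s..t} \<subseteq> X \<longrightarrow> sq (lebesgue_on {s..t}) B1 F)"

lemma contX_L2l: "contX y \<Longrightarrow> L2l y"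
  unfolding L2l_def sq_def
proof (intro allI impI conjI)
  fix s t assume y: "contX y" and st: "{s..t} \<subseteq> X"
  have "continuous_on {s..t} y" using y st by (auto simp: contX_def)
  then show "y \<in> borel_measurable (lebesgue_on {s..t})"
    by (rule continuous_imp_measurable_on_sets_lebesgue) simp
  show "integrable (lebesgue_on {s..t}) (\<lambda>x. cinner (B1 x *v y x) (y x))"
    using q_L1[OF y y] st by (auto simp: L1_loc_def set_integrable_def integrable_restrict_space)
qed

lemma L2l_lincomb:
  assumes "L2l F" "L2l G" shows "L2l (\<lambda>x. F x + k *s G x)"
  unfolding L2l_def
proof (intro allI impI)
  fix s t assume st: "{s..t} \<subseteq> X"
  interpret weight "lebesgue_on {s..t}" B1 by (rule weight_sub[OF st]) simp
  show "sq (lebesgue_on {s..t}) B1 (\<lambda>x. F x + k *s G x)"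
    using assms st unfolding L2l_def by (intro sq_add sq_scale) auto
qed

text \<open>Each component of \<open>B1 F\<close> is the weighted product of \<open>F\<close> with a
  constant vector, which is itself locally square integrable.\<close>

lemma L2l_B1: assumes "L2l F" shows "(\<lambda>x. B1 x *v F x) \<in> L1_loc a b"
  unfolding L1_loc_def
proof (clarify, rule absolutely_integrable_if_components)
  fix s t k assume st: "{s..t} \<subseteq> X"
  interpret weight "lebesgue_on {s..t}" B1 by (rule weight_sub[OF st]) simp
  have "L2l (\<lambda>x. axis k 1)" by (rule contX_L2l) (simp add: contX_def)
  then have "integrable (lebesgue_on {s..t}) (\<lambda>x. cinner (B1 x *v F x) (axis k 1))"
    using assms st unfolding L2l_def by (intro integrable_ip) auto
  then show "(\<lambda>x. cinner (B1 x *v F x) (axis k 1)) absolutely_integrable_on {s..t}"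
    by (simp add: set_integrable_def integrable_restrict_space)
qed

abbreviation bf where "bf y z x \<equiv> cinner (Jmat *v y x) (z x)"

text \<open>Integration by parts for (J y, z); the terms with \<open>B0\<close> cancel because
  \<open>B0\<close> is self-adjoint.\<close>

lemma green:
  assumes y: "mrel y F" and z: "mrel z G" and F: "L2l F" and G: "L2l G"
    and st: "s \<le> t" "{s..t} \<subseteq> X"
  shows "bf y z t - bf y z s = ip (lebesgue_on {s..t}) B1 F z - ip (lebesgue_on {s..t}) B1 y G"
proof -
  let ?p = "\<lambda>u v. cinner (Jmat *v u) v"
  let ?h = "\<lambda>x. cinner (B1 x *v F x) (z x) - cinner (B1 x *v y x) (G x)"
  have bl: "bounded_bilinear ?p"
    by (rule bounded_bilinear.comp1[OF bounded_bilinear_cinner bounded_linear_mv])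
  have cont: "contX y" "contX z" using y z mrel_contX by auto
  have "primitive_on X (\<lambda>x. ?p (y x) (rhs z G x) + ?p (rhs y F x) (z x)) (\<lambda>x. ?p (y x) (z x))"
    by (rule primitive_on_bilinear[OF bl ab])
      (use y z in \<open>auto simp: mrel_def intro!: rhs_L1 cont L2l_B1 F G\<close>)
  from primitive_onD[OF this st]
  have hi: "((\<lambda>x. ?p (y x) (rhs z G x) + ?p (rhs y F x) (z x)) has_integral bf y z t - bf y z s) {s..t}" .
  obtain N where N: "negligible N" "\<And>x. x \<in> X - N \<Longrightarrow> madj (B0 x) = B0 x \<and> madj (B1 x) = B1 x"
    using herm unfolding eventually_ae_filter_negligible by blast
  have "(?h has_integral bf y z t - bf y z s) {s..t}"
  proof (rule has_integral_spike[OF N(1) _ hi])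
    fix x assume x: "x \<in> {s..t} - N"
    then have m: "madj (B0 x) = B0 x" "madj (B1 x) = B1 x" using N(2)[of x] st by auto
    have "?p (y x) (rhs z G x) = - cinner (y x) (B0 x *v z x + B1 x *v G x)"
      unfolding rhs_def cinner_minus_right cinner_Jmat_Jmat ..
    also have "\<dots> = - cinner (B0 x *v y x) (z x) - cinner (B1 x *v y x) (G x)"
      by (simp add: cinner_add_right cinner_madj m)
    finally have 1: "?p (y x) (rhs z G x) = - cinner (B0 x *v y x) (z x) - cinner (B1 x *v y x) (G x)" .
    have 2: "?p (rhs y F x) (z x) = cinner (B0 x *v y x) (z x) + cinner (B1 x *v F x) (z x)"
      unfolding rhs_def by (simp add: mv_minus Jmat_Jmat cinner_add_left)
    show "?h x = ?p (y x) (rhs z G x) + ?p (rhs y F x) (z x)" unfolding 1 2 by simp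
  qed
  then have I: "integral {s..t} ?h = bf y z t - bf y z s" by (rule integral_unique)
  interpret weight "lebesgue_on {s..t}" B1 by (rule weight_sub[OF st(2)]) simp
  have sq: "sq (lebesgue_on {s..t}) B1 y" "sq (lebesgue_on {s..t}) B1 z"
    "sq (lebesgue_on {s..t}) B1 F" "sq (lebesgue_on {s..t}) B1 G"
    using contX_L2l[OF cont(1)] contX_L2l[OF cont(2)] F G st by (auto simp: L2l_def)
  have i: "integrable (lebesgue_on {s..t}) (\<lambda>x. cinner (B1 x *v F x) (z x))"
    "integrable (lebesgue_on {s..t}) (\<lambda>x. cinner (B1 x *v y x) (G x))"
    by (intro integrable_ip sq)+
  have "ip (lebesgue_on {s..t}) B1 F z - ip (lebesgue_on {s..t}) B1 y G = integral\<^sup>L (lebesgue_on {s..t}) ?h"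
    unfolding ip_def using i by simp
  also have "\<dots> = integral {s..t} ?h"
    using i by (intro lebesgue_integral_eq_integral) auto
  finally show ?thesis using I by simp
qed

end

locale ham_at = ham a b B0 B1
  for a b :: ereal and B0 B1 :: "real \<Rightarrow> complex ^ ('n::finite + 'n) ^ ('n + 'n)" +
  fixes c :: real
  assumes c: "c \<in> einterval a b"
begin

text \<open>With the value 0 outside (a,b), solutions that agree on the interval are equal as
  functions on the line, in accordance with the spaces in \<open>m_left\<close> and
  \<open>m_right\<close>.\<close>

definition sol :: "complex \<Rightarrow> complex^('n+'n) \<Rightarrow> real \<Rightarrow> complex^('n+'n)" where
  "sol \<zeta> w x = (if x \<in> X then (SOME y. mrel y (\<lambda>x. \<zeta> *s y x) \<and> y c = w) x else 0)"

lemma sol: "mrel (sol \<zeta> w) (\<lambda>x. \<zeta> *s sol \<zeta> w x)" and sol_c [simp]: "sol \<zeta> w c = w"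
proof -
  have "\<exists>y. mrel y (\<lambda>x. \<zeta> *s y x) \<and> y c = w" using mrel_ode(1)[OF L1_zero c, of \<zeta> w] by simp
  then have *: "mrel (SOME y. mrel y (\<lambda>x. \<zeta> *s y x) \<and> y c = w) (\<lambda>x. \<zeta> *s (SOME y. mrel y (\<lambda>x. \<zeta> *s y x) \<and> y c = w) x)
     \<and> (SOME y. mrel y (\<lambda>x. \<zeta> *s y x) \<and> y c = w) c = w" by (rule someI_ex)
  show "mrel (sol \<zeta> w) (\<lambda>x. \<zeta> *s sol \<zeta> w x)"
    by (rule mrel_cong[OF conjunct1[OF *]]) (simp_all add: sol_def)
  show "sol \<zeta> w c = w" using conjunct2[OF *] c by (simp add: sol_def)
qed

lemma sol_outside: "x \<notin> X \<Longrightarrow> sol \<zeta> w x = 0" by (simp add: sol_def)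

lemma sol_unique:
  assumes y: "mrel y (\<lambda>x. \<zeta> *s y x)" and x: "x \<in> X"
  shows "y x = sol \<zeta> (y c) x"
proof -
  have "mrel y (\<lambda>x. \<zeta> *s y x + 0)" "mrel (sol \<zeta> (y c)) (\<lambda>x. \<zeta> *s sol \<zeta> (y c) x + 0)"
    using y sol by simp_all
  from mrel_unique[OF this c _ x] show ?thesis by simp
qed

lemma sol_lincomb: "sol \<zeta> (u + k *s v) x = sol \<zeta> u x + k *s sol \<zeta> v x"
proof (cases "x \<in> X")
  case True
  have "mrel (\<lambda>x. sol \<zeta> u x + k *s sol \<zeta> v x) (\<lambda>x. \<zeta> *s (sol \<zeta> u x + k *s sol \<zeta> v x))"
    by (rule mrel_cong[OF mrel_lincomb[OF sol[of \<zeta> u] sol[of \<zeta> v], of k]]) (simp_all add: vec_eq_iff algebra_simps)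
  from sol_unique[OF this True] show ?thesis by simp
qed (simp add: sol_outside)

lemma sol_zero: "sol \<zeta> 0 x = 0"
  using sol_lincomb[of \<zeta> 0 "-1" 0 x] by (simp add: vector_smult_lneg)

lemma sol_surj: assumes "x \<in> X" shows "\<exists>w. sol \<zeta> w x = v"
proof -
  obtain y where "mrel y (\<lambda>x. \<zeta> *s y x + 0)" "y x = v" using mrel_ode(1)[OF L1_zero assms] by blast
  then show ?thesis using sol_unique[OF _ assms, of y \<zeta>] by auto
qed

lemma contX_sol: "contX (sol \<zeta> w)" by (rule mrel_contX[OF sol])

lemma L2l_sol: "L2l (\<lambda>x. k *s sol \<zeta> w x)"
  using L2l_lincomb[OF contX_L2l[of "\<lambda>x. 0"] contX_L2l[OF contX_sol], of k \<zeta> w]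
  by (simp add: contX_def)

lemma sol_pos:
  assumes w: "w \<noteq> 0" and st: "s < t" "{s..t} \<subseteq> X"
  shows "0 < nr (lebesgue_on {s..t}) B1 (sol \<zeta> w)"
proof -
  have "0 < Re (LINT x:{s..t}|lebesgue. cinner (B1 x *v sol \<zeta> w x) (sol \<zeta> w x))"
    using w c st by (intro definite[of \<zeta>]) (auto simp: is_solution_iff sol intro!: bexI[of _ c])
  then show ?thesis by (simp add: nr_def ip_def set_lebesgue_integral_def integral_restrict_space)
qed

end

subsection \<open>The boundary form at an end point\<close>

text \<open>Riesz representation of a functional that is conjugate-linear on a subspace only: it is
  first extended to the whole space through a basis of \<open>V\<close>.\<close>

lemma conj_linear_representation:
  fixes \<psi> :: "complex^'m::finite \<Rightarrow> complex"
  assumes V: "vec.subspace V"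
    and \<psi>: "\<And>u v k. u \<in> V \<Longrightarrow> v \<in> V \<Longrightarrow> \<psi> (u + k *s v) = \<psi> u + cnj k * \<psi> v"
  shows "\<exists>\<eta>. \<forall>w\<in>V. \<psi> w = cinner \<eta> w"
proof -
  obtain B where B: "B \<subseteq> V" "vec.independent B" "V \<subseteq> vec.span B" "card B = vec.dim V"
    using that by (rule vec.basis_exists)
  \<comment> \<open>The extension is made for maps of the vector space into itself, so the scalar is
    stored in all coordinates and later read off at \<open>i0\<close>.\<close>
  define f where "f w = ((\<chi> i. cnj (\<psi> w)) :: complex^'m)" for w :: "complex^'m"
  obtain T where T: "Vector_Spaces.linear (*s) (*s) T" "\<And>x. x \<in> B \<Longrightarrow> T x = (f x :: complex^'m)"
    using vec.linear_independent_extend[OF B(2), of f] by blast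
  have Tl: "T (u + k *s v) = T u + k *s T v" for u v k
    using T(1) by (simp add: Vector_Spaces.linear_iff)
  define i0 where "i0 = (undefined :: 'm)"
  have T0: "T 0 = 0" using Tl[of 0 "-1" 0] by (simp add: vector_smult_lneg)
  have \<psi>0: "\<psi> 0 = 0" using \<psi>[of 0 0 1] vec.subspace_0[OF V] by simp
  have "vec.subspace {w\<in>V. cnj (T w $ i0) = \<psi> w}"
  proof (rule vec.subspaceI)
    show "0 \<in> {w\<in>V. cnj (T w $ i0) = \<psi> w}" using vec.subspace_0[OF V] T0 \<psi>0 by simp
    show "x + y \<in> {w\<in>V. cnj (T w $ i0) = \<psi> w}" if "x \<in> {w\<in>V. cnj (T w $ i0) = \<psi> w}" "y \<in> {w\<in>V. cnj (T w $ i0) = \<psi> w}" for x y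
      using that Tl[of x 1 y] \<psi>[of x y 1] vec.subspace_add[OF V] by simp
    show "k *s x \<in> {w\<in>V. cnj (T w $ i0) = \<psi> w}" if "x \<in> {w\<in>V. cnj (T w $ i0) = \<psi> w}" for k x
      using that Tl[of 0 k x] \<psi>[of 0 x k] T0 \<psi>0 vec.subspace_0[OF V] vec.subspace_scale[OF V] by simp
  qed
  moreover have "B \<subseteq> {w\<in>V. cnj (T w $ i0) = \<psi> w}" using B(1) T(2) by (auto simp: f_def)
  ultimately have "vec.span B \<subseteq> {w\<in>V. cnj (T w $ i0) = \<psi> w}" by (rule vec.span_minimal[rotated])
  then have 1: "\<psi> w = cnj (T w $ i0)" if "w \<in> V" for w using that B(3) by auto
  define \<eta> where "\<eta> = (\<chi> i. cnj (T (axis i 1) $ i0))"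
  have "cnj (T w $ i0) = cinner \<eta> w" for w
  proof -
    have Ts: "T (\<Sum>i\<in>A. k i *s axis i 1) = (\<Sum>i\<in>A. k i *s T (axis i 1))" if "finite A" for A k
      using that
    proof (induction A rule: finite_induct)
      case (insert x F)
      then show ?case using Tl[of "\<Sum>i\<in>F. k i *s axis i 1" "k x" "axis x 1"] by (simp add: add.commute)
    qed (simp add: T0)
    have "T w = (\<Sum>i\<in>UNIV. w $ i *s T (axis i 1))"
      using Ts[of UNIV "\<lambda>i. w $ i"] basis_expansion[of w] by simp
    then show ?thesis by (simp add: cinner_def \<eta>_def mult.commute)
  qed
  then show ?thesis using 1 by metis
qed

text \<open>One locale serves both end points: \<open>I\<close> is the part of (a,b) on one side of
  \<open>c\<close>, and \<sigma> is the orientation sign with which integrals over \<open>I\<close>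
  enter Green's formula.\<close>

locale ham_end = ham_at a b B0 B1 c
  for a b :: ereal and B0 B1 :: "real \<Rightarrow> complex ^ ('n::finite + 'n) ^ ('n + 'n)" and c :: real +
  fixes I :: "real set" and \<sigma> :: real
  assumes I_cases: "(I = einterval a b \<inter> {..c} \<and> \<sigma> = 1) \<or> (I = einterval a b \<inter> {c..} \<and> \<sigma> = -1)"
begin

definition K :: "real \<Rightarrow> real set" where "K t = {min t c..max t c}"

lemma I_sub: "I \<subseteq> X" and I_sets: "I \<in> sets lebesgue" and \<sigma>2: "\<sigma> * \<sigma> = 1"
  using I_cases c by auto

lemma K_sub: assumes "t \<in> I" shows "K t \<subseteq> I"
proof -
  have "K t \<subseteq> X" unfolding K_def using I_sub assms c by (intro einterval_Icc) (auto simp: min_def max_def)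
  then show ?thesis using I_cases assms by (auto simp: K_def)
qed

lemma K_sets: "K t \<in> sets lebesgue" by (simp add: K_def)

lemma K_X: "t \<in> I \<Longrightarrow> K t \<subseteq> X" using K_sub I_sub by blast

lemma K_mono: "s \<in> K t \<Longrightarrow> K s \<subseteq> K t" by (auto simp: K_def)

lemma K_total: "s \<in> I \<Longrightarrow> t \<in> I \<Longrightarrow> s \<in> K t \<or> t \<in> K s" using I_cases by (auto simp: K_def)

sublocale W: weight "lebesgue_on I" B1 by (rule weight_sub[OF I_sub I_sets])

lemma WK: "t \<in> I \<Longrightarrow> weight (lebesgue_on (K t)) B1" by (rule weight_sub[OF K_X K_sets])

abbreviation "M \<equiv> lebesgue_on I"
abbreviation "MK t \<equiv> lebesgue_on (K t)"

lemma L2l_K: "L2l F \<Longrightarrow> t \<in> I \<Longrightarrow> sq (MK t) B1 F"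
  using K_X unfolding L2l_def K_def by blast

lemma green_K:
  assumes "mrel y F" "mrel z G" "L2l F" "L2l G" "t \<in> I"
  shows "bf y z c - bf y z t = of_real \<sigma> * (ip (MK t) B1 F z - ip (MK t) B1 y G)"
  using I_cases
proof
  assume I: "I = X \<inter> {..c} \<and> \<sigma> = 1"
  then have "K t = {t..c}" "t \<le> c" using assms(5) by (auto simp: K_def)
  then show ?thesis using green[OF assms(1-4), of t c] K_X[OF assms(5)] I by simp
next
  assume I: "I = X \<inter> {c..} \<and> \<sigma> = -1"
  then have "K t = {c..t}" "c \<le> t" using assms(5) by (auto simp: K_def)
  then show ?thesis using green[OF assms(1-4), of c t] K_X[OF assms(5)] I by (simp add: algebra_simps)
qed

text \<open>Convergence to the end point, finite or infinite, expressed as exhaustion of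
  \<open>I\<close>.\<close>

definition ends :: "(nat \<Rightarrow> real) \<Rightarrow> bool" where
  "ends T \<longleftrightarrow> (\<forall>k. T k \<in> I) \<and> (\<forall>x\<in>I. eventually (\<lambda>k. x \<in> K (T k)) sequentially)"

lemma ends_exist: "\<exists>T. ends T"
proof -
  obtain l u :: "nat \<Rightarrow> real" where lu: "\<And>i. l i < u i" "\<And>i. {l i..u i} \<subseteq> X"
    "X = (\<Union>i. {l i<..<u i})" "\<And>i. {l i..u i} \<subseteq> {l (Suc i)..u (Suc i)}"
    using that by (rule einterval_cover[OF ab])
  have mem: "l k \<in> X" "u k \<in> X" for k using lu(1)[of k] lu(2)[of k] by auto
  have ev: "eventually (\<lambda>k. l k \<le> x \<and> x \<le> u k) sequentially" if "x \<in> X" for x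
  proof -
    obtain i where i: "x \<in> {l i<..<u i}" using lu(3) \<open>x \<in> X\<close> by blast
    have "x \<in> {l j..u j}" if "j \<ge> i" for j
      using that
    proof (induction j rule: dec_induct)
      case base show ?case using i by auto
    next
      case (step n) then show ?case using lu(4)[of n] by blast
    qed
    then show ?thesis by (auto simp: eventually_sequentially)
  qed
  show ?thesis using I_cases
  proof
    assume I: "I = X \<inter> {..c} \<and> \<sigma> = 1"
    have "ends (\<lambda>k. min (l k) c)" unfolding ends_def
    proof (intro conjI allI ballI)
      show "min (l k) c \<in> I" for k using I mem c by (auto simp: min_def)
      fix x assume x: "x \<in> I"
      then have "x \<in> X" using I by auto
      from ev[OF this] show "\<forall>\<^sub>F k in sequentially. x \<in> K (min (l k) c)"
        by eventually_elim (use x I in \<open>auto simp: K_def\<close>)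
    qed
    then show ?thesis by blast
  next
    assume I: "I = X \<inter> {c..} \<and> \<sigma> = -1"
    have "ends (\<lambda>k. max (u k) c)" unfolding ends_def
    proof (intro conjI allI ballI)
      show "max (u k) c \<in> I" for k using I mem c by (auto simp: max_def)
      fix x assume x: "x \<in> I"
      then have "x \<in> X" using I by auto
      from ev[OF this] show "\<forall>\<^sub>F k in sequentially. x \<in> K (max (u k) c)"
        by eventually_elim (use x I in \<open>auto simp: K_def\<close>)
    qed
    then show ?thesis by blast
  qed
qed

text \<open>The truncation error of \<open>f\<close> tends to 0 in the seminorm, and Cauchy-Schwarz
  transfers this to the inner product.\<close>

lemma ip_K_tendsto:
  assumes T: "ends T" and f: "sq M B1 f" and g: "sq M B1 g"
  shows "(\<lambda>k. ip (MK (T k)) B1 f g) \<longlonglongrightarrow> ip M B1 f g"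
proof -
  have TI: "T k \<in> I" for k using T by (simp add: ends_def)
  have KI: "K (T k) \<subseteq> I" for k by (rule K_sub[OF TI])
  have cf: "sq M B1 (cut (K (T k)) f)" for k
    by (rule sq_cut[OF sq_subset[OF f KI I_sets K_sets] KI I_sets K_sets])
  have "(\<lambda>k. nr M B1 (\<lambda>x. f x - cut (K (T k)) f x)) \<longlonglongrightarrow> 0"
    using T by (intro nr_diff_cut_tendsto[OF W.weight_axioms f KI I_sets K_sets]) (auto simp: ends_def)
  then have "(\<lambda>k. sqrt (nr M B1 (\<lambda>x. f x - cut (K (T k)) f x)) * sqrt (nr M B1 g)) \<longlonglongrightarrow> sqrt 0 * sqrt (nr M B1 g)"
    by (intro tendsto_intros)
  then have 0: "(\<lambda>k. sqrt (nr M B1 (\<lambda>x. f x - cut (K (T k)) f x)) * sqrt (nr M B1 g)) \<longlonglongrightarrow> 0" by simp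
  have "norm (ip M B1 f g - ip (MK (T k)) B1 f g) \<le> sqrt (nr M B1 (\<lambda>x. f x - cut (K (T k)) f x)) * sqrt (nr M B1 g)" for k
  proof -
    have "ip M B1 f g - ip (MK (T k)) B1 f g = ip M B1 (\<lambda>x. f x - cut (K (T k)) f x) g"
      unfolding ip_cut_left[OF KI I_sets K_sets, symmetric] by (rule W.ip_diff_left[OF f cf g, symmetric])
    then show ?thesis using W.ip_le[OF W.sq_diff[OF f cf] g] by simp
  qed
  then have "(\<lambda>k. ip M B1 f g - ip (MK (T k)) B1 f g) \<longlonglongrightarrow> 0"
    by (intro Lim_null_comparison[OF _ 0]) auto
  from tendsto_diff[OF tendsto_const[of "ip M B1 f g"] this] show ?thesis by simp
qed

text \<open>The image \<open>F\<close> is an explicit argument because \<open>y\<close> determines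
  it only up to functions of seminorm zero.\<close>

definition dom :: "(real \<Rightarrow> complex^('n+'n)) \<Rightarrow> (real \<Rightarrow> complex^('n+'n)) \<Rightarrow> bool" where
  "dom y F \<longleftrightarrow> mrel y F \<and> L2l F \<and> sq M B1 y \<and> sq M B1 F"

text \<open>The form E at the end point, defined through Green's formula instead of a limit: its
  sesquilinearity is then algebra, and \<open>bnd_tendsto\<close> identifies it with the limit of (J
  y, z).\<close>

definition bnd where
  "bnd y F z G = bf y z c - of_real \<sigma> * (ip M B1 F z - ip M B1 y G)"

lemma bnd_tendsto:
  assumes y: "dom y F" and z: "dom z G" and T: "ends T"
  shows "(\<lambda>k. bf y z (T k)) \<longlonglongrightarrow> bnd y F z G"
proof -
  have "bf y z (T k) = bf y z c - of_real \<sigma> * (ip (MK (T k)) B1 F z - ip (MK (T k)) B1 y G)" for k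
    using green_K[of y F z G "T k"] y z T by (simp add: dom_def ends_def algebra_simps)
  moreover have "(\<lambda>k. bf y z c - of_real \<sigma> * (ip (MK (T k)) B1 F z - ip (MK (T k)) B1 y G)) \<longlonglongrightarrow> bnd y F z G"
    unfolding bnd_def using y z by (intro tendsto_intros ip_K_tendsto[OF T]) (auto simp: dom_def)
  ultimately show ?thesis by simp
qed

lemma dom_lincomb:
  assumes "dom y F" "dom z G" shows "dom (\<lambda>x. y x + k *s z x) (\<lambda>x. F x + k *s G x)"
  using assms unfolding dom_def by (auto intro: mrel_lincomb L2l_lincomb W.sq_add W.sq_scale)

lemma bnd_lincomb_left:
  assumes "dom y F" "dom z G" "dom v V"
  shows "bnd (\<lambda>x. y x + k *s z x) (\<lambda>x. F x + k *s G x) v V = bnd y F v V + k * bnd z G v V"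
  using assms unfolding bnd_def dom_def
  by (simp add: W.ip_add_left W.ip_scale_left W.sq_scale matrix_vector_right_distrib vector_scalar_commute
      cinner_add_left cinner_scale_left algebra_simps)

lemma bnd_commute:
  assumes "dom y F" "dom z G"
  shows "bnd z G y F = - cnj (bnd y F z G)"
proof -
  have m: "y \<in> borel_measurable M" "z \<in> borel_measurable M" "F \<in> borel_measurable M" "G \<in> borel_measurable M"
    using assms by (auto simp: dom_def intro: W.sq_meas)
  show ?thesis unfolding bnd_def
    using W.ip_commute[OF m(1,4)] W.ip_commute[OF m(3,2)] cinner_Jmat_commute[of "z c" "y c"]
    by (simp add: algebra_simps)
qed

lemma bnd_lincomb_right:
  assumes "dom y F" "dom z G" "dom v V"
  shows "bnd v V (\<lambda>x. y x + k *s z x) (\<lambda>x. F x + k *s G x) = bnd v V y F + cnj k * bnd v V z G"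
  using bnd_lincomb_left[OF assms, of k] bnd_commute[OF dom_lincomb[OF assms(1,2)] assms(3), of k]
    bnd_commute[OF assms(1,3)] bnd_commute[OF assms(2,3)] by simp

lemma sq_K_imp_cut_sq: "t \<in> I \<Longrightarrow> sq (MK t) B1 f \<Longrightarrow> sq M B1 (cut (K t) f)"
  by (rule sq_cut[OF _ K_sub I_sets K_sets])

lemma sq_M_K: "sq M B1 f \<Longrightarrow> t \<in> I \<Longrightarrow> sq (MK t) B1 f"
  by (rule sq_subset[OF _ K_sub I_sets K_sets])

lemma sq_cong: "(\<And>x. x \<in> I \<Longrightarrow> f x = g x) \<Longrightarrow> sq M B1 f \<Longrightarrow> sq M B1 g"
  by (rule sq_lebesgue_on_cong)

lemma ip_cong: "(\<And>x. x \<in> I \<Longrightarrow> f x = f' x) \<Longrightarrow> (\<And>x. x \<in> I \<Longrightarrow> g x = g' x) \<Longrightarrow> ip M B1 f g = ip M B1 f' g'"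
  unfolding ip_def by (intro Bochner_Integration.integral_cong) (auto simp: space_restrict_space)

lemma nrK_le: "sq M B1 f \<Longrightarrow> t \<in> I \<Longrightarrow> nr (MK t) B1 f \<le> nr M B1 f"
  by (rule nr_subset_le[OF W.weight_axioms _ K_sub I_sets K_sets])

subsubsection \<open>Compactly supported approximation\<close>

text \<open>Functions vanishing near the end point can be paired with all solutions, square
  integrable or not.\<close>

definition supp :: "(real \<Rightarrow> complex^('n+'n)) \<Rightarrow> bool" where
  "supp g \<longleftrightarrow> sq M B1 g \<and> (\<exists>t\<in>I. \<forall>x. x \<notin> K t \<longrightarrow> g x = 0)"

lemma supp_lincomb:
  assumes "supp f" "supp g" shows "supp (\<lambda>x. f x + k *s g x)"
proof -
  obtain s t where st: "s \<in> I" "\<And>x. x \<notin> K s \<Longrightarrow> f x = 0" "t \<in> I" "\<And>x. x \<notin> K t \<Longrightarrow> g x = 0"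
    using assms unfolding supp_def by metis
  have "\<exists>t\<in>I. \<forall>x. x \<notin> K t \<longrightarrow> f x + k *s g x = 0"
    using K_total[OF st(1,3)]
  proof
    assume "s \<in> K t"
    then show ?thesis using K_mono[of s t] st by (intro bexI[of _ t]) auto
  next
    assume "t \<in> K s"
    then show ?thesis using K_mono[of t s] st by (intro bexI[of _ s]) auto
  qed
  then show ?thesis using assms unfolding supp_def by (auto intro: W.sq_add W.sq_scale)
qed

lemma supp_cut: "sq (MK t) B1 f \<Longrightarrow> t \<in> I \<Longrightarrow> supp (cut (K t) f)"
  unfolding supp_def using sq_K_imp_cut_sq by (auto simp: cut_def)

lemma supp_L2l: assumes "supp g" shows "L2l g"
  unfolding L2l_def
proof (intro allI impI)
  fix s r assume sr: "{s..r} \<subseteq> X"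
  obtain t where t: "t \<in> I" "\<And>x. x \<notin> K t \<Longrightarrow> g x = 0" using assms by (auto simp: supp_def)
  have "sq (MK t) B1 g" using assms t by (auto simp: supp_def intro: sq_M_K)
  then have "sq (lebesgue_on X) B1 (cut (K t) g)" by (rule sq_cut[OF _ K_X[OF t(1)] X_sets K_sets])
  moreover have "cut (K t) g = g" using t(2) by (auto simp: cut_def fun_eq_iff)
  ultimately show "sq (lebesgue_on {s..r}) B1 g" using sq_subset[OF _ sr X_sets] by simp
qed

lemma supp_ip_K:
  assumes "supp g" "t \<in> I" "\<And>x. x \<notin> K t \<Longrightarrow> g x = 0"
  shows "ip M B1 g z = ip (MK t) B1 g z"
proof -
  have "cut (K t) g = g" using assms(3) by (auto simp: cut_def fun_eq_iff)
  then show ?thesis using ip_cut_left[OF K_sub[OF assms(2)] I_sets K_sets, of B1 g z] by simp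
qed

lemma supp_ip_lincomb_right:
  assumes "supp g"
  shows "ip M B1 g (sol \<zeta> (u + k *s v)) = ip M B1 g (sol \<zeta> u) + cnj k * ip M B1 g (sol \<zeta> v)"
proof -
  obtain t where t: "t \<in> I" "\<And>x. x \<notin> K t \<Longrightarrow> g x = 0" using assms by (auto simp: supp_def)
  interpret WK: weight "MK t" B1 by (rule WK[OF t(1)])
  have s: "sq (MK t) B1 (sol \<zeta> w)" for w by (rule L2l_K[OF contX_L2l[OF contX_sol] t(1)])
  have g: "sq (MK t) B1 g" using assms t by (auto simp: supp_def intro: sq_M_K)
  have "sol \<zeta> (u + k *s v) = (\<lambda>x. sol \<zeta> u x + k *s sol \<zeta> v x)" by (simp add: fun_eq_iff sol_lincomb)
  then have "ip (MK t) B1 g (sol \<zeta> (u + k *s v)) = ip (MK t) B1 g (sol \<zeta> u) + cnj k * ip (MK t) B1 g (sol \<zeta> v)"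
    using WK.ip_add_right[OF s[of u] WK.sq_scale[OF s[of v], of k] g] WK.ip_scale_right[of g k "sol \<zeta> v"] by simp
  moreover have "ip M B1 g z = ip (MK t) B1 g z" for z by (rule supp_ip_K[OF assms t])
  ultimately show ?thesis by metis
qed

lemma supp_ip_lincomb_left:
  assumes "supp f" "supp g"
  shows "ip M B1 (\<lambda>x. f x + k *s g x) (sol \<zeta> w) = ip M B1 f (sol \<zeta> w) + k * ip M B1 g (sol \<zeta> w)"
proof -
  have i: "integrable M (\<lambda>x. cinner (B1 x *v g x) (sol \<zeta> w x))" if g: "supp g" for g
  proof -
    obtain t where t: "t \<in> I" "\<And>x. x \<notin> K t \<Longrightarrow> g x = 0" using g by (auto simp: supp_def)
    interpret WK: weight "MK t" B1 by (rule WK[OF t(1)])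
    have "sq (MK t) B1 g" using g t by (auto simp: supp_def intro: sq_M_K)
    then have "integrable (MK t) (\<lambda>x. cinner (B1 x *v g x) (sol \<zeta> w x))"
      by (rule WK.integrable_ip[OF _ L2l_K[OF contX_L2l[OF contX_sol] t(1)]])
    then have "integrable M (cut (K t) (\<lambda>x. cinner (B1 x *v g x) (sol \<zeta> w x)))"
      using integral_lebesgue_on_cut(2)[OF K_sub[OF t(1)] I_sets K_sets] by blast
    moreover have "cut (K t) (\<lambda>x. cinner (B1 x *v g x) (sol \<zeta> w x)) = (\<lambda>x. cinner (B1 x *v g x) (sol \<zeta> w x))"
      using t(2) by (auto simp: cut_def fun_eq_iff)
    ultimately show ?thesis by simp
  qed
  show ?thesis unfolding ip_def using i[OF assms(1)] i[OF assms(2)]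
    by (simp add: matrix_vector_right_distrib vector_scalar_commute cinner_add_left cinner_scale_left)
qed

definition moment where
  "moment \<zeta> g = (SOME \<eta>. \<forall>w. ip M B1 g (sol \<zeta> w) = cinner \<eta> w)"

lemma moment: "supp g \<Longrightarrow> ip M B1 g (sol \<zeta> w) = cinner (moment \<zeta> g) w"
proof -
  assume g: "supp g"
  have "\<exists>\<eta>. \<forall>w\<in>UNIV. ip M B1 g (sol \<zeta> w) = cinner \<eta> w"
    by (rule conj_linear_representation[OF vec.subspace_UNIV]) (rule supp_ip_lincomb_right[OF g])
  then have "\<exists>\<eta>. \<forall>w. ip M B1 g (sol \<zeta> w) = cinner \<eta> w" by blast
  from someI_ex[OF this] have "\<forall>w. ip M B1 g (sol \<zeta> w) = cinner (moment \<zeta> g) w" unfolding moment_def .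
  then show "ip M B1 g (sol \<zeta> w) = cinner (moment \<zeta> g) w" by blast
qed

lemma cinner_ext: "(\<And>w. cinner u w = cinner v w) \<Longrightarrow> u = v"
  using cinner_eq_zero_imp[of "u - v"] by (simp add: cinner_diff_left)

lemma moment_lincomb:
  assumes "supp f" "supp g" shows "moment \<zeta> (\<lambda>x. f x + k *s g x) = moment \<zeta> f + k *s moment \<zeta> g"
  by (rule cinner_ext)
    (simp add: moment[symmetric] supp_lincomb assms supp_ip_lincomb_left cinner_add_left cinner_scale_left)

text \<open>N(\<zeta>) in coordinates, each solution being represented by its value at
  \<open>c\<close>.\<close>

definition NS :: "complex \<Rightarrow> (complex^('n+'n)) set" where
  "NS \<zeta> = {w. sq M B1 (sol \<zeta> w)}"

lemma subspace_NS: "vec.subspace (NS \<zeta>)"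
proof (rule vec.subspaceI)
  show "0 \<in> NS \<zeta>" using W.sq_zero by (simp add: NS_def sol_zero[abs_def])
  show "x + y \<in> NS \<zeta>" if "x \<in> NS \<zeta>" "y \<in> NS \<zeta>" for x y
  proof -
    have "sol \<zeta> (x + y) = (\<lambda>t. sol \<zeta> x t + sol \<zeta> y t)" using sol_lincomb[of \<zeta> x 1 y] by (simp add: fun_eq_iff)
    then show ?thesis using W.sq_add[of "sol \<zeta> x" "sol \<zeta> y"] that by (simp add: NS_def)
  qed
  show "k *s x \<in> NS \<zeta>" if "x \<in> NS \<zeta>" for k x
  proof -
    have "sol \<zeta> (k *s x) = (\<lambda>t. k *s sol \<zeta> x t)" using sol_lincomb[of \<zeta> 0 k x] by (simp add: fun_eq_iff sol_zero)
    then show ?thesis using W.sq_scale[of "sol \<zeta> x" k] that by (simp add: NS_def)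
  qed
qed

lemma sqrt_nr_scale: "sqrt (nr M B1 (\<lambda>x. k *s f x)) = cmod k * sqrt (nr M B1 f)"
  by (simp add: W.nr_scale real_sqrt_mult)

text \<open>A separating functional would be unbounded unless it comes from a solution that is square
  integrable near the end point, where it is already under control.\<close>

lemma approximation:
  assumes g: "sq M B1 g" and \<eta>: "\<And>w. w \<in> NS \<zeta> \<Longrightarrow> cinner \<eta> w = ip M B1 g (sol \<zeta> w)" and e: "e > 0"
  shows "\<exists>g'. supp g' \<and> sqrt (nr M B1 (\<lambda>x. g x - g' x)) < e \<and> (\<forall>w. ip M B1 g' (sol \<zeta> w) = cinner \<eta> w)"
proof (rule ccontr)
  assume neg: "\<not> ?thesis"
  \<comment> \<open>The vectors representing the pairings with all solutions, for functions that are
    close to \<open>g\<close> and vanish near the end point. The claim is that \<eta> occurs among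
    them.\<close>
  define C where "C = {moment \<zeta> g' | g'. supp g' \<and> sqrt (nr M B1 (\<lambda>x. g x - g' x)) < e}"
  have \<eta>C: "\<eta> \<notin> C"
  proof
    assume "\<eta> \<in> C"
    then obtain g' where "supp g'" "sqrt (nr M B1 (\<lambda>x. g x - g' x)) < e" "\<eta> = moment \<zeta> g'" by (auto simp: C_def)
    then show False using neg moment by blast
  qed
  obtain T where T: "ends T" using ends_exist by blast
  have TI: "T k \<in> I" for k using T by (simp add: ends_def)
  have KI: "K (T k) \<subseteq> I" for k by (rule K_sub[OF TI])
  define gk where "gk k = cut (K (T k)) g" for k
  have gk: "supp (gk k)" "sq M B1 (gk k)" for k
    unfolding gk_def using supp_cut[OF sq_M_K[OF g TI] TI] by (auto simp: supp_def)
  have "(\<lambda>k. nr M B1 (\<lambda>x. g x - gk k x)) \<longlonglongrightarrow> 0" unfolding gk_def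
    using T by (intro nr_diff_cut_tendsto[OF W.weight_axioms g KI I_sets K_sets]) (auto simp: ends_def)
  from tendsto_real_sqrt[OF this] have lim: "(\<lambda>k. sqrt (nr M B1 (\<lambda>x. g x - gk k x))) \<longlonglongrightarrow> 0" by simp
  then have evgk: "\<forall>\<^sub>F k in sequentially. sqrt (nr M B1 (\<lambda>x. g x - gk k x)) < e/2"
    using e by (intro order_tendstoD(2)[OF lim]) simp
  then obtain k0 where k0: "sqrt (nr M B1 (\<lambda>x. g x - gk k0 x)) < e/2" by (auto simp: eventually_sequentially)
  have "moment \<zeta> (gk k0) \<in> C" unfolding C_def using gk k0 e by auto
  moreover have "convex C" unfolding convex_def
  proof (intro ballI allI impI)
    fix x y :: "complex^('n+'n)" and u v :: real
    assume x: "x \<in> C" and y: "y \<in> C" and uv: "0 \<le> u" "0 \<le> v" "u + v = 1"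
    obtain f h where f: "supp f" "sqrt (nr M B1 (\<lambda>x. g x - f x)) < e" "x = moment \<zeta> f"
      and h: "supp h" "sqrt (nr M B1 (\<lambda>x. g x - h x)) < e" "y = moment \<zeta> h" using x y by (auto simp: C_def)
    let ?f = "\<lambda>x. f x + complex_of_real v *s (h x + (-1) *s f x)"
    have hf: "supp (\<lambda>x. h x + (-1) *s f x)" by (intro supp_lincomb f h)
    have s: "supp ?f" by (intro supp_lincomb f h)
    have "moment \<zeta> ?f = x + of_real v *s (y + (-1) *s x)"
      using moment_lincomb[OF f(1) hf, of \<zeta> "of_real v"] moment_lincomb[OF h(1) f(1), of \<zeta> "-1"] f(3) h(3) by simp
    also have "\<dots> = u *\<^sub>R x + v *\<^sub>R y"
    proof -
      have u: "u = 1 - v" using uv by simp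
      show ?thesis unfolding u by (simp add: vec_eq_iff scaleR_conv_of_real[where 'a=complex] algebra_simps)
    qed
    finally have m: "moment \<zeta> ?f = u *\<^sub>R x + v *\<^sub>R y" .
    have sqs: "sq M B1 (\<lambda>x. g x - f x)" "sq M B1 (\<lambda>x. g x - h x)"
      using f(1) h(1) g by (auto simp: supp_def intro: W.sq_diff)
    have "(\<lambda>x. g x - ?f x) = (\<lambda>x. of_real u *s (g x - f x) + of_real v *s (g x - h x))"
    proof -
      have u: "u = 1 - v" using uv by simp
      show ?thesis unfolding u by (simp add: vec_eq_iff fun_eq_iff algebra_simps)
    qed
    then have "sqrt (nr M B1 (\<lambda>x. g x - ?f x)) \<le> sqrt (nr M B1 (\<lambda>x. complex_of_real u *s (g x - f x))) + sqrt (nr M B1 (\<lambda>x. complex_of_real v *s (g x - h x)))"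
      using W.nr_triangle[OF W.sq_scale[OF sqs(1)] W.sq_scale[OF sqs(2)], of "of_real u" "of_real v"] by simp
    also have "\<dots> = u * sqrt (nr M B1 (\<lambda>x. g x - f x)) + v * sqrt (nr M B1 (\<lambda>x. g x - h x))"
      unfolding sqrt_nr_scale using uv by simp
    also have "\<dots> < e" by (rule convex_bound_lt[OF f(2) h(2) uv])
    finally show "u *\<^sub>R x + v *\<^sub>R y \<in> C" using s m unfolding C_def by force
  qed
  \<comment> \<open>In finite dimension a point outside a convex set can be separated from it,
    whether or not the set is closed. The separating vector is then read as the value at
    \<open>c\<close> of a solution \<open>z\<close>.\<close>
  ultimately obtain w \<beta> where w: "w \<noteq> 0" "\<And>x. x \<in> C \<Longrightarrow> inner w x \<le> \<beta>" "\<beta> \<le> inner w \<eta>"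
    using separating_hyperplane_sets[of C "{\<eta>}"] \<eta>C by auto
  then have sep: "Re (ip M B1 g' (sol \<zeta> w)) \<le> Re (cinner \<eta> w)"
    if "supp g'" "sqrt (nr M B1 (\<lambda>x. g x - g' x)) < e" for g'
    using w(2)[of "moment \<zeta> g'"] w(3) that unfolding moment[OF that(1)] Re_cinner C_def
    by (force simp: inner_commute)
  define z where "z = sol \<zeta> w"
  have zK: "sq (MK t) B1 z" if "t \<in> I" for t unfolding z_def by (rule L2l_K[OF contX_L2l[OF contX_sol] that])
  define nj where "nj t = sqrt (nr (MK t) B1 z)" for t
  have nj0: "nj t \<ge> 0" if "t \<in> I" for t
    unfolding nj_def using weight.nr_nonneg[OF WK[OF that]] by simp
  \<comment> \<open>The separation inequality for \<open>gk k\<close> plus a positive multiple of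
    the truncated \<open>z\<close>, small enough to stay within distance \<open>e\<close> of
    \<open>g\<close>. The summand 1 in the denominator of the multiple \<open>d\<close> covers a
    truncation of norm 0.\<close>
  have key: "Re (ip M B1 (gk k) z) + e * ((nj t)\<^sup>2 / (2 * (nj t + 1))) \<le> Re (cinner \<eta> w)"
    if k: "sqrt (nr M B1 (\<lambda>x. g x - gk k x)) < e/2" and t: "t \<in> I" for k t
  proof -
    define d where "d = e / (2 * (nj t + 1))"
    have d: "d > 0" using e nj0[OF t] by (simp add: d_def)
    have zt: "supp (cut (K t) z)" by (rule supp_cut[OF zK[OF t] t])
    let ?g = "\<lambda>x. gk k x + of_real d *s cut (K t) z x"
    have nz: "sqrt (nr M B1 (cut (K t) z)) = nj t"
      unfolding nj_def nr_cut[OF K_sub[OF t] I_sets K_sets] ..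
    have sg: "supp ?g" by (intro supp_lincomb gk zt)
    have "(\<lambda>x. g x - ?g x) = (\<lambda>x. (g x - gk k x) + of_real (-d) *s cut (K t) z x)"
      by (simp add: fun_eq_iff vec_eq_iff)
    then have "sqrt (nr M B1 (\<lambda>x. g x - ?g x)) \<le> sqrt (nr M B1 (\<lambda>x. g x - gk k x)) + sqrt (nr M B1 (\<lambda>x. of_real (-d) *s cut (K t) z x))"
      using W.nr_triangle[OF W.sq_diff[OF g gk(2)] W.sq_scale, of "cut (K t) z" k "of_real (-d)"] zt by (simp add: supp_def)
    also have "\<dots> < e/2 + d * nj t"
      unfolding sqrt_nr_scale nz using k d by simp
    also have "d * nj t \<le> e/2" using e nj0[OF t] by (simp add: d_def field_simps)
    finally have "Re (ip M B1 ?g z) \<le> Re (cinner \<eta> w)" using sep[OF sg] by (simp add: z_def)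
    moreover have "ip M B1 ?g z = ip M B1 (gk k) z + of_real d * ip (MK t) B1 z z"
      using supp_ip_lincomb_left[OF gk(1)[of k] zt, of "of_real d" \<zeta> w] ip_cut_left[OF K_sub[OF t] I_sets K_sets, of B1 z z]
      by (simp add: z_def)
    moreover have "Re (ip (MK t) B1 z z) = (nj t)\<^sup>2"
      using weight.nr_nonneg[OF WK[OF t], of z] by (simp add: nj_def nr_def)
    ultimately show ?thesis by (simp add: d_def)
  qed
  have "\<exists>R. \<forall>t\<in>I. nj t \<le> R"
  proof (intro exI ballI)
    fix t assume t: "t \<in> I"
    let ?R = "(Re (cinner \<eta> w) - Re (ip M B1 (gk k0) z)) / e"
    have "e * ((nj t)\<^sup>2 / (2 * (nj t + 1))) \<le> Re (cinner \<eta> w) - Re (ip M B1 (gk k0) z)" using key[OF k0 t] by simp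
    then have "(nj t)\<^sup>2 / (2 * (nj t + 1)) \<le> ?R" using e by (simp add: pos_le_divide_eq mult.commute)
    \<comment> \<open>Since n^2 - 1 <= n^2, the gain in \<open>key\<close> grows at least linearly
      in n = \<open>nj t\<close>, so the norms of the truncations are bounded.\<close>
    moreover have "(nj t - 1) / 2 \<le> (nj t)\<^sup>2 / (2 * (nj t + 1))"
      using nj0[OF t] by (simp add: field_simps power2_eq_square)
    ultimately have "(nj t - 1) / 2 \<le> ?R" by (rule order_trans[rotated])
    moreover have "x \<le> 2 * r + 1" if "(x - 1) / 2 \<le> r" for x r :: real
      using that by (simp add: pos_divide_le_eq)
    ultimately show "nj t \<le> 2 * ?R + 1" by blast
  qed
  then obtain R where R: "\<And>t. t \<in> I \<Longrightarrow> nj t \<le> R" by blast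
  have zM: "sq M B1 z"
  proof (rule W.nr_Fatou(1)[where fk="\<lambda>k. cut (K (T k)) z" and C="R\<^sup>2"])
    show "sq M B1 (cut (K (T k)) z)" for k using supp_cut[OF zK[OF TI] TI] by (simp add: supp_def)
    show "z \<in> borel_measurable M"
      unfolding z_def by (rule measurable_restrict_mono[OF contX_measurable[OF contX_sol] I_sub])
    show "AE x in M. (\<lambda>k. B1 x *v cut (K (T k)) z x) \<longlonglongrightarrow> B1 x *v z x"
    proof (rule AE_I2)
      fix x assume "x \<in> space M"
      then have "\<forall>\<^sub>F k in sequentially. x \<in> K (T k)" using T by (simp add: ends_def space_restrict_space)
      then show "(\<lambda>k. B1 x *v cut (K (T k)) z x) \<longlonglongrightarrow> B1 x *v z x"
        by (intro tendsto_eventually) (elim eventually_mono, simp add: cut_def)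
    qed
    show "nr M B1 (cut (K (T k)) z) \<le> R\<^sup>2" for k
      unfolding nr_cut[OF KI I_sets K_sets]
      using R[OF TI, of k] weight.nr_nonneg[OF WK[OF TI], of k z] by (simp add: nj_def real_le_lsqrt sqrt_le_D)
  qed
  then have "w \<in> NS \<zeta>" by (simp add: NS_def z_def)
  then have \<eta>w: "cinner \<eta> w = ip M B1 g z" using \<eta> by (simp add: z_def)
  obtain t where t: "t \<in> I" "t \<noteq> c"
  proof -
    obtain d where "d > 0" "ball c d \<subseteq> X" using c open_einterval open_contains_ball by blast
    moreover have "c - d/2 \<in> ball c d" "c + d/2 \<in> ball c d" using \<open>d > 0\<close> by (auto simp: dist_real_def)
    ultimately have "c - d/2 \<in> X" "c + d/2 \<in> X" "d > 0" by auto
    then show ?thesis using that[of "c - d/2"] that[of "c + d/2"] I_cases by auto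
  qed
  have "min t c < max t c" "{min t c..max t c} \<subseteq> X" using t K_X[OF t(1)] by (auto simp: K_def)
  from sol_pos[OF w(1) this, of \<zeta>] have njt: "nj t > 0" by (simp add: nj_def K_def z_def)
  have lim2: "(\<lambda>k. Re (ip M B1 (gk k) z)) \<longlonglongrightarrow> Re (ip M B1 g z)"
    unfolding gk_def ip_cut_left[OF KI I_sets K_sets] by (intro tendsto_intros ip_K_tendsto T g zM)
  \<comment> \<open>Now \<open>z\<close> is square integrable, and the hypothesis on \<eta> makes
    the two outer terms equal, although the middle one is strictly positive.\<close>
  have "Re (ip M B1 g z) + e * ((nj t)\<^sup>2 / (2 * (nj t + 1))) \<le> Re (cinner \<eta> w)"
  proof (rule tendsto_upperbound)
    show "(\<lambda>k. Re (ip M B1 (gk k) z) + e * ((nj t)\<^sup>2 / (2 * (nj t + 1)))) \<longlonglongrightarrow> Re (ip M B1 g z) + e * ((nj t)\<^sup>2 / (2 * (nj t + 1)))"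
      by (intro tendsto_intros lim2)
    show "\<forall>\<^sub>F k in sequentially. Re (ip M B1 (gk k) z) + e * ((nj t)\<^sup>2 / (2 * (nj t + 1))) \<le> Re (cinner \<eta> w)"
      using evgk by eventually_elim (rule key[OF _ t(1)])
  qed simp
  moreover have "e * ((nj t)\<^sup>2 / (2 * (nj t + 1))) > 0" using e njt by simp
  ultimately show False unfolding \<eta>w by simp
qed

end

section \<open>Solutions with trivial boundary form at the end point\<close>

context ham_end
begin

lemma dom_sol: "w \<in> NS \<zeta> \<Longrightarrow> dom (sol \<zeta> w) (\<lambda>x. \<zeta> *s sol \<zeta> w x)"
  unfolding dom_def NS_def using sol L2l_sol W.sq_scale by auto

text \<open>The compatibility \<open>m\<close> of \<open>g\<close> with \<open>y c\<close> cancels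
  the boundary term at \<open>c\<close> in Green's formula. So (J y, z) vanishes at \<open>t\<close>
  for all solutions z for cnj \<zeta>, and their values at \<open>t\<close> fill the whole
  space.\<close>

lemma mrel_vanish:
  assumes y: "mrel y (\<lambda>x. \<zeta> *s y x + g x)" and g: "supp g"
    and m: "\<And>w. ip M B1 g (sol (cnj \<zeta>) w) = of_real \<sigma> * cinner (Jmat *v y c) w"
    and s: "s \<in> I" "\<And>x. x \<notin> K s \<Longrightarrow> g x = 0" and t: "t \<in> I" "s \<in> K t"
  shows "y t = 0"
proof -
  have L2y: "L2l (\<lambda>x. \<zeta> *s y x + g x)"
    using L2l_lincomb[OF supp_L2l[OF g] contX_L2l[OF mrel_contX[OF y]], of \<zeta>] by (simp add: add.commute)
  have gt: "\<And>x. x \<notin> K t \<Longrightarrow> g x = 0" using s K_mono[OF t(2)] by blast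
  interpret WK: weight "MK t" B1 by (rule WK[OF t(1)])
  have g': "sq (MK t) B1 g" using g t by (auto simp: supp_def intro: sq_M_K)
  have y': "sq (MK t) B1 y" by (rule L2l_K[OF contX_L2l[OF mrel_contX[OF y]] t(1)])
  have "bf y (sol (cnj \<zeta>) w) t = 0" for w
  proof -
    let ?z = "sol (cnj \<zeta>) w"
    have z: "sq (MK t) B1 ?z" by (rule L2l_K[OF contX_L2l[OF contX_sol] t(1)])
    have "bf y ?z c - bf y ?z t = of_real \<sigma> * (ip (MK t) B1 (\<lambda>x. \<zeta> *s y x + g x) ?z - ip (MK t) B1 y (\<lambda>x. cnj \<zeta> *s ?z x))"
      by (rule green_K[OF y sol L2y L2l_sol t(1)])
    also have "\<dots> = of_real \<sigma> * ip (MK t) B1 g ?z"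
      by (simp add: WK.ip_add_left[OF WK.sq_scale[OF y'] g' z] WK.ip_scale_left WK.ip_scale_right)
    also have "ip (MK t) B1 g ?z = ip M B1 g ?z" using supp_ip_K[OF g t(1) gt] by simp
    also have "of_real \<sigma> * \<dots> = of_real (\<sigma> * \<sigma>) * bf y ?z c" unfolding m by simp
    finally show ?thesis by (simp add: \<sigma>2)
  qed
  moreover obtain w where "sol (cnj \<zeta>) w t = Jmat *v y t" using sol_surj I_sub t(1) by blast
  ultimately have "cinner (Jmat *v y t) (Jmat *v y t) = 0" by metis
  then show ?thesis unfolding cinner_Jmat_Jmat by (simp add: cinner_self)
qed

text \<open>Beyond the support of \<open>g\<close> the solution vanishes, which makes it square
  integrable and all its boundary limits zero.\<close>

lemma supp_solution:
  assumes y: "mrel y (\<lambda>x. \<zeta> *s y x + g x)" and g: "supp g"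
    and m: "\<And>w. ip M B1 g (sol (cnj \<zeta>) w) = of_real \<sigma> * cinner (Jmat *v y c) w"
  shows "dom y (\<lambda>x. \<zeta> *s y x + g x)" "\<exists>s\<in>I. \<forall>x\<in>I. x \<notin> K s \<longrightarrow> y x = 0"
    "dom v V \<Longrightarrow> bnd y (\<lambda>x. \<zeta> *s y x + g x) v V = 0"
proof -
  obtain s where s: "s \<in> I" "\<And>x. x \<notin> K s \<Longrightarrow> g x = 0" using g by (auto simp: supp_def)
  have van: "y x = 0" if x: "x \<in> I" "x \<notin> K s" for x
    using mrel_vanish[OF y g m s x(1)] K_total[OF s(1) x(1)] x(2) by blast
  then show "\<exists>s\<in>I. \<forall>x\<in>I. x \<notin> K s \<longrightarrow> y x = 0" using s(1) by blast
  have cy: "contX y" by (rule mrel_contX[OF y])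
  have "sq M B1 (cut (K s) y)" by (rule sq_K_imp_cut_sq[OF s(1) L2l_K[OF contX_L2l[OF cy] s(1)]])
  then have sy: "sq M B1 y" by (rule sq_cong[rotated]) (auto simp: cut_def van)
  have sg: "sq M B1 g" using g by (simp add: supp_def)
  show dy: "dom y (\<lambda>x. \<zeta> *s y x + g x)"
    unfolding dom_def
    using y L2l_lincomb[OF supp_L2l[OF g] contX_L2l[OF cy], of \<zeta>] sy sg
    by (auto simp: add.commute intro: W.sq_add W.sq_scale)
  assume v: "dom v V"
  obtain T where T: "ends T" using ends_exist by blast
  show "bnd y (\<lambda>x. \<zeta> *s y x + g x) v V = 0"
  proof (rule LIMSEQ_unique[OF bnd_tendsto[OF dy v T]])
    have "\<exists>t\<in>I. t \<notin> K s"
      using I_cases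
    proof
      assume I: "I = X \<inter> {..c} \<and> \<sigma> = 1"
      then have "s \<in> X" using s by auto
      then obtain d where "d > 0" "ball s d \<subseteq> X" using open_einterval open_contains_ball by blast
      then have "s - d/2 \<in> X" "d > 0" by (auto simp: dist_real_def subset_iff)
      then show ?thesis using I s(1) by (intro bexI[of _ "s - d/2"]) (auto simp: K_def)
    next
      assume I: "I = X \<inter> {c..} \<and> \<sigma> = -1"
      then have "s \<in> X" using s by auto
      then obtain d where "d > 0" "ball s d \<subseteq> X" using open_einterval open_contains_ball by blast
      then have "s + d/2 \<in> X" "d > 0" by (auto simp: dist_real_def subset_iff)
      then show ?thesis using I s(1) by (intro bexI[of _ "s + d/2"]) (auto simp: K_def)
    qed
    then obtain t where t: "t \<in> I" "t \<notin> K s" by blast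
    then have st: "s \<in> K t" using K_total[OF s(1) t(1)] by blast
    have "\<forall>\<^sub>F k in sequentially. t \<in> K (T k)" using T t(1) by (simp add: ends_def)
    then have "\<forall>\<^sub>F k in sequentially. bf y v (T k) = 0"
    proof eventually_elim
      case (elim k)
      have "T k \<in> I" using T by (simp add: ends_def)
      moreover have "s \<in> K (T k)" using K_mono[OF elim] st by blast
      ultimately have "y (T k) = 0" by (intro mrel_vanish[OF y g m s])
      then show ?case by simp
    qed
    then show "(\<lambda>k. bf y v (T k)) \<longlonglongrightarrow> 0" by (rule tendsto_eventually)
  qed
qed

text \<open>A priori estimate from the imaginary part of Green's formula, the boundary terms at both
  ends of \<open>I\<close> being zero.\<close>

lemma energy:
  assumes u: "dom u (\<lambda>x. \<zeta> *s u x + g x)" and g: "sq M B1 g" and b: "bnd u (\<lambda>x. \<zeta> *s u x + g x) u (\<lambda>x. \<zeta> *s u x + g x) = 0"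
    and c0: "u c = 0"
  shows "\<bar>Im \<zeta>\<bar> * sqrt (nr M B1 u) \<le> sqrt (nr M B1 g)"
proof -
  have su: "sq M B1 u" using u by (simp add: dom_def)
  have "ip M B1 (\<lambda>x. \<zeta> *s u x + g x) u - ip M B1 u (\<lambda>x. \<zeta> *s u x + g x) = 0"
    using b c0 \<sigma>2 unfolding bnd_def by auto
  then have "\<zeta> * ip M B1 u u + ip M B1 g u - (cnj \<zeta> * ip M B1 u u + ip M B1 u g) = 0"
    by (simp add: W.ip_add_left W.ip_add_right W.sq_scale su g W.ip_scale_left W.ip_scale_right)
  then have "(\<zeta> - cnj \<zeta>) * of_real (nr M B1 u) = cnj (ip M B1 g u) - ip M B1 g u"
    using W.ip_self[OF su] W.ip_commute[OF W.sq_meas[OF g] W.sq_meas[OF su]] by (simp add: algebra_simps)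
  then have "Im ((\<zeta> - cnj \<zeta>) * of_real (nr M B1 u)) = Im (cnj (ip M B1 g u) - ip M B1 g u)" by simp
  then have "Im \<zeta> * nr M B1 u = - Im (ip M B1 g u)" by simp
  then have "\<bar>Im \<zeta>\<bar> * nr M B1 u = \<bar>Im (ip M B1 g u)\<bar>"
    using W.nr_nonneg[of u] by (metis abs_minus_cancel abs_mult abs_of_nonneg)
  also have "\<dots> \<le> sqrt (nr M B1 g) * sqrt (nr M B1 u)"
    using W.ip_le[OF g su] abs_Im_le_cmod[of "ip M B1 g u"] by linarith
  finally have *: "sqrt (nr M B1 u) * (\<bar>Im \<zeta>\<bar> * sqrt (nr M B1 u)) \<le> sqrt (nr M B1 u) * sqrt (nr M B1 g)"
    using W.nr_nonneg[of u] by (simp add: mult_ac)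
  show ?thesis
  proof (cases "sqrt (nr M B1 u) = 0")
    case True then show ?thesis using W.nr_nonneg[of g] by simp
  next
    case False
    then have "sqrt (nr M B1 u) > 0" using W.nr_nonneg[of u] by simp
    then show ?thesis by (rule mult_left_le_imp_le[OF *])
  qed
qed

text \<open>If the value at \<open>c\<close> of a solution of \<open>(T - \<zeta>) y = g\<close> is compatible with the square
  integrable solutions for \<open>cnj \<zeta>\<close>, then \<open>y\<close> is a limit of solutions vanishing near the end point.\<close>

lemma limit_solution:
  assumes \<zeta>: "Im \<zeta> \<noteq> 0" and y: "mrel y (\<lambda>x. \<zeta> *s y x + g x)" and g: "sq M B1 g" "L2l g"
    and m: "\<And>w. w \<in> NS (cnj \<zeta>) \<Longrightarrow> cinner (Jmat *v y c) w = of_real \<sigma> * ip M B1 g (sol (cnj \<zeta>) w)"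
  shows "dom y (\<lambda>x. \<zeta> *s y x + g x)" "dom v V \<Longrightarrow> bnd y (\<lambda>x. \<zeta> *s y x + g x) v V = 0"
proof -
  define \<eta> where "\<eta> = of_real \<sigma> *s (Jmat *v y c)"
  have \<eta>w: "cinner \<eta> w = of_real \<sigma> * cinner (Jmat *v y c) w" for w
    by (simp add: \<eta>_def cinner_scale_left)
  have \<sigma>\<sigma>: "complex_of_real \<sigma> * (complex_of_real \<sigma> * x) = x" for x
    using \<sigma>2 by (metis mult.assoc mult_1 of_real_1 of_real_mult)
  \<comment> \<open>The approximants of \<open>g\<close> reproduce the pairings given by \<eta>
    exactly, so that the solutions starting from the value \<open>y c\<close> vanish near the end
    point.\<close>
  have "\<forall>k. \<exists>g'. supp g' \<and> sqrt (nr M B1 (\<lambda>x. g x - g' x)) < 1 / real (Suc k) \<and> (\<forall>w. ip M B1 g' (sol (cnj \<zeta>) w) = cinner \<eta> w)"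
    by (rule allI, rule approximation[OF g(1)]) (simp_all add: \<eta>w m \<sigma>\<sigma>)
  from choice[OF this] obtain gk where "\<forall>k. supp (gk k) \<and> sqrt (nr M B1 (\<lambda>x. g x - gk k x)) < 1 / real (Suc k) \<and> (\<forall>w. ip M B1 (gk k) (sol (cnj \<zeta>) w) = cinner \<eta> w)"
    by blast
  then have gk: "\<And>k. supp (gk k)" "\<And>k. sqrt (nr M B1 (\<lambda>x. g x - gk k x)) < 1 / real (Suc k)"
    "\<And>k w. ip M B1 (gk k) (sol (cnj \<zeta>) w) = cinner \<eta> w" by blast+
  have sgk: "sq M B1 (gk k)" for k using gk(1) by (simp add: supp_def)
  have "\<exists>u. mrel u (\<lambda>x. \<zeta> *s u x + gk k x) \<and> u c = y c" for k
    by (rule mrel_ode(1)[OF L2l_B1[OF supp_L2l[OF gk(1)]] c])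
  then obtain yk where yk: "\<And>k. mrel (yk k) (\<lambda>x. \<zeta> *s yk k x + gk k x)" "\<And>k. yk k c = y c" by metis
  have mom: "ip M B1 (gk k) (sol (cnj \<zeta>) w) = of_real \<sigma> * cinner (Jmat *v yk k c) w" for k w
    using gk(3) \<eta>w yk(2) by simp
  note sup = supp_solution[OF yk(1) gk(1) mom]
  have syk: "sq M B1 (yk k)" for k using sup(1) by (simp add: dom_def)
  have gd: "sqrt (nr M B1 (\<lambda>x. gk k x - gk l x)) \<le> 1 / real (Suc k) + 1 / real (Suc l)" for k l
    using W.nr_triangle_diff[OF sgk[of k] g(1) sgk[of l]] gk(2)[of k] gk(2)[of l]
    unfolding W.nr_minus_commute[of "gk k" g] by linarith
  have cau: "\<bar>Im \<zeta>\<bar> * sqrt (nr M B1 (\<lambda>x. yk k x - yk l x)) \<le> 1 / real (Suc k) + 1 / real (Suc l)" for k l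
  proof -
    let ?u = "\<lambda>x. yk k x + (-1) *s yk l x" and ?g = "\<lambda>x. gk k x + (-1) *s gk l x"
    let ?U = "\<lambda>x. \<zeta> *s ?u x + ?g x"
    have eqU: "(\<lambda>x. (\<zeta> *s yk k x + gk k x) + (-1) *s (\<zeta> *s yk l x + gk l x)) = ?U"
      by (simp add: fun_eq_iff vec_eq_iff algebra_simps)
    have du: "dom ?u ?U" using dom_lincomb[OF sup(1)[of k] sup(1)[of l], of "-1"] unfolding eqU .
    have "bnd ?u ?U ?u ?U = 0"
      using bnd_lincomb_left[OF sup(1)[of k] sup(1)[of l] du, of "-1"] sup(3)[OF du, of k] sup(3)[OF du, of l]
      unfolding eqU by simp
    moreover have "sq M B1 ?g" by (intro W.sq_add W.sq_scale sgk)
    moreover have "?u c = 0" by (simp add: yk(2) vector_smult_lneg)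
    ultimately have "\<bar>Im \<zeta>\<bar> * sqrt (nr M B1 ?u) \<le> sqrt (nr M B1 ?g)" using energy[OF du] by blast
    then show ?thesis using gd[of k l] by (simp add: vector_smult_lneg)
  qed
  have g0: "(\<lambda>l. sqrt (nr M B1 (\<lambda>x. gk l x - g x))) \<longlonglongrightarrow> 0"
  proof (rule Lim_null_comparison[OF always_eventually[OF allI] lim_1_over_n[THEN LIMSEQ_Suc]])
    show "norm (sqrt (nr M B1 (\<lambda>x. gk l x - g x))) \<le> 1 / real (Suc l)" for l
      using gk(2)[of l] W.nr_nonneg[of "\<lambda>x. gk l x - g x"] unfolding W.nr_minus_commute[of "gk l" g] by simp
  qed
  \<comment> \<open>Convergence at a point is tested with solutions for cnj \<zeta>: by Green's
    formula (J u, z) at \<open>x\<close> is, up to sign, an inner product with the error of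
    \<open>gk\<close>, and these solutions attain every vector at \<open>x\<close>.\<close>
  have ptw: "(\<lambda>l. yk l x) \<longlonglongrightarrow> y x" if x: "x \<in> I" for x
  proof -
    interpret WK: weight "MK x" B1 by (rule WK[OF x])
    define u where "u l x = yk l x + (-1) *s y x" for l x
    define h where "h l x = gk l x + (-1) *s g x" for l x
    have Lh: "L2l (h l)" for l unfolding h_def by (intro L2l_lincomb supp_L2l gk g)
    have Kh: "sq (MK x) B1 (h l)" for l by (rule L2l_K[OF Lh x])
    have "mrel (u l) (\<lambda>x. \<zeta> *s u l x + h l x)" for l unfolding u_def h_def
      by (rule mrel_cong[OF mrel_lincomb[OF yk(1)[of l] y, of "-1"]]) (simp_all add: vec_eq_iff algebra_simps)
    note mu = this
    have Lu: "L2l (\<lambda>x. \<zeta> *s u l x + h l x)" for l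
      using L2l_lincomb[OF Lh[of l] contX_L2l[OF mrel_contX[OF mu[of l]]], of \<zeta>] by (simp add: add.commute)
    have Ku: "sq (MK x) B1 (u l)" for l by (rule L2l_K[OF contX_L2l[OF mrel_contX[OF mu]] x])
    have "(\<lambda>l. bf (u l) (sol (cnj \<zeta>) w) x) \<longlonglongrightarrow> 0" for w
    proof -
      let ?z = "sol (cnj \<zeta>) w"
      have z: "sq (MK x) B1 ?z" by (rule L2l_K[OF contX_L2l[OF contX_sol] x])
      have bd: "cmod (bf (u l) ?z x) \<le> sqrt (nr M B1 (\<lambda>x. gk l x - g x)) * (\<bar>\<sigma>\<bar> * sqrt (nr (MK x) B1 ?z))" for l
      proof -
        have u0: "u l c = 0" by (simp add: u_def yk(2) vector_smult_lneg)
        have "bf (u l) ?z c - bf (u l) ?z x = of_real \<sigma> * (ip (MK x) B1 (\<lambda>x. \<zeta> *s u l x + h l x) ?z - ip (MK x) B1 (u l) (\<lambda>x. cnj \<zeta> *s ?z x))"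
          by (rule green_K[OF mu sol Lu L2l_sol x])
        also have "\<dots> = of_real \<sigma> * ip (MK x) B1 (h l) ?z"
          by (simp add: WK.ip_add_left[OF WK.sq_scale[OF Ku] Kh z] WK.ip_scale_left WK.ip_scale_right)
        finally have "- bf (u l) ?z x = of_real \<sigma> * ip (MK x) B1 (h l) ?z" using u0 by simp
        then have "bf (u l) ?z x = - of_real \<sigma> * ip (MK x) B1 (h l) ?z" by (metis minus_minus mult_minus_left)
        then have "cmod (bf (u l) ?z x) = \<bar>\<sigma>\<bar> * cmod (ip (MK x) B1 (h l) ?z)" by (simp add: norm_mult)
        also have "\<dots> \<le> \<bar>\<sigma>\<bar> * (sqrt (nr (MK x) B1 (h l)) * sqrt (nr (MK x) B1 ?z))"
          by (intro mult_left_mono WK.ip_le Kh z) auto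
        also have "\<dots> \<le> \<bar>\<sigma>\<bar> * (sqrt (nr M B1 (\<lambda>x. gk l x - g x)) * sqrt (nr (MK x) B1 ?z))"
        proof -
          have "h l = (\<lambda>x. gk l x - g x)" by (simp add: h_def fun_eq_iff vector_smult_lneg)
          then have "nr (MK x) B1 (h l) \<le> nr M B1 (\<lambda>x. gk l x - g x)"
            using nrK_le[OF W.sq_diff[OF sgk g(1)] x] by simp
          then show ?thesis using WK.nr_nonneg[of ?z] by (intro mult_left_mono mult_right_mono) auto
        qed
        finally show ?thesis by (simp add: mult_ac)
      qed
      have "(\<lambda>l. sqrt (nr M B1 (\<lambda>x. gk l x - g x)) * (\<bar>\<sigma>\<bar> * sqrt (nr (MK x) B1 ?z))) \<longlonglongrightarrow> 0"
        by (rule tendsto_mult_left_zero[OF g0])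
      then show ?thesis by (rule Lim_null_comparison[OF always_eventually[OF allI[OF bd]]])
    qed
    moreover have "\<exists>w. sol (cnj \<zeta>) w x = v" for v using sol_surj I_sub x by blast
    ultimately have Ju: "(\<lambda>l. cinner (Jmat *v u l x) v) \<longlonglongrightarrow> 0" for v by metis
    have "(\<lambda>l. u l x) \<longlonglongrightarrow> 0"
    proof (rule vec_tendstoI)
      fix i
      have "(\<lambda>l. cinner (Jmat *v u l x) (Jmat *v axis i 1)) \<longlonglongrightarrow> 0" by (rule Ju)
      then show "(\<lambda>l. u l x $ i) \<longlonglongrightarrow> 0 $ i" by (simp add: cinner_Jmat_Jmat cinner_axis)
    qed
    from tendsto_add[OF this tendsto_const[of "y x"]] show ?thesis by (simp add: u_def vector_smult_lneg)
  qed
  have cy: "contX y" by (rule mrel_contX[OF y])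
  have ym: "y \<in> borel_measurable M"
    by (rule borel_measurable_LIMSEQ_metric[where f=yk, OF W.sq_meas[OF syk]]) (simp add: ptw space_restrict_space)
  \<comment> \<open>The Cauchy estimate as its second index tends to infinity; the factor 2 collects
    two errors of size at most 1/(k+1).\<close>
  have est: "sq M B1 (\<lambda>x. yk k x - y x) \<and> nr M B1 (\<lambda>x. yk k x - y x) \<le> (2 / (real (Suc k) * \<bar>Im \<zeta>\<bar>))\<^sup>2" for k
  proof -
    have "sq M B1 (\<lambda>x. yk k x - yk (l + k) x)" for l by (rule W.sq_diff[OF syk syk])
    moreover have "(\<lambda>x. yk k x - y x) \<in> borel_measurable M" by (intro borel_measurable_diff ym W.sq_meas[OF syk])
    moreover have "AE x in M. (\<lambda>l. B1 x *v (yk k x - yk (l + k) x)) \<longlonglongrightarrow> B1 x *v (yk k x - y x)"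
    proof (rule AE_I2)
      fix x assume "x \<in> space M"
      then have "(\<lambda>l. yk l x) \<longlonglongrightarrow> y x" by (intro ptw) (simp add: space_restrict_space)
      then have "(\<lambda>l. yk (l + k) x) \<longlonglongrightarrow> y x" by (rule LIMSEQ_ignore_initial_segment)
      then show "(\<lambda>l. B1 x *v (yk k x - yk (l + k) x)) \<longlonglongrightarrow> B1 x *v (yk k x - y x)"
        by (intro bounded_linear.tendsto[OF bounded_linear_mv] tendsto_intros)
    qed
    moreover have "nr M B1 (\<lambda>x. yk k x - yk (l + k) x) \<le> (2 / (real (Suc k) * \<bar>Im \<zeta>\<bar>))\<^sup>2" for l
    proof -
      have "\<bar>Im \<zeta>\<bar> * sqrt (nr M B1 (\<lambda>x. yk k x - yk (l + k) x)) \<le> 1 / real (Suc k) + 1 / real (Suc (l + k))" by (rule cau)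
      also have "\<dots> \<le> 1 / real (Suc k) + 1 / real (Suc k)" by (intro add_left_mono divide_left_mono) auto
      also have "\<dots> = 2 / real (Suc k)" by simp
      finally have "\<bar>Im \<zeta>\<bar> * sqrt (nr M B1 (\<lambda>x. yk k x - yk (l + k) x)) * real (Suc k) \<le> 2"
        by (subst (asm) pos_le_divide_eq) simp_all
      moreover have "real (Suc k) * \<bar>Im \<zeta>\<bar> > 0" using \<zeta> by simp
      ultimately have "sqrt (nr M B1 (\<lambda>x. yk k x - yk (l + k) x)) \<le> 2 / (real (Suc k) * \<bar>Im \<zeta>\<bar>)"
        by (simp only: pos_le_divide_eq mult_ac)
      then show ?thesis using W.nr_nonneg[of "\<lambda>x. yk k x - yk (l + k) x"] by (simp add: sqrt_le_D)
    qed
    ultimately show ?thesis using W.nr_Fatou[where fk="\<lambda>l x. yk k x - yk (l + k) x" and f="\<lambda>x. yk k x - y x"] by blast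
  qed
  have "sq M B1 y" using W.sq_diff[OF syk[of 0] conjunct1[OF est[of 0]]] by simp
  then show dy: "dom y (\<lambda>x. \<zeta> *s y x + g x)"
    unfolding dom_def
    using y L2l_lincomb[OF g(2) contX_L2l[OF cy], of \<zeta>] g(1)
    by (auto simp: add.commute intro: W.sq_add W.sq_scale)
  assume v: "dom v V"
  then have sv: "sq M B1 v" "sq M B1 V" by (auto simp: dom_def)
  have "cmod (bnd y (\<lambda>x. \<zeta> *s y x + g x) v V) \<le>
     (1 / real (Suc k)) * (2 * cmod \<zeta> / \<bar>Im \<zeta>\<bar> * sqrt (nr M B1 v) + sqrt (nr M B1 v) + 2 / \<bar>Im \<zeta>\<bar> * sqrt (nr M B1 V))" for k
  proof -
    let ?u = "\<lambda>x. yk k x + (-1) *s y x" and ?g = "\<lambda>x. gk k x + (-1) *s g x"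
    let ?U = "\<lambda>x. \<zeta> *s ?u x + ?g x"
    have eqU: "(\<lambda>x. (\<zeta> *s yk k x + gk k x) + (-1) *s (\<zeta> *s y x + g x)) = ?U"
      by (simp add: fun_eq_iff vec_eq_iff algebra_simps)
    have su: "sq M B1 ?u" "sq M B1 ?g" by (intro W.sq_add W.sq_scale syk sgk g \<open>sq M B1 y\<close>)+
    have "bnd ?u ?U v V = - bnd y (\<lambda>x. \<zeta> *s y x + g x) v V"
      using bnd_lincomb_left[OF sup(1)[of k] dy v, of "-1"] sup(3)[OF v, of k] unfolding eqU by simp
    then have n1: "cmod (bnd y (\<lambda>x. \<zeta> *s y x + g x) v V) = cmod (bnd ?u ?U v V)" by simp
    have n2: "bnd ?u ?U v V = - of_real \<sigma> * (\<zeta> * ip M B1 ?u v + ip M B1 ?g v - ip M B1 ?u V)"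
    proof -
      have "ip M B1 ?U v = \<zeta> * ip M B1 ?u v + ip M B1 ?g v"
        using W.ip_add_left[OF W.sq_scale[OF su(1)] su(2) sv(1), of \<zeta>] unfolding W.ip_scale_left .
      then show ?thesis unfolding bnd_def by (simp add: yk(2) vector_smult_lneg)
    qed
    note n1
    also have "cmod (bnd ?u ?U v V) = cmod (\<zeta> * ip M B1 ?u v + ip M B1 ?g v - ip M B1 ?u V)"
    proof -
      have "cmod (- complex_of_real \<sigma>) = 1" using I_cases by auto
      then show ?thesis unfolding n2 norm_mult by simp
    qed
    also have "\<dots> \<le> cmod (\<zeta> * ip M B1 ?u v + ip M B1 ?g v) + cmod (ip M B1 ?u V)" by (rule norm_triangle_ineq4)
    also have "\<dots> \<le> cmod \<zeta> * cmod (ip M B1 ?u v) + cmod (ip M B1 ?g v) + cmod (ip M B1 ?u V)"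
      unfolding norm_mult[symmetric] by (intro add_right_mono norm_triangle_ineq)
    also have "\<dots> \<le> cmod \<zeta> * ((2 / (real (Suc k) * \<bar>Im \<zeta>\<bar>)) * sqrt (nr M B1 v)) + (1 / real (Suc k)) * sqrt (nr M B1 v)
        + (2 / (real (Suc k) * \<bar>Im \<zeta>\<bar>)) * sqrt (nr M B1 V)"
    proof -
      have nu: "sqrt (nr M B1 ?u) \<le> 2 / (real (Suc k) * \<bar>Im \<zeta>\<bar>)"
        using est[of k] by (intro real_le_lsqrt) (auto simp: vector_smult_lneg W.nr_nonneg)
      have ng: "sqrt (nr M B1 ?g) \<le> 1 / real (Suc k)"
        using gk(2)[of k] by (simp add: vector_smult_lneg W.nr_minus_commute[of "gk k" g])
      have "cmod (ip M B1 ?u v) \<le> (2 / (real (Suc k) * \<bar>Im \<zeta>\<bar>)) * sqrt (nr M B1 v)"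
        by (rule order_trans[OF W.ip_le[OF su(1) sv(1)] mult_right_mono[OF nu]]) (simp add: W.nr_nonneg)
      moreover have "cmod (ip M B1 ?u V) \<le> (2 / (real (Suc k) * \<bar>Im \<zeta>\<bar>)) * sqrt (nr M B1 V)"
        by (rule order_trans[OF W.ip_le[OF su(1) sv(2)] mult_right_mono[OF nu]]) (simp add: W.nr_nonneg)
      moreover have "cmod (ip M B1 ?g v) \<le> (1 / real (Suc k)) * sqrt (nr M B1 v)"
        by (rule order_trans[OF W.ip_le[OF su(2) sv(1)] mult_right_mono[OF ng]]) (simp add: W.nr_nonneg)
      ultimately show ?thesis by (intro add_mono mult_left_mono) auto
    qed
    also have "\<dots> = (1 / real (Suc k)) * (2 * cmod \<zeta> / \<bar>Im \<zeta>\<bar> * sqrt (nr M B1 v) + sqrt (nr M B1 v) + 2 / \<bar>Im \<zeta>\<bar> * sqrt (nr M B1 V))"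
    proof -
      have "z * ((2 / (S * \<iota>)) * v) + (1 / S) * v + (2 / (S * \<iota>)) * w = (1 / S) * (2 * z / \<iota> * v + v + 2 / \<iota> * w)" for z S \<iota> v w :: real
        by (simp add: divide_inverse algebra_simps)
      then show ?thesis .
    qed
    finally show ?thesis .
  qed
  note bd = this
  have "(\<lambda>k. (1 / real (Suc k)) * (2 * cmod \<zeta> / \<bar>Im \<zeta>\<bar> * sqrt (nr M B1 v) + sqrt (nr M B1 v) + 2 / \<bar>Im \<zeta>\<bar> * sqrt (nr M B1 V)))
     \<longlonglongrightarrow> 0 * (2 * cmod \<zeta> / \<bar>Im \<zeta>\<bar> * sqrt (nr M B1 v) + sqrt (nr M B1 v) + 2 / \<bar>Im \<zeta>\<bar> * sqrt (nr M B1 V))"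
    by (intro tendsto_mult tendsto_const LIMSEQ_Suc lim_1_over_n)
  then have "cmod (bnd y (\<lambda>x. \<zeta> *s y x + g x) v V) \<le> 0 * (2 * cmod \<zeta> / \<bar>Im \<zeta>\<bar> * sqrt (nr M B1 v) + sqrt (nr M B1 v) + 2 / \<bar>Im \<zeta>\<bar> * sqrt (nr M B1 V))"
    by (rule LIMSEQ_le_const) (use bd in blast)
  then show "bnd y (\<lambda>x. \<zeta> *s y x + g x) v V = 0" by simp
qed

text \<open>The functional on N(cnj \<zeta>) that J y(c) has to match is conjugate-linear; -J
  applied to a representing vector is a suitable initial value.\<close>

lemma limit_solution_exists:
  assumes \<zeta>: "Im \<zeta> \<noteq> 0" and g: "sq M B1 g" "L2l g"
  shows "\<exists>y. dom y (\<lambda>x. \<zeta> *s y x + g x) \<and> (\<forall>v V. dom v V \<longrightarrow> bnd y (\<lambda>x. \<zeta> *s y x + g x) v V = 0)"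
proof -
  have "\<exists>\<eta>. \<forall>w\<in>NS (cnj \<zeta>). of_real \<sigma> * ip M B1 g (sol (cnj \<zeta>) w) = cinner \<eta> w"
  proof (rule conj_linear_representation[OF subspace_NS])
    fix u v k assume uv: "u \<in> NS (cnj \<zeta>)" "v \<in> NS (cnj \<zeta>)"
    have "sol (cnj \<zeta>) (u + k *s v) = (\<lambda>x. sol (cnj \<zeta>) u x + k *s sol (cnj \<zeta>) v x)"
      by (simp add: fun_eq_iff sol_lincomb)
    then show "of_real \<sigma> * ip M B1 g (sol (cnj \<zeta>) (u + k *s v)) =
      of_real \<sigma> * ip M B1 g (sol (cnj \<zeta>) u) + cnj k * (of_real \<sigma> * ip M B1 g (sol (cnj \<zeta>) v))"
      using uv by (simp add: W.ip_add_right[OF _ W.sq_scale g(1)] NS_def W.ip_scale_right algebra_simps)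
  qed
  then obtain \<eta> where \<eta>: "\<And>w. w \<in> NS (cnj \<zeta>) \<Longrightarrow> of_real \<sigma> * ip M B1 g (sol (cnj \<zeta>) w) = cinner \<eta> w" by blast
  obtain y where y: "mrel y (\<lambda>x. \<zeta> *s y x + g x)" "y c = - (Jmat *v \<eta>)"
    using mrel_ode(1)[OF L2l_B1[OF g(2)] c] by blast
  have "cinner (Jmat *v y c) w = of_real \<sigma> * ip M B1 g (sol (cnj \<zeta>) w)" if "w \<in> NS (cnj \<zeta>)" for w
    using \<eta>[OF that] by (simp add: y(2) mv_minus Jmat_Jmat)
  from limit_solution[OF \<zeta> y(1) g this] show ?thesis by blast
qed

section \<open>The boundary form on the square integrable solutions\<close>

abbreviation bs where
  "bs \<zeta> u \<xi> v \<equiv> bnd (sol \<zeta> u) (\<lambda>x. \<zeta> *s sol \<zeta> u x) (sol \<xi> v) (\<lambda>x. \<xi> *s sol \<xi> v x)"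

text \<open>Modulo elements with trivial boundary form, the maximal domain near the end point consists of
  solutions for any given non-real spectral parameter.\<close>

lemma boundary_representative:
  assumes \<zeta>: "Im \<zeta> \<noteq> 0" and y: "dom y F"
  shows "\<exists>p\<in>NS \<zeta>. \<forall>v V. dom v V \<longrightarrow> bnd y F v V = bnd (sol \<zeta> p) (\<lambda>x. \<zeta> *s sol \<zeta> p x) v V"
proof -
  \<comment> \<open>So (T - \<zeta>) y = g. Subtracting a solution \<open>u\<close> for the same
    right-hand side with trivial boundary form leaves an element of N(\<zeta>).\<close>
  define g where "g x = F x + (- \<zeta>) *s y x" for x
  have cy: "contX y" using y mrel_contX by (auto simp: dom_def)
  have "sq M B1 g" unfolding g_def using y by (intro W.sq_add W.sq_scale) (simp_all add: dom_def)
  moreover have "L2l g" unfolding g_def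
    by (rule L2l_lincomb[OF _ contX_L2l[OF cy]]) (use y in \<open>simp add: dom_def\<close>)
  ultimately have g: "sq M B1 g" "L2l g" .
  obtain u where u: "dom u (\<lambda>x. \<zeta> *s u x + g x)" "\<And>v V. dom v V \<Longrightarrow> bnd u (\<lambda>x. \<zeta> *s u x + g x) v V = 0"
    using limit_solution_exists[OF \<zeta> g] by blast
  let ?d = "\<lambda>x. y x + (-1) *s u x"
  have eq: "(\<lambda>x. F x + (-1) *s (\<zeta> *s u x + g x)) = (\<lambda>x. \<zeta> *s ?d x)"
    by (simp add: fun_eq_iff vec_eq_iff g_def algebra_simps)
  have dd: "dom ?d (\<lambda>x. \<zeta> *s ?d x)" using dom_lincomb[OF y u(1), of "-1"] unfolding eq .
  have ds: "?d x = sol \<zeta> (?d c) x" if "x \<in> X" for x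
    using dd that by (intro sol_unique) (simp_all add: dom_def)
  have "sq M B1 (sol \<zeta> (?d c))"
    using dd ds I_sub by (intro sq_cong[of ?d "sol \<zeta> (?d c)"]) (auto simp: dom_def)
  then have N: "?d c \<in> NS \<zeta>" by (simp add: NS_def)
  have "bnd y F v V = bnd (sol \<zeta> (?d c)) (\<lambda>x. \<zeta> *s sol \<zeta> (?d c) x) v V" if v: "dom v V" for v V
  proof -
    have "bnd ?d (\<lambda>x. \<zeta> *s ?d x) v V = bnd y F v V"
      using bnd_lincomb_left[OF y u(1) v, of "-1"] u(2)[OF v] unfolding eq by simp
    moreover have "bnd ?d (\<lambda>x. \<zeta> *s ?d x) v V = bnd (sol \<zeta> (?d c)) (\<lambda>x. \<zeta> *s sol \<zeta> (?d c) x) v V"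
    proof -
      have "ip M B1 (\<lambda>x. \<zeta> *s ?d x) v = ip M B1 (\<lambda>x. \<zeta> *s sol \<zeta> (?d c) x) v"
        by (rule ip_cong) (simp_all only: ds[OF subsetD[OF I_sub]])
      moreover have "ip M B1 ?d V = ip M B1 (sol \<zeta> (?d c)) V"
        by (rule ip_cong) (simp_all only: ds[OF subsetD[OF I_sub]])
      ultimately show ?thesis unfolding bnd_def by simp
    qed
    ultimately show ?thesis by simp
  qed
  then show ?thesis using N by blast
qed

text \<open>For conjugate parameters the two integrals in Green's formula cancel, and only the term
  at \<open>c\<close> remains.\<close>

lemma bs_cnj: "w \<in> NS \<zeta> \<Longrightarrow> v \<in> NS (cnj \<zeta>) \<Longrightarrow> bs \<zeta> w (cnj \<zeta>) v = cinner (Jmat *v w) v"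
  unfolding bnd_def by (simp add: W.ip_scale_left W.ip_scale_right)

lemma bs_self: "w \<in> NS \<zeta> \<Longrightarrow> Im (bs \<zeta> w \<zeta> w) = Im (cinner (Jmat *v w) w) - 2 * \<sigma> * Im \<zeta> * nr M B1 (sol \<zeta> w)"
  using W.ip_self[of "sol \<zeta> w"] unfolding bnd_def NS_def by (simp add: W.ip_scale_left W.ip_scale_right algebra_simps)

lemma bs_Re: "w \<in> NS \<zeta> \<Longrightarrow> Re (bs \<zeta> w \<zeta> w) = 0"
  using bnd_commute[OF dom_sol dom_sol, of w \<zeta> w \<zeta>] by (simp add: complex_eq_iff)

lemma bs_left: "u \<in> NS \<zeta> \<Longrightarrow> v \<in> NS \<zeta> \<Longrightarrow> dom z G \<Longrightarrow>
    bnd (sol \<zeta> (u + k *s v)) (\<lambda>x. \<zeta> *s sol \<zeta> (u + k *s v) x) z G =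
      bnd (sol \<zeta> u) (\<lambda>x. \<zeta> *s sol \<zeta> u x) z G + k * bnd (sol \<zeta> v) (\<lambda>x. \<zeta> *s sol \<zeta> v x) z G"
proof -
  assume uv: "u \<in> NS \<zeta>" "v \<in> NS \<zeta>" and z: "dom z G"
  have "sol \<zeta> (u + k *s v) = (\<lambda>x. sol \<zeta> u x + k *s sol \<zeta> v x)"
    "(\<lambda>x. \<zeta> *s sol \<zeta> (u + k *s v) x) = (\<lambda>x. \<zeta> *s sol \<zeta> u x + k *s (\<zeta> *s sol \<zeta> v x))"
    by (simp_all add: fun_eq_iff sol_lincomb vec_eq_iff algebra_simps)
  then show ?thesis using bnd_lincomb_left[OF dom_sol[OF uv(1)] dom_sol[OF uv(2)] z, of k] by simp
qed

lemma bs_right: "u \<in> NS \<zeta> \<Longrightarrow> v \<in> NS \<zeta> \<Longrightarrow> dom z G \<Longrightarrow>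
    bnd z G (sol \<zeta> (u + k *s v)) (\<lambda>x. \<zeta> *s sol \<zeta> (u + k *s v) x) =
      bnd z G (sol \<zeta> u) (\<lambda>x. \<zeta> *s sol \<zeta> u x) + cnj k * bnd z G (sol \<zeta> v) (\<lambda>x. \<zeta> *s sol \<zeta> v x)"
proof -
  assume uv: "u \<in> NS \<zeta>" "v \<in> NS \<zeta>" and z: "dom z G"
  have "sol \<zeta> (u + k *s v) = (\<lambda>x. sol \<zeta> u x + k *s sol \<zeta> v x)"
    "(\<lambda>x. \<zeta> *s sol \<zeta> (u + k *s v) x) = (\<lambda>x. \<zeta> *s sol \<zeta> u x + k *s (\<zeta> *s sol \<zeta> v x))"
    by (simp_all add: fun_eq_iff sol_lincomb vec_eq_iff algebra_simps)
  then show ?thesis using bnd_lincomb_right[OF dom_sol[OF uv(1)] dom_sol[OF uv(2)] z, of k] by simp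
qed

definition isotropic where
  "isotropic \<zeta> L \<longleftrightarrow> vec.subspace L \<and> L \<subseteq> NS \<zeta> \<and> (\<forall>u\<in>L. \<forall>v\<in>L. bs \<zeta> u \<zeta> v = 0)"

definition Lperp where
  "Lperp \<zeta> L = {p\<in>NS \<zeta>. \<forall>q\<in>L. bs \<zeta> p \<zeta> q = 0}"

text \<open>By \<open>radical_eq_RS\<close> this is the radical of the boundary form on N(\<zeta>);
  written as an annihilator, it has dimension 2n - dim N(cnj \<zeta>).\<close>

definition RS where "RS \<zeta> = Jperp (NS (cnj \<zeta>))"

lemma subspace_RS: "vec.subspace (RS \<zeta>)"
  unfolding RS_def by (rule subspace_Jperp)

lemma dim_RS: "vec.dim (NS (cnj \<zeta>)) + vec.dim (RS \<zeta>) = 2 * CARD('n)"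
  unfolding RS_def by (rule dim_Jperp[OF subspace_NS])

text \<open>The case g = 0 of \<open>limit_solution\<close>, where compatibility means
  \<open>J\<close>-orthogonality to N(cnj \<zeta>).\<close>

lemma RS_radical:
  assumes \<zeta>: "Im \<zeta> \<noteq> 0" and r: "r \<in> RS \<zeta>"
  shows "r \<in> NS \<zeta>" "dom v V \<Longrightarrow> bnd (sol \<zeta> r) (\<lambda>x. \<zeta> *s sol \<zeta> r x) v V = 0"
proof -
  have m: "mrel (sol \<zeta> r) (\<lambda>x. \<zeta> *s sol \<zeta> r x + 0)" using sol by simp
  have "L2l (\<lambda>x. 0)" by (rule contX_L2l) (simp add: contX_def)
  moreover have "cinner (Jmat *v sol \<zeta> r c) w = of_real \<sigma> * ip M B1 (\<lambda>x. 0) (sol (cnj \<zeta>) w)" if "w \<in> NS (cnj \<zeta>)" for w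
    using r that by (simp add: RS_def Jperp_def ip_def)
  ultimately have *: "dom (sol \<zeta> r) (\<lambda>x. \<zeta> *s sol \<zeta> r x + 0)"
      "\<And>v V. dom v V \<Longrightarrow> bnd (sol \<zeta> r) (\<lambda>x. \<zeta> *s sol \<zeta> r x + 0) v V = 0"
    using limit_solution[OF \<zeta> m W.sq_zero] by blast+
  show "r \<in> NS \<zeta>" using *(1) by (simp add: NS_def dom_def)
  show "dom v V \<Longrightarrow> bnd (sol \<zeta> r) (\<lambda>x. \<zeta> *s sol \<zeta> r x) v V = 0" using *(2) by simp
qed

text \<open>For the harder inclusion, each element of N(cnj \<zeta>) has the boundary form of some
  element of N(\<zeta>), and its pairing with \<open>q\<close> is \<open>J\<close> at
  \<open>c\<close>.\<close>

lemma radical_eq_RS: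
  assumes \<zeta>: "Im \<zeta> \<noteq> 0"
  shows "{q\<in>NS \<zeta>. \<forall>p\<in>NS \<zeta>. bs \<zeta> p \<zeta> q = 0} = RS \<zeta>"
proof (intro equalityI subsetI)
  fix q assume "q \<in> RS \<zeta>"
  then have q: "q \<in> NS \<zeta>" and z: "\<And>v V. dom v V \<Longrightarrow> bnd (sol \<zeta> q) (\<lambda>x. \<zeta> *s sol \<zeta> q x) v V = 0"
    using RS_radical[OF \<zeta>] by blast+
  have "bs \<zeta> p \<zeta> q = 0" if p: "p \<in> NS \<zeta>" for p
    using bnd_commute[OF dom_sol[OF q] dom_sol[OF p]] z[OF dom_sol[OF p]] by simp
  then show "q \<in> {q\<in>NS \<zeta>. \<forall>p\<in>NS \<zeta>. bs \<zeta> p \<zeta> q = 0}" using q by blast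
next
  fix q assume q: "q \<in> {q\<in>NS \<zeta>. \<forall>p\<in>NS \<zeta>. bs \<zeta> p \<zeta> q = 0}"
  have "cinner (Jmat *v z) q = 0" if z: "z \<in> NS (cnj \<zeta>)" for z
  proof -
    obtain p where p: "p \<in> NS \<zeta>" "\<And>v V. dom v V \<Longrightarrow> bnd (sol (cnj \<zeta>) z) (\<lambda>x. cnj \<zeta> *s sol (cnj \<zeta>) z x) v V = bnd (sol \<zeta> p) (\<lambda>x. \<zeta> *s sol \<zeta> p x) v V"
      using boundary_representative[OF \<zeta> dom_sol[OF z]] by blast
    have "cinner (Jmat *v z) q = bs (cnj \<zeta>) z \<zeta> q" using bs_cnj[OF z, of q] q by simp
    also have "\<dots> = bs \<zeta> p \<zeta> q" using p(2)[OF dom_sol[of q \<zeta>]] q by simp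
    also have "\<dots> = 0" using p(1) q by blast
    finally show ?thesis .
  qed
  then show "q \<in> RS \<zeta>" unfolding RS_def Jperp_sym by blast
qed

text \<open>Dimension formula for the pairing of N(\<zeta>) with \<open>L\<close>, whose kernels are
  \<open>Lperp\<close> and the radical; by the equality of the dimensions only 2n remains.\<close>

lemma dim_Lperp:
  assumes \<zeta>: "Im \<zeta> \<noteq> 0" and L: "vec.subspace L" "RS \<zeta> \<subseteq> L" "L \<subseteq> NS \<zeta>"
    and eq: "vec.dim (NS \<zeta>) = vec.dim (NS (cnj \<zeta>))"
  shows "vec.dim L + vec.dim (Lperp \<zeta> L) = 2 * CARD('n)"
proof -
  have "vec.dim (NS \<zeta>) + vec.dim {q\<in>L. \<forall>p\<in>NS \<zeta>. bs \<zeta> p \<zeta> q = 0} = vec.dim L + vec.dim {p\<in>NS \<zeta>. \<forall>q\<in>L. bs \<zeta> p \<zeta> q = 0}"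
    by (rule dim_pairing[OF subspace_NS L(1)]) (use L(3) in \<open>auto intro!: bs_left bs_right dom_sol\<close>)
  moreover have "{q\<in>L. \<forall>p\<in>NS \<zeta>. bs \<zeta> p \<zeta> q = 0} = RS \<zeta>"
    using L radical_eq_RS[OF \<zeta>] by blast
  ultimately show ?thesis using dim_RS[of \<zeta>] eq by (simp add: Lperp_def)
qed

lemma subspace_Lperp: "L \<subseteq> NS \<zeta> \<Longrightarrow> vec.subspace (Lperp \<zeta> L)"
  unfolding Lperp_def by (rule subspace_annihilator[OF subspace_NS]) (auto intro!: bs_left dom_sol)

lemma nr_sol_pos: assumes "w \<in> NS \<zeta>" "w \<noteq> 0" shows "0 < nr M B1 (sol \<zeta> w)"
proof -
  obtain t where t: "t \<in> I" "t \<noteq> c"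
  proof -
    obtain d where "d > 0" "ball c d \<subseteq> X" using c open_einterval open_contains_ball by blast
    moreover have "c - d/2 \<in> ball c d" "c + d/2 \<in> ball c d" using \<open>d > 0\<close> by (auto simp: dist_real_def)
    ultimately have "c - d/2 \<in> X" "c + d/2 \<in> X" "d > 0" by auto
    then show ?thesis using that[of "c - d/2"] that[of "c + d/2"] I_cases by auto
  qed
  have "min t c < max t c" "{min t c..max t c} \<subseteq> X" using t K_X[OF t(1)] by (auto simp: K_def)
  from sol_pos[OF assms(2) this, of \<zeta>] have "0 < nr (MK t) B1 (sol \<zeta> w)" by (simp add: K_def)
  then show ?thesis using nrK_le[of "sol \<zeta> w" t] assms(1) t by (simp add: NS_def)
qed

text \<open>Both forms differ by a definite one, so semidefiniteness at the end point implies
  definiteness of \<open>J\<close> at \<open>c\<close>, which bounds the dimension.\<close>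

lemma dim_le_if_semidefinite:
  assumes \<zeta>: "Im \<zeta> \<noteq> 0" and P: "vec.subspace P" "P \<subseteq> NS \<zeta>"
    and semi: "\<And>p. p \<in> P \<Longrightarrow> 0 \<le> \<sigma> * Im \<zeta> * Im (bs \<zeta> p \<zeta> p)"
  shows "vec.dim P \<le> CARD('n)"
proof (rule dim_definite_le[OF P(1)])
  fix p assume p: "p \<in> P" "p \<noteq> 0"
  let ?\<theta> = "\<sigma> * Im \<zeta>"
  have "?\<theta> \<noteq> 0" using \<zeta> I_cases by auto
  then have "0 < ?\<theta> * ?\<theta>" using not_real_square_gt_zero by blast
  moreover have "0 < nr M B1 (sol \<zeta> p)" using p P by (intro nr_sol_pos) auto
  ultimately have "0 < 2 * (?\<theta> * ?\<theta>) * nr M B1 (sol \<zeta> p)" using mult_pos_pos by simp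
  moreover have "?\<theta> * Im (cinner (Jmat *v p) p) = ?\<theta> * Im (bs \<zeta> p \<zeta> p) + 2 * (?\<theta> * ?\<theta>) * nr M B1 (sol \<zeta> p)"
  proof -
    have e: "Im (cinner (Jmat *v p) p) = Im (bs \<zeta> p \<zeta> p) + 2 * ?\<theta> * nr M B1 (sol \<zeta> p)"
      using bs_self[of p \<zeta>] p P(2) by auto
    show ?thesis unfolding e by (simp add: algebra_simps)
  qed
  ultimately show "0 < ?\<theta> * Im (cinner (Jmat *v p) p)" using semi[OF p(1)] by linarith
qed

lemma isotropic_RS: assumes \<zeta>: "Im \<zeta> \<noteq> 0" shows "isotropic \<zeta> (RS \<zeta>)"
  unfolding isotropic_def using subspace_RS RS_radical[OF \<zeta>] dom_sol by blast

lemma isotropic_extend: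
  assumes L: "isotropic \<zeta> L" and p: "p \<in> Lperp \<zeta> L" "bs \<zeta> p \<zeta> p = 0"
  shows "isotropic \<zeta> {u + k *s p |u k. u \<in> L}"
proof -
  have LN: "L \<subseteq> NS \<zeta>" "vec.subspace L" and iso: "\<And>u v. u \<in> L \<Longrightarrow> v \<in> L \<Longrightarrow> bs \<zeta> u \<zeta> v = 0"
    using L by (auto simp: isotropic_def)
  have pN: "p \<in> NS \<zeta>" and pL: "\<And>q. q \<in> L \<Longrightarrow> bs \<zeta> p \<zeta> q = 0" using p by (auto simp: Lperp_def)
  have Lp: "bs \<zeta> q \<zeta> p = 0" if "q \<in> L" for q
    using bnd_commute[OF dom_sol[OF pN] dom_sol, of q \<zeta>] pL[OF that] that LN by auto
  have mem: "u + k *s p \<in> NS \<zeta>" if "u \<in> L" for u k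
    using that LN pN subspace_NS by (auto intro: vec.subspace_add vec.subspace_scale)
  have "bs \<zeta> (u + k *s p) \<zeta> (v + l *s p) = 0" if "u \<in> L" "v \<in> L" for u v k l
  proof -
    have uN: "u \<in> NS \<zeta>" "v \<in> NS \<zeta>" using that LN by auto
    show ?thesis
      using bs_left[OF uN(1) pN dom_sol[OF mem[OF that(2), of l]], of k]
        bs_right[OF uN(2) pN dom_sol[OF uN(1)], of l] bs_right[OF uN(2) pN dom_sol[OF pN], of l]
        iso[OF that] Lp[OF that(1)] pL[OF that(2)] p(2) by simp
  qed
  moreover have "vec.subspace {u + k *s p |u k. u \<in> L}"
  proof (rule vec.subspaceI)
    show "0 \<in> {u + k *s p |u k. u \<in> L}" using vec.subspace_0[OF LN(2)] by (auto intro!: exI[of _ 0])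
    show "x + y \<in> {u + k *s p |u k. u \<in> L}" if xy: "x \<in> {u + k *s p |u k. u \<in> L}" "y \<in> {u + k *s p |u k. u \<in> L}" for x y
    proof -
      obtain u k v l where "x = u + k *s p" "u \<in> L" "y = v + l *s p" "v \<in> L" using xy by blast
      then show ?thesis using vec.subspace_add[OF LN(2)]
        by (auto intro!: exI[of _ "u + v"] exI[of _ "k + l"] simp: vec_eq_iff algebra_simps)
    qed
    show "m *s x \<in> {u + k *s p |u k. u \<in> L}" if x: "x \<in> {u + k *s p |u k. u \<in> L}" for m x
    proof -
      obtain u k where "x = u + k *s p" "u \<in> L" using x by blast
      then show ?thesis using vec.subspace_scale[OF LN(2)]
        by (auto intro!: exI[of _ "m *s u"] exI[of _ "m * k"] simp: vec_eq_iff algebra_simps)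
    qed
  qed
  ultimately show ?thesis unfolding isotropic_def using mem by blast
qed

lemma isotropic_dim_le: assumes \<zeta>: "Im \<zeta> \<noteq> 0" and L: "isotropic \<zeta> L" shows "vec.dim L \<le> CARD('n)"
  using L by (intro dim_le_if_semidefinite[OF \<zeta>]) (auto simp: isotropic_def)

lemma bs_swap: "u \<in> NS \<zeta> \<Longrightarrow> v \<in> NS \<zeta> \<Longrightarrow> bs \<zeta> u \<zeta> v = 0 \<Longrightarrow> bs \<zeta> v \<zeta> u = 0"
  using bnd_commute[OF dom_sol dom_sol, of u \<zeta> v \<zeta>] by simp

lemma mem_maximal_isotropic:
  assumes \<zeta>: "Im \<zeta> \<noteq> 0" and L: "isotropic \<zeta> L"
    and max: "\<And>L'. isotropic \<zeta> L' \<Longrightarrow> L \<subseteq> L' \<Longrightarrow> L' = L"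
    and p: "p \<in> Lperp \<zeta> L" "bs \<zeta> p \<zeta> p = 0"
  shows "p \<in> L"
proof -
  have "L \<subseteq> {u + k *s p |u k. u \<in> L}"
  proof
    fix u assume "u \<in> L"
    then have "u + 0 *s p \<in> {u + k *s p |u k. u \<in> L}" by blast
    then show "u \<in> {u + k *s p |u k. u \<in> L}" by simp
  qed
  then have "{u + k *s p |u k. u \<in> L} = L" by (intro max isotropic_extend L p)
  moreover have "0 + 1 *s p \<in> {u + k *s p |u k. u \<in> L}"
    using L vec.subspace_0 unfolding isotropic_def by blast
  ultimately show ?thesis by simp
qed

lemma isotropic_maximal:
  assumes \<zeta>: "Im \<zeta> \<noteq> 0" and L: "isotropic \<zeta> L" and dim: "\<And>L'. isotropic \<zeta> L' \<Longrightarrow> vec.dim L' \<le> vec.dim L"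
  shows "RS \<zeta> \<subseteq> L" "p \<in> Lperp \<zeta> L \<Longrightarrow> bs \<zeta> p \<zeta> p = 0 \<Longrightarrow> p \<in> L"
proof -
  have max: "L' = L" if "isotropic \<zeta> L'" "L \<subseteq> L'" for L'
    using dim[OF that(1)] that L by (intro vec.subspace_dim_equal[symmetric]) (auto simp: isotropic_def)
  show *: "p \<in> Lperp \<zeta> L \<Longrightarrow> bs \<zeta> p \<zeta> p = 0 \<Longrightarrow> p \<in> L" for p
    by (rule mem_maximal_isotropic[OF \<zeta> L max])
  show "RS \<zeta> \<subseteq> L"
  proof
    fix r assume r: "r \<in> RS \<zeta>"
    have LN: "L \<subseteq> NS \<zeta>" using L by (simp add: isotropic_def)
    show "r \<in> L"
      by (rule *) (use RS_radical[OF \<zeta> r] dom_sol LN in \<open>auto simp: Lperp_def\<close>)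
  qed
qed

text \<open>For \<open>L\<close> of maximal dimension every null vector of the form in
  \<open>Lperp\<close> belongs to \<open>L\<close>, so the form on \<open>Lperp\<close> cannot
  change sign. Depending on its sign, the signature bound is applied to \<open>Lperp\<close> or to
  \<open>Jperp L\<close>; both have dimension 2n - dim L.\<close>

theorem isotropic_exists:
  assumes \<zeta>: "Im \<zeta> \<noteq> 0" and eq: "vec.dim (NS \<zeta>) = vec.dim (NS (cnj \<zeta>))"
  shows "\<exists>L. isotropic \<zeta> L \<and> vec.dim L = CARD('n)"
proof -
  let ?D = "{vec.dim L |L. isotropic \<zeta> L}"
  have fin: "finite ?D" by (rule finite_subset[of _ "{..CARD('n)}"]) (use isotropic_dim_le[OF \<zeta>] in auto)
  moreover have "?D \<noteq> {}" using isotropic_RS[OF \<zeta>] by blast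
  ultimately have "Max ?D \<in> ?D" by (rule Max_in)
  then obtain L where L: "isotropic \<zeta> L" "vec.dim L = Max ?D" by auto
  have dim: "vec.dim L' \<le> vec.dim L" if "isotropic \<zeta> L'" for L'
    unfolding L(2) using that by (intro Max_ge[OF fin]) blast
  have mx1: "RS \<zeta> \<subseteq> L" by (rule isotropic_maximal(1)[OF \<zeta> L(1)]) (rule dim)
  have mx2: "p \<in> L" if "p \<in> Lperp \<zeta> L" "bs \<zeta> p \<zeta> p = 0" for p
    by (rule isotropic_maximal(2)[OF \<zeta> L(1) _ that]) (rule dim)
  have LN: "L \<subseteq> NS \<zeta>" "vec.subspace L" and iso: "\<And>u v. u \<in> L \<Longrightarrow> v \<in> L \<Longrightarrow> bs \<zeta> u \<zeta> v = 0"
    using L(1) by (auto simp: isotropic_def)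
  have dimP: "vec.dim L + vec.dim (Lperp \<zeta> L) = 2 * CARD('n)"
    by (rule dim_Lperp[OF \<zeta> LN(2) mx1 LN(1) eq])
  have PN: "p \<in> NS \<zeta>" if "p \<in> Lperp \<zeta> L" for p using that by (simp add: Lperp_def)
  let ?h = "\<lambda>p. Im (bs \<zeta> p \<zeta> p)"
  \<comment> \<open>Between vectors of opposite sign the form has a null vector \<open>?v\<close>.
    Maximality puts it into \<open>L\<close>, so it is orthogonal to \<open>p\<close> and
    \<open>q\<close>, which relates the two values of the form by a nonnegative factor.\<close>
  have same: False if p: "p \<in> Lperp \<zeta> L" "?h p > 0" and q: "q \<in> Lperp \<zeta> L" "?h q < 0" for p q
  proof -
    have N: "p \<in> NS \<zeta>" "q \<in> NS \<zeta>" using PN p q by auto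
    define \<beta> where "\<beta> = Im (bs \<zeta> p \<zeta> q) + Im (bs \<zeta> q \<zeta> p)"
    have h: "?h (p + of_real \<tau> *s q) = ?h p + \<tau> * \<beta> + \<tau>\<^sup>2 * ?h q" for \<tau>
    proof -
      have "p + of_real \<tau> *s q \<in> NS \<zeta>" using N subspace_NS by (auto intro: vec.subspace_add vec.subspace_scale)
      then have "bs \<zeta> (p + of_real \<tau> *s q) \<zeta> (p + of_real \<tau> *s q) =
         bs \<zeta> p \<zeta> p + of_real \<tau> * bs \<zeta> p \<zeta> q + of_real \<tau> * (bs \<zeta> q \<zeta> p + of_real \<tau> * bs \<zeta> q \<zeta> q)"
        using bs_left[OF N dom_sol, of "p + of_real \<tau> *s q" \<zeta> "of_real \<tau>"]
          bs_right[OF N dom_sol[OF N(1)], of "of_real \<tau>"] bs_right[OF N dom_sol[OF N(2)], of "of_real \<tau>"] by simp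
      then show ?thesis by (simp add: \<beta>_def power2_eq_square algebra_simps)
    qed
    have "\<exists>\<tau>\<ge>0. ?h p + \<tau> * \<beta> + \<tau>\<^sup>2 * ?h q = 0"
    proof -
      \<comment> \<open>A point where the quadratic polynomial in \<tau> is nonpositive; the summand
        1 ensures m >= 1, which the estimate below uses.\<close>
      define m where "m = (\<bar>\<beta>\<bar> + ?h p) / (- ?h q) + 1"
      have "(\<bar>\<beta>\<bar> + ?h p) / (- ?h q) \<ge> 0" using p q by (intro divide_nonneg_pos) auto
      then have m1: "m \<ge> 1" unfolding m_def by linarith
      have "?h p + m * \<beta> + m\<^sup>2 * ?h q \<le> 0"
      proof -
        have e: "m * (- ?h q) = \<bar>\<beta>\<bar> + ?h p + (- ?h q)" using q by (simp add: m_def field_simps)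
        have "?h p + m * \<beta> \<le> m * ?h p + m * \<bar>\<beta>\<bar>"
          using m1 p(2) by (intro add_mono mult_left_mono) auto
        also have "\<dots> \<le> m * (m * (- ?h q))" unfolding e using m1 q(2)
          by (simp add: algebra_simps mult_nonneg_nonpos)
        finally show ?thesis by (simp add: power2_eq_square algebra_simps)
      qed
      moreover have "?h p + 0 * \<beta> + 0\<^sup>2 * ?h q \<ge> 0" using p by simp
      moreover have "continuous_on {0..m} (\<lambda>\<tau>. ?h p + \<tau> * \<beta> + \<tau>\<^sup>2 * ?h q)" by (intro continuous_intros)
      ultimately show ?thesis
        using IVT2'[of "\<lambda>\<tau>. ?h p + \<tau> * \<beta> + \<tau>\<^sup>2 * ?h q" m 0 0] m1 by auto
    qed
    then obtain \<tau> where \<tau>: "?h (p + of_real \<tau> *s q) = 0" unfolding h by blast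
    let ?v = "p + of_real \<tau> *s q"
    have v: "?v \<in> Lperp \<zeta> L" using subspace_Lperp[OF LN(1)] p q by (auto intro: vec.subspace_add vec.subspace_scale)
    have "bs \<zeta> ?v \<zeta> ?v = 0" using \<tau> bs_Re[OF PN[OF v]] by (simp add: complex_eq_iff)
    then have vL: "?v \<in> L" by (rule mx2[OF v])
    have "bs \<zeta> q \<zeta> ?v = 0" "bs \<zeta> p \<zeta> ?v = 0" using vL p(1) q(1) by (auto simp: Lperp_def)
    then have 1: "bs \<zeta> ?v \<zeta> p = 0" "bs \<zeta> ?v \<zeta> q = 0" using bs_swap N PN[OF v] by blast+
    have "bs \<zeta> p \<zeta> p + of_real \<tau> * bs \<zeta> q \<zeta> p = 0" "bs \<zeta> p \<zeta> q + of_real \<tau> * bs \<zeta> q \<zeta> q = 0"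
      using 1 bs_left[OF N dom_sol[OF N(1)], of "of_real \<tau>"] bs_left[OF N dom_sol[OF N(2)], of "of_real \<tau>"] by simp_all
    then have e: "?h p + \<tau> * Im (bs \<zeta> q \<zeta> p) = 0" "Im (bs \<zeta> p \<zeta> q) + \<tau> * ?h q = 0"
      by (simp_all add: complex_eq_iff)
    have "Im (bs \<zeta> q \<zeta> p) = Im (bs \<zeta> p \<zeta> q)" using bnd_commute[OF dom_sol[OF N(1)] dom_sol[OF N(2)]] by simp
    also have "\<dots> = - (\<tau> * ?h q)" using e(2) by linarith
    finally have "?h p = \<tau> * \<tau> * ?h q" using e(1) by simp
    moreover have "\<tau> * \<tau> * ?h q \<le> 0" using q by (simp add: mult_nonneg_nonpos)
    ultimately show False using p by simp
  qed
  have "vec.dim L \<ge> CARD('n)"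
  proof (cases "\<forall>p\<in>Lperp \<zeta> L. 0 \<le> \<sigma> * Im \<zeta> * ?h p")
    case True
    then have "vec.dim (Lperp \<zeta> L) \<le> CARD('n)"
      by (intro dim_le_if_semidefinite[OF \<zeta> subspace_Lperp[OF LN(1)]]) (auto simp: Lperp_def)
    then show ?thesis using dimP by linarith
  next
    case False
    then obtain p0 where p0: "p0 \<in> Lperp \<zeta> L" "\<sigma> * Im \<zeta> * ?h p0 < 0" by force
    have neg: "\<sigma> * Im \<zeta> * ?h p \<le> 0" if p: "p \<in> Lperp \<zeta> L" for p
    proof (rule ccontr)
      assume "\<not> \<sigma> * Im \<zeta> * ?h p \<le> 0"
      then have "\<sigma> * Im \<zeta> * ?h p > 0" by simp
      then show False using same[OF p _ p0(1)] same[OF p0(1) _ p] p0(2)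
        by (auto simp: zero_less_mult_iff mult_less_0_iff)
    qed
    \<comment> \<open>\<open>L\<close> contains the annihilator of N(cnj \<zeta>), and taking
      annihilators twice gives back the subspace.\<close>
    have JN: "Jperp L \<subseteq> NS (cnj \<zeta>)"
      using Jperp_antimono[OF mx1] Jperp_Jperp[OF subspace_NS] unfolding RS_def by metis
    have "vec.dim (Jperp L) \<le> CARD('n)"
    proof (rule dim_le_if_semidefinite[OF _ subspace_Jperp JN])
      show "Im (cnj \<zeta>) \<noteq> 0" using \<zeta> by simp
      fix z assume z: "z \<in> Jperp L"
      then have zN: "z \<in> NS (cnj \<zeta>)" using JN by blast
      obtain p where p: "p \<in> NS \<zeta>" "\<And>v V. dom v V \<Longrightarrow> bnd (sol (cnj \<zeta>) z) (\<lambda>x. cnj \<zeta> *s sol (cnj \<zeta>) z x) v V = bnd (sol \<zeta> p) (\<lambda>x. \<zeta> *s sol \<zeta> p x) v V"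
        using boundary_representative[OF \<zeta> dom_sol[OF zN]] by blast
      have "bs \<zeta> p \<zeta> u = 0" if u: "u \<in> L" for u
      proof -
        have uN: "u \<in> NS \<zeta>" using u LN by blast
        have "bs \<zeta> p \<zeta> u = bs (cnj \<zeta>) z \<zeta> u" using p(2)[OF dom_sol[OF uN]] by simp
        also have "\<dots> = cinner (Jmat *v z) u" using bs_cnj[OF zN, of u] uN by simp
        also have "\<dots> = 0" using z u by (simp add: Jperp_def)
        finally show ?thesis .
      qed
      then have pL: "p \<in> Lperp \<zeta> L" using p(1) by (simp add: Lperp_def)
      have "bs (cnj \<zeta>) z (cnj \<zeta>) z = bs \<zeta> p (cnj \<zeta>) z" by (rule p(2)[OF dom_sol[OF zN]])
      also have "\<dots> = - cnj (bs (cnj \<zeta>) z \<zeta> p)" by (rule bnd_commute[OF dom_sol[OF zN] dom_sol[OF p(1)]])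
      also have "bs (cnj \<zeta>) z \<zeta> p = bs \<zeta> p \<zeta> p" by (rule p(2)[OF dom_sol[OF p(1)]])
      finally have "Im (bs (cnj \<zeta>) z (cnj \<zeta>) z) = ?h p" by simp
      then show "0 \<le> \<sigma> * Im (cnj \<zeta>) * Im (bs (cnj \<zeta>) z (cnj \<zeta>) z)" using neg[OF pL] by simp
    qed
    then show ?thesis using dim_Jperp[OF LN(2)] by linarith
  qed
  then show ?thesis using L(1) isotropic_dim_le[OF \<zeta> L(1)] by (intro exI[of _ L]) simp
qed

text \<open>By \<open>dim_Lperp\<close> the orthogonal space of \<open>L\<close> has dimension n as
  well, so it cannot exceed the isotropic \<open>L\<close>.\<close>

lemma lagrangian:
  assumes \<zeta>: "Im \<zeta> \<noteq> 0" and eq: "vec.dim (NS \<zeta>) = vec.dim (NS (cnj \<zeta>))"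
    and L: "isotropic \<zeta> L" "vec.dim L = CARD('n)"
  shows "RS \<zeta> \<subseteq> L" "Lperp \<zeta> L = L"
proof -
  have LN: "L \<subseteq> NS \<zeta>" "vec.subspace L" and iso: "\<And>u v. u \<in> L \<Longrightarrow> v \<in> L \<Longrightarrow> bs \<zeta> u \<zeta> v = 0"
    using L(1) by (auto simp: isotropic_def)
  show R: "RS \<zeta> \<subseteq> L" using isotropic_maximal(1)[OF \<zeta> L(1)] isotropic_dim_le[OF \<zeta>] L(2) by simp
  have "vec.dim (Lperp \<zeta> L) = CARD('n)" using dim_Lperp[OF \<zeta> LN(2) R LN(1) eq] L(2) by linarith
  moreover have "L \<subseteq> Lperp \<zeta> L" using LN iso by (auto simp: Lperp_def)
  ultimately show "Lperp \<zeta> L = L"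
    using L(2) LN(2) subspace_Lperp[OF LN(1)] by (intro vec.subspace_dim_equal[symmetric]) auto
qed

section \<open>Boundary conditions given by Lagrangian subspaces\<close>

definition bcond where
  "bcond \<zeta> L y F \<longleftrightarrow> (\<forall>u\<in>L. bnd y F (sol \<zeta> u) (\<lambda>x. \<zeta> *s sol \<zeta> u x) = 0)"

text \<open>The condition on \<open>y\<close> puts its representative in N(\<zeta>) into
  \<open>Lperp\<close>, that is, into \<open>L\<close>; the condition on \<open>z\<close> then makes
  the form vanish.\<close>

lemma bcond_symmetric:
  assumes \<zeta>: "Im \<zeta> \<noteq> 0" and eq: "vec.dim (NS \<zeta>) = vec.dim (NS (cnj \<zeta>))"
    and L: "isotropic \<zeta> L" "vec.dim L = CARD('n)"
    and y: "dom y F" "bcond \<zeta> L y F" and z: "dom z G" "bcond \<zeta> L z G"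
  shows "bnd y F z G = 0"
proof -
  have LN: "L \<subseteq> NS \<zeta>" using L(1) by (auto simp: isotropic_def)
  have rep: "\<exists>p\<in>L. \<forall>v V. dom v V \<longrightarrow> bnd y F v V = bnd (sol \<zeta> p) (\<lambda>x. \<zeta> *s sol \<zeta> p x) v V"
    if y: "dom y F" "bcond \<zeta> L y F" for y F
  proof -
    obtain p where p: "p \<in> NS \<zeta>" "\<And>v V. dom v V \<Longrightarrow> bnd y F v V = bnd (sol \<zeta> p) (\<lambda>x. \<zeta> *s sol \<zeta> p x) v V"
      using boundary_representative[OF \<zeta> y(1)] by blast
    have "bs \<zeta> p \<zeta> u = 0" if u: "u \<in> L" for u
      using p(2)[OF dom_sol[of u \<zeta>]] y(2) u LN by (auto simp: bcond_def)
    then have "p \<in> Lperp \<zeta> L" using p(1) by (simp add: Lperp_def)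
    then show ?thesis using p(2) lagrangian(2)[OF \<zeta> eq L] by blast
  qed
  obtain p where p: "p \<in> L" "\<And>v V. dom v V \<Longrightarrow> bnd y F v V = bnd (sol \<zeta> p) (\<lambda>x. \<zeta> *s sol \<zeta> p x) v V"
    using rep[OF y] by blast
  have "bnd z G (sol \<zeta> p) (\<lambda>x. \<zeta> *s sol \<zeta> p x) = 0" using z(2) p(1) by (simp add: bcond_def)
  then have "bnd (sol \<zeta> p) (\<lambda>x. \<zeta> *s sol \<zeta> p x) z G = 0"
    using bnd_commute[OF z(1) dom_sol, of p \<zeta>] p(1) LN by auto
  then show ?thesis using p(2)[OF z(1)] by simp
qed

text \<open>For \<zeta> the space is \<open>L\<close> itself. For cnj \<zeta> the form against
  \<open>L\<close> is \<open>J\<close> at \<open>c\<close>, so \<open>Jperp L\<close> serves, of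
  dimension 2n - n.\<close>

lemma bcond_solutions:
  assumes \<zeta>: "Im \<zeta> \<noteq> 0" and eq: "vec.dim (NS \<zeta>) = vec.dim (NS (cnj \<zeta>))"
    and L: "isotropic \<zeta> L" "vec.dim L = CARD('n)" and \<mu>: "\<mu> = \<zeta> \<or> \<mu> = cnj \<zeta>"
  shows "\<exists>P. vec.subspace P \<and> vec.dim P = CARD('n) \<and> P \<subseteq> NS \<mu> \<and>
     (\<forall>p\<in>P. bcond \<zeta> L (sol \<mu> p) (\<lambda>x. \<mu> *s sol \<mu> p x))"
  using \<mu>
proof
  assume "\<mu> = \<zeta>"
  then show ?thesis using L by (intro exI[of _ L]) (auto simp: isotropic_def bcond_def)
next
  assume \<mu>: "\<mu> = cnj \<zeta>"
  have LN: "L \<subseteq> NS \<zeta>" "vec.subspace L" using L(1) by (auto simp: isotropic_def)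
  have JN: "Jperp L \<subseteq> NS (cnj \<zeta>)"
    using Jperp_antimono[OF lagrangian(1)[OF \<zeta> eq L]] Jperp_Jperp[OF subspace_NS] unfolding RS_def by metis
  have "bs (cnj \<zeta>) z \<zeta> u = 0" if "z \<in> Jperp L" "u \<in> L" for z u
    using bs_cnj[of z "cnj \<zeta>" u] that JN LN by (auto simp: Jperp_def)
  then show ?thesis using JN dim_Jperp[OF LN(2)] L(2) subspace_Jperp unfolding \<mu>
    by (intro exI[of _ "Jperp L"]) (auto simp: bcond_def)
qed

end

subsection \<open>Classes of functions\<close>

context weight
begin

lemma nr_diff_trans:
  assumes "sq M B f" "sq M B g" "sq M B h" "nr M B (\<lambda>x. f x - g x) = 0" "nr M B (\<lambda>x. g x - h x) = 0"
  shows "nr M B (\<lambda>x. f x - h x) = 0"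
proof -
  have "sqrt (nr M B (\<lambda>x. f x - h x)) \<le> 0" using nr_triangle_diff[OF assms(1-3)] assms(4,5) by simp
  then show ?thesis using nr_nonneg[of "\<lambda>x. f x - h x"] by simp
qed

lemma ip_zero_left: "sq M B f \<Longrightarrow> sq M B g \<Longrightarrow> nr M B f = 0 \<Longrightarrow> ip M B f g = 0"
  using ip_le[of f g] by simp

lemma ip_zero_right: "sq M B f \<Longrightarrow> sq M B g \<Longrightarrow> nr M B g = 0 \<Longrightarrow> ip M B f g = 0"
  using ip_le[of f g] by simp

lemma ip_eq_if_nr_zero:
  assumes "sq M B f" "sq M B f'" "sq M B g" "sq M B g'"
    and "nr M B (\<lambda>x. f x - f' x) = 0" "nr M B (\<lambda>x. g x - g' x) = 0"
  shows "ip M B f g = ip M B f' g'"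
proof -
  have "ip M B f g - ip M B f' g' = ip M B (\<lambda>x. f x - f' x) g + ip M B f' (\<lambda>x. g x - g' x)"
    using assms by (simp add: ip_diff_left ip_diff_right)
  also have "\<dots> = 0" using assms by (simp add: ip_zero_left ip_zero_right sq_diff)
  finally show ?thesis by simp
qed

end

locale weight_on =
  fixes S :: "real set" and B :: "real \<Rightarrow> complex^'m::finite^'m"
  assumes S_sets: "S \<in> sets lebesgue" and S_weight: "weight (lebesgue_on S) B"
begin

sublocale weight "lebesgue_on S" B by (rule S_weight)

abbreviation "MW \<equiv> lebesgue_on S"

lemma L2_rel_iff: "(f, g) \<in> L2_rel S B \<longleftrightarrow> sq MW B f \<and> sq MW B g \<and> nr MW B (\<lambda>x. f x - g x) = 0"
  unfolding L2_rel_def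
  by (auto simp: L2_fun_iff_sq[OF S_sets] L2_inner_eq_ip[OF S_sets] ip_self sq_diff)

lemma mem_class: "g \<in> L2_class S B f \<longleftrightarrow> sq MW B f \<and> sq MW B g \<and> nr MW B (\<lambda>x. f x - g x) = 0"
  by (simp add: L2_class_def L2_rel_iff)

lemma nr_zero: "nr MW B (\<lambda>x. 0) = 0"
  by (simp add: nr_def ip_def)

lemma zero_diff: "nr MW B (\<lambda>x. f x - f x) = 0"
  by (simp add: nr_zero)

lemma class_eq_iff:
  assumes f: "sq MW B f" and g: "sq MW B g"
  shows "L2_class S B f = L2_class S B g \<longleftrightarrow> nr MW B (\<lambda>x. f x - g x) = 0"
proof
  assume "L2_class S B f = L2_class S B g"
  moreover have "g \<in> L2_class S B g" using g by (simp add: mem_class nr_zero)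
  ultimately show "nr MW B (\<lambda>x. f x - g x) = 0" using mem_class by blast
next
  assume e: "nr MW B (\<lambda>x. f x - g x) = 0"
  have e': "nr MW B (\<lambda>x. g x - f x) = 0" using e nr_minus_commute[of f g] by simp
  show "L2_class S B f = L2_class S B g"
    using nr_diff_trans[OF g f _ e'] nr_diff_trans[OF f g _ e] f g by (auto simp: mem_class)
qed

lemma class_in_space: "sq MW B f \<Longrightarrow> L2_class S B f \<in> L2_space S B"
  by (auto simp: L2_space_def L2_class_def L2_fun_iff_sq[OF S_sets] intro: quotientI)

lemma space_class: "V \<in> L2_space S B \<Longrightarrow> \<exists>v. sq MW B v \<and> V = L2_class S B v"
  by (auto simp: L2_space_def L2_class_def L2_fun_iff_sq[OF S_sets] elim!: quotientE)

lemma class_rep: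
  assumes f: "sq MW B f"
  shows "sq MW B (SOME g. g \<in> L2_class S B f)" "nr MW B (\<lambda>x. f x - (SOME g. g \<in> L2_class S B f) x) = 0"
proof -
  have "f \<in> L2_class S B f" using f by (simp add: mem_class nr_zero)
  then have "(SOME g. g \<in> L2_class S B f) \<in> L2_class S B f" by (rule someI[of "\<lambda>g. g \<in> L2_class S B f"])
  then show "sq MW B (SOME g. g \<in> L2_class S B f)" "nr MW B (\<lambda>x. f x - (SOME g. g \<in> L2_class S B f) x) = 0"
    unfolding mem_class by blast+
qed

lemma class_inner_eq:
  assumes f: "sq MW B f" and g: "sq MW B g"
  shows "class_inner S B (L2_class S B f) (L2_class S B g) = ip MW B f g"
  unfolding class_inner_def L2_inner_eq_ip[OF S_sets]
  by (rule ip_eq_if_nr_zero[symmetric, OF f class_rep(1)[OF f] g class_rep(1)[OF g] class_rep(2)[OF f] class_rep(2)[OF g]])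

lemma class_dist_eq:
  assumes f: "sq MW B f" and g: "sq MW B g"
  shows "class_dist S B (L2_class S B f) (L2_class S B g) = sqrt (nr MW B (\<lambda>x. f x - g x))"
proof -
  define f' g' where "f' = (SOME h. h \<in> L2_class S B f)" and "g' = (SOME h. h \<in> L2_class S B g)"
  note F = class_rep[OF f, folded f'_def] and G = class_rep[OF g, folded g'_def]
  have F2: "nr MW B (\<lambda>x. f' x - f x) = 0" and G2: "nr MW B (\<lambda>x. g' x - g x) = 0"
    using F G nr_minus_commute[of f' f] nr_minus_commute[of g' g] by auto
  have "sqrt (nr MW B (\<lambda>x. f' x - g' x)) = sqrt (nr MW B (\<lambda>x. f x - g x))"
  proof (rule antisym)
    show "sqrt (nr MW B (\<lambda>x. f' x - g' x)) \<le> sqrt (nr MW B (\<lambda>x. f x - g x))"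
      using nr_triangle_diff[OF F(1) f G(1)] nr_triangle_diff[OF f g G(1)] F2 G(2) by simp
    show "sqrt (nr MW B (\<lambda>x. f x - g x)) \<le> sqrt (nr MW B (\<lambda>x. f' x - g' x))"
      using nr_triangle_diff[OF f F(1) g] nr_triangle_diff[OF F(1) G(1) g] F(2) G2 by simp
  qed
  then show ?thesis
    by (simp add: class_dist_def Let_def L2_inner_eq_ip[OF S_sets] f'_def g'_def nr_def)
qed

end

subsection \<open>Self-adjoint restrictions\<close>

context ham_end
begin

lemma dom_cong:
  assumes y: "\<And>x. x \<in> X \<Longrightarrow> y x = y' x" and F: "\<And>x. x \<in> X \<Longrightarrow> F x = F' x" and d: "dom y F"
  shows "dom y' F'"
proof -
  have "L2l F'" unfolding L2l_def
  proof (intro allI impI)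
    fix s t assume st: "{s..t} \<subseteq> X"
    show "sq (lebesgue_on {s..t}) B1 F'"
      by (rule sq_lebesgue_on_cong[of _ F]) (use F st d in \<open>auto simp: dom_def L2l_def\<close>)
  qed
  then show ?thesis
    using d mrel_cong[of y F y' F'] sq_cong[of y y'] sq_cong[of F F'] y F I_sub unfolding dom_def by blast
qed

lemma bnd_cong:
  assumes y: "\<And>x. x \<in> X \<Longrightarrow> y x = y' x" and F: "\<And>x. x \<in> X \<Longrightarrow> F x = F' x"
  shows "bnd y F z G = bnd y' F' z G"
proof -
  have "ip M B1 F z = ip M B1 F' z" "ip M B1 y G = ip M B1 y' G"
    by (rule ip_cong; use y F I_sub in auto)+
  then show ?thesis unfolding bnd_def using y[OF c] by simp
qed

lemma bnd_unique: "dom y F \<Longrightarrow> dom y F' \<Longrightarrow> dom z G \<Longrightarrow> bnd y F z G = bnd y F' z G"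
proof -
  assume d: "dom y F" "dom y F'" "dom z G"
  obtain T where "ends T" using ends_exist by blast
  then show "bnd y F z G = bnd y F' z G"
    using LIMSEQ_unique bnd_tendsto[OF d(1,3)] bnd_tendsto[OF d(2,3)] by blast
qed

lemma bcond_lincomb:
  assumes "L \<subseteq> NS \<zeta>" "dom y F" "dom z G" "bcond \<zeta> L y F" "bcond \<zeta> L z G"
  shows "bcond \<zeta> L (\<lambda>x. y x + k *s z x) (\<lambda>x. F x + k *s G x)"
  using assms bnd_lincomb_left[OF assms(2,3) dom_sol] unfolding bcond_def by force

end

section \<open>The maximal operator on the whole interval\<close>

context ham_at
begin

interpretation Le: ham_end a b B0 B1 c "einterval a b \<inter> {..c}" 1 by unfold_locales simp
interpretation Ri: ham_end a b B0 B1 c "einterval a b \<inter> {c..}" "-1" by unfold_locales simp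
interpretation WX: weight_on X B1 by (rule weight_on.intro[OF X_sets weight_X])

definition pdom :: "(real \<Rightarrow> complex^('n+'n)) \<Rightarrow> (real \<Rightarrow> complex^('n+'n)) \<Rightarrow> bool" where
  "pdom y f \<longleftrightarrow> mrel y f \<and> sq (lebesgue_on X) B1 y \<and> sq (lebesgue_on X) B1 f"

lemma sq_X_L2l: "sq (lebesgue_on X) B1 f \<Longrightarrow> L2l f"
  unfolding L2l_def by (auto intro: sq_subset[OF _ _ X_sets])

lemma pdom_ends: "pdom y f \<Longrightarrow> Le.dom y f" "pdom y f \<Longrightarrow> Ri.dom y f"
  unfolding pdom_def Le.dom_def Ri.dom_def
  using sq_X_L2l sq_subset[OF _ Le.I_sub X_sets Le.I_sets] sq_subset[OF _ Ri.I_sub X_sets Ri.I_sets] by auto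

lemma max_rel_iff:
  assumes "y \<in> AC_loc a b"
  shows "max_rel a b B0 B1 y f \<longleftrightarrow> mrel y f \<and> sq (lebesgue_on X) B1 f"
proof -
  have "(Jmat *v y' - B0 x *v y x = B1 x *v f x) \<longleftrightarrow> (Jmat *v y' = B0 x *v y x + B1 x *v f x)" for x y'
    by (auto simp: algebra_simps)
  then show ?thesis
    using mrel_iff[OF L2l_B1[OF sq_X_L2l]] assms
    by (auto simp: max_rel_def L2_fun_iff_sq[OF X_sets])
qed

lemma mrel_AC: "mrel y f \<Longrightarrow> sq (lebesgue_on X) B1 f \<Longrightarrow> y \<in> AC_loc a b"
  using mrel_iff[OF L2l_B1[OF sq_X_L2l]] by blast

lemma max_dom_iff: "y \<in> max_dom a b B0 B1 \<longleftrightarrow> (\<exists>f. pdom y f)"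
  unfolding max_dom_def pdom_def
  using max_rel_iff mrel_AC by (auto simp: L2_fun_iff_sq[OF X_sets])

definition Top where "Top y = (SOME f. max_rel a b B0 B1 y f)"

lemma pdom_Top: assumes "pdom y f" shows "pdom y (Top y)"
proof -
  have ac: "y \<in> AC_loc a b" using assms mrel_AC by (auto simp: pdom_def)
  have "max_rel a b B0 B1 y f" using assms max_rel_iff[OF ac] by (auto simp: pdom_def)
  then have "max_rel a b B0 B1 y (Top y)" unfolding Top_def by (rule someI[of "max_rel a b B0 B1 y"])
  then show ?thesis using assms max_rel_iff[OF ac] by (auto simp: pdom_def)
qed

lemma max_op_eq: "max_op a b B0 B1 y = L2_class X B1 (Top y)"
  by (simp add: max_op_def Top_def)

lemma pdom_lincomb: "pdom y f \<Longrightarrow> pdom z g \<Longrightarrow> pdom (\<lambda>x. y x + k *s z x) (\<lambda>x. f x + k *s g x)"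
  unfolding pdom_def by (auto intro: mrel_lincomb WX.sq_add WX.sq_scale)

text \<open>The difference of two images is an image of the function 0, so \<open>B1\<close>
  annihilates it almost everywhere.\<close>

lemma pdom_unique:
  assumes "pdom y f" "pdom y f'"
  shows "nr (lebesgue_on X) B1 (\<lambda>x. f x - f' x) = 0"
proof -
  let ?g = "\<lambda>x. f x + (-1) *s f' x"
  have "mrel (\<lambda>x. y x + (-1) *s y x) ?g" "sq (lebesgue_on X) B1 ?g"
    using pdom_lincomb[OF assms, of "-1"] by (auto simp: pdom_def)
  then have m: "mrel (\<lambda>x. 0) ?g" and g: "sq (lebesgue_on X) B1 ?g" by (simp_all add: vector_smult_lneg)
  have "AE x in lebesgue. x \<in> X \<longrightarrow> B1 x *v ?g x = 0"
    using mrel_iff[OF L2l_B1[OF sq_X_L2l[OF g]], of "\<lambda>x. 0"] m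
    by (auto elim!: eventually_mono dest!: vector_derivative_unique_at[OF has_vector_derivative_const])
  then have ae: "AE x in lebesgue_on X. B1 x *v ?g x = 0" by (simp add: AE_restrict_space_iff)
  have "nr (lebesgue_on X) B1 ?g = (\<integral>x. WX.q ?g x \<partial>lebesgue_on X)" by (rule WX.nr_eq_integral[OF g])
  also have "\<dots> = 0" by (rule integral_eq_zero_AE) (use ae in \<open>auto elim!: eventually_mono\<close>)
  finally show ?thesis by (simp add: vector_smult_lneg)
qed

lemma integral_X_split:
  fixes h :: "real \<Rightarrow> complex"
  assumes "integrable (lebesgue_on X) h"
  shows "integral\<^sup>L (lebesgue_on X) h = integral\<^sup>L (lebesgue_on (X \<inter> {..c})) h + integral\<^sup>L (lebesgue_on (X \<inter> {c..})) h"
proof -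
  have XU: "X \<inter> {..c} \<union> X \<inter> {c..} = X" by auto
  have s: "set_integrable lebesgue X h" using assms by (simp add: set_integrable_def integrable_restrict_space)
  have "(LINT x:X \<inter> {..c} \<union> X \<inter> {c..}|lebesgue. h x) = (LINT x:X \<inter> {..c}|lebesgue. h x) + (LINT x:X \<inter> {c..}|lebesgue. h x)"
  proof (rule set_integral_Un_AE)
    have "AE x in lebesgue. x \<notin> {c}" by (rule AE_not_in) (simp add: negligible_iff_null_sets[symmetric])
    then show "AE x in lebesgue. \<not> (x \<in> X \<inter> {..c} \<and> x \<in> X \<inter> {c..})" by eventually_elim auto
    show "set_integrable lebesgue (X \<inter> {..c}) h" "set_integrable lebesgue (X \<inter> {c..}) h"
      by (rule set_integrable_subset[OF s]; simp)+
  qed simp_all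
  then show ?thesis unfolding XU by (simp add: set_lebesgue_integral_def integral_restrict_space)
qed

lemma ip_X_split:
  assumes "sq (lebesgue_on X) B1 f" "sq (lebesgue_on X) B1 g"
  shows "ip (lebesgue_on X) B1 f g = ip Le.M B1 f g + ip Ri.M B1 f g"
  unfolding ip_def by (rule integral_X_split[OF WX.integrable_ip[OF assms]])

text \<open>The contributions of the two halves at \<open>c\<close> cancel.\<close>

lemma green_X:
  assumes "pdom y f" "pdom z g"
  shows "ip (lebesgue_on X) B1 f z - ip (lebesgue_on X) B1 y g = Ri.bnd y f z g - Le.bnd y f z g"
  using assms unfolding Le.bnd_def Ri.bnd_def pdom_def by (simp add: ip_X_split)

lemma sq_X_of_ends:
  assumes y: "contX y" and "sq Le.M B1 y" "sq Ri.M B1 y"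
  shows "sq (lebesgue_on X) B1 y"
proof -
  have XU: "X \<inter> {..c} \<union> X \<inter> {c..} = X" by auto
  have "set_integrable lebesgue (X \<inter> {..c}) (\<lambda>x. cinner (B1 x *v y x) (y x))"
    "set_integrable lebesgue (X \<inter> {c..}) (\<lambda>x. cinner (B1 x *v y x) (y x))"
    using assms by (simp_all add: sq_def set_integrable_def integrable_restrict_space)
  from set_integrable_Un[OF this] have "set_integrable lebesgue X (\<lambda>x. cinner (B1 x *v y x) (y x))"
    unfolding XU by simp
  then show ?thesis using contX_measurable[OF y] by (simp add: sq_def set_integrable_def integrable_restrict_space)
qed

section \<open>Surjectivity and self-adjointness for fixed conditions at both end points\<close>

context
  fixes \<zeta> :: complex and La Lb :: "(complex^('n+'n)) set"
  assumes \<zeta>: "Im \<zeta> \<noteq> 0"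
    and eqa: "vec.dim (Le.NS \<zeta>) = vec.dim (Le.NS (cnj \<zeta>))"
    and eqb: "vec.dim (Ri.NS \<zeta>) = vec.dim (Ri.NS (cnj \<zeta>))"
    and La: "Le.isotropic \<zeta> La" "vec.dim La = CARD('n)"
    and Lb: "Ri.isotropic \<zeta> Lb" "vec.dim Lb = CARD('n)"
begin

definition rdom :: "(real \<Rightarrow> complex^('n+'n)) \<Rightarrow> (real \<Rightarrow> complex^('n+'n)) \<Rightarrow> bool" where
  "rdom y f \<longleftrightarrow> pdom y f \<and> Le.bcond \<zeta> La y f \<and> Ri.bcond \<zeta> Lb y f"

lemma LaN: "La \<subseteq> Le.NS \<zeta>" and LbN: "Lb \<subseteq> Ri.NS \<zeta>"
  using La Lb by (auto simp: Le.isotropic_def Ri.isotropic_def)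

text \<open>The boundary values are limits of (J y, z), in which the image of \<open>y\<close> does
  not occur.\<close>

lemma rdom_change:
  assumes y: "rdom y f" and f': "pdom y f'"
  shows "rdom y f'"
proof -
  have p: "pdom y f" using y by (simp add: rdom_def)
  have "Le.bnd y f (sol \<zeta> u) (\<lambda>x. \<zeta> *s sol \<zeta> u x) = Le.bnd y f' (sol \<zeta> u) (\<lambda>x. \<zeta> *s sol \<zeta> u x)" if "u \<in> La" for u
    by (rule Le.bnd_unique[OF pdom_ends(1)[OF p] pdom_ends(1)[OF f'] Le.dom_sol]) (use LaN that in blast)
  moreover have "Ri.bnd y f (sol \<zeta> u) (\<lambda>x. \<zeta> *s sol \<zeta> u x) = Ri.bnd y f' (sol \<zeta> u) (\<lambda>x. \<zeta> *s sol \<zeta> u x)" if "u \<in> Lb" for u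
    by (rule Ri.bnd_unique[OF pdom_ends(2)[OF p] pdom_ends(2)[OF f'] Ri.dom_sol]) (use LbN that in blast)
  ultimately show ?thesis using y f' by (simp add: rdom_def Le.bcond_def Ri.bcond_def)
qed

lemma rdom_Top: assumes "rdom y f" shows "rdom y (Top y)"
  by (rule rdom_change[OF assms pdom_Top[of y f]]) (use assms in \<open>simp add: rdom_def\<close>)

lemma rdom_lincomb: "rdom y f \<Longrightarrow> rdom z g \<Longrightarrow> rdom (\<lambda>x. y x + k *s z x) (\<lambda>x. f x + k *s g x)"
  unfolding rdom_def
  using pdom_lincomb Le.bcond_lincomb[OF LaN pdom_ends(1) pdom_ends(1)] Ri.bcond_lincomb[OF LbN pdom_ends(2) pdom_ends(2)] by blast

lemma rdom_symmetric:
  assumes "rdom y f" "rdom z g"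
  shows "ip (lebesgue_on X) B1 f z = ip (lebesgue_on X) B1 y g"
proof -
  have p: "pdom y f" "pdom z g" using assms by (auto simp: rdom_def)
  have "Le.bnd y f z g = 0"
    by (rule Le.bcond_symmetric[OF \<zeta> eqa La]) (use assms pdom_ends in \<open>auto simp: rdom_def\<close>)
  moreover have "Ri.bnd y f z g = 0"
    by (rule Ri.bcond_symmetric[OF \<zeta> eqb Lb]) (use assms pdom_ends in \<open>auto simp: rdom_def\<close>)
  ultimately show ?thesis using green_X[OF p] by simp
qed

text \<open>Vanishing of the form at the left end point makes the imaginary part of (J u, u) a
  positive multiple of Im \<mu>, at the right end point a negative one.\<close>

lemma transversal:
  assumes \<mu>: "\<mu> = \<zeta> \<or> \<mu> = cnj \<zeta>"
    and P: "u \<in> Le.NS \<mu>" "u \<in> Ri.NS \<mu>" "Le.bcond \<zeta> La (sol \<mu> u) (\<lambda>x. \<mu> *s sol \<mu> u x)"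
      "Ri.bcond \<zeta> Lb (sol \<mu> u) (\<lambda>x. \<mu> *s sol \<mu> u x)"
  shows "u = 0"
proof (rule ccontr)
  assume u: "u \<noteq> 0"
  have "Le.bs \<mu> u \<mu> u = 0" by (rule Le.bcond_symmetric[OF \<zeta> eqa La]) (rule Le.dom_sol[OF P(1)] P(3))+
  then have 1: "Im (cinner (Jmat *v u) u) = 2 * Im \<mu> * nr Le.M B1 (sol \<mu> u)" using Le.bs_self[OF P(1)] by simp
  have "Ri.bs \<mu> u \<mu> u = 0" by (rule Ri.bcond_symmetric[OF \<zeta> eqb Lb]) (rule Ri.dom_sol[OF P(2)] P(4))+
  then have 2: "Im (cinner (Jmat *v u) u) = - (2 * Im \<mu> * nr Ri.M B1 (sol \<mu> u))" using Ri.bs_self[OF P(2)] by simp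
  have "2 * Im \<mu> * (nr Le.M B1 (sol \<mu> u) + nr Ri.M B1 (sol \<mu> u)) = 0"
    unfolding distrib_left using 1 2 by linarith
  moreover have "Im \<mu> \<noteq> 0" using \<zeta> \<mu> by auto
  moreover have "nr Le.M B1 (sol \<mu> u) > 0" "nr Ri.M B1 (sol \<mu> u) > 0"
    using Le.nr_sol_pos[OF P(1) u] Ri.nr_sol_pos[OF P(2) u] by auto
  ultimately show False by simp
qed

text \<open>Solutions of (T - \<mu>) y = F from the two end points are corrected by homogeneous
  solutions satisfying the conditions. The two correction spaces are n-dimensional and transversal,
  so their sum contains the mismatch at \<open>c\<close>.\<close>

lemma rdom_range:
  assumes \<mu>: "\<mu> = \<zeta> \<or> \<mu> = cnj \<zeta>" and F: "sq (lebesgue_on X) B1 F"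
  shows "\<exists>y. rdom y (\<lambda>x. \<mu> *s y x + F x)"
proof -
  have \<mu>0: "Im \<mu> \<noteq> 0" using \<zeta> \<mu> by auto
  have LF: "L2l F" by (rule sq_X_L2l[OF F])
  have FL: "sq Le.M B1 F" "sq Ri.M B1 F"
    using sq_subset[OF F Le.I_sub X_sets Le.I_sets] sq_subset[OF F Ri.I_sub X_sets Ri.I_sets] by auto
  obtain ya where ya: "Le.dom ya (\<lambda>x. \<mu> *s ya x + F x)" "\<And>v V. Le.dom v V \<Longrightarrow> Le.bnd ya (\<lambda>x. \<mu> *s ya x + F x) v V = 0"
    using Le.limit_solution_exists[OF \<mu>0 FL(1) LF] by blast
  obtain yb where yb: "Ri.dom yb (\<lambda>x. \<mu> *s yb x + F x)" "\<And>v V. Ri.dom v V \<Longrightarrow> Ri.bnd yb (\<lambda>x. \<mu> *s yb x + F x) v V = 0"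
    using Ri.limit_solution_exists[OF \<mu>0 FL(2) LF] by blast
  obtain Pa where Pa: "vec.subspace Pa" "vec.dim Pa = CARD('n)" "Pa \<subseteq> Le.NS \<mu>"
     "\<And>p. p \<in> Pa \<Longrightarrow> Le.bcond \<zeta> La (sol \<mu> p) (\<lambda>x. \<mu> *s sol \<mu> p x)"
    using Le.bcond_solutions[OF \<zeta> eqa La \<mu>] by blast
  obtain Pb where Pb: "vec.subspace Pb" "vec.dim Pb = CARD('n)" "Pb \<subseteq> Ri.NS \<mu>"
     "\<And>p. p \<in> Pb \<Longrightarrow> Ri.bcond \<zeta> Lb (sol \<mu> p) (\<lambda>x. \<mu> *s sol \<mu> p x)"
    using Ri.bcond_solutions[OF \<zeta> eqb Lb \<mu>] by blast
  have "Pa \<inter> Pb \<subseteq> {0}" using transversal[OF \<mu>] Pa(3,4) Pb(3,4) by blast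
  then have d0: "vec.dim (Pa \<inter> Pb) = 0" by (rule dim_subset_zero)
  have "vec.dim {x + y |x y. x \<in> Pa \<and> y \<in> Pb} = 2 * CARD('n)"
    using vec.dim_sums_Int[OF Pa(1) Pb(1)] Pa(2) Pb(2) d0 by linarith
  moreover have "vec.dim (UNIV :: (complex^('n+'n)) set) = 2 * CARD('n)" by (simp add: card_cart_basis)
  ultimately have "{x + y |x y. x \<in> Pa \<and> y \<in> Pb} = UNIV"
    using vec.subspace_sums[OF Pa(1) Pb(1)] by (intro vec.subspace_dim_equal vec.subspace_UNIV) simp_all
  then have "ya c - yb c \<in> {x + y |x y. x \<in> Pa \<and> y \<in> Pb}" by simp
  then obtain p q where pq: "p \<in> Pa" "q \<in> Pb" "ya c - yb c = p + q" by blast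
  let ?y = "\<lambda>x. ya x + (-1) *s sol \<mu> p x" and ?z = "\<lambda>x. yb x + 1 *s sol \<mu> q x"
  have eqF: "(\<lambda>x. (\<mu> *s ya x + F x) + (-1) *s (\<mu> *s sol \<mu> p x)) = (\<lambda>x. \<mu> *s ?y x + F x)"
    "(\<lambda>x. (\<mu> *s yb x + F x) + 1 *s (\<mu> *s sol \<mu> q x)) = (\<lambda>x. \<mu> *s ?z x + F x)"
    by (simp_all add: fun_eq_iff vec_eq_iff algebra_simps)
  have dp: "Le.dom (sol \<mu> p) (\<lambda>x. \<mu> *s sol \<mu> p x)" using pq Pa(3) by (intro Le.dom_sol) auto
  have dq: "Ri.dom (sol \<mu> q) (\<lambda>x. \<mu> *s sol \<mu> q x)" using pq Pb(3) by (intro Ri.dom_sol) auto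
  have dy: "Le.dom ?y (\<lambda>x. \<mu> *s ?y x + F x)" using Le.dom_lincomb[OF ya(1) dp, of "-1"] unfolding eqF .
  have dz: "Ri.dom ?z (\<lambda>x. \<mu> *s ?z x + F x)" using Ri.dom_lincomb[OF yb(1) dq, of 1] unfolding eqF .
  have ba: "Le.bcond \<zeta> La ?y (\<lambda>x. \<mu> *s ?y x + F x)"
    unfolding eqF(1)[symmetric]
    by (rule Le.bcond_lincomb[OF LaN ya(1) dp]) (use ya(2) LaN Le.dom_sol Pa(4)[OF pq(1)] in \<open>auto simp: Le.bcond_def\<close>)
  have bz: "Ri.bcond \<zeta> Lb ?z (\<lambda>x. \<mu> *s ?z x + F x)"
    unfolding eqF(2)[symmetric]
    by (rule Ri.bcond_lincomb[OF LbN yb(1) dq]) (use yb(2) LbN Ri.dom_sol Pb(4)[OF pq(2)] in \<open>auto simp: Ri.bcond_def\<close>)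
  have my: "mrel ?y (\<lambda>x. \<mu> *s ?y x + F x)" and mz: "mrel ?z (\<lambda>x. \<mu> *s ?z x + F x)"
    using dy dz by (auto simp: Le.dom_def Ri.dom_def)
  have "?y c = ?z c" using pq(3) by (simp add: vector_smult_lneg algebra_simps)
  then have yz: "?z x = ?y x" if "x \<in> X" for x using mrel_unique[OF my mz c _ that] by simp
  have dy2: "Ri.dom ?y (\<lambda>x. \<mu> *s ?y x + F x)"
    by (rule Ri.dom_cong[OF _ _ dz]) (simp_all only: yz)
  have "Ri.bcond \<zeta> Lb ?y (\<lambda>x. \<mu> *s ?y x + F x)"
    unfolding Ri.bcond_def
  proof
    fix u assume "u \<in> Lb"
    then have "Ri.bnd ?z (\<lambda>x. \<mu> *s ?z x + F x) (sol \<zeta> u) (\<lambda>x. \<zeta> *s sol \<zeta> u x) = 0" using bz unfolding Ri.bcond_def by blast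
    moreover have "Ri.bnd ?z (\<lambda>x. \<mu> *s ?z x + F x) (sol \<zeta> u) (\<lambda>x. \<zeta> *s sol \<zeta> u x) = Ri.bnd ?y (\<lambda>x. \<mu> *s ?y x + F x) (sol \<zeta> u) (\<lambda>x. \<zeta> *s sol \<zeta> u x)"
      by (rule Ri.bnd_cong) (simp_all only: yz)
    ultimately show "Ri.bnd ?y (\<lambda>x. \<mu> *s ?y x + F x) (sol \<zeta> u) (\<lambda>x. \<zeta> *s sol \<zeta> u x) = 0" by simp
  qed
  moreover have "pdom ?y (\<lambda>x. \<mu> *s ?y x + F x)"
  proof -
    have "sq (lebesgue_on X) B1 ?y"
      by (rule sq_X_of_ends[OF mrel_contX[OF my]]) (use dy dy2 in \<open>auto simp: Le.dom_def Ri.dom_def\<close>)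
    then show ?thesis unfolding pdom_def using my F WX.sq_add[OF WX.sq_scale F] by blast
  qed
  ultimately show ?thesis using ba unfolding rdom_def by blast
qed

text \<open>For (v, w) in the adjoint graph choose y with (T - cnj \<zeta>) y = w - cnj \<zeta> v.
  Then F = y - v is orthogonal to the range of T - \<zeta>, which contains F, so F has seminorm 0.
  The argument uses graphs and therefore covers linear relations.\<close>

lemma selfadjoint_core:
  assumes D: "D = {y \<in> max_dom a b B0 B1. \<exists>f. rdom y f}"
  shows "selfadjoint_restr a b B0 B1 D"
proof -
  define MX where "MX = lebesgue_on X"
  let ?cl = "L2_class X B1"
  let ?G = "restr_graph a b B0 B1 D"
  have G: "?G = {(?cl y, ?cl (Top y)) |y. y \<in> D}"
    unfolding restr_graph_def by (auto simp: max_op_eq)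
  have DT: "rdom y (Top y)" if "y \<in> D" for y using that D rdom_Top by auto
  have Dd: "y \<in> D" if "rdom y f" for y f using that D unfolding max_dom_iff by (auto simp: rdom_def)
  have Dsq: "sq MX B1 y" "sq MX B1 (Top y)" if "y \<in> D" for y
    using DT[OF that] by (auto simp: rdom_def pdom_def MX_def)
  note ci = WX.class_inner_eq[folded MX_def] and ce = WX.class_eq_iff[folded MX_def]
  have sub1: "?G \<subseteq> adjoint_graph X B1 ?G"
  proof
    fix p assume "p \<in> ?G"
    then obtain z where z: "z \<in> D" "p = (?cl z, ?cl (Top z))" unfolding G by blast
    have "class_inner X B1 (?cl (Top y)) (?cl z) = class_inner X B1 (?cl y) (?cl (Top z))" if y: "y \<in> D" for y
      using rdom_symmetric[OF DT[OF y] DT[OF z(1)]] by (simp add: ci Dsq y z(1)) (simp add: MX_def)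
    then show "p \<in> adjoint_graph X B1 ?G"
      unfolding adjoint_graph_def z(2) G using Dsq[OF z(1)] WX.class_in_space by (auto simp: MX_def)
  qed
  have sub2: "adjoint_graph X B1 ?G \<subseteq> ?G"
  proof
    fix p assume p: "p \<in> adjoint_graph X B1 ?G"
    obtain V W where VW: "p = (V, W)" by (cases p)
    have "V \<in> L2_space X B1" "W \<in> L2_space X B1" using p by (auto simp: adjoint_graph_def VW)
    then obtain v w where v: "sq MX B1 v" "V = ?cl v" and w: "sq MX B1 w" "W = ?cl w"
      using WX.space_class unfolding MX_def by blast
    have adj: "ip MX B1 (Top y) v = ip MX B1 y w" if "y \<in> D" for y
    proof -
      have "(?cl y, ?cl (Top y)) \<in> ?G" using that unfolding G by blast
      then have "class_inner X B1 (?cl (Top y)) V = class_inner X B1 (?cl y) W"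
        using p unfolding adjoint_graph_def VW by blast
      then show ?thesis by (simp add: v w ci Dsq that)
    qed
    define \<mu> where "\<mu> = cnj \<zeta>"
    have s1: "sq MX B1 (\<lambda>x. w x - \<mu> *s v x)" unfolding MX_def
      by (intro WX.sq_diff WX.sq_scale) (use v w in \<open>simp_all add: MX_def\<close>)
    then obtain y where y: "rdom y (\<lambda>x. \<mu> *s y x + (w x - \<mu> *s v x))"
      using rdom_range[of \<mu> "\<lambda>x. w x - \<mu> *s v x"] by (auto simp: MX_def \<mu>_def)
    define h where "h x = \<mu> *s y x + (w x - \<mu> *s v x)" for x
    have yh: "rdom y h" using y by (simp add: h_def[abs_def])
    have sy: "sq MX B1 y" "sq MX B1 h" using yh by (auto simp: rdom_def pdom_def MX_def)
    define F where "F x = y x - v x" for x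
    have sF: "sq MX B1 F" unfolding MX_def F_def by (intro WX.sq_diff) (use sy v in \<open>simp_all add: MX_def\<close>)
    then obtain x where x: "rdom x (\<lambda>t. \<zeta> *s x t + F t)" using rdom_range[of \<zeta> F] by (auto simp: MX_def)
    define k where "k t = \<zeta> *s x t + F t" for t
    have xk: "rdom x k" using x by (simp add: k_def[abs_def])
    have sx: "sq MX B1 x" "sq MX B1 k" using xk by (auto simp: rdom_def pdom_def MX_def)
    have xD: "x \<in> D" by (rule Dd[OF xk])
    interpret WM: weight MX B1 unfolding MX_def by (rule weight_X)
    have "nr MX B1 (\<lambda>t. Top x t - k t) = 0"
      using pdom_unique[of x "Top x" k] DT[OF xD] xk by (auto simp: rdom_def MX_def)
    then have "ip MX B1 (Top x) v = ip MX B1 k v"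
      by (intro WM.ip_eq_if_nr_zero Dsq[OF xD] sx v WX.zero_diff[folded MX_def])
    then have e1: "ip MX B1 k v = ip MX B1 x w" using adj[OF xD] by simp
    have e2: "ip MX B1 k y = ip MX B1 x h" using rdom_symmetric[OF xk yh] by (simp add: MX_def)
    have kF: "ip MX B1 k F = ip MX B1 k y - ip MX B1 k v"
      unfolding F_def by (rule WM.ip_diff_right[OF sy(1) v(1) sx(2)])
    have "h = (\<lambda>t. w t + \<mu> *s F t)" by (simp add: fun_eq_iff h_def F_def vec_eq_iff algebra_simps)
    then have "ip MX B1 x h = ip MX B1 x w + cnj \<mu> * ip MX B1 x F"
      using WM.ip_add_right[OF w(1) WM.sq_scale[OF sF] sx(1), of \<mu>] by (simp add: WM.ip_scale_right)
    then have "ip MX B1 k F = \<zeta> * ip MX B1 x F" using kF e1 e2 by (simp add: \<mu>_def)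
    moreover have "ip MX B1 k F = \<zeta> * ip MX B1 x F + ip MX B1 F F"
      unfolding k_def using WM.ip_add_left[OF WM.sq_scale[OF sx(1)] sF sF, of \<zeta>] by (simp add: WM.ip_scale_left)
    ultimately have "ip MX B1 F F = 0" by simp
    then have F0: "nr MX B1 F = 0" by (simp add: nr_def)
    have yD: "y \<in> D" by (rule Dd[OF yh])
    have "?cl v = ?cl y"
      using F0 sy v ce[of v y] WM.nr_minus_commute[of v y] unfolding F_def[abs_def] by simp
    moreover have "?cl w = ?cl (Top y)"
    proof -
      have "(\<lambda>t. h t - w t) = (\<lambda>t. \<mu> *s F t)" by (simp add: fun_eq_iff h_def F_def vec_eq_iff algebra_simps)
      then have "nr MX B1 (\<lambda>t. h t - w t) = 0" using WM.nr_scale[of \<mu> F] F0 by simp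
      then have "?cl h = ?cl w" using ce[OF sy(2) w(1)] by simp
      moreover have "nr MX B1 (\<lambda>t. Top y t - h t) = 0"
        using pdom_unique[of y "Top y" h] DT[OF yD] yh by (auto simp: rdom_def MX_def)
      then have "?cl (Top y) = ?cl h" using ce[OF Dsq(2)[OF yD] sy(2)] by simp
      ultimately show ?thesis by simp
    qed
    ultimately show "p \<in> ?G" unfolding G VW v w using yD by blast
  qed
  have adjG: "adjoint_graph X B1 ?G = ?G" using sub1 sub2 by blast
  moreover have "single_valued ?G \<and> L2_dense X B1 (Domain ?G)"
    if sv: "single_valued (restr_graph a b B0 B1 (max_dom a b B0 B1))"
  proof
    have GM: "?G \<subseteq> restr_graph a b B0 B1 (max_dom a b B0 B1)"
      unfolding restr_graph_def D by blast
    then show svG: "single_valued ?G" using sv single_valued_subset by blast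
    have Dom: "Domain ?G = ?cl ` D" unfolding G by auto
    have z: "rdom (\<lambda>x. 0) (\<lambda>x. 0)"
    proof -
      have "sq MX B1 (\<lambda>x. 0)" unfolding MX_def by (rule WX.sq_zero)
      then obtain y where y: "rdom y (\<lambda>x. \<zeta> *s y x + 0)" using rdom_range[of \<zeta> "\<lambda>x. 0"] by (auto simp: MX_def)
      from rdom_lincomb[OF y y, of "-1"] show ?thesis by (simp add: vector_smult_lneg)
    qed
    \<comment> \<open>If \<open>r\<close> is orthogonal to \<open>D\<close>, the pair (0, r) lies in
      the adjoint graph, hence in the graph itself, and single-valuedness makes \<open>r\<close>
      zero.\<close>
    have orth: "nr MX B1 r = 0" if r: "sq MX B1 r" and o: "\<And>s. s \<in> D \<Longrightarrow> ip MX B1 s r = 0" for r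
    proof -
      have s0: "sq MX B1 (\<lambda>x. 0)" unfolding MX_def by (rule WX.sq_zero)
      have "(?cl (\<lambda>x. 0), ?cl r) \<in> adjoint_graph X B1 ?G"
        unfolding adjoint_graph_def G using WX.class_in_space[folded MX_def] r s0
        by (auto simp: ci Dsq o) (simp add: ip_def)
      then have 1: "(?cl (\<lambda>x. 0), ?cl r) \<in> ?G" unfolding adjG .
      have zD: "(\<lambda>x. 0) \<in> D" by (rule Dd[OF z])
      then have 2: "(?cl (\<lambda>x. 0), ?cl (Top (\<lambda>x. 0))) \<in> ?G" unfolding G by blast
      have "nr MX B1 (\<lambda>x. Top (\<lambda>x. 0) x - 0) = 0"
        using pdom_unique[of "\<lambda>x. 0" "Top (\<lambda>x. 0)" "\<lambda>x. 0"] DT[OF zD] z by (auto simp: rdom_def MX_def)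
      then have "?cl (Top (\<lambda>x. 0)) = ?cl (\<lambda>x. 0)" using ce[OF Dsq(2)[OF zD] s0] by simp
      then have "?cl r = ?cl (\<lambda>x. 0)" using 1 2 svG by (metis single_valuedD)
      then show ?thesis using ce[OF r s0] by simp
    qed
    show "L2_dense X B1 (Domain ?G)"
      unfolding L2_dense_def Dom
    proof (intro conjI ballI allI impI)
      show "?cl ` D \<subseteq> L2_space X B1" using Dsq WX.class_in_space by (auto simp: MX_def)
      fix F :: "(real \<Rightarrow> complex^('n+'n)) set" and e :: real assume F: "F \<in> L2_space X B1" and e: "e > 0"
      then obtain f where f: "sq MX B1 f" "F = ?cl f" using WX.space_class by (auto simp: MX_def)
      interpret WM: weight MX B1 unfolding MX_def by (rule weight_X)
      have "\<exists>s\<in>D. nr MX B1 (\<lambda>x. f x - s x) < e\<^sup>2"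
      proof (rule WM.sq_dense_if_orthogonal_trivial[OF Dsq(1) Dd[OF z] _ orth f(1)])
        show "(\<lambda>x. s x + k *s t x) \<in> D" if "s \<in> D" "t \<in> D" for s t k
          using Dd[OF rdom_lincomb[OF DT[OF that(1)] DT[OF that(2)]]] .
      qed (use e in auto)
      then obtain s where s: "s \<in> D" "nr MX B1 (\<lambda>x. f x - s x) < e\<^sup>2" by blast
      have "class_dist X B1 F (?cl s) = sqrt (nr MX B1 (\<lambda>x. f x - s x))"
        unfolding f(2) using WX.class_dist_eq[of f s] f(1) Dsq(1)[OF s(1)] by (simp add: MX_def)
      also have "\<dots> < e" using s(2) e by (simp add: real_sqrt_less_iff real_less_lsqrt WM.nr_nonneg)
      finally show "\<exists>G\<in>?cl ` D. class_dist X B1 F G < e" using s(1) by blast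
    qed
  qed
  ultimately show ?thesis
    unfolding selfadjoint_restr_def selfadjoint_graph_def selfadjoint_operator_def by blast
qed

end

end

subsection \<open>Solutions and boundary conditions as matrices\<close>

lemma spanning_family:
  fixes L :: "(complex^'m::finite) set"
  assumes "vec.subspace L" "vec.dim L = CARD('n::finite)"
  shows "\<exists>u :: 'n \<Rightarrow> complex^'m. vec.span (range u) = L"
proof -
  obtain B where B: "B \<subseteq> L" "vec.independent B" "L \<subseteq> vec.span B" "card B = vec.dim L"
    by (rule vec.basis_exists)
  have "finite B" by (rule vec.finiteI_independent[OF B(2)])
  then obtain u :: "'n \<Rightarrow> complex^'m" where "bij_betw u UNIV B"
    using finite_same_card_bij[of "UNIV :: 'n set" B] B(4) assms(2) by auto
  then have "range u = B" by (simp add: bij_betw_def)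
  moreover have "vec.span B = L" using B(1,3) assms(1) vec.span_minimal by blast
  ultimately show ?thesis by blast
qed

context ham_at
begin

definition cols :: "complex \<Rightarrow> ('n \<Rightarrow> complex^('n+'n)) \<Rightarrow> real \<Rightarrow> complex^'n^('n+'n)" where
  "cols \<zeta> u x = (\<chi> i j. sol \<zeta> (u j) x $ i)"

lemma column_cols: "column j (cols \<zeta> u x) = sol \<zeta> (u j) x"
  by (simp add: column_def cols_def vec_eq_iff)

lemma madj_cols: "(madj (cols \<zeta> u x) *v v) $ j = cinner v (sol \<zeta> (u j) x)"
  by (simp add: madj_def cols_def matrix_vector_mult_def cinner_def mult.commute)

lemma sol_is_solution: "is_solution a b B0 B1 \<zeta> (sol \<zeta> w)"
  using sol by (simp add: is_solution_iff)

text \<open>The passage from values at \<open>c\<close> to solutions is linear and injective, so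
  solution spaces can be measured in the 2n-space.\<close>

lemma dim_solutions: "cfun.dim (sol \<zeta> ` W) = vec.dim W"
proof -
  interpret P: finite_dimensional_vector_space_pair_1
    "(*s) :: complex \<Rightarrow> complex^('n+'n) \<Rightarrow> complex^('n+'n)" cart_basis
    "fscale :: complex \<Rightarrow> (real \<Rightarrow> complex^('n+'n)) \<Rightarrow> real \<Rightarrow> complex^('n+'n)"
    by unfold_locales
  have "Vector_Spaces.linear (*s) fscale (sol \<zeta>)"
    unfolding Vector_Spaces.linear_iff
  proof (intro conjI allI vec.vector_space_axioms cfun.vector_space_axioms)
    show "sol \<zeta> (u + v) = sol \<zeta> u + sol \<zeta> v" for u v
      using sol_lincomb[of \<zeta> u 1 v] by (simp add: fun_eq_iff)
    show "sol \<zeta> (k *s v) = fscale k (sol \<zeta> v)" for k v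
      using sol_lincomb[of \<zeta> 0 k v] by (simp add: fun_eq_iff fscale_def sol_zero)
  qed
  moreover have "inj_on (sol \<zeta>) S" for S
    by (rule inj_onI) (metis sol_c)
  ultimately show ?thesis by (rule P.dim_image_eq)
qed

lemma solutions_eq:
  assumes "\<And>w. P (sol \<zeta> w) \<longleftrightarrow> w \<in> W"
  shows "{y. is_solution a b B0 B1 \<zeta> y \<and> P y \<and> (\<forall>x. x \<notin> X \<longrightarrow> y x = 0)} = sol \<zeta> ` W"
proof -
  have "y = sol \<zeta> (y c)" if "is_solution a b B0 B1 \<zeta> y" "\<forall>x. x \<notin> X \<longrightarrow> y x = 0" for y
    using sol_unique[of y \<zeta>] sol_outside that by (fastforce simp: is_solution_iff)
  then show ?thesis using assms sol_is_solution sol_outside by (auto simp: image_iff) metis+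
qed

lemma sq_Un_contX:
  assumes y: "contX y" and S: "sq (lebesgue_on S) B1 y" "S \<in> sets lebesgue" and T: "sq (lebesgue_on T) B1 y" "T \<in> sets lebesgue"
    and U: "U \<subseteq> S \<union> T" "U \<in> sets lebesgue" "S \<union> T \<subseteq> X"
  shows "sq (lebesgue_on U) B1 y"
proof -
  have "set_integrable lebesgue S (\<lambda>x. cinner (B1 x *v y x) (y x))"
    "set_integrable lebesgue T (\<lambda>x. cinner (B1 x *v y x) (y x))"
    using S T by (simp_all add: sq_def set_integrable_def integrable_restrict_space)
  from set_integrable_Un[OF this] have "set_integrable lebesgue (S \<union> T) (\<lambda>x. cinner (B1 x *v y x) (y x))"
    using S T by simp
  moreover have "y \<in> borel_measurable (lebesgue_on (S \<union> T))"
    by (rule measurable_restrict_mono[OF contX_measurable[OF y]]) (use U in auto)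
  ultimately have "sq (lebesgue_on (S \<union> T)) B1 y"
    using S T by (simp add: sq_def set_integrable_def integrable_restrict_space)
  then show ?thesis by (rule sq_subset[OF _ U(1)]) (use S T U in auto)
qed

end

context ham_end
begin

lemma bcond_iff_generators:
  assumes y: "dom y F" and u: "vec.span (range u) = L" "L \<subseteq> NS \<zeta>"
  shows "bcond \<zeta> L y F \<longleftrightarrow> (\<forall>j. bnd y F (sol \<zeta> (u j)) (\<lambda>x. \<zeta> *s sol \<zeta> (u j) x) = 0)"
proof
  assume "bcond \<zeta> L y F"
  then show "\<forall>j. bnd y F (sol \<zeta> (u j)) (\<lambda>x. \<zeta> *s sol \<zeta> (u j) x) = 0"
    using u vec.span_base[of _ "range u"] by (auto simp: bcond_def)
next
  assume z: "\<forall>j. bnd y F (sol \<zeta> (u j)) (\<lambda>x. \<zeta> *s sol \<zeta> (u j) x) = 0"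
  let ?Z = "{v\<in>NS \<zeta>. bnd y F (sol \<zeta> v) (\<lambda>x. \<zeta> *s sol \<zeta> v x) = 0}"
  have lin: "v + k *s w \<in> ?Z" if v: "v \<in> ?Z" and w: "w \<in> ?Z" for v w k
  proof -
    have "v + k *s w \<in> NS \<zeta>" using v w subspace_NS by (auto intro: vec.subspace_add vec.subspace_scale)
    moreover have "sol \<zeta> (v + k *s w) = (\<lambda>x. sol \<zeta> v x + k *s sol \<zeta> w x)"
      by (simp add: fun_eq_iff sol_lincomb)
    moreover have "(\<lambda>x. \<zeta> *s (sol \<zeta> v x + k *s sol \<zeta> w x)) = (\<lambda>x. \<zeta> *s sol \<zeta> v x + k *s (\<zeta> *s sol \<zeta> w x))"
      by (simp add: fun_eq_iff vec_eq_iff algebra_simps)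
    ultimately show ?thesis
      using v w bnd_lincomb_right[OF dom_sol[of v \<zeta>] dom_sol[of w \<zeta>] y, of k] by simp
  qed
  have 0: "0 \<in> ?Z"
  proof -
    have "vec.subspace (NS \<zeta>)" by (rule subspace_NS)
    then show ?thesis by (simp add: vec.subspace_0 sol_zero bnd_def W.ip_scale_left ip_def cinner_def)
  qed
  have "vec.subspace ?Z"
  proof (rule vec.subspaceI[OF 0])
    show "v + w \<in> ?Z" if "v \<in> ?Z" "w \<in> ?Z" for v w using lin[OF that, of 1] by simp
    show "k *s v \<in> ?Z" if "v \<in> ?Z" for k v using lin[OF 0 that, of k] by simp
  qed
  moreover have "range u \<subseteq> ?Z" using z u vec.span_base[of _ "range u"] by auto
  ultimately have "L \<subseteq> ?Z" unfolding u(1)[symmetric] by (intro vec.span_minimal)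
  then show "bcond \<zeta> L y F" by (auto simp: bcond_def)
qed

text \<open>The filter \<Phi> stands for the one-sided neighbourhoods of either end point. Each
  component converges to a value of the boundary form, so the limit is 0 exactly if these values
  vanish.\<close>

lemma matrix_bc_iff:
  assumes bot: "\<Phi> \<noteq> bot" and lim: "\<And>z Z. dom z Z \<Longrightarrow> ((\<lambda>e. bf y z (real_of_ereal e)) \<longlongrightarrow> bnd y F z Z) \<Phi>"
    and y: "dom y F" and u: "vec.span (range u) = L" "L \<subseteq> NS \<zeta>"
  shows "(((\<lambda>x. madj (cols \<zeta> u x) *v (Jmat *v y x)) \<circ> real_of_ereal) \<longlongrightarrow> 0) \<Phi> \<longleftrightarrow> bcond \<zeta> L y F"
proof -
  have N: "u j \<in> NS \<zeta>" for j using u vec.span_base[of "u j" "range u"] by auto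
  have "(((\<lambda>x. madj (cols \<zeta> u x) *v (Jmat *v y x)) \<circ> real_of_ereal) \<longlongrightarrow> 0) \<Phi>
     \<longleftrightarrow> (\<forall>j. ((\<lambda>e. bf y (sol \<zeta> (u j)) (real_of_ereal e)) \<longlongrightarrow> 0) \<Phi>)" (is "?l \<longleftrightarrow> ?r")
  proof
    assume ?l
    from tendsto_vec_nth[OF this] show ?r by (simp add: madj_cols)
  next
    assume ?r
    then show ?l by (intro vec_tendstoI) (simp add: madj_cols)
  qed
  also have "\<dots> \<longleftrightarrow> (\<forall>j. bnd y F (sol \<zeta> (u j)) (\<lambda>x. \<zeta> *s sol \<zeta> (u j) x) = 0)"
  proof (intro iff_allI)
    fix j
    have "((\<lambda>e. bf y (sol \<zeta> (u j)) (real_of_ereal e)) \<longlongrightarrow> bnd y F (sol \<zeta> (u j)) (\<lambda>x. \<zeta> *s sol \<zeta> (u j) x)) \<Phi>"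
      by (rule lim[OF dom_sol[OF N]])
    then show "((\<lambda>e. bf y (sol \<zeta> (u j)) (real_of_ereal e)) \<longlongrightarrow> 0) \<Phi> \<longleftrightarrow> bnd y F (sol \<zeta> (u j)) (\<lambda>x. \<zeta> *s sol \<zeta> (u j) x) = 0"
      using tendsto_unique[OF bot] by auto
  qed
  also have "\<dots> \<longleftrightarrow> bcond \<zeta> L y F" by (rule bcond_iff_generators[OF y u, symmetric])
  finally show ?thesis .
qed

end

lemma at_right_ereal_neq_bot: "(a :: ereal) < b \<Longrightarrow> at_right a \<noteq> bot"
  unfolding trivial_limit_def eventually_at_right using dense by blast

lemma at_left_ereal_neq_bot: "(a :: ereal) < b \<Longrightarrow> at_left b \<noteq> bot"
  unfolding trivial_limit_def eventually_at_left using dense by blast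

section \<open>Deficiency numbers and limits at the two end points\<close>

context ham_at
begin

interpretation Le: ham_end a b B0 B1 c "einterval a b \<inter> {..c}" 1 by unfold_locales simp
interpretation Ri: ham_end a b B0 B1 c "einterval a b \<inter> {c..}" "-1" by unfold_locales simp

lemma a_less_c: "a < ereal c" and c_less_b: "ereal c < b" using c by (auto simp: einterval_def)

text \<open>A continuous function is square integrable over compact subintervals, so the position of
  the cut does not matter.\<close>

lemma lies_left_iff: assumes y: "contX y" shows "lies_left a b B1 y \<longleftrightarrow> sq Le.M B1 y"
proof
  assume l: "lies_left a b B1 y"
  obtain d where d: "ereal c < ereal d" "ereal d < b" using ereal_dense2[OF c_less_b] by blast
  then have "d \<in> X" using less_trans[OF a_less_c d(1)] by (simp add: einterval_def)
  then have "sq (lebesgue_on (einterval a (ereal d))) B1 y"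
    using l by (simp add: lies_left_def L2_fun_iff_sq)
  then show "sq Le.M B1 y"
    by (rule sq_subset) (use d a_less_c in \<open>auto simp: einterval_def intro: le_less_trans\<close>)
next
  assume s: "sq Le.M B1 y"
  show "lies_left a b B1 y" unfolding lies_left_def
  proof
    fix d assume d: "d \<in> X"
    have cd: "{c..d} \<subseteq> X" by (rule einterval_Icc[OF c d])
    have "sq (lebesgue_on (einterval a (ereal d))) B1 y"
    proof (rule sq_Un_contX[OF y s Le.I_sets])
      show "sq (lebesgue_on {c..d}) B1 y" using contX_L2l[OF y] cd by (simp add: L2l_def)
      show "einterval a (ereal d) \<subseteq> X \<inter> {..c} \<union> {c..d}"
      proof
        fix x assume x: "x \<in> einterval a (ereal d)"
        then have "x \<in> X" using d less_trans[of "ereal x" "ereal d" b] by (auto simp: einterval_def)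
        then show "x \<in> X \<inter> {..c} \<union> {c..d}" using x by (auto simp: einterval_def)
      qed
    qed (use cd in auto)
    then show "y \<in> L2_fun (einterval a (ereal d)) B1" by (simp add: L2_fun_iff_sq)
  qed
qed

lemma lies_right_iff: assumes y: "contX y" shows "lies_right a b B1 y \<longleftrightarrow> sq Ri.M B1 y"
proof
  assume l: "lies_right a b B1 y"
  obtain d where d: "a < ereal d" "ereal d < ereal c" using ereal_dense2[OF a_less_c] by blast
  then have "d \<in> X" using c_less_b less_trans[of "ereal d" "ereal c" b] by (auto simp: einterval_def)
  then have "sq (lebesgue_on (einterval (ereal d) b)) B1 y"
    using l by (simp add: lies_right_def L2_fun_iff_sq)
  then show "sq Ri.M B1 y"
    by (rule sq_subset) (use d in \<open>auto simp: einterval_def\<close>)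
next
  assume s: "sq Ri.M B1 y"
  show "lies_right a b B1 y" unfolding lies_right_def
  proof
    fix d assume d: "d \<in> X"
    have dc: "{d..c} \<subseteq> X" by (rule einterval_Icc[OF d c])
    have "sq (lebesgue_on (einterval (ereal d) b)) B1 y"
    proof (rule sq_Un_contX[OF y s Ri.I_sets])
      show "sq (lebesgue_on {d..c}) B1 y" using contX_L2l[OF y] dc by (simp add: L2l_def)
      show "einterval (ereal d) b \<subseteq> X \<inter> {c..} \<union> {d..c}"
      proof
        fix x assume x: "x \<in> einterval (ereal d) b"
        then have "x \<in> X" using d less_trans[of a "ereal d" "ereal x"] by (auto simp: einterval_def)
        then show "x \<in> X \<inter> {c..} \<union> {d..c}" using x by (auto simp: einterval_def)
      qed
    qed (use dc in auto)
    then show "y \<in> L2_fun (einterval (ereal d) b) B1" by (simp add: L2_fun_iff_sq)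
  qed
qed

lemma m_left_eq: "m_left a b B0 B1 \<zeta> = vec.dim (Le.NS \<zeta>)"
proof -
  have "lies_left a b B1 (sol \<zeta> w) \<longleftrightarrow> w \<in> Le.NS \<zeta>" for w
    using lies_left_iff[OF contX_sol] by (simp add: Le.NS_def)
  from solutions_eq[of "lies_left a b B1", OF this] show ?thesis
    unfolding m_left_def by (simp add: dim_solutions)
qed

lemma m_right_eq: "m_right a b B0 B1 \<zeta> = vec.dim (Ri.NS \<zeta>)"
proof -
  have "lies_right a b B1 (sol \<zeta> w) \<longleftrightarrow> w \<in> Ri.NS \<zeta>" for w
    using lies_right_iff[OF contX_sol] by (simp add: Ri.NS_def)
  from solutions_eq[of "lies_right a b B1", OF this] show ?thesis
    unfolding m_right_def by (simp add: dim_solutions)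
qed

text \<open>Sequences suffice for one-sided limits in the extended reals, and those tending to
  \<open>a\<close> from above are exhausting in the sense of \<open>ends\<close>.\<close>

lemma bnd_left_limit:
  assumes y: "Le.dom y F" and z: "Le.dom z Z"
  shows "((\<lambda>e. bf y z (real_of_ereal e)) \<longlongrightarrow> Le.bnd y F z Z) (at_right a)"
proof (rule tendsto_at_right_sequentially[OF a_less_c])
  fix S :: "nat \<Rightarrow> ereal" assume S: "\<And>k. a < S k" "\<And>k. S k < ereal c" "S \<longlonglongrightarrow> a"
  have e: "ereal (real_of_ereal (S k)) = S k" for k using S(1)[of k] S(2)[of k] by (cases "S k") auto
  have "Le.ends (\<lambda>k. real_of_ereal (S k))" unfolding Le.ends_def
  proof (intro conjI allI ballI)
    fix k
    have "S k < b" using S(2)[of k] c_less_b by (rule less_trans)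
    moreover have "real_of_ereal (S k) \<le> c" using S(2)[of k] e[of k] by (metis ereal_less_eq(3) less_imp_le)
    ultimately show "real_of_ereal (S k) \<in> X \<inter> {..c}" using S(1)[of k] by (simp add: einterval_def e)
  next
    fix x assume x: "x \<in> X \<inter> {..c}"
    then have "a < ereal x" by (auto simp: einterval_def)
    from order_tendstoD(2)[OF S(3) this] show "\<forall>\<^sub>F k in sequentially. x \<in> Le.K (real_of_ereal (S k))"
    proof eventually_elim
      case (elim k)
      then have "real_of_ereal (S k) \<le> x" using e[of k] by (metis ereal_less_eq(3) less_imp_le)
      then show ?case using x by (auto simp: Le.K_def)
    qed
  qed
  then show "(\<lambda>k. bf y z (real_of_ereal (S k))) \<longlonglongrightarrow> Le.bnd y F z Z" by (rule Le.bnd_tendsto[OF y z])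
qed

lemma bnd_right_limit:
  assumes y: "Ri.dom y F" and z: "Ri.dom z Z"
  shows "((\<lambda>e. bf y z (real_of_ereal e)) \<longlongrightarrow> Ri.bnd y F z Z) (at_left b)"
proof (rule tendsto_at_left_sequentially[OF c_less_b])
  fix S :: "nat \<Rightarrow> ereal" assume S: "\<And>k. S k < b" "\<And>k. ereal c < S k" "S \<longlonglongrightarrow> b"
  have e: "ereal (real_of_ereal (S k)) = S k" for k using S(1)[of k] S(2)[of k] by (cases "S k") auto
  have "Ri.ends (\<lambda>k. real_of_ereal (S k))" unfolding Ri.ends_def
  proof (intro conjI allI ballI)
    fix k
    have "a < S k" using a_less_c S(2)[of k] by (rule less_trans)
    moreover have "c \<le> real_of_ereal (S k)" using S(2)[of k] e[of k] by (metis ereal_less_eq(3) less_imp_le)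
    ultimately show "real_of_ereal (S k) \<in> X \<inter> {c..}" using S(1)[of k] by (simp add: einterval_def e)
  next
    fix x assume x: "x \<in> X \<inter> {c..}"
    then have "ereal x < b" by (auto simp: einterval_def)
    from order_tendstoD(1)[OF S(3) this] show "\<forall>\<^sub>F k in sequentially. x \<in> Ri.K (real_of_ereal (S k))"
    proof eventually_elim
      case (elim k)
      then have "x \<le> real_of_ereal (S k)" using e[of k] by (metis ereal_less_eq(3) less_imp_le)
      then show ?case using x by (auto simp: Ri.K_def)
    qed
  qed
  then show "(\<lambda>k. bf y z (real_of_ereal (S k))) \<longlonglongrightarrow> Ri.bnd y F z Z" by (rule Ri.bnd_tendsto[OF y z])
qed

lemma bc_left_iff:
  assumes "Le.dom y F" "vec.span (range u) = L" "L \<subseteq> Le.NS \<zeta>"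
  shows "bc_left a (cols \<zeta> u) y \<longleftrightarrow> Le.bcond \<zeta> L y F"
  unfolding bc_left_def
  by (rule Le.matrix_bc_iff[OF at_right_ereal_neq_bot[OF a_less_c] bnd_left_limit[OF assms(1)] assms])

lemma bc_right_iff:
  assumes "Ri.dom y F" "vec.span (range u) = L" "L \<subseteq> Ri.NS \<zeta>"
  shows "bc_right b (cols \<zeta> u) y \<longleftrightarrow> Ri.bcond \<zeta> L y F"
  unfolding bc_right_def
  by (rule Ri.matrix_bc_iff[OF at_left_ereal_neq_bot[OF c_less_b] bnd_right_limit[OF assms(1)] assms])

lemma right_end:
  assumes \<zeta>: "Im \<zeta> \<noteq> 0" and m: "m_right a b B0 B1 \<zeta> = m_right a b B0 B1 (cnj \<zeta>)"
  shows "\<exists>u Lb. vec.span (range u) = Lb \<and> Ri.isotropic \<zeta> Lb \<and> vec.dim Lb = CARD('n) \<and>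
     (\<forall>j. is_solution a b B0 B1 \<zeta> (\<lambda>x. column j (cols \<zeta> u x)) \<and> lies_right a b B1 (\<lambda>x. column j (cols \<zeta> u x)))"
proof -
  obtain Lb where Lb: "Ri.isotropic \<zeta> Lb" "vec.dim Lb = CARD('n)"
    using Ri.isotropic_exists[OF \<zeta>] m by (auto simp: m_right_eq)
  then obtain u :: "'n \<Rightarrow> complex^('n+'n)" where u: "vec.span (range u) = Lb"
    using spanning_family[of Lb, where ?'n = 'n] by (auto simp: Ri.isotropic_def)
  have "u j \<in> Ri.NS \<zeta>" for j using u Lb vec.span_base[of "u j" "range u"] by (auto simp: Ri.isotropic_def)
  then have "lies_right a b B1 (sol \<zeta> (u j))" for j
    using lies_right_iff[OF contX_sol] by (simp add: Ri.NS_def)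
  then show ?thesis using u Lb sol_is_solution unfolding column_cols by blast
qed

lemma left_end:
  assumes \<zeta>: "Im \<zeta> \<noteq> 0" and m: "m_left a b B0 B1 \<zeta> = m_left a b B0 B1 (cnj \<zeta>)"
  shows "\<exists>u La. vec.span (range u) = La \<and> Le.isotropic \<zeta> La \<and> vec.dim La = CARD('n) \<and>
     (\<forall>j. is_solution a b B0 B1 \<zeta> (\<lambda>x. column j (cols \<zeta> u x)) \<and> lies_left a b B1 (\<lambda>x. column j (cols \<zeta> u x)))"
proof -
  obtain La where La: "Le.isotropic \<zeta> La" "vec.dim La = CARD('n)"
    using Le.isotropic_exists[OF \<zeta>] m by (auto simp: m_left_eq)
  then obtain u :: "'n \<Rightarrow> complex^('n+'n)" where u: "vec.span (range u) = La"
    using spanning_family[of La, where ?'n = 'n] by (auto simp: Le.isotropic_def)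
  have "u j \<in> Le.NS \<zeta>" for j using u La vec.span_base[of "u j" "range u"] by (auto simp: Le.isotropic_def)
  then have "lies_left a b B1 (sol \<zeta> (u j))" for j
    using lies_left_iff[OF contX_sol] by (simp add: Le.NS_def)
  then show ?thesis using u La sol_is_solution unfolding column_cols by blast
qed

text \<open>Common interface for both parts of the theorem: \<open>P\<close> and \<open>Q\<close>
  are concrete boundary conditions equivalent to those given by Lagrangian subspaces.\<close>

lemma selfadjoint_if_bcond:
  assumes \<zeta>: "Im \<zeta> \<noteq> 0"
    and ml: "m_left a b B0 B1 \<zeta> = m_left a b B0 B1 (cnj \<zeta>)" and mr: "m_right a b B0 B1 \<zeta> = m_right a b B0 B1 (cnj \<zeta>)"
    and La: "Le.isotropic \<zeta> La" "vec.dim La = CARD('n)"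
    and Lb: "Ri.isotropic \<zeta> Lb" "vec.dim Lb = CARD('n)"
    and P: "\<And>y f. pdom y f \<Longrightarrow> P y \<longleftrightarrow> Le.bcond \<zeta> La y f"
    and Q: "\<And>y f. pdom y f \<Longrightarrow> Q y \<longleftrightarrow> Ri.bcond \<zeta> Lb y f"
  shows "selfadjoint_restr a b B0 B1 {y \<in> max_dom a b B0 B1. P y \<and> Q y}"
proof -
  have eq: "vec.dim (Le.NS \<zeta>) = vec.dim (Le.NS (cnj \<zeta>))" "vec.dim (Ri.NS \<zeta>) = vec.dim (Ri.NS (cnj \<zeta>))"
    using ml mr by (simp_all add: m_left_eq m_right_eq)
  have "P y \<and> Q y \<longleftrightarrow> (\<exists>f. rdom \<zeta> La Lb y f)" if "y \<in> max_dom a b B0 B1" for y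
    using that P Q unfolding max_dom_iff rdom_def[OF \<zeta> eq La Lb] by blast
  then show ?thesis by (intro selfadjoint_core[OF \<zeta> eq La Lb]) blast
qed

lemma selfadjoint_separated:
  assumes \<zeta>: "Im \<zeta> \<noteq> 0"
    and ml: "m_left a b B0 B1 \<zeta> = m_left a b B0 B1 (cnj \<zeta>)" and mr: "m_right a b B0 B1 \<zeta> = m_right a b B0 B1 (cnj \<zeta>)"
  shows "\<exists>Ua Ub :: real \<Rightarrow> complex ^ 'n ^ ('n + 'n).
        (\<forall>j. is_solution a b B0 B1 \<zeta> (\<lambda>x. column j (Ua x)) \<and> lies_left a b B1 (\<lambda>x. column j (Ua x))) \<and>
        (\<forall>j. is_solution a b B0 B1 \<zeta> (\<lambda>x. column j (Ub x)) \<and> lies_right a b B1 (\<lambda>x. column j (Ub x))) \<and>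
        selfadjoint_restr a b B0 B1 {y \<in> max_dom a b B0 B1. bc_left a Ua y \<and> bc_right b Ub y}"
proof -
  obtain u La where u: "vec.span (range u) = La" "Le.isotropic \<zeta> La" "vec.dim La = CARD('n)"
    "\<forall>j. is_solution a b B0 B1 \<zeta> (\<lambda>x. column j (cols \<zeta> u x)) \<and> lies_left a b B1 (\<lambda>x. column j (cols \<zeta> u x))"
    using left_end[OF \<zeta> ml] by blast
  obtain v Lb where v: "vec.span (range v) = Lb" "Ri.isotropic \<zeta> Lb" "vec.dim Lb = CARD('n)"
    "\<forall>j. is_solution a b B0 B1 \<zeta> (\<lambda>x. column j (cols \<zeta> v x)) \<and> lies_right a b B1 (\<lambda>x. column j (cols \<zeta> v x))"
    using right_end[OF \<zeta> mr] by blast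
  have "selfadjoint_restr a b B0 B1 {y \<in> max_dom a b B0 B1. bc_left a (cols \<zeta> u) y \<and> bc_right b (cols \<zeta> v) y}"
  proof (rule selfadjoint_if_bcond[OF \<zeta> ml mr u(2,3) v(2,3)])
    show "bc_left a (cols \<zeta> u) y \<longleftrightarrow> Le.bcond \<zeta> La y f" if "pdom y f" for y f
      by (rule bc_left_iff[OF pdom_ends(1)[OF that] u(1)]) (use u in \<open>simp add: Le.isotropic_def\<close>)
    show "bc_right b (cols \<zeta> v) y \<longleftrightarrow> Ri.bcond \<zeta> Lb y f" if "pdom y f" for y f
      by (rule bc_right_iff[OF pdom_ends(2)[OF that] v(1)]) (use v in \<open>simp add: Ri.isotropic_def\<close>)
  qed
  then show ?thesis using u(4) v(4) by blast
qed

end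

subsection \<open>A regular left end point\<close>

text \<open>Full rank makes the n rows distinct and independent; a kernel vector of the conjugate
  transpose is, after conjugation, a linear relation between them.\<close>

lemma madj_full_rank_inj:
  fixes \<alpha> :: "complex^'m::finite^'n::finite"
  assumes r: "rank \<alpha> = CARD('n)" and k: "madj \<alpha> *v k = 0"
  shows "k = 0"
proof -
  let ?r = "\<lambda>j. row j \<alpha>"
  have rows: "rows \<alpha> = range ?r" by (auto simp: rows_def)
  have d: "vec.dim (rows \<alpha>) = CARD('n)" using r by (simp add: row_rank_def_gen)
  have fin: "finite (rows \<alpha>)" by (simp add: rows)
  have le: "card (rows \<alpha>) \<le> CARD('n)" unfolding rows by (rule card_image_le) simp
  moreover have "vec.dim (rows \<alpha>) \<le> card (rows \<alpha>)" by (rule vec.dim_le_card'[OF fin])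
  ultimately have "card (range ?r) = card (UNIV :: 'n set)" using d by (simp add: rows)
  then have inj: "inj ?r" by (intro eq_card_imp_inj_on) simp_all
  have ind: "vec.independent (rows \<alpha>)"
    by (rule vec.card_le_dim_spanning[OF vec.span_superset subset_refl fin]) (use le d in simp)
  have "(\<Sum>j\<in>UNIV. cnj (k $ j) *s row j \<alpha>) = 0"
  proof -
    have "(\<Sum>j\<in>UNIV. cnj (\<alpha> $ j $ i) * k $ j) = 0" for i
      using arg_cong[OF k, of "\<lambda>v. v $ i"] by (simp add: madj_def matrix_vector_mult_def)
    then have "cnj (\<Sum>j\<in>UNIV. cnj (\<alpha> $ j $ i) * k $ j) = 0" for i by simp
    then show ?thesis by (simp add: vec_eq_iff row_def mult.commute)
  qed
  then have "(\<Sum>v\<in>range ?r. cnj (k $ (inv ?r v)) *s v) = 0" by (simp add: sum.reindex[OF inj] inv_f_f[OF inj])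
  then have "cnj (k $ (inv ?r (?r j))) = 0" for j
    using vec.independentD[OF ind, of "range ?r" "\<lambda>v. cnj (k $ (inv ?r v))" "?r j"] by (simp add: rows[symmetric]) (simp add: rows)
  then show ?thesis by (simp add: vec_eq_iff inv_f_f[OF inj])
qed

text \<open>Integrability up to \<open>a\<close> becomes local integrability below \<open>b\<close>,
  so that \<open>a\<close> is an interior point for the extended equation.\<close>

lemma cut_L1_loc:
  fixes f :: "real \<Rightarrow> 'v::euclidean_space"
  assumes ab: "ereal a < b" and f: "\<And>d. d \<in> einterval (ereal a) b \<Longrightarrow> f absolutely_integrable_on einterval (ereal a) (ereal d)"
  shows "cut (einterval (ereal a) b) f \<in> L1_loc (-\<infinity>) b"
  unfolding L1_loc_def
proof (intro CollectI allI impI)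
  let ?X = "einterval (ereal a) b"
  fix s t assume st: "{s..t} \<subseteq> einterval (-\<infinity>) b"
  have eq: "(\<lambda>x. indicat_real {s..t} x *\<^sub>R cut ?X f x) = (\<lambda>x. indicat_real ({s..t} \<inter> ?X) x *\<^sub>R f x)"
    by (auto simp: cut_def indicator_def)
  have "f absolutely_integrable_on ({s..t} \<inter> ?X)"
  proof (cases "s \<le> t \<and> a < t")
    case True
    then have "ereal t < b" using st by (auto simp: einterval_def)
    then obtain d where d: "ereal t < ereal d" "ereal d < b" using ereal_dense2 by blast
    then have "f absolutely_integrable_on einterval (ereal a) (ereal d)"
      using True by (intro f) (auto simp: einterval_def)
    then show ?thesis by (rule set_integrable_subset) (use d in \<open>auto simp: einterval_def\<close>)
  next
    case False
    then have "{s..t} \<inter> ?X = {}" by (auto simp: einterval_def)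
    then show ?thesis by simp
  qed
  then show "cut ?X f absolutely_integrable_on {s..t}" unfolding set_integrable_def eq .
qed

text \<open>The coefficients are extended by zero beyond the end point, so that the extended solutions
  are continuous there.\<close>

locale ham_regular = ham_at a b B0 B1 c
  for a b :: ereal and B0 B1 :: "real \<Rightarrow> complex ^ ('n::finite + 'n) ^ ('n + 'n)" and c :: real +
  fixes a0 :: real
  assumes a_eq: "a = ereal a0"
    and B0_reg: "d \<in> einterval a b \<Longrightarrow> B0 absolutely_integrable_on einterval a (ereal d)"
    and B1_reg: "d \<in> einterval a b \<Longrightarrow> B1 absolutely_integrable_on einterval a (ereal d)"
begin

interpretation Le: ham_end a b B0 B1 c "einterval a b \<inter> {..c}" 1 by unfold_locales simp
interpretation Ri: ham_end a b B0 B1 c "einterval a b \<inter> {c..}" "-1" by unfold_locales simp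

abbreviation "XE \<equiv> einterval (-\<infinity>) b"

lemma X_XE: "X \<subseteq> XE" by (auto simp: einterval_def)

lemma XE_below: "d \<in> X \<Longrightarrow> {a0 - 1..d} \<subseteq> XE"
  by (auto simp: einterval_def intro: le_less_trans[of _ "ereal d"])

lemma below_subset: assumes "d \<in> X" shows "einterval a (ereal d) \<subseteq> X"
proof
  fix x assume "x \<in> einterval a (ereal d)"
  then show "x \<in> X" using assms less_trans[of "ereal x" "ereal d" b] by (auto simp: einterval_def)
qed

lemma a0_XE: "a0 \<in> XE" using ab a_eq by (simp add: einterval_def)

lemma regular_ode:
  assumes F: "\<And>d. d \<in> X \<Longrightarrow> (\<lambda>x. B1 x *v F x) absolutely_integrable_on einterval a (ereal d)"
  shows "linear_ode (-\<infinity>) b (cut X (ode_coeff \<zeta>)) (cut X (ode_term F))"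
proof
  show "-\<infinity> < b" using ab a_eq by auto
  have "ode_coeff \<zeta> absolutely_integrable_on einterval a (ereal d)" if "d \<in> X" for d
  proof -
    have "(\<lambda>x. B0 x + mat \<zeta> ** B1 x) absolutely_integrable_on einterval a (ereal d)"
      using absolutely_integrable_linear[OF B1_reg[OF that] bounded_linear_matrix_mult_left[of "mat \<zeta>"]]
      by (intro set_integral_add B0_reg[OF that]) (simp add: o_def)
    from absolutely_integrable_linear[OF this bounded_linear_matrix_mult_left[of "mat (-1) ** Jmat"]]
    show ?thesis by (simp add: o_def ode_coeff_def[abs_def])
  qed
  then show "cut X (ode_coeff \<zeta>) \<in> L1_loc (-\<infinity>) b" using ab unfolding a_eq by (intro cut_L1_loc)
  have "ode_term F absolutely_integrable_on einterval a (ereal d)" if "d \<in> X" for d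
    using absolutely_integrable_linear[OF F[OF that] bounded_linear_minus[OF bounded_linear_mv[of Jmat]]]
    by (simp add: o_def ode_term_def[abs_def])
  then show "cut X (ode_term F) \<in> L1_loc (-\<infinity>) b" using ab unfolding a_eq by (intro cut_L1_loc)
qed

definition extension :: "complex \<Rightarrow> (real \<Rightarrow> complex^('n+'n)) \<Rightarrow> (real \<Rightarrow> complex^('n+'n)) \<Rightarrow> bool" where
  "extension \<zeta> F z \<longleftrightarrow> primitive_on XE (\<lambda>x. cut X (ode_coeff \<zeta>) x *v z x + cut X (ode_term F) x) z"

lemma extension_mrel: "extension \<zeta> F z \<Longrightarrow> mrel z (\<lambda>x. \<zeta> *s z x + F x)"
  unfolding extension_def mrel_def rhs_ode
  by (drule primitive_on_subset[OF _ X_XE], erule primitive_on_cong) (auto simp: cut_def)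

lemma extension_continuous: "extension \<zeta> F z \<Longrightarrow> d \<in> X \<Longrightarrow> continuous_on {a0 - 1..d} z"
  unfolding extension_def by (rule primitive_on_continuous[OF _ XE_below])

lemma extension_tendsto:
  assumes z: "extension \<zeta> F z" and y: "\<And>x. x \<in> X \<Longrightarrow> y x = z x"
  shows "((y \<circ> real_of_ereal) \<longlongrightarrow> z a0) (at_right a)"
proof -
  have "a0 < c" using a_less_c a_eq by simp
  then have "isCont z a0"
    using extension_continuous[OF z c] by (intro continuous_on_interior) (auto simp: interior_atLeastAtMost_real)
  then have "(z \<longlongrightarrow> z a0) (at_right a0)" by (auto simp: isCont_def intro: filterlim_mono at_le)
  moreover have "\<forall>\<^sub>F x in at_right a0. z x = y x"
    unfolding eventually_at_right_field
  proof (intro exI[of _ c] conjI allI impI)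
    fix x assume x: "a0 < x" "x < c"
    then have "x \<in> X" using c less_trans[of "ereal x" "ereal c" b] by (auto simp: einterval_def a_eq)
    then show "z x = y x" by (simp add: y)
  qed (rule \<open>a0 < c\<close>)
  ultimately have "(y \<longlongrightarrow> z a0) (at_right a0)" using tendsto_cong by blast
  then show ?thesis by (simp add: a_eq ereal_tendsto_simps1)
qed

lemma extension_of:
  assumes F: "\<And>d. d \<in> X \<Longrightarrow> (\<lambda>x. B1 x *v F x) absolutely_integrable_on einterval a (ereal d)"
    and y: "mrel y (\<lambda>x. \<zeta> *s y x + F x)"
  shows "\<exists>z. extension \<zeta> F z \<and> (\<forall>x\<in>X. y x = z x)"
proof -
  interpret E: linear_ode "-\<infinity>" b "cut X (ode_coeff \<zeta>)" "cut X (ode_term F)" by (rule regular_ode[OF F])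
  obtain z where z: "extension \<zeta> F z" "z c = y c"
    using E.sol_exists[of c "y c"] c X_XE unfolding extension_def E.sol_on_def by blast
  have "y x = z x" if "x \<in> X" for x
    by (rule mrel_unique[OF y extension_mrel[OF z(1)] c _ that]) (simp add: z)
  then show ?thesis using z by blast
qed

lemma reg_zero: "(\<lambda>x. B1 x *v 0) absolutely_integrable_on S"
  by simp

lemma extension_exists: "\<exists>z. extension \<zeta> (\<lambda>x. 0) z \<and> z a0 = w"
proof -
  interpret E: linear_ode "-\<infinity>" b "cut X (ode_coeff \<zeta>)" "cut X (ode_term (\<lambda>x. 0))"
    by (rule regular_ode[OF reg_zero])
  show ?thesis using E.sol_exists[OF a0_XE, of w] unfolding extension_def E.sol_on_def .
qed

lemma extension_zero:
  assumes z: "extension \<zeta> (\<lambda>x. 0) z" "z a0 = 0" and x: "x \<in> X"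
  shows "z x = 0"
proof -
  interpret E: linear_ode "-\<infinity>" b "cut X (ode_coeff \<zeta>)" "cut X (ode_term (\<lambda>x. 0))"
    by (rule regular_ode[OF reg_zero])
  have "cut X (ode_term (\<lambda>x. 0)) = (\<lambda>x. 0)" by (simp add: fun_eq_iff cut_def ode_term_def)
  then have "E.hsol_on XE z" using z(1) by (simp add: extension_def E.hsol_on_def)
  then show ?thesis using E.hsol_zero[of z a0 x] a0_XE z(2) x X_XE by blast
qed

lemma sq_regular:
  assumes z: "continuous_on {a0..d} z" and d: "d \<in> X"
  shows "sq (lebesgue_on (einterval a (ereal d))) B1 z"
proof -
  let ?S = "einterval a (ereal d)"
  have sub: "?S \<subseteq> {a0..d}" "?S \<subseteq> {a0..}" by (auto simp: einterval_def a_eq)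
  have S: "?S \<in> sets lebesgue" by simp
  have cutS: "(\<lambda>x. indicat_real {a0..d} x *\<^sub>R cut ?S f x) = (\<lambda>x. indicat_real ?S x *\<^sub>R f x)"
    for f :: "real \<Rightarrow> 'v::real_vector" using sub(1) by (auto simp: cut_def indicator_def fun_eq_iff)
  have "cut ?S B1 absolutely_integrable_on {a0..d}"
    using B1_reg[OF d] by (simp add: set_integrable_def cutS)
  then have "(\<lambda>x. cinner (cut ?S B1 x *v z x) (z x)) absolutely_integrable_on {a0..d}"
    by (intro absolutely_integrable_cinner absolutely_integrable_matrix_vector_mult z)
  then have "(\<lambda>x. cinner (cut ?S B1 x *v z x) (z x)) absolutely_integrable_on ?S"
    by (rule set_integrable_subset) (use sub in auto)
  moreover have "(\<lambda>x. indicat_real ?S x *\<^sub>R cinner (cut ?S B1 x *v z x) (z x)) = (\<lambda>x. indicat_real ?S x *\<^sub>R cinner (B1 x *v z x) (z x))"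
    by (auto simp: cut_def indicator_def)
  ultimately have "integrable (lebesgue_on ?S) (\<lambda>x. cinner (B1 x *v z x) (z x))"
    using S by (simp add: set_integrable_def integrable_restrict_space)
  moreover have "z \<in> borel_measurable (lebesgue_on {a0..d})"
    using z by (rule continuous_imp_measurable_on_sets_lebesgue) simp
  then have "z \<in> borel_measurable (lebesgue_on ?S)" by (rule measurable_restrict_mono) (rule sub)
  ultimately show ?thesis by (simp add: sq_def)
qed

text \<open>Near a regular end point constant vectors are square integrable, so each component of
  \<open>B1 f\<close> is an integrable product.\<close>

lemma pdom_reg:
  assumes y: "pdom y f" and d: "d \<in> X"
  shows "(\<lambda>x. B1 x *v f x) absolutely_integrable_on einterval a (ereal d)"
proof (rule absolutely_integrable_if_components)
  fix k
  let ?S = "einterval a (ereal d)"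
  have S: "?S \<in> sets lebesgue" "?S \<subseteq> X" using below_subset[OF d] by auto
  interpret weight "lebesgue_on ?S" B1 by (rule weight_sub[OF S(2,1)])
  have "sq (lebesgue_on ?S) B1 f" by (rule sq_subset[OF _ S(2) X_sets S(1)]) (use y in \<open>simp add: pdom_def\<close>)
  then have "integrable (lebesgue_on ?S) (\<lambda>x. cinner (B1 x *v f x) (axis k 1))"
    by (rule integrable_ip[OF _ sq_regular[OF _ d]]) simp
  then show "(\<lambda>x. cinner (B1 x *v f x) (axis k 1)) absolutely_integrable_on ?S"
    by (simp add: set_integrable_def integrable_restrict_space)
qed

lemma limit_pdom:
  assumes y: "pdom y f"
  shows "\<exists>ya. ((y \<circ> real_of_ereal) \<longlongrightarrow> ya) (at_right a)"
proof -
  have "mrel y (\<lambda>x. 0 *s y x + f x)" using y by (simp add: pdom_def)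
  from extension_of[OF pdom_reg[OF y] this] obtain z where "extension 0 f z" "\<And>x. x \<in> X \<Longrightarrow> y x = z x" by blast
  from extension_tendsto[OF this] show ?thesis by blast
qed

lemma sol_extension: "\<exists>z. extension \<zeta> (\<lambda>x. 0) z \<and> (\<forall>x\<in>X. sol \<zeta> w x = z x)"
  using extension_of[OF reg_zero, of "sol \<zeta> w" \<zeta>] sol by simp

text \<open>The boundary value at \<open>a\<close> as a function of the value at \<open>c\<close>;
  the following lemmas make it a linear bijection.\<close>

definition left_value :: "complex \<Rightarrow> complex^('n+'n) \<Rightarrow> complex^('n+'n)" where
  "left_value \<zeta> w = Lim (at_right a) (sol \<zeta> w \<circ> real_of_ereal)"

lemma at_right_a: "at_right a \<noteq> bot" by (rule at_right_ereal_neq_bot[OF a_less_c])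

lemma left_value_eq: "((sol \<zeta> w \<circ> real_of_ereal) \<longlongrightarrow> l) (at_right a) \<Longrightarrow> left_value \<zeta> w = l"
  unfolding left_value_def by (rule tendsto_Lim[OF at_right_a])

lemma left_value_tendsto: "((sol \<zeta> w \<circ> real_of_ereal) \<longlongrightarrow> left_value \<zeta> w) (at_right a)"
proof -
  obtain z where "extension \<zeta> (\<lambda>x. 0) z" "\<And>x. x \<in> X \<Longrightarrow> sol \<zeta> w x = z x" using sol_extension by blast
  from extension_tendsto[OF this] show ?thesis using left_value_eq by metis
qed

lemma left_value_linear: "Vector_Spaces.linear (*s) (*s) (left_value \<zeta>)"
proof -
  have tr: "left_value \<zeta> (u + k *s v) = left_value \<zeta> u + k *s left_value \<zeta> v" for u k v
  proof (rule left_value_eq)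
    have "(((\<lambda>e. sol \<zeta> u (real_of_ereal e) + k *s sol \<zeta> v (real_of_ereal e))) \<longlongrightarrow> left_value \<zeta> u + k *s left_value \<zeta> v) (at_right a)"
      using left_value_tendsto[of \<zeta> u] left_value_tendsto[of \<zeta> v]
      by (intro tendsto_add bounded_linear.tendsto[OF bounded_linear_cscale]) (simp_all add: o_def)
    then show "((sol \<zeta> (u + k *s v) \<circ> real_of_ereal) \<longlongrightarrow> left_value \<zeta> u + k *s left_value \<zeta> v) (at_right a)"
      by (simp add: o_def sol_lincomb)
  qed
  have "left_value \<zeta> 0 = 0" using tr[of 0 "-1" 0] by (simp add: vector_smult_lneg)
  then show ?thesis
    unfolding Vector_Spaces.linear_iff using tr[of _ 1] tr[of 0] by (simp add: vec.vector_space_axioms)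
qed

lemma left_value_inj: "inj (left_value \<zeta>)"
proof -
  interpret T: Vector_Spaces.linear "(*s)" "(*s)" "left_value \<zeta>" by (rule left_value_linear)
  have "w = 0" if w: "left_value \<zeta> w = 0" for w
  proof -
    obtain z where z: "extension \<zeta> (\<lambda>x. 0) z" "\<And>x. x \<in> X \<Longrightarrow> sol \<zeta> w x = z x" using sol_extension by blast
    then have "z a0 = 0" using w left_value_eq[OF extension_tendsto[OF z]] by simp
    then have "sol \<zeta> w c = 0" using extension_zero[OF z(1) _ c] z(2)[OF c] by simp
    then show ?thesis by simp
  qed
  then show ?thesis by (simp add: T.inj_iff_eq_0)
qed

lemma left_value_surj: "surj (left_value \<zeta>)"
proof -
  have "\<exists>v. w = left_value \<zeta> v" for w
  proof -
    obtain z where z: "extension \<zeta> (\<lambda>x. 0) z" "z a0 = w" using extension_exists by blast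
    have "mrel z (\<lambda>x. \<zeta> *s z x)" using extension_mrel[OF z(1)] by simp
    then have "sol \<zeta> (z c) x = z x" if "x \<in> X" for x using sol_unique[of z \<zeta> x] that by simp
    from left_value_eq[OF extension_tendsto[OF z(1) this]] show ?thesis using z(2) by metis
  qed
  then show ?thesis by (auto simp: surj_def)
qed

text \<open>Solutions extend continuously to a regular end point, where the weight is
  integrable.\<close>

lemma NS_regular: "Le.NS \<zeta> = UNIV"
proof -
  have "w \<in> Le.NS \<zeta>" for w
  proof -
    obtain z where z: "extension \<zeta> (\<lambda>x. 0) z" "\<And>x. x \<in> X \<Longrightarrow> sol \<zeta> w x = z x" using sol_extension by blast
    have "lies_left a b B1 (sol \<zeta> w)"
      unfolding lies_left_def
    proof
      fix d assume d: "d \<in> X"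
      have "continuous_on {a0..d} z" using extension_continuous[OF z(1) d] by (rule continuous_on_subset) auto
      from sq_regular[OF this d] have "sq (lebesgue_on (einterval a (ereal d))) B1 (sol \<zeta> w)"
        by (rule sq_lebesgue_on_cong[rotated])
          (use z(2) below_subset[OF d] in auto)
      then show "sol \<zeta> w \<in> L2_fun (einterval a (ereal d)) B1" by (simp add: L2_fun_iff_sq)
    qed
    then show ?thesis using lies_left_iff[OF contX_sol] by (simp add: Le.NS_def)
  qed
  then show ?thesis by blast
qed

lemma bnd_left_value:
  assumes y: "Le.dom y F" and l: "((y \<circ> real_of_ereal) \<longlongrightarrow> ya) (at_right a)"
  shows "Le.bnd y F (sol \<zeta> v) (\<lambda>x. \<zeta> *s sol \<zeta> v x) = cinner (Jmat *v ya) (left_value \<zeta> v)"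
proof -
  have "Le.dom (sol \<zeta> v) (\<lambda>x. \<zeta> *s sol \<zeta> v x)" by (rule Le.dom_sol) (simp add: NS_regular)
  from bnd_left_limit[OF y this]
  have "((\<lambda>e. bf y (sol \<zeta> v) (real_of_ereal e)) \<longlongrightarrow> Le.bnd y F (sol \<zeta> v) (\<lambda>x. \<zeta> *s sol \<zeta> v x)) (at_right a)" .
  moreover have "((\<lambda>e. bf y (sol \<zeta> v) (real_of_ereal e)) \<longlongrightarrow> cinner (Jmat *v ya) (left_value \<zeta> v)) (at_right a)"
    using l left_value_tendsto[of \<zeta> v]
    by (intro bounded_bilinear.tendsto[OF bounded_bilinear_cinner] bounded_linear.tendsto[OF bounded_linear_mv])
      (simp_all add: o_def)
  ultimately show ?thesis by (rule tendsto_unique[OF at_right_a])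
qed

definition boundary_space :: "complex ^ ('n + 'n) ^ 'n \<Rightarrow> complex \<Rightarrow> (complex^('n+'n)) set" where
  "boundary_space \<alpha> \<zeta> = {v. \<exists>k. left_value \<zeta> v = Jmat *v (madj \<alpha> *v k)}"

context
  fixes \<alpha> :: "complex ^ ('n + 'n) ^ 'n" and \<zeta> :: complex
  assumes rank: "rank \<alpha> = CARD('n)" and sym: "\<alpha> ** Jmat ** madj \<alpha> = 0"
begin

lemma boundary_spaceI: "left_value \<zeta> v = Jmat *v (madj \<alpha> *v k) \<Longrightarrow> v \<in> boundary_space \<alpha> \<zeta>"
  unfolding boundary_space_def by blast

lemma boundary_spaceE:
  assumes "v \<in> boundary_space \<alpha> \<zeta>"
  obtains k where "left_value \<zeta> v = Jmat *v (madj \<alpha> *v k)"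
  using assms unfolding boundary_space_def by blast

lemma left_value_onto: obtains v where "left_value \<zeta> v = Jmat *v (madj \<alpha> *v k)"
  using left_value_surj by (metis surj_def)

text \<open>\<open>J\<close> preserves the inner product, so (J w, J \<alpha>' k) = (\<alpha> w, k)
  with the conjugate transpose \<alpha>'; every \<open>k\<close> occurs because
  \<open>left_value\<close> is onto.\<close>

lemma regular_cond: "(\<forall>v\<in>boundary_space \<alpha> \<zeta>. cinner (Jmat *v w) (left_value \<zeta> v) = 0) \<longleftrightarrow> \<alpha> *v w = 0"
proof -
  have "(\<forall>v\<in>boundary_space \<alpha> \<zeta>. cinner (Jmat *v w) (left_value \<zeta> v) = 0) \<longleftrightarrow> (\<forall>k. cinner (Jmat *v w) (Jmat *v (madj \<alpha> *v k)) = 0)"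
    by (metis boundary_spaceI boundary_spaceE left_value_onto)
  also have "\<dots> \<longleftrightarrow> (\<forall>k. cinner (\<alpha> *v w) k = 0)" unfolding cinner_Jmat_Jmat by (simp add: cinner_madj)
  also have "\<dots> \<longleftrightarrow> \<alpha> *v w = 0" using cinner_eq_zero_imp[of "\<alpha> *v w"] by (auto simp: cinner_def)
  finally show ?thesis .
qed

lemma regular_bcond:
  assumes y: "Le.dom y F" and l: "((y \<circ> real_of_ereal) \<longlongrightarrow> ya) (at_right a)"
  shows "Le.bcond \<zeta> (boundary_space \<alpha> \<zeta>) y F \<longleftrightarrow> \<alpha> *v ya = 0"
  unfolding Le.bcond_def bnd_left_value[OF y l] by (rule regular_cond)

lemma bc_regular_iff:
  assumes "pdom y f"
  shows "bc_regular a \<alpha> y \<longleftrightarrow> Le.bcond \<zeta> (boundary_space \<alpha> \<zeta>) y f"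
proof -
  obtain ya where ya: "((y \<circ> real_of_ereal) \<longlongrightarrow> ya) (at_right a)" using limit_pdom[OF assms] by blast
  then have "bc_regular a \<alpha> y \<longleftrightarrow> \<alpha> *v ya = 0"
    unfolding bc_regular_def using tendsto_unique[OF at_right_a] by blast
  then show ?thesis using regular_bcond[OF pdom_ends(1)[OF assms] ya] by simp
qed

text \<open>By \<alpha> J \<alpha>' = 0 the boundary values of the space satisfy the boundary
  condition themselves, which \<open>regular_cond\<close> turns into isotropy.\<close>

lemma regular_isotropic: "Le.isotropic \<zeta> (boundary_space \<alpha> \<zeta>)"
  unfolding Le.isotropic_def NS_regular
proof (intro conjI ballI subset_UNIV)
  interpret T: Vector_Spaces.linear "(*s)" "(*s)" "left_value \<zeta>" by (rule left_value_linear)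
  show "vec.subspace (boundary_space \<alpha> \<zeta>)"
  proof (rule vec.subspaceI)
    show "0 \<in> boundary_space \<alpha> \<zeta>" by (rule boundary_spaceI[of _ 0]) (simp add: T.zero)
    show "u + v \<in> boundary_space \<alpha> \<zeta>" if u: "u \<in> boundary_space \<alpha> \<zeta>" and v: "v \<in> boundary_space \<alpha> \<zeta>" for u v
    proof -
      obtain k l where "left_value \<zeta> u = Jmat *v (madj \<alpha> *v k)" "left_value \<zeta> v = Jmat *v (madj \<alpha> *v l)"
        using u v boundary_spaceE by metis
      then show ?thesis by (intro boundary_spaceI[of _ "k + l"]) (simp add: T.add matrix_vector_right_distrib)
    qed
    show "r *s u \<in> boundary_space \<alpha> \<zeta>" if "u \<in> boundary_space \<alpha> \<zeta>" for r u
    proof -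
      obtain k where "left_value \<zeta> u = Jmat *v (madj \<alpha> *v k)" using \<open>u \<in> _\<close> by (rule boundary_spaceE)
      then show ?thesis by (intro boundary_spaceI[of _ "r *s k"]) (simp add: T.scale vector_scalar_commute)
    qed
  qed
  fix u v assume u: "u \<in> boundary_space \<alpha> \<zeta>" and v: "v \<in> boundary_space \<alpha> \<zeta>"
  obtain k where k: "left_value \<zeta> u = Jmat *v (madj \<alpha> *v k)" using u by (rule boundary_spaceE)
  have "\<alpha> *v left_value \<zeta> u = 0" unfolding k using sym by (simp add: matrix_vector_mul_assoc matrix_mul_assoc)
  then show "Le.bs \<zeta> u \<zeta> v = 0"
    using regular_cond[of "left_value \<zeta> u"] v by (subst bnd_left_value[OF Le.dom_sol left_value_tendsto]) (auto simp: NS_regular)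
qed

text \<open>The boundary value map is injective, and so is k -> J \<alpha>' k by full rank; both
  images are the same.\<close>

lemma regular_dim: "vec.dim (boundary_space \<alpha> \<zeta>) = CARD('n)"
proof -
  interpret T: Vector_Spaces.linear "(*s)" "(*s)" "left_value \<zeta>" by (rule left_value_linear)
  have "left_value \<zeta> ` (boundary_space \<alpha> \<zeta>) = range (\<lambda>k. Jmat *v (madj \<alpha> *v k))"
  proof
    show "left_value \<zeta> ` boundary_space \<alpha> \<zeta> \<subseteq> range (\<lambda>k. Jmat *v (madj \<alpha> *v k))"
      using boundary_spaceE by blast
    show "range (\<lambda>k. Jmat *v (madj \<alpha> *v k)) \<subseteq> left_value \<zeta> ` boundary_space \<alpha> \<zeta>"
    proof
      fix w assume "w \<in> range (\<lambda>k. Jmat *v (madj \<alpha> *v k))"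
      then obtain k v where "left_value \<zeta> v = Jmat *v (madj \<alpha> *v k)" "w = Jmat *v (madj \<alpha> *v k)"
        using left_value_onto by blast
      then show "w \<in> left_value \<zeta> ` boundary_space \<alpha> \<zeta>" using boundary_spaceI by (metis imageI)
    qed
  qed
  moreover have "vec.dim (left_value \<zeta> ` boundary_space \<alpha> \<zeta>) = vec.dim (boundary_space \<alpha> \<zeta>)"
    by (rule vec.dim_image_eq[OF left_value_linear]) (use left_value_inj inj_on_subset in blast)
  moreover have "vec.dim (range (\<lambda>k. Jmat *v (madj \<alpha> *v k))) = vec.dim (UNIV :: (complex^'n) set)"
  proof (rule vec.dim_image_eq)
    show "Vector_Spaces.linear (*s) (*s) (\<lambda>k. Jmat *v (madj \<alpha> *v k))"
      unfolding matrix_vector_mul_assoc by (rule matrix_vector_mul_linear_gen)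
    have "k = k'" if "Jmat *v (madj \<alpha> *v k) = Jmat *v (madj \<alpha> *v k')" for k k'
    proof -
      have "madj \<alpha> *v k = madj \<alpha> *v k'" using that by (metis Jmat_Jmat neg_equal_iff_equal)
      then have "madj \<alpha> *v (k - k') = 0" by (simp add: matrix_vector_mult_diff_distrib)
      from madj_full_rank_inj[OF rank this] show ?thesis by simp
    qed
    then show "inj_on (\<lambda>k. Jmat *v (madj \<alpha> *v k)) (vec.span UNIV)" by (auto intro: inj_onI)
  qed
  ultimately show ?thesis by (simp add: card_cart_basis)
qed

end

lemma selfadjoint_regular:
  fixes \<alpha> :: "complex ^ ('n + 'n) ^ 'n"
  assumes \<zeta>: "Im \<zeta> \<noteq> 0"
    and ml: "m_left a b B0 B1 \<zeta> = m_left a b B0 B1 (cnj \<zeta>)" and mr: "m_right a b B0 B1 \<zeta> = m_right a b B0 B1 (cnj \<zeta>)"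
    and \<alpha>: "rank \<alpha> = CARD('n)" "\<alpha> ** Jmat ** madj \<alpha> = 0"
  shows "\<exists>Ub :: real \<Rightarrow> complex ^ 'n ^ ('n + 'n).
        (\<forall>j. is_solution a b B0 B1 \<zeta> (\<lambda>x. column j (Ub x)) \<and> lies_right a b B1 (\<lambda>x. column j (Ub x))) \<and>
        selfadjoint_restr a b B0 B1 {y \<in> max_dom a b B0 B1. bc_regular a \<alpha> y \<and> bc_right b Ub y}"
proof -
  obtain v Lb where v: "vec.span (range v) = Lb" "Ri.isotropic \<zeta> Lb" "vec.dim Lb = CARD('n)"
    "\<forall>j. is_solution a b B0 B1 \<zeta> (\<lambda>x. column j (cols \<zeta> v x)) \<and> lies_right a b B1 (\<lambda>x. column j (cols \<zeta> v x))"
    using right_end[OF \<zeta> mr] by blast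
  have "selfadjoint_restr a b B0 B1 {y \<in> max_dom a b B0 B1. bc_regular a \<alpha> y \<and> bc_right b (cols \<zeta> v) y}"
  proof (rule selfadjoint_if_bcond[OF \<zeta> ml mr regular_isotropic[OF \<alpha>] regular_dim[OF \<alpha>] v(2,3)])
    show "bc_regular a \<alpha> y \<longleftrightarrow> Le.bcond \<zeta> (boundary_space \<alpha> \<zeta>) y f" if "pdom y f" for y f
      by (rule bc_regular_iff[OF \<alpha> that])
    show "bc_right b (cols \<zeta> v) y \<longleftrightarrow> Ri.bcond \<zeta> Lb y f" if "pdom y f" for y f
      by (rule bc_right_iff[OF pdom_ends(2)[OF that] v(1)]) (use v in \<open>simp add: Ri.isotropic_def\<close>)
  qed
  then show ?thesis using v(4) by blast
qed

end

theorem lemma1p1: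
  fixes a b :: ereal
    and B0 B1 :: "real \<Rightarrow> complex ^ ('n::finite + 'n) ^ ('n + 'n)"
    and \<zeta>\<^sub>0 :: complex
  assumes "a < b"
    and "B0 \<in> L1_loc a b" and "B1 \<in> L1_loc a b"
    and "AE x in lebesgue. x \<in> einterval a b \<longrightarrow> madj (B0 x) = B0 x \<and> madj (B1 x) = B1 x"
    and definite:
      "\<And>\<zeta> y c d. \<lbrakk> is_solution a b B0 B1 \<zeta> y; \<exists>x\<in>einterval a b. y x \<noteq> 0;
                   c < d; {c..d} \<subseteq> einterval a b \<rbrakk>
         \<Longrightarrow> 0 < Re (LINT x:{c..d}|lebesgue. cinner (B1 x *v y x) (y x))"
    and "\<And>\<zeta> \<eta>. \<lbrakk> Im \<zeta> \<noteq> 0; Im \<eta> \<noteq> 0 \<rbrakk> \<Longrightarrow> m_left a b B0 B1 \<zeta> = m_left a b B0 B1 \<eta>"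
    and "\<And>\<zeta> \<eta>. \<lbrakk> Im \<zeta> \<noteq> 0; Im \<eta> \<noteq> 0 \<rbrakk> \<Longrightarrow> m_right a b B0 B1 \<zeta> = m_right a b B0 B1 \<eta>"
    and "Im \<zeta>\<^sub>0 \<noteq> 0"
  shows
    "(\<exists>Ua Ub :: real \<Rightarrow> complex ^ 'n ^ ('n + 'n).
        (\<forall>j. is_solution a b B0 B1 \<zeta>\<^sub>0 (\<lambda>x. column j (Ua x)) \<and>
             lies_left a b B1 (\<lambda>x. column j (Ua x))) \<and>
        (\<forall>j. is_solution a b B0 B1 \<zeta>\<^sub>0 (\<lambda>x. column j (Ub x)) \<and>
             lies_right a b B1 (\<lambda>x. column j (Ub x))) \<and>
        selfadjoint_restr a b B0 B1
          {y \<in> max_dom a b B0 B1. bc_left a Ua y \<and> bc_right b Ub y})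
   \<and> (\<bar>a\<bar> \<noteq> \<infinity> \<and>
       (\<forall>c\<in>einterval a b. B0 absolutely_integrable_on einterval a (ereal c) \<and>
                           B1 absolutely_integrable_on einterval a (ereal c)) \<longrightarrow>
      (\<forall>\<alpha> :: complex ^ ('n + 'n) ^ 'n.
         rank \<alpha> = CARD('n) \<and> \<alpha> ** Jmat ** madj \<alpha> = 0 \<longrightarrow>
         (\<exists>Ub :: real \<Rightarrow> complex ^ 'n ^ ('n + 'n).
            (\<forall>j. is_solution a b B0 B1 \<zeta>\<^sub>0 (\<lambda>x. column j (Ub x)) \<and>
                 lies_right a b B1 (\<lambda>x. column j (Ub x))) \<and>
            selfadjoint_restr a b B0 B1
              {y \<in> max_dom a b B0 B1. bc_regular a \<alpha> y \<and> bc_right b Ub y})))"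
proof -
  obtain c where "c \<in> einterval a b" using einterval_nonempty[OF \<open>a < b\<close>] by blast
  then interpret ham_at a b B0 B1 c using assms(1-5) by unfold_locales
  \<comment> \<open>Here the constancy of the dimensions enters, as a comparison of the two
    half-planes.\<close>
  have ml: "m_left a b B0 B1 \<zeta>\<^sub>0 = m_left a b B0 B1 (cnj \<zeta>\<^sub>0)" and mr: "m_right a b B0 B1 \<zeta>\<^sub>0 = m_right a b B0 B1 (cnj \<zeta>\<^sub>0)"
    using assms(6,7)[of "\<zeta>\<^sub>0" "cnj \<zeta>\<^sub>0"] \<open>Im \<zeta>\<^sub>0 \<noteq> 0\<close> by simp_all
  show ?thesis
  proof (intro conjI impI allI, goal_cases)
    case 1
    show ?case by (rule selfadjoint_separated[OF \<open>Im \<zeta>\<^sub>0 \<noteq> 0\<close> ml mr])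
  next
    case (2 \<alpha>)
    then obtain a0 where a0: "a = ereal a0" by (cases a) auto
    interpret ham_regular a b B0 B1 c a0 using 2 a0 by unfold_locales auto
    show ?case using 2 by (intro selfadjoint_regular[OF \<open>Im \<zeta>\<^sub>0 \<noteq> 0\<close> ml mr]) auto
  qed
qed

end
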